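(* Let $\Gamma\subset SL_2(\mathbb R)$ be a Fuchsian group of the first kind, $\chi:\Gamma\to\mathbb C^\times$ a character of finite order, and $m\ge 1$ an integer. Let $\Xi\subset M_m(\Gamma,\chi)$ be a complex subspace with $\dim\Xi\ge 3$, equipped with the Zariski topology. Let $f,g\in\Xi$ be linearly independent. For $l\ge1$ let $X_l$ be the set of all $h\in\Xi-(\mathbb C f+\mathbb C g)$ with $\deg\mathcal C(f,g,h)=l$, and for $k\ge 1$ let $Z_k$ be the set of all $h\in\Xi-(\mathbb C f+\mathbb C g)$ with $d(f,g,h)=k$. Then: (i) For every $l\ge 1$ the set $X_l$ is locally closed. The set of all $h\in\Xi-(\mathbb C f+\mathbb C g)$ such that $\deg\mathcal C(f,g,h)$ is largest possible is open (i.e., $X_L$ is open for the largest $L$ such that $X_L\ne\emptyset$). (ii) For each $l$ such that $X_l\neq\emptyset$, the set of all $h\in X_l$ such that $d(f,g,h)$ is smallest possible in $X_l$ (i.e., equal to $\min_{h'\in X_l}d(f,g,h')$) is an open set in $X_l$. (iii) For every $k\ge1$ the set $Z_k$ is constructible. The set $Z_k$ is empty unless $k$ divides the field extension degree $[\mathbb C(\mathfrak R_\Gamma):\mathbb C(g/f)]$.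
   Context: Let $\mathbb H$ be the upper half-plane with the action of $SL_2(\mathbb R)$ by $\gamma.z=(az+b)/(cz+d)$ and $j(\gamma,z)=cz+d$ for $\gamma=\begin{pmatrix}a&b\\c&d\end{pmatrix}$. A discrete subgroup $\Gamma\subset SL_2(\mathbb R)$ is a Fuchsian group of the first kind if $\iint_{\Gamma\backslash\mathbb H}\frac{dx\,dy}{y^2}<\infty$. $\mathfrak R_\Gamma$ denotes the compact Riemann surface obtained from $\Gamma\backslash\mathbb H$ by adding the finitely many cusps; it is regarded as a smooth irreducible projective curve over $\mathbb C$, and $\mathbb C(\mathfrak R_\Gamma)$ is its field of rational (equivalently, meromorphic) functions. $M_m(\Gamma,\chi)$ is the (finite-dimensional) complex vector space of holomorphic $f:\mathbb H\to\mathbb C$ with $f(\gamma.z)=\chi(\gamma)j(\gamma,z)^mf(z)$ for all $z\in\mathbb H$, $\gamma\in\Gamma$, that are holomorphic at every cusp of $\Gamma$. For linearly independent $f,g,h\in M_m(\Gamma,\chi)$, there is a unique holomorphic map $\mathfrak R_\Gamma\to\mathbb P^2$ given by $z\mapsto(f(z):g(z):h(z))$ on the complement of a finite set of $\Gamma$-orbits of common zeros of $f,g,h$. Its image is an irreducible projective plane curve denoted $\mathcal C(f,g,h)$. Its degree as a plane curve (the number of points of intersection with a line in general position) is denoted $\deg\mathcal C(f,g,h)$. The field of rational functions $\mathbb C(\mathcal C(f,g,h))$ is identified with the subfield $\mathbb C(g/f,h/f)$ of $\mathbb C(\mathfrak R_\Gamma)$, and $d(f,g,h)=[\mathbb C(\mathfrak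 R_\Gamma):\mathbb C(\mathcal C(f,g,h))]$ is the degree of the map. The Zariski topology on $\Xi$ is that of an affine space $\mathbb C^s$, $s=\dim \Xi$. A locally closed set is an intersection of an open and a closed set; a constructible set is a finite union of locally closed sets. *)

theory Defs
  imports
    "HOL-Complex_Analysis.Complex_Analysis"
    "HOL-Algebra.Embedded_Algebras"
    "HOL-Algebra.Generated_Fields"
    "HOL-Library.Function_Algebras"
begin

unbundle no Formal_Power_Series.fps_syntax

section \<open>Fuchsian groups of the first kind\<close>

definition upper_half_plane :: "complex set"
  where "upper_half_plane = {z. 0 < Im z}"

definition SL2R :: "(real^2^2) monoid"
  where "SL2R = \<lparr>carrier = {A. det A = 1}, monoid.mult = (**), one = mat 1\<rparr>"

definition mobius_act :: "real^2^2 \<Rightarrow> complex \<Rightarrow> complex"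
  where "mobius_act A z =
    (of_real (A$1$1) * z + of_real (A$1$2)) / (of_real (A$2$1) * z + of_real (A$2$2))"

definition automorphy :: "real^2^2 \<Rightarrow> complex \<Rightarrow> complex"
  where "automorphy A z = of_real (A$2$1) * z + of_real (A$2$2)"

text \<open>The area of the quotient is the area of any Borel set of representatives of the orbits.\<close>

definition finite_covolume :: "(real^2^2) set \<Rightarrow> bool"
  where "finite_covolume \<Gamma> \<longleftrightarrow>
    (\<exists>F \<in> sets borel. F \<subseteq> upper_half_plane \<and>
      (\<forall>z\<in>upper_half_plane. \<exists>!w. w \<in> F \<and> (\<exists>\<gamma>\<in>\<Gamma>. w = mobius_act \<gamma> z)) \<and>
      (\<integral>\<^sup>+z\<in>F. ennreal (1 / (Im z)\<^sup>2) \<partial>lborel) < \<infinity>)"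

definition fuchsian_first_kind :: "(real^2^2) set \<Rightarrow> bool"
  where "fuchsian_first_kind \<Gamma> \<longleftrightarrow> subgroup \<Gamma> SL2R \<and> discrete \<Gamma> \<and> finite_covolume \<Gamma>"

definition Cstar :: "complex monoid"
  where "Cstar = \<lparr>carrier = {z. z \<noteq> 0}, monoid.mult = (*), one = 1\<rparr>"

definition finite_order_character :: "(real^2^2) set \<Rightarrow> (real^2^2 \<Rightarrow> complex) \<Rightarrow> bool"
  where "finite_order_character \<Gamma> chi \<longleftrightarrow>
    chi \<in> hom (SL2R\<lparr>carrier := \<Gamma>\<rparr>) Cstar \<and> (\<exists>n>0. \<forall>\<gamma>\<in>\<Gamma>. chi \<gamma> ^ n = 1)"

section \<open>Cusps\<close>

definition parabolic :: "real^2^2 \<Rightarrow> bool"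
  where "parabolic A \<longleftrightarrow> \<bar>trace A\<bar> = 2 \<and> A \<noteq> mat 1 \<and> A \<noteq> - mat 1"

text \<open>
  A cusp is represented by the elements \<open>\<sigma>\<close> of \<open>SL\<^sub>2(\<real>)\<close> that carry \<open>\<infinity>\<close> to it. It is a fixed
  point of a parabolic element \<open>\<gamma>\<close> of the group, and \<open>\<gamma>\<close> fixes \<open>\<sigma>.\<infinity>\<close> iff the lower left
  entry of \<open>\<sigma>\<^sup>-\<^sup>1 \<gamma> \<sigma>\<close> vanishes.
\<close>

definition cusp_frames :: "(real^2^2) set \<Rightarrow> (real^2^2) set"
  where "cusp_frames \<Gamma> =
    {\<sigma> \<in> carrier SL2R. \<exists>\<gamma>\<in>\<Gamma>. parabolic \<gamma> \<and> (inv\<^bsub>SL2R\<^esub> \<sigma> ** \<gamma> ** \<sigma>)$2$1 = 0}"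

text \<open>The filter of neighbourhoods of the point at infinity of the half-plane.\<close>

definition at_cusp_infinity :: "complex filter"
  where "at_cusp_infinity = filtercomap Im at_top"

definition cusp_param :: "real \<Rightarrow> complex \<Rightarrow> complex"
  where "cusp_param w z = exp (2 * of_real pi * \<i> * z / of_real w)"

section \<open>Modular forms with character\<close>

text \<open>
  The width \<open>w\<close> is existentially quantified: \<open>f|\<sigma>\<close> need only be invariant up to a root of unity
  under the stabiliser of the cusp (because of the character, and of irregular cusps), so it has a
  genuine expansion only in the parameter belonging to a suitable multiple of the cusp width.
  The condition does not depend on the choice of that multiple.
\<close>

definition holomorphic_at_cusps :: "nat \<Rightarrow> (real^2^2) set \<Rightarrow> (complex \<Rightarrow> complex) \<Rightarrow> bool"
  where "holomorphic_at_cusps m \<Gamma> f \<longleftrightarrow>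
    (\<forall>\<sigma>\<in>cusp_frames \<Gamma>. \<exists>w>0. \<exists>F. F analytic_on {0} \<and>
      (\<forall>\<^sub>F z in at_cusp_infinity.
        f (mobius_act \<sigma> z) / automorphy \<sigma> z ^ m = F (cusp_param w z)))"

text \<open>
  Functions on the half-plane are extended by \<open>0\<close>, so that they form a vector space
  under the pointwise operations on \<open>complex \<Rightarrow> complex\<close>.
\<close>

definition modular_forms ::
    "nat \<Rightarrow> (real^2^2) set \<Rightarrow> (real^2^2 \<Rightarrow> complex) \<Rightarrow> (complex \<Rightarrow> complex) set"
  where "modular_forms m \<Gamma> chi =
    {f. f holomorphic_on upper_half_plane \<and> (\<forall>z. z \<notin> upper_half_plane \<longrightarrow> f z = 0) \<and>
        (\<forall>\<gamma>\<in>\<Gamma>. \<forall>z\<in>upper_half_plane.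
          f (mobius_act \<gamma> z) = chi \<gamma> * automorphy \<gamma> z ^ m * f z) \<and>
        holomorphic_at_cusps m \<Gamma> f}"

definition cfun_scale :: "complex \<Rightarrow> (complex \<Rightarrow> complex) \<Rightarrow> complex \<Rightarrow> complex"
  where "cfun_scale c f = (\<lambda>z. c * f z)"

interpretation cfun: vector_space cfun_scale
  by standard (auto simp: cfun_scale_def fun_eq_iff algebra_simps)

section \<open>The function field of the compactified quotient\<close>

text \<open>
  A meromorphic function on the compact Riemann surface is represented by its pullback to the
  half-plane: a \<open>\<Gamma>\<close>-invariant meromorphic function that is meromorphic in the local parameter
  at every cusp. Values at poles and outside the half-plane are \<open>0\<close>, removable singularities are
  filled in, so each meromorphic function has exactly one representative; after every operation
  \<open>remove_sings\<close> restores this normal form.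
\<close>

definition on_uhp :: "(complex \<Rightarrow> complex) \<Rightarrow> complex \<Rightarrow> complex"
  where "on_uhp f = (\<lambda>z. if z \<in> upper_half_plane then remove_sings f z else 0)"

definition meromorphic_at_cusps :: "(real^2^2) set \<Rightarrow> (complex \<Rightarrow> complex) \<Rightarrow> bool"
  where "meromorphic_at_cusps \<Gamma> f \<longleftrightarrow>
    (\<forall>\<sigma>\<in>cusp_frames \<Gamma>. \<exists>w>0. \<exists>F. F meromorphic_on {0} \<and>
      (\<forall>\<^sub>F z in at_cusp_infinity. f (mobius_act \<sigma> z) = F (cusp_param w z)))"

definition function_field :: "(real^2^2) set \<Rightarrow> (complex \<Rightarrow> complex) ring"
  where "function_field \<Gamma> = \<lparr>
    carrier = {f. f nicely_meromorphic_on upper_half_plane \<and>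
      (\<forall>z. z \<notin> upper_half_plane \<longrightarrow> f z = 0) \<and>
      (\<forall>\<gamma>\<in>\<Gamma>. \<forall>z\<in>upper_half_plane. f (mobius_act \<gamma> z) = f z) \<and>
      meromorphic_at_cusps \<Gamma> f},
    monoid.mult = (\<lambda>f g. on_uhp (\<lambda>z. f z * g z)),
    one = on_uhp (\<lambda>z. 1),
    zero = on_uhp (\<lambda>z. 0),
    add = (\<lambda>f g. on_uhp (\<lambda>z. f z + g z))\<rparr>"

definition quotient_fun :: "(complex \<Rightarrow> complex) \<Rightarrow> (complex \<Rightarrow> complex) \<Rightarrow> complex \<Rightarrow> complex"
  where "quotient_fun g f = on_uhp (\<lambda>z. g z / f z)"

text \<open>The subfield of the function field generated over the complex numbers by the given set.\<close>

definition adjoin :: "(real^2^2) set \<Rightarrow> (complex \<Rightarrow> complex) set \<Rightarrow> (complex \<Rightarrow> complex) set"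
  where "adjoin \<Gamma> S = generate_field (function_field \<Gamma>) (range (\<lambda>c. on_uhp (\<lambda>z. c)) \<union> S)"

definition field_degree :: "(real^2^2) set \<Rightarrow> (complex \<Rightarrow> complex) set \<Rightarrow> nat"
  where "field_degree \<Gamma> K = ring.dim (function_field \<Gamma>) K (carrier (function_field \<Gamma>))"

definition map_degree :: "(real^2^2) set \<Rightarrow>
    (complex \<Rightarrow> complex) \<Rightarrow> (complex \<Rightarrow> complex) \<Rightarrow> (complex \<Rightarrow> complex) \<Rightarrow> nat"
  where "map_degree \<Gamma> f g h = field_degree \<Gamma> (adjoin \<Gamma> {quotient_fun g f, quotient_fun h f})"

section \<open>The Zariski topology of a vector space\<close>

text \<open>
  Polynomial functions on a subspace \<open>V\<close>: the algebra generated by the linear functionals, that is,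
  the polynomials in linear coordinates if \<open>V\<close> has finite dimension.
\<close>

inductive_set polynomial_functions ::
    "('a::field \<Rightarrow> 'v::ab_group_add \<Rightarrow> 'v) \<Rightarrow> 'v set \<Rightarrow> ('v \<Rightarrow> 'a) set"
  for sc V
  where
    const: "(\<lambda>x. c) \<in> polynomial_functions sc V"
  | linear: "\<lbrakk>\<forall>x\<in>V. \<forall>y\<in>V. \<phi> (x + y) = \<phi> x + \<phi> y; \<forall>c. \<forall>x\<in>V. \<phi> (sc c x) = c * \<phi> x\<rbrakk>
      \<Longrightarrow> \<phi> \<in> polynomial_functions sc V"
  | add: "\<lbrakk>p \<in> polynomial_functions sc V; q \<in> polynomial_functions sc V\<rbrakk>
      \<Longrightarrow> (\<lambda>x. p x + q x) \<in> polynomial_functions sc V"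
  | mult: "\<lbrakk>p \<in> polynomial_functions sc V; q \<in> polynomial_functions sc V\<rbrakk>
      \<Longrightarrow> (\<lambda>x. p x * q x) \<in> polynomial_functions sc V"

definition zariski :: "('a::field \<Rightarrow> 'v::ab_group_add \<Rightarrow> 'v) \<Rightarrow> 'v set \<Rightarrow> 'v topology"
  where "zariski sc V = topology (\<lambda>U. U \<subseteq> V \<and>
    (\<exists>P \<subseteq> polynomial_functions sc V. V - U = {x \<in> V. \<forall>p\<in>P. p x = 0}))"

lemma istopology_zariski:
  "istopology (\<lambda>U. U \<subseteq> V \<and>
    (\<exists>P \<subseteq> polynomial_functions sc V. V - U = {x \<in> V. \<forall>p\<in>P. p x = 0}))"
  unfolding istopology_def
proof (intro conjI allI impI)
  fix S T
  assume "S \<subseteq> V \<and> (\<exists>P \<subseteq> polynomial_functions sc V. V - S = {x \<in> V. \<forall>p\<in>P. p x = 0})"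
    and "T \<subseteq> V \<and> (\<exists>P \<subseteq> polynomial_functions sc V. V - T = {x \<in> V. \<forall>p\<in>P. p x = 0})"
  then obtain P Q where "S \<subseteq> V"
    and P: "P \<subseteq> polynomial_functions sc V" "V - S = {x \<in> V. \<forall>p\<in>P. p x = 0}"
    and Q: "Q \<subseteq> polynomial_functions sc V" "V - T = {x \<in> V. \<forall>p\<in>Q. p x = 0}"
    by (elim conjE exE)
  from \<open>S \<subseteq> V\<close> show "S \<inter> T \<subseteq> V" by blast
  define R where "R = (\<lambda>(p, q) x. p x * q x) ` (P \<times> Q)"
  have R: "R \<subseteq> polynomial_functions sc V"
    unfolding R_def using P(1) Q(1) by (auto intro!: polynomial_functions.mult)
  have "x \<in> V - (S \<inter> T) \<longleftrightarrow> x \<in> V \<and> (\<forall>p\<in>R. p x = 0)" for x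
  proof -
    have "x \<in> V - (S \<inter> T) \<longleftrightarrow> x \<in> V - S \<or> x \<in> V - T" by blast
    also have "\<dots> \<longleftrightarrow> x \<in> V \<and> ((\<forall>p\<in>P. p x = 0) \<or> (\<forall>q\<in>Q. q x = 0))"
      unfolding P(2) Q(2) by blast
    also have "\<dots> \<longleftrightarrow> x \<in> V \<and> (\<forall>p\<in>P. \<forall>q\<in>Q. p x * q x = 0)"
      unfolding mult_eq_0_iff by blast
    also have "\<dots> \<longleftrightarrow> x \<in> V \<and> (\<forall>p\<in>R. p x = 0)"
      unfolding R_def by simp
    finally show ?thesis .
  qed
  then have "V - (S \<inter> T) = {x \<in> V. \<forall>p\<in>R. p x = 0}"
    unfolding set_eq_iff mem_Collect_eq by (rule allI)
  with R show "\<exists>P \<subseteq> polynomial_functions sc V. V - (S \<inter> T) = {x \<in> V. \<forall>p\<in>P. p x = 0}"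
    by (intro exI conjI)
next
  fix \<U>
  assume U: "\<forall>S\<in>\<U>. S \<subseteq> V \<and>
    (\<exists>P \<subseteq> polynomial_functions sc V. V - S = {x \<in> V. \<forall>p\<in>P. p x = 0})"
  show "\<Union>\<U> \<subseteq> V" by (rule Union_least) (rule U[THEN bspec, THEN conjunct1])
  from U have "\<forall>S\<in>\<U>. \<exists>P. P \<subseteq> polynomial_functions sc V \<and> V - S = {x \<in> V. \<forall>p\<in>P. p x = 0}"
    by (intro ballI) (drule (1) bspec, erule conjunct2)
  then obtain P where P: "\<forall>S\<in>\<U>. P S \<subseteq> polynomial_functions sc V \<and>
      V - S = {x \<in> V. \<forall>p\<in>P S. p x = 0}"
    by (rule bchoice[THEN exE])
  have "V - \<Union>\<U> = {x \<in> V. \<forall>S\<in>\<U>. x \<in> V - S}" by blast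
  also have "\<dots> = {x \<in> V. \<forall>S\<in>\<U>. x \<in> {x \<in> V. \<forall>p\<in>P S. p x = 0}}"
    using P by (intro Collect_cong conj_cong ball_cong refl) simp
  also have "\<dots> = {x \<in> V. \<forall>p\<in>\<Union>(P ` \<U>). p x = 0}" by blast
  finally have "V - \<Union>\<U> = {x \<in> V. \<forall>p\<in>\<Union>(P ` \<U>). p x = 0}" .
  moreover have "\<Union>(P ` \<U>) \<subseteq> polynomial_functions sc V" using P by blast
  ultimately show "\<exists>P \<subseteq> polynomial_functions sc V. V - \<Union>\<U> = {x \<in> V. \<forall>p\<in>P. p x = 0}"
    by (intro exI conjI)
qed

lemma openin_zariski:
  "openin (zariski sc V) U \<longleftrightarrow> U \<subseteq> V \<and>
    (\<exists>P \<subseteq> polynomial_functions sc V. V - U = {x \<in> V. \<forall>p\<in>P. p x = 0})"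
  unfolding zariski_def by (subst topology_inverse'[OF istopology_zariski]) (rule refl)

lemma topspace_zariski: "topspace (zariski sc V) = V"
proof
  have "openin (zariski sc V) (topspace (zariski sc V))" by (rule openin_topspace)
  then show "topspace (zariski sc V) \<subseteq> V" unfolding openin_zariski by (rule conjunct1)
  have "{\<lambda>x. 1} \<subseteq> polynomial_functions sc V"
    by (blast intro: polynomial_functions.const)
  then have "openin (zariski sc V) V"
    unfolding openin_zariski by (intro conjI exI[of _ "{\<lambda>x. 1}"] subset_refl) auto
  then show "V \<subseteq> topspace (zariski sc V)" by (rule openin_subset)
qed

definition locally_closed_in :: "'a topology \<Rightarrow> 'a set \<Rightarrow> bool"
  where "locally_closed_in T S \<longleftrightarrow> (\<exists>U C. openin T U \<and> closedin T C \<and> S = U \<inter> C)"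

definition constructible_in :: "'a topology \<Rightarrow> 'a set \<Rightarrow> bool"
  where "constructible_in T S \<longleftrightarrow>
    (\<exists>\<A>. finite \<A> \<and> (\<forall>A\<in>\<A>. locally_closed_in T A) \<and> S = \<Union>\<A>)"

section \<open>The plane curve and its degree\<close>

text \<open>A point of the projective plane is a line through the origin of \<open>\<complex>\<^sup>3\<close>.\<close>

definition proj_point :: "complex^3 \<Rightarrow> (complex^3) set"
  where "proj_point v = vec.span {v}"

text \<open>Convergence in the projective plane of the classes of \<open>u z\<close> to the class of \<open>v\<close>.\<close>

definition proj_tendsto :: "('a \<Rightarrow> complex^3) \<Rightarrow> complex^3 \<Rightarrow> 'a filter \<Rightarrow> bool"
  where "proj_tendsto u v F \<longleftrightarrow> v \<noteq> 0 \<and>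
    (\<exists>c. (\<forall>\<^sub>F z in F. c z \<noteq> 0) \<and> ((\<lambda>z. c z *s u z) \<longlongrightarrow> v) F)"

text \<open>
  The points of the half-plane and the cusps, given by the traces on the half-plane of their
  punctured neighbourhoods.
\<close>

definition surface_points :: "(real^2^2) set \<Rightarrow> complex filter set"
  where "surface_points \<Gamma> = at ` upper_half_plane \<union>
    (\<lambda>\<sigma>. filtermap (mobius_act \<sigma>) at_cusp_infinity) ` cusp_frames \<Gamma>"

text \<open>
  The image of the compact Riemann surface under the holomorphic extension of \<open>(f : g : h)\<close>; the
  value of the extension at a common zero or at a cusp is the limit of \<open>(f : g : h)\<close> there.
\<close>

definition plane_curve :: "(real^2^2) set \<Rightarrow>
    (complex \<Rightarrow> complex) \<Rightarrow> (complex \<Rightarrow> complex) \<Rightarrow> (complex \<Rightarrow> complex) \<Rightarrow> (complex^3) set set"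
  where "plane_curve \<Gamma> f g h =
    {proj_point v | v. \<exists>F\<in>surface_points \<Gamma>. proj_tendsto (\<lambda>z. vector [f z, g z, h z]) v F}"

definition proj_line :: "complex^3 \<Rightarrow> (complex^3) set set"
  where "proj_line a = {proj_point v | v. v \<noteq> 0 \<and> (\<Sum>i\<in>UNIV. a$i * v$i) = 0}"

text \<open>
  The number of points on a line in general position, that is, on the lines \<open>proj_line a\<close> with
  \<open>a \<noteq> 0\<close> in some nonempty Zariski open set of coefficient vectors.
\<close>

definition plane_degree :: "(complex^3) set set \<Rightarrow> nat"
  where "plane_degree C = (THE n. \<exists>U. openin (zariski (*s) UNIV) U \<and> U \<noteq> {} \<and>
    (\<forall>a\<in>U - {0}. finite (C \<inter> proj_line a) \<and> card (C \<inter> proj_line a) = n))"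

section \<open>The strata\<close>

definition X_stratum :: "(real^2^2) set \<Rightarrow> (complex \<Rightarrow> complex) set \<Rightarrow>
    (complex \<Rightarrow> complex) \<Rightarrow> (complex \<Rightarrow> complex) \<Rightarrow> nat \<Rightarrow> (complex \<Rightarrow> complex) set"
  where "X_stratum \<Gamma> \<Xi> f g l =
    {h \<in> \<Xi> - cfun.span {f, g}. plane_degree (plane_curve \<Gamma> f g h) = l}"

definition Z_stratum :: "(real^2^2) set \<Rightarrow> (complex \<Rightarrow> complex) set \<Rightarrow>
    (complex \<Rightarrow> complex) \<Rightarrow> (complex \<Rightarrow> complex) \<Rightarrow> nat \<Rightarrow> (complex \<Rightarrow> complex) set"
  where "Z_stratum \<Gamma> \<Xi> f g k = {h \<in> \<Xi> - cfun.span {f, g}. map_degree \<Gamma> f g h = k}"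

end

theory Submission
  imports Defs "Jordan_Normal_Form.Char_Poly" "HOL-Computational_Algebra.Field_as_Ring"
begin

text \<open>
 By Zassenhaus' lemma, the elements of \<open>\<Gamma>\<close> with small displacement at a point commute, and finite covolume
 then leaves, modulo \<open>\<Gamma>\<close>, a compact set together with finitely many cusp neighbourhoods. This compactness
 shows that functions whose poles are dominated by those of \<open>\<phi> = g/f\<close> form finitely generated modules over
 \<open>\<complex>[\<phi>]\<close>, so that the function field has a finite degree \<open>N\<close> over \<open>\<complex>(\<phi>)\<close>. The relation of least degree \<open>l\<close>
 between \<open>\<phi>\<close> and \<open>\<psi> = h/f\<close> is the equation of the curve: \<open>deg C(f, g, h) = l\<close>, and \<open>d(f, g, h) \<cdot> e = N\<close>, where
 \<open>e\<close> is its degree in \<open>\<psi>\<close>. A relation with given bounds on both degrees exists if and only if the corresponding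
 monomials \<open>\<phi>\<^sup>i \<psi>\<^sup>j\<close> are linearly dependent, which is a Zariski closed condition on \<open>h\<close>.
\<close>

no_notation vec_index (infixl "$" 100)
hide_const (open) Matrix.mat Determinant.det Matrix.row Matrix.col Matrix.vec
hide_type (open) Matrix.vec Matrix.mat
hide_fact (open) Matrix.vec_eq_iff Matrix.mat_def

text \<open>
 The class instances of \<^theory>\<open>HOL-Computational_Algebra.Field_as_Ring\<close> turn these rules into rewrite rules
 for complex division that loop with \<open>field_simps\<close>.
\<close>
declare div_mult_self1 [simp del] div_mult_self2 [simp del] div_mult_self3 [simp del] div_mult_self4 [simp del]
 div_add_self1 [simp del] div_add_self2 [simp del]
hide_const (open) up_ring.coeff up_ring.monom module.smult

text \<open>The hypothesis supplies only a Borel set of representatives of finite area: compactness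
  of the surface, finiteness of the cusps and finite dimension of spaces of functions have to be
  extracted from it. Compactness is used in one form throughout: neighbourhoods chosen at all points
  and cusps have a finite subfamily that covers modulo \<open>\<Gamma>\<close>. Riemann-Roch is
  replaced by the growth spaces \<open>|u| \<le> K (1 + |\<phi>|)^k\<close>; the codimension of each
  in the next is bounded independently of \<open>k\<close>, whence finite generation. Two obstacles
  shape the rest. The degree of the relation in \<open>\<psi>\<close> is detected by linear
  dependence only if the total degree is bounded first, by one bound for all \<open>h\<close>;
  counting monomials provides it, because only finitely many generators and denominators, those of a
  basis of \<open>\<Xi>\<close>, enter. And the relation is monic in \<open>\<psi>\<close>, up to a
  constant, only when \<open>(0 : 0 : 1)\<close> is off the curve, so it is treated as a ternary
  form and coordinates are changed for every point to be excluded. Both invariants come from one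
  relation because it divides all others.\<close>

abbreviation ae_uhp :: "(complex => bool) => bool" (binder "AEH " 10) where
  "ae_uhp P \<equiv> eventually P (cosparse upper_half_plane)"
type_synonym cfn = "complex => complex"
abbreviation "PF \<equiv> polynomial_functions (*s) UNIV"
abbreviation "\<H> \<equiv> upper_half_plane"
abbreviation "mob \<equiv> mobius_act"
abbreviation "at_cusp \<equiv> at_cusp_infinity"

section \<open>The group SL(2,R) and its action on the half-plane\<close>

definition mat2 :: "real => real => real => real => real^2^2"
 where "mat2 a b c d = (\<chi> i j. if i = 1 then (if j = 1 then a else b) else (if j = 1 then c else d))"

lemma mat2_nth [simp]:
 "mat2 a b c d $ 1 $ 1 = a" "mat2 a b c d $ 1 $ 2 = b"
 "mat2 a b c d $ 2 $ 1 = c" "mat2 a b c d $ 2 $ 2 = d" by (simp_all add: mat2_def)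

lemma mat2_eqI:
 fixes A B :: "real^2^2"
 assumes "A$1$1 = B$1$1" "A$1$2 = B$1$2" "A$2$1 = B$2$1" "A$2$2 = B$2$2"
 shows "A = B" using assms by (simp add: Finite_Cartesian_Product.vec_eq_iff forall_2)

lemma mat2_mult_nth [simp]:
 fixes A B :: "real^2^2"
 shows "(A ** B)$i$j = A$i$1 * B$1$j + A$i$2 * B$2$j" by (simp add: matrix_matrix_mult_def sum_2)

lemma mat_1_nth_2 [simp]:
 "(mat 1 :: real^2^2)$1$1 = 1" "(mat 1 :: real^2^2)$1$2 = 0"
 "(mat 1 :: real^2^2)$2$1 = 0" "(mat 1 :: real^2^2)$2$2 = 1" by (simp_all add: Finite_Cartesian_Product.mat_def)

lemma norm_mat2_sq:
 fixes A :: "real^2^2"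
 shows "(norm A)\<^sup>2 = (A$1$1)\<^sup>2 + (A$1$2)\<^sup>2 + (A$2$1)\<^sup>2 + (A$2$2)\<^sup>2"
 by (simp add: norm_vec_def L2_set_def sum_2)

text \<open>Cauchy-Schwarz for each entry of the product: \<open>norm\<close> is the Euclidean norm
  of the four entries, hence the Frobenius norm.\<close>

lemma norm_mat2_mult:
 fixes A B :: "real^2^2"
 shows "norm (A ** B) \<le> norm A * norm B"
proof -
 have cs: "(a * x + b * y)\<^sup>2 \<le> (a\<^sup>2 + b\<^sup>2) * (x\<^sup>2 + y\<^sup>2)" for a b x y :: real
 proof -
  have "(a\<^sup>2 + b\<^sup>2) * (x\<^sup>2 + y\<^sup>2) - (a * x + b * y)\<^sup>2 = (a * y - b * x)\<^sup>2"
   by (simp add: power2_eq_square algebra_simps)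
  thus ?thesis by (smt (verit) zero_le_power2)
 qed
 have "(norm (A ** B))\<^sup>2 \<le> (norm A)\<^sup>2 * (norm B)\<^sup>2" unfolding norm_mat2_sq[of "A ** B"] mat2_mult_nth
  using cs[of "A$1$1" "B$1$1" "A$1$2" "B$2$1"] cs[of "A$1$1" "B$1$2" "A$1$2" "B$2$2"]
   cs[of "A$2$1" "B$1$1" "A$2$2" "B$2$1"] cs[of "A$2$1" "B$1$2" "A$2$2" "B$2$2"] by (simp add: norm_mat2_sq algebra_simps)
 hence "(norm (A ** B))\<^sup>2 \<le> (norm A * norm B)\<^sup>2" by (simp add: power_mult_distrib)
 thus ?thesis by (rule power2_le_imp_le) simp
qed

lemma abs_nth_le_norm_mat2: "\<bar>(A::real^2^2)$i$j\<bar> \<le> norm A"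
 using component_le_norm_cart[of "A$i" j] Finite_Cartesian_Product.norm_nth_le[of A i] by linarith

text \<open>The adjugate: it is the inverse when the determinant is 1, but it is defined and linear
  for all matrices and preserves the norm, which keeps estimates free of group inverses.\<close>

definition adj2 :: "real^2^2 => real^2^2"
 where "adj2 A = mat2 (A$2$2) (- A$1$2) (- A$2$1) (A$1$1)"

lemma adj2_nth [simp]:
 "adj2 A $ 1 $ 1 = A$2$2" "adj2 A $ 1 $ 2 = - A$1$2"
 "adj2 A $ 2 $ 1 = - A$2$1" "adj2 A $ 2 $ 2 = A$1$1" by (simp_all add: adj2_def)

lemma norm_adj2 [simp]: "norm (adj2 A) = norm A"
proof -
 have "(norm (adj2 A))\<^sup>2 = (norm A)\<^sup>2" by (simp add: norm_mat2_sq)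
 thus ?thesis by (metis norm_ge_zero power2_eq_iff_nonneg)
qed

lemma adj2_adj2 [simp]: "adj2 (adj2 A) = A" by (rule mat2_eqI) simp_all

lemma det_adj2 [simp]: "det (adj2 A) = det A" by (simp add: det_2)

lemma det_mat2 [simp]: "det (mat2 a b c d) = a * d - b * c" by (simp add: det_2)

lemma adj2_left: "det A = 1 ==> adj2 A ** A = mat 1" by (rule mat2_eqI) (simp_all add: det_2 algebra_simps)

lemma adj2_right: "det A = 1 ==> A ** adj2 A = mat 1" by (rule mat2_eqI) (simp_all add: det_2 algebra_simps)

lemma adj2_mult: "adj2 (A ** B) = adj2 B ** adj2 A" by (rule mat2_eqI) (simp_all add: algebra_simps)

lemma adj2_cancel [simp]:
 assumes "det A = 1"
 shows "adj2 A ** (A ** B) = B" "A ** (adj2 A ** B) = B" "(B ** A) ** adj2 A = B" "(B ** adj2 A) ** A = B"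
 using assms by (simp_all add: matrix_mul_assoc adj2_left adj2_right) (simp_all add: matrix_mul_assoc[symmetric] adj2_left adj2_right)

lemma carrier_SL2R [simp]: "A \<in> carrier SL2R \<longleftrightarrow> det A = 1" by (simp add: SL2R_def)

lemma mult_SL2R [simp]: "A \<otimes>\<^bsub>SL2R\<^esub> B = A ** B" by (simp add: SL2R_def)

lemma one_SL2R [simp]: "\<one>\<^bsub>SL2R\<^esub> = mat 1" by (simp add: SL2R_def)

lemma group_SL2R: "group SL2R"
proof (rule groupI)
 fix A assume "A \<in> carrier SL2R"
 thus "\<exists>B\<in>carrier SL2R. B \<otimes>\<^bsub>SL2R\<^esub> A = \<one>\<^bsub>SL2R\<^esub>"
  by (intro bexI[of _ "adj2 A"]) (simp_all add: adj2_left)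
qed (simp_all add: det_mul matrix_mul_assoc)

lemma inv_SL2R: "det A = 1 ==> inv\<^bsub>SL2R\<^esub> A = adj2 A"
 by (rule group.inv_equality[OF group_SL2R]) (simp_all add: adj2_left)

lemma uhp_iff [simp]: "z \<in> \<H> \<longleftrightarrow> 0 < Im z" by (simp add: upper_half_plane_def)

lemma open_uhp: "open \<H>" unfolding upper_half_plane_def by (rule open_halfspace_Im_gt)

lemma convex_uhp: "convex \<H>" unfolding upper_half_plane_def by (rule convex_halfspace_Im_gt)

lemma connected_uhp: "connected \<H>" by (rule convex_connected[OF convex_uhp])

lemma automorphy_nonzero:
 assumes "det A = 1" "0 < Im z"
 shows "automorphy A z ~= 0"
proof
 assume *: "automorphy A z = 0"
 hence "Im (automorphy A z) = 0" by simp
 with assms have "A$2$1 = 0" by (simp add: automorphy_def)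
 with * have "A$2$2 = 0" by (simp add: automorphy_def)
 with \<open>A$2$1 = 0\<close> assms show False by (simp add: det_2)
qed

lemma mobius_act_altdef:
 "mob A z = (of_real (A$1$1) * z + of_real (A$1$2)) / automorphy A z" by (simp add: mobius_act_def automorphy_def)

lemma Im_mobius_act:
 assumes "det A = 1" "0 < Im z"
 shows "Im (mob A z) = Im z / (cmod (automorphy A z))\<^sup>2"
proof -
 have "Im (mob A z) = Im ((of_real (A$1$1) * z + of_real (A$1$2)) * cnj (automorphy A z)) /
   (cmod (automorphy A z))\<^sup>2"
  unfolding mobius_act_altdef by (simp only: Im_complex_div_eq_0 complex_div_cnj[of _ "automorphy A z"]) (metis Im_divide_of_real of_real_power)
 also have "Im ((of_real (A$1$1) * z + of_real (A$1$2)) * cnj (automorphy A z)) =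
   (A$1$1 * A$2$2 - A$1$2 * A$2$1) * Im z" by (simp add: automorphy_def algebra_simps)
 finally show ?thesis using assms(1) by (simp add: det_2)
qed

lemma mobius_act_uhp [simp]:
 assumes "det A = 1" "0 < Im z"
 shows "0 < Im (mob A z)" using assms by (simp add: Im_mobius_act automorphy_nonzero)

lemma automorphy_mult:
 assumes "det B = 1" "0 < Im z"
 shows "automorphy (A ** B) z = automorphy A (mob B z) * automorphy B z" using automorphy_nonzero[OF assms]
 unfolding automorphy_def[of A] mobius_act_altdef by (simp add: distrib_right) (simp add: automorphy_def algebra_simps)

lemma mobius_act_mult:
 assumes "det A = 1" "det B = 1" "0 < Im z"
 shows "mob (A ** B) z = mob A (mob B z)"
proof -
 have nz: "automorphy B z ~= 0" "automorphy A (mob B z) ~= 0" using assms by (simp_all add: automorphy_nonzero)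
 have "mob A (mob B z) =
  ((of_real (A$1$1) * mob B z + of_real (A$1$2)) * automorphy B z) /
  (automorphy A (mob B z) * automorphy B z)" using nz by (simp add: mobius_act_altdef[of A])
 also have "(of_real (A$1$1) * mob B z + of_real (A$1$2)) * automorphy B z =
   of_real ((A ** B)$1$1) * z + of_real ((A ** B)$1$2)"
  using nz by (simp add: mobius_act_altdef[of B] field_simps) (simp add: automorphy_def algebra_simps)
 finally show ?thesis using assms by (simp add: automorphy_mult mobius_act_altdef[of "A ** B"])
qed

lemma mobius_act_1 [simp]: "mob (mat 1) z = z" by (simp add: mobius_act_def)

lemma mobius_act_adj2 [simp]:
 assumes "det A = 1" "0 < Im z"
 shows "mob (adj2 A) (mob A z) = z" "mob A (mob (adj2 A) z) = z"
 using assms by (simp_all flip: mobius_act_mult add: adj2_left adj2_right)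

text \<open>A point \<open>z\<close> is represented by a frame \<open>g\<close> with
  \<open>g.\<i> = z\<close>, so that estimates of hyperbolic distances become estimates of matrix
  norms; this is the upper triangular choice of \<open>g\<close>.\<close>

definition point_mat :: "complex => real^2^2"
 where "point_mat z = mat2 (sqrt (Im z)) (Re z / sqrt (Im z)) 0 (1 / sqrt (Im z))"

lemma point_mat:
 assumes "0 < Im z"
 shows "det (point_mat z) = 1" "mob (point_mat z) \<i> = z"
 using assms by (simp_all add: point_mat_def mobius_act_def complex_eq_iff
   flip: of_real_mult of_real_divide)

text \<open>Both bounds come from the sums of squares of the rows; they turn a norm bound on frames
  into a compact set of points.\<close>

lemma mobius_act_i_bounds:
 assumes "det A = 1" "norm A \<le> R"
 shows "1 / R\<^sup>2 \<le> Im (mob A \<i>)" "cmod (mob A \<i>) \<le> R\<^sup>2"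
proof -
 have R: "R\<^sup>2 \<ge> (A$1$1)\<^sup>2 + (A$1$2)\<^sup>2 + (A$2$1)\<^sup>2 + (A$2$2)\<^sup>2"
  unfolding norm_mat2_sq[symmetric] using assms(2) by (simp add: power_mono)
 have j: "(cmod (automorphy A \<i>))\<^sup>2 = (A$2$1)\<^sup>2 + (A$2$2)\<^sup>2" by (simp add: automorphy_def cmod_def)
 have pos: "0 < (A$2$1)\<^sup>2 + (A$2$2)\<^sup>2"
  unfolding j[symmetric] using automorphy_nonzero[OF assms(1), of \<i>] by simp
 have "(A$2$1)\<^sup>2 + (A$2$2)\<^sup>2 \<le> R\<^sup>2" using R by (smt (verit) zero_le_power2)
 thus "1 / R\<^sup>2 \<le> Im (mob A \<i>)"
  using pos assms by (subst Im_mobius_act) (auto simp: j intro!: divide_left_mono mult_pos_pos)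
 define u v where "u = (A$1$1)\<^sup>2 + (A$1$2)\<^sup>2" and "v = (A$2$1)\<^sup>2 + (A$2$2)\<^sup>2"
 \<comment> \<open>Lagrange's identity for the two rows; with determinant 1 it gives
   \<open>1 / v \<le> u\<close>, hence \<open>u / v \<le> u * u\<close>.\<close>
 have uv: "u * v = (A$1$1 * A$2$1 + A$1$2 * A$2$2)\<^sup>2 + (det A)\<^sup>2"
  by (simp add: u_def v_def det_2 power2_eq_square algebra_simps)
 hence "u * v \<ge> 1" using assms by simp
 have "(cmod (mob A \<i>))\<^sup>2 = u / v" by (simp add: mobius_act_altdef norm_divide power_divide j v_def u_def)
   (simp add: cmod_power2)
 also have "\<dots> \<le> u * u"
  using \<open>u * v \<ge> 1\<close> pos by (simp add: v_def[symmetric] divide_le_eq) (metis mult.assoc mult_le_cancel_left1 not_less sum_power2_ge_zero u_def)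
 also have "\<dots> \<le> (R\<^sup>2)\<^sup>2"
 proof -
  have "u \<le> R\<^sup>2" using R pos by (simp add: u_def)
  moreover have "0 \<le> u" by (simp add: u_def)
  ultimately show ?thesis unfolding power2_eq_square[of "R\<^sup>2"] by (intro mult_mono) auto
 qed
 finally show "cmod (mob A \<i>) \<le> R\<^sup>2" by (rule power2_le_imp_le) simp
qed

section \<open>Invariance of the hyperbolic area\<close>

text \<open>Only an inequality is claimed, so that an infinite right-hand side is trivial and a
  finite one makes the integrand absolutely integrable. Equality for Moebius maps is recovered by
  applying it to the inverse map as well.\<close>

lemma nn_integral_change_of_variables_le:
 fixes u :: "real^'m::{finite,wellorder} => real" and G :: "real^'m::{finite,wellorder} => real^'m::{finite,wellorder}"
 assumes B: "B \<in> sets borel" and GB: "G ` B \<in> sets borel"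
  and der: "\<And>x. x \<in> B ==> (G has_derivative G' x) (at x)"
  and inj: "inj_on G B"
  and u: "u \<in> borel_measurable borel" "\<And>x. 0 \<le> u x"
  and v: "v \<in> borel_measurable borel" "\<And>x. 0 \<le> v x"
  and uv: "\<And>x. x \<in> B ==> \<bar>det (matrix (G' x))\<bar> * u (G x) = v x"
 shows "(\<integral>\<^sup>+x\<in>G ` B. ennreal (u x) \<partial>lborel) \<le> (\<integral>\<^sup>+x\<in>B. ennreal (v x) \<partial>lborel)"
proof (cases "(\<integral>\<^sup>+x\<in>B. ennreal (v x) \<partial>lborel) = \<infinity>")
 case False
 define r where "r = enn2real (\<integral>\<^sup>+x\<in>B. ennreal (v x) \<partial>lborel)"
 have eqv: "(\<lambda>x. ennreal (v x) * indicator B x) = (\<lambda>x. ennreal (v x * indicator B x))"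
  by (auto simp: indicator_def)
 have equ: "(\<lambda>x. ennreal (u x) * indicator (G ` B) x) = (\<lambda>x. ennreal (u x * indicator (G ` B) x))"
  by (auto simp: indicator_def)
 have r: "(\<integral>\<^sup>+x. ennreal (v x * indicator B x) \<partial>lborel) = ennreal r" "0 \<le> r"
  using False by (simp_all add: r_def eqv less_top)
 have "((\<lambda>x. v x * indicator B x) has_integral r) UNIV" by (rule nn_integral_has_integral) (use r v B in auto)
 hence "((\<lambda>x. if x \<in> B then v x else 0) has_integral r) UNIV" by (rule has_integral_eq[rotated]) auto
 hence "(v has_integral r) B" by (simp only: has_integral_restrict_UNIV)
 hence 1: "((\<lambda>x. \<bar>det (matrix (G' x))\<bar> *\<^sub>R u (G x)) has_integral r) B"
  by (rule has_integral_eq[rotated]) (simp add: uv)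
 hence 2: "(\<lambda>x. \<bar>det (matrix (G' x))\<bar> *\<^sub>R u (G x)) absolutely_integrable_on B"
  by (intro nonnegative_absolutely_integrable_1) (auto simp: u)
 \<comment> \<open>Passage to \<open>real^1\<close>-valued functions, the form in which the theorem
   on absolutely integrable functions is applied.\<close>
 have "(\<lambda>x. \<bar>det (matrix (G' x))\<bar> *\<^sub>R (vec (u (G x)) :: real^1)) absolutely_integrable_on B \<and>
   integral B (\<lambda>x. \<bar>det (matrix (G' x))\<bar> *\<^sub>R (vec (u (G x)) :: real^1)) = vec r"
  using 1 2 unfolding integrable_on_1_iff integral_on_1_eq absolutely_integrable_on_1_iff
  by (simp add: integral_unique o_def vec_eq_iff)
 hence "(\<lambda>x. vec (u x) :: real^1) absolutely_integrable_on (G ` B) \<and>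
   integral (G ` B) (\<lambda>x. vec (u x) :: real^1) = vec r" by (subst (asm) has_absolute_integral_change_of_variables)
   (use B inj in \<open>auto intro: has_derivative_at_withinI[OF der]\<close>)
 hence "(u has_integral r) (G ` B)" unfolding absolutely_integrable_on_1_iff integral_on_1_eq
  by (auto simp: o_def vec_eq_iff has_integral_iff absolutely_integrable_on_def)
 hence "((\<lambda>x. if x \<in> G ` B then u x else 0) has_integral r) UNIV" by (simp only: has_integral_restrict_UNIV)
 hence "((\<lambda>x. u x * indicator (G ` B) x) has_integral r) UNIV" by (rule has_integral_eq[rotated]) auto
 hence "(\<integral>\<^sup>+x. ennreal (u x * indicator (G ` B) x) \<partial>lborel) = ennreal r"
  by (intro nn_integral_has_integral_lborel) (use u GB in auto)
 thus ?thesis using r by (simp add: equ eqv)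
qed auto

definition of_vec2 :: "real^2 => complex" where "of_vec2 v = Complex (v$1) (v$2)"
definition to_vec2 :: "complex => real^2" where "to_vec2 z = vector [Re z, Im z]"

lemma of_vec2_to_vec2 [simp]: "of_vec2 (to_vec2 z) = z" by (simp add: of_vec2_def to_vec2_def)

lemma to_vec2_of_vec2 [simp]: "to_vec2 (of_vec2 v) = v" by (simp add: of_vec2_def to_vec2_def vec_eq_iff forall_2)

lemma bounded_linear_of_vec2: "bounded_linear of_vec2"
proof -
 have "linear of_vec2" by (intro linearI) (simp_all add: of_vec2_def complex_eq_iff)
 thus ?thesis by (rule linear_conv_bounded_linear[THEN iffD1])
qed

lemma bounded_linear_to_vec2: "bounded_linear to_vec2"
proof -
 have "linear to_vec2" by (intro linearI) (simp_all add: to_vec2_def vec_eq_iff forall_2)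
 thus ?thesis by (rule linear_conv_bounded_linear[THEN iffD1])
qed

lemma borel_measurable_of_vec2 [measurable]: "of_vec2 \<in> borel_measurable borel"
 by (intro borel_measurable_continuous_onI linear_continuous_on bounded_linear_of_vec2)

text \<open>Lebesgue measure is determined by its values on boxes; this moves integrals to
  \<open>real^2\<close>, where derivatives have matrices and determinants.\<close>

lemma lborel_complex: "(lborel :: complex measure) = distr lborel borel of_vec2"
proof (rule lborel_eqI)
 fix l u :: complex
 assume le: "\<And>b. b \<in> Basis ==> l \<bullet> b \<le> u \<bullet> b"
 have le': "Re l \<le> Re u" "Im l \<le> Im u" using le[of 1] le[of \<i>] by (simp_all add: Basis_complex_def)
 have B2: "Basis = {axis 1 1, axis 2 1 :: real^2}" "axis 1 (1::real) ~= (axis 2 1 :: real^2)"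
  by (auto simp: Basis_vec_def UNIV_2 axis_eq_axis)
 have "of_vec2 -` box l u = box (to_vec2 l) (to_vec2 u)"
  by (auto simp: box_def Basis_complex_def of_vec2_def to_vec2_def B2 inner_axis)
 moreover have "(\<Prod>b\<in>Basis. (to_vec2 u - to_vec2 l) \<bullet> b) = (\<Prod>b\<in>Basis. (u - l) \<bullet> b)"
  using B2(2) by (simp add: Basis_complex_def B2(1) inner_axis to_vec2_def)
 moreover have "to_vec2 l \<bullet> b \<le> to_vec2 u \<bullet> b" if "b \<in> Basis" for b
  using that le' by (auto simp: B2 inner_axis to_vec2_def)
 ultimately show "emeasure (distr lborel borel of_vec2) (box l u) = (\<Prod>b\<in>Basis. (u - l) \<bullet> b)"
  by (simp add: emeasure_distr emeasure_lborel_box_eq)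
qed simp

definition hyp_measure :: "complex measure"
 where "hyp_measure = density lborel (\<lambda>z. ennreal (1 / (Im z)\<^sup>2))"

lemma sets_hyp_measure [simp, measurable_cong]: "sets hyp_measure = sets borel" by (simp add: hyp_measure_def)

lemma emeasure_hyp_measure:
 assumes "S \<in> sets borel"
 shows "emeasure hyp_measure S = (\<integral>\<^sup>+z\<in>S. ennreal (1 / (Im z)\<^sup>2) \<partial>lborel)"
 unfolding hyp_measure_def by (rule emeasure_density) (use assms in auto)

lemma borel_measurable_mobius_act [measurable]: "mob A \<in> borel_measurable borel"
 unfolding mobius_act_def[abs_def] by measurable

lemma mobius_act_image_eq:
 assumes "det A = 1" "B \<subseteq> \<H>"
 shows "mob A ` B = mob (adj2 A) -` B \<inter> \<H>"
proof (intro equalityI subsetI)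
 fix z assume "z \<in> mob A ` B"
 thus "z \<in> mob (adj2 A) -` B \<inter> \<H>" using assms by (auto simp: subset_iff)
next
 fix z assume z: "z \<in> mob (adj2 A) -` B \<inter> \<H>"
 hence "mob A (mob (adj2 A) z) = z" using assms by simp
 thus "z \<in> mob A ` B" using z by (metis Int_iff image_eqI vimage_eq)
qed

lemma uhp_borel [measurable]: "\<H> \<in> sets borel" using open_uhp by simp

lemma mobius_act_image_borel:
 assumes "det A = 1" "B \<subseteq> \<H>" "B \<in> sets borel"
 shows "mob A ` B \<in> sets borel" unfolding mobius_act_image_eq[OF assms(1,2)]
 using measurable_sets[OF borel_measurable_mobius_act, of B "adj2 A"] assms(3) by auto

lemma has_field_derivative_mobius_act:
 assumes "det A = 1" "0 < Im z"
 shows "(mob A has_field_derivative 1 / (automorphy A z)\<^sup>2) (at z)"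
proof -
 have nz: "of_real (A$2$1) * z + of_real (A$2$2) ~= 0" using automorphy_nonzero[OF assms] by (simp add: automorphy_def)
 have d: "complex_of_real (A$1$1) * complex_of_real (A$2$2) - complex_of_real (A$1$2) * complex_of_real (A$2$1) = 1"
  using arg_cong[OF assms(1), of complex_of_real] by (simp add: det_2)
 have "(mob A has_field_derivative
  (of_real (A$1$1) * (of_real (A$2$1) * z + of_real (A$2$2)) -
   (of_real (A$1$1) * z + of_real (A$1$2)) * of_real (A$2$1)) /
  ((of_real (A$2$1) * z + of_real (A$2$2)) * (of_real (A$2$1) * z + of_real (A$2$2)))) (at z)"
  unfolding mobius_act_def[abs_def] using nz by (auto intro!: derivative_eq_intros)
 also have "of_real (A$1$1) * (of_real (A$2$1) * z + of_real (A$2$2)) -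
   (of_real (A$1$1) * z + of_real (A$1$2)) * of_real (A$2$1) = (1::complex)" using d by (simp add: algebra_simps)
 finally show ?thesis by (simp add: automorphy_def power2_eq_square)
qed

lemma inj_on_mobius_act: "det A = 1 ==> inj_on (mob A) \<H>" by (rule inj_on_inverseI[of _ "mob (adj2 A)"]) simp

text \<open>The real Jacobian of a holomorphic map is the squared modulus of its derivative, here
  the inverse fourth power of \<open>|automorphy A z|\<close>; the imaginary part scales by the
  inverse square, so the density \<open>1 / (Im z)\<^sup>2\<close> compensates exactly.\<close>

lemma emeasure_hyp_mobius_le:
 assumes A: "det A = 1" and B: "B \<subseteq> \<H>" "B \<in> sets borel"
 shows "emeasure hyp_measure (mob A ` B) \<le> emeasure hyp_measure B"
proof -
 define G where "G = to_vec2 \<circ> mob A \<circ> of_vec2"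
 define u where "u = (\<lambda>v::real^2. 1 / (v$2)\<^sup>2)"
 define d where "d z = 1 / (automorphy A z)\<^sup>2" for z
 define B' where "B' = of_vec2 -` B"
 have AB: "mob A ` B \<in> sets borel" by (rule mobius_act_image_borel) fact+
 have B'_borel: "B' \<in> sets borel" using measurable_sets[OF borel_measurable_of_vec2 B(2)] by (simp add: B'_def)
 have GB': "G ` B' = of_vec2 -` (mob A ` B)"
 proof (intro equalityI subsetI)
  fix v assume "v \<in> of_vec2 -` (mob A ` B)"
  then obtain z where z: "z \<in> B" "of_vec2 v = mob A z" by auto
  hence "to_vec2 (of_vec2 v) = G (to_vec2 z)" "to_vec2 z \<in> B'" by (simp_all add: G_def B'_def)
  hence "v = G (to_vec2 z)" "to_vec2 z \<in> B'" by simp_all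
  thus "v \<in> G ` B'" by blast
 qed (auto simp: G_def B'_def)
 have u_meas: "u \<in> borel_measurable borel" unfolding u_def by measurable
 have area: "emeasure hyp_measure S = (\<integral>\<^sup>+v\<in>of_vec2 -` S. ennreal (u v) \<partial>lborel)"
  if S: "S \<in> sets borel" for S
 proof -
  have [measurable]: "(\<lambda>x. indicator S (of_vec2 x) :: ennreal) \<in> borel_measurable borel"
   by (rule measurable_compose[OF borel_measurable_of_vec2 borel_measurable_indicator[OF S]])
  show ?thesis unfolding emeasure_hyp_measure[OF S] by (subst lborel_complex, subst nn_integral_distr)
    (use S in \<open>auto simp: u_def of_vec2_def indicator_def intro!: nn_integral_cong\<close>)
 qed
 have der: "(G has_derivative (\<lambda>h. to_vec2 (d (of_vec2 v) * of_vec2 h))) (at v)" if "v \<in> B'" for v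
 proof -
  have "(mob A has_derivative (*) (d (of_vec2 v))) (at (of_vec2 v))"
   using has_field_derivative_mobius_act[OF A, of "of_vec2 v"] that B by (auto simp: B'_def d_def has_field_derivative_def)
  hence "(mob A \<circ> of_vec2 has_derivative (*) (d (of_vec2 v)) \<circ> of_vec2) (at v)"
   by (rule diff_chain_at[OF bounded_linear_imp_has_derivative[OF bounded_linear_of_vec2]])
  hence "(to_vec2 \<circ> (mob A \<circ> of_vec2) has_derivative to_vec2 \<circ> ((*) (d (of_vec2 v)) \<circ> of_vec2)) (at v)"
   by (rule diff_chain_at[OF _ bounded_linear_imp_has_derivative[OF bounded_linear_to_vec2]])
  thus ?thesis by (simp add: G_def o_def)
 qed
 have "(\<integral>\<^sup>+v\<in>G ` B'. ennreal (u v) \<partial>lborel) \<le> (\<integral>\<^sup>+v\<in>B'. ennreal (u v) \<partial>lborel)"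
 proof (rule nn_integral_change_of_variables_le[OF B'_borel _ der])
  show "G ` B' \<in> sets borel" unfolding GB' using measurable_sets[OF borel_measurable_of_vec2 AB] by simp
  show "inj_on G B'"
  proof (rule inj_onI)
   fix v w assume vw: "v \<in> B'" "w \<in> B'" "G v = G w"
   hence "of_vec2 (G v) = of_vec2 (G w)" by (simp only:)
   hence "mob A (of_vec2 v) = mob A (of_vec2 w)" by (simp only: G_def o_apply of_vec2_to_vec2)
   moreover have "of_vec2 v \<in> \<H>" "of_vec2 w \<in> \<H>" using vw B unfolding B'_def by blast+
   ultimately have "of_vec2 v = of_vec2 w" by (rule inj_onD[OF inj_on_mobius_act[OF A]])
   hence "to_vec2 (of_vec2 v) = to_vec2 (of_vec2 w)" by (simp only:)
   thus "v = w" by (simp only: to_vec2_of_vec2)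
  qed
  show "\<bar>det (matrix (\<lambda>h. to_vec2 (d (of_vec2 v) * of_vec2 h)))\<bar> * u (G v) = u v" if "v \<in> B'" for v
  proof -
   have "of_vec2 v \<in> \<H>" using that B(1) unfolding B'_def by blast
   hence v: "0 < v$2" by (simp add: of_vec2_def)
   have "det (matrix (\<lambda>h. to_vec2 (d (of_vec2 v) * of_vec2 h))) = (cmod (d (of_vec2 v)))\<^sup>2"
    unfolding cmod_power2 by (simp add: det_2 matrix_def to_vec2_def of_vec2_def axis_def power2_eq_square)
   moreover have "G v $ 2 = v$2 / (cmod (automorphy A (of_vec2 v)))\<^sup>2"
    using Im_mobius_act[OF A, of "of_vec2 v"] v by (simp add: G_def to_vec2_def) (simp add: of_vec2_def)
   moreover have "automorphy A (of_vec2 v) ~= 0" using v by (intro automorphy_nonzero[OF A], unfold of_vec2_def complex.sel)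
   moreover have "\<bar>(1 / N\<^sup>2)\<^sup>2\<bar> * (1 / (y / N\<^sup>2)\<^sup>2) = 1 / y\<^sup>2" if "N ~= 0" for N y :: real
    using that by (simp add: power_divide)
   ultimately show ?thesis unfolding u_def by (simp add: d_def norm_divide norm_power)
  qed
  show "u \<in> borel_measurable borel" "u \<in> borel_measurable borel" by (fact u_meas)+
  show "0 \<le> u x" "0 \<le> u x" for x by (simp_all add: u_def)
 qed
 thus ?thesis unfolding area[OF AB] area[OF B(2)] GB'[symmetric] B'_def .
qed

lemma emeasure_hyp_mobius:
 assumes A: "det A = 1" and B: "B \<subseteq> \<H>" "B \<in> sets borel"
 shows "emeasure hyp_measure (mob A ` B) = emeasure hyp_measure B"
proof (rule antisym)
 have "z \<in> \<H>" if "z \<in> B" for z using B(1) that by blast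
 hence H: "0 < Im z" if "z \<in> B" for z using that by (simp only: uhp_iff)
 have AB: "mob A ` B \<subseteq> \<H>" by (rule image_subsetI, unfold uhp_iff, rule mobius_act_uhp[OF A H])
 have eq: "mob (adj2 A) ` mob A ` B = B"
  unfolding image_image by (rule trans[OF image_cong[OF refl mobius_act_adj2(1)[OF A H]] image_ident])
 have "det (adj2 A) = 1" using A by simp
 from emeasure_hyp_mobius_le[OF this AB mobius_act_image_borel[OF assms]]
 show "emeasure hyp_measure B \<le> emeasure hyp_measure (mob A ` B)" unfolding eq .
qed (rule emeasure_hyp_mobius_le[OF assms])

section \<open>The thick part is compact\<close>

text \<open>Displacement is measured in the frame \<open>g\<close>, by the distance of the conjugate
  from the identity; as rotations preserve the norm, it depends on the point \<open>g.\<i>\<close>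
  only. The element \<open>- mat 1\<close> has displacement \<open>2 * sqrt 2\<close> everywhere, so
  it never makes a frame thin for the small \<open>de\<close> in use.\<close>

definition thick :: "(real^2^2) set => real => real^2^2 => bool"
 where "thick \<Gamma> de g \<longleftrightarrow> (\<forall>ga\<in>\<Gamma>. ga ~= mat 1 --> de \<le> norm (adj2 g ** ga ** g - mat 1))"

text \<open>Properness of the action in quantitative form: the imaginary parts control
  \<open>automorphy h b\<close>, thus the lower row, and the numerator of \<open>mob h b\<close>
  then controls the upper row.\<close>

lemma norm_bound_of_ball_i:
 assumes h: "det h = 1" and b: "b \<in> ball \<i> (1/2)" "mob h b \<in> ball \<i> (1/2)"
 shows "norm h \<le> 17"
proof -
 define b' where "b' = mob h b"
 have near: "1/2 < Im w \<and> Im w < 3/2 \<and> cmod w < 3/2" if "w \<in> ball \<i> (1/2)" for w :: complex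
 proof -
  have d: "cmod (\<i> - w) < 1/2" using that by (simp add: dist_norm)
  have "\<bar>Im (\<i> - w)\<bar> \<le> cmod (\<i> - w)" by (rule abs_Im_le_cmod)
  moreover have "cmod w \<le> cmod \<i> + cmod (\<i> - w)" by (metis norm_minus_commute norm_triangle_sub)
  ultimately show ?thesis using d by (simp add: abs_le_iff abs_less_iff)
 qed
 note nb = near[OF b(1)] and nb' = near[OF b(2), folded b'_def]
 have pos: "0 < Im b" using nb by simp
 define j where "j = automorphy h b"
 have j0: "j ~= 0" unfolding j_def by (rule automorphy_nonzero[OF h pos])
 have "Im b' * (cmod j)\<^sup>2 = Im b" using Im_mobius_act[OF h pos] j0 by (simp add: b'_def j_def)
 moreover have "1/2 * (cmod j)\<^sup>2 \<le> Im b' * (cmod j)\<^sup>2" using nb' by (intro mult_right_mono) auto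
 ultimately have "(cmod j)\<^sup>2 \<le> 2\<^sup>2" using nb by simp
 hence j2: "cmod j \<le> 2" by (rule power2_le_imp_le) simp
 have "\<bar>h$2$1\<bar> * Im b \<le> cmod j" using abs_Im_le_cmod[of j] pos by (simp add: j_def automorphy_def abs_mult)
 moreover have "\<bar>h$2$1\<bar> * (1/2) \<le> \<bar>h$2$1\<bar> * Im b" using nb by (intro mult_left_mono) auto
 ultimately have c: "\<bar>h$2$1\<bar> \<le> 4" using j2 by simp
 have cb: "\<bar>h$2$1\<bar> * cmod b \<le> 4 * (3/2)" using c nb by (intro mult_mono) auto
 have "of_real (h$2$2) = j - of_real (h$2$1) * b" by (simp add: j_def automorphy_def)
 hence "\<bar>h$2$2\<bar> \<le> cmod j + \<bar>h$2$1\<bar> * cmod b" by (metis norm_mult norm_of_real norm_triangle_ineq4)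
 hence d: "\<bar>h$2$2\<bar> \<le> 8" using j2 cb by simp
 define t where "t = of_real (h$1$1) * b + of_real (h$1$2)"
 have t: "t = b' * j" using j0 by (simp add: b'_def j_def t_def mobius_act_altdef)
 have "cmod t \<le> (3/2) * 2" unfolding t norm_mult using nb' j2 by (intro mult_mono) auto
 hence t3: "cmod t \<le> 3" by simp
 have "\<bar>h$1$1\<bar> * Im b \<le> cmod t" using abs_Im_le_cmod[of t] pos by (simp add: t_def abs_mult)
 moreover have "\<bar>h$1$1\<bar> * (1/2) \<le> \<bar>h$1$1\<bar> * Im b" using nb by (intro mult_left_mono) auto
 ultimately have a: "\<bar>h$1$1\<bar> \<le> 6" using t3 by simp
 have ab: "\<bar>h$1$1\<bar> * cmod b \<le> 6 * (3/2)" using a nb by (intro mult_mono) auto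
 have "of_real (h$1$2) = t - of_real (h$1$1) * b" by (simp add: t_def)
 hence "\<bar>h$1$2\<bar> \<le> cmod t + \<bar>h$1$1\<bar> * cmod b" by (metis norm_mult norm_of_real norm_triangle_ineq4)
 hence e: "\<bar>h$1$2\<bar> \<le> 12" using t3 ab by simp
 have sq: "x\<^sup>2 \<le> k\<^sup>2" if "\<bar>x\<bar> \<le> k" for x k :: real
  using that by (metis abs_ge_zero power2_abs power_mono)
 \<comment> \<open>The four entry bounds give 260 for the sum of squares, below
   \<open>17\<^sup>2 = 289\<close>.\<close>
 have "(norm h)\<^sup>2 \<le> 6\<^sup>2 + 12\<^sup>2 + 4\<^sup>2 + 8\<^sup>2"
  unfolding norm_mat2_sq using sq[OF a] sq[OF e] sq[OF c] sq[OF d] by linarith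
 also have "\<dots> \<le> 17\<^sup>2" by simp
 finally show ?thesis by (rule power2_le_imp_le) simp
qed

text \<open>A ball is covered by finitely many balls of radius \<open>\<eta>/2\<close>, each of
  which contains at most one point of a separated set. Their number depends on \<open>R\<close> and
  \<open>\<eta>\<close> alone.\<close>

lemma separated_card_le:
 fixes R \<eta> :: real
 assumes "\<eta> > 0"
 obtains M where "\<And>S::'a::euclidean_space set. S \<subseteq> cball 0 R ==>
   (\<And>x y. x \<in> S ==> y \<in> S ==> x ~= y ==> \<eta> \<le> dist x y) ==> finite S \<and> card S \<le> M"
proof -
 have "compact (cball (0::'a) R)" by simp
 then obtain k where k: "finite k" "cball (0::'a) R \<subseteq> (\<Union>x\<in>k. ball x (\<eta>/2))"
  using assms unfolding compact_eq_totally_bounded by (metis half_gt_zero)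
 show thesis
 proof (rule that[of "card k"])
  fix S :: "'a set"
  assume S: "S \<subseteq> cball 0 R" and sep: "\<And>x y. x \<in> S ==> y \<in> S ==> x ~= y ==> \<eta> \<le> dist x y"
  have "\<forall>x\<in>S. \<exists>c\<in>k. x \<in> ball c (\<eta>/2)" using S k by blast
  then obtain c where c: "\<And>x. x \<in> S ==> c x \<in> k \<and> x \<in> ball (c x) (\<eta>/2)" by metis
  have inj: "inj_on c S"
  proof (rule inj_onI, rule ccontr)
   fix x y assume xy: "x \<in> S" "y \<in> S" "c x = c y" "x ~= y"
   have "dist x y \<le> dist (c x) x + dist (c x) y" by (metis dist_commute dist_triangle)
   also have "\<dots> < \<eta>/2 + \<eta>/2" using c[OF xy(1)] c[OF xy(2)] xy(3) by simp
   finally show False using sep[OF xy(1,2,4)] by simp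
  qed
  have im: "c ` S \<subseteq> k" using c by blast
  show "finite S \<and> card S \<le> card k" using inj im k(1) by (metis card_inj_on_le inj_on_finite)
 qed
qed

locale fuchsian =
 fixes \<Gamma> :: "(real^2^2) set"
 assumes fuchsian: "fuchsian_first_kind \<Gamma>"
begin

lemma subgroup: "subgroup \<Gamma> SL2R" using fuchsian by (simp add: fuchsian_first_kind_def)

lemma det_Gamma: "ga \<in> \<Gamma> ==> det ga = 1" using subgroup.subset[OF subgroup] by auto

lemma one_Gamma [simp]: "mat 1 \<in> \<Gamma>" using subgroup.one_closed[OF subgroup] by simp

lemma mult_Gamma: "ga \<in> \<Gamma> ==> ga' \<in> \<Gamma> ==> ga ** ga' \<in> \<Gamma>"
 using subgroup.m_closed[OF subgroup] by simp

lemma adj2_Gamma: "ga \<in> \<Gamma> ==> adj2 ga \<in> \<Gamma>"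
 using subgroup.m_inv_closed[OF subgroup] by (simp add: inv_SL2R det_Gamma)

lemma Gamma_separated:
 obtains ep where "ep > 0" "\<And>ga. ga \<in> \<Gamma> ==> norm (ga - mat 1) < ep ==> ga = mat 1"
proof -
 have "mat 1 isolated_in \<Gamma>" using fuchsian by (simp add: fuchsian_first_kind_def discrete_def)
 thus thesis unfolding isolated_in_dist_Ex_iff using that by (auto simp: dist_norm norm_minus_commute)
qed

lemma norm_Gamma_diff:
 assumes "det A = 1" "det B = 1"
 shows "norm (adj2 A ** B - mat 1) \<le> norm A * norm (B - A)"
proof -
 have "adj2 A ** B - mat 1 = adj2 A ** (B - A)" using adj2_left[OF assms(1)] by (simp add: vec_eq_iff forall_2 algebra_simps)
 thus ?thesis using norm_mat2_mult[of "adj2 A" "B - A"] by simp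
qed

text \<open>Discreteness at the identity spreads by left translation: two elements of norm at most
  \<open>R\<close> at distance less than \<open>ep / (\<bar>R\<bar> + 1)\<close> would make
  \<open>adj2 A ** B\<close> an element of \<open>\<Gamma>\<close> closer than \<open>ep\<close> to
  1. So the bounded part of \<open>\<Gamma>\<close> is a separated set.\<close>

lemma finite_Gamma_bounded: "finite {ga \<in> \<Gamma>. norm ga \<le> R}"
proof -
 obtain ep where e: "ep > 0" "\<And>ga. ga \<in> \<Gamma> ==> norm (ga - mat 1) < ep ==> ga = mat 1"
  using Gamma_separated by blast
 define \<eta> where "\<eta> = ep / (\<bar>R\<bar> + 1)"
 have "\<eta> > 0" using e by (simp add: \<eta>_def)
 then obtain M where M: "\<And>S::(real^2^2) set. S \<subseteq> cball 0 R ==>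
   (\<And>x y. x \<in> S ==> y \<in> S ==> x ~= y ==> \<eta> \<le> dist x y) ==> finite S \<and> card S \<le> M"
  by (rule separated_card_le) blast
 have "\<eta> \<le> dist A B" if AB: "A \<in> \<Gamma>" "norm A \<le> R" "B \<in> \<Gamma>" "A ~= B" for A B
 proof (rule ccontr)
  assume "\<not> \<eta> \<le> dist A B"
  hence "norm (B - A) < \<eta>" by (simp add: dist_norm norm_minus_commute)
  hence "norm A * norm (B - A) \<le> (\<bar>R\<bar> + 1) * norm (B - A)" using AB by (intro mult_right_mono) auto
  also have "\<dots> < (\<bar>R\<bar> + 1) * \<eta>" using \<open>norm (B - A) < \<eta>\<close> by (intro mult_strict_left_mono) auto
  also have "\<dots> = ep" by (simp add: \<eta>_def)
  finally have "norm (adj2 A ** B - mat 1) < ep" using norm_Gamma_diff[of A B] AB by (simp add: det_Gamma)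
  hence "adj2 A ** B = mat 1" using e(2) AB mult_Gamma adj2_Gamma by blast
  hence "A ** (adj2 A ** B) = A" by simp
  with AB show False by (simp add: det_Gamma)
 qed
 thus ?thesis by (intro M[THEN conjunct1]) auto
qed

lemma countable_Gamma: "countable \<Gamma>"
proof -
 have "\<Gamma> = (\<Union>n::nat. {ga \<in> \<Gamma>. norm ga \<le> real n})" by (auto intro: real_nat_ceiling_ge)
 also have "countable \<dots>" by (intro countable_UN) (auto intro: countable_finite finite_Gamma_bounded)
 finally show ?thesis .
qed

lemma hyp_fundamental_set:
 obtains F where "F \<in> sets borel" "F \<subseteq> \<H>" "emeasure hyp_measure F < \<infinity>"
  "\<And>z. 0 < Im z ==> \<exists>ga\<in>\<Gamma>. mob ga z \<in> F"
proof -
 obtain F where "F \<in> sets borel" "F \<subseteq> \<H>"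
   "\<forall>z\<in>\<H>. \<exists>!w. w \<in> F \<and> (\<exists>ga\<in>\<Gamma>. w = mob ga z)"
   "(\<integral>\<^sup>+z\<in>F. ennreal (1 / (Im z)\<^sup>2) \<partial>lborel) < \<infinity>"
  using fuchsian unfolding fuchsian_first_kind_def finite_covolume_def by blast
 thus thesis by (intro that[of F]) (auto simp: emeasure_hyp_measure)
qed

section \<open>Areas in the quotient and packing by balls\<close>

definition orbit_set :: "complex set => complex set"
 where "orbit_set S = (\<Union>ga\<in>\<Gamma>. mob ga ` S)"

lemma orbit_set_borel:
 assumes "S \<in> sets borel" "S \<subseteq> \<H>"
 shows "orbit_set S \<in> sets borel" unfolding orbit_set_def
 by (rule sets.countable_UN'[OF countable_Gamma]) (auto intro: mobius_act_image_borel[OF det_Gamma assms(2,1)])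

text \<open>
 A ball that meets at most \<open>M\<close> of its translates occupies at least \<open>1/M\<close> of its area in
 the quotient.
\<close>

lemma emeasure_ball_le_quotient:
 assumes F: "F \<in> sets borel" "F \<subseteq> \<H>" "\<And>z. 0 < Im z ==> \<exists>ga\<in>\<Gamma>. mob ga z \<in> F"
  and S: "S \<in> sets borel" "S \<subseteq> \<H>"
  and M: "finite {ga\<in>\<Gamma>. mob ga ` S \<inter> S ~= {}}" "card {ga\<in>\<Gamma>. mob ga ` S \<inter> S ~= {}} \<le> M"
 shows "emeasure hyp_measure S \<le> of_nat M * emeasure hyp_measure (F \<inter> orbit_set S)"
proof -
 define T where "T ga = mob ga ` S" for ga
 have Im_S: "0 < Im z" if "z \<in> S" for z using S(2) that by auto
 have T_borel [measurable]: "T ga \<in> sets borel" if "ga \<in> \<Gamma>" for ga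
  unfolding T_def by (rule mobius_act_image_borel[OF det_Gamma[OF that] S(2,1)])
 have T_uhp: "T ga \<subseteq> \<H>" if "ga \<in> \<Gamma>" for ga
  unfolding T_def by (rule image_subsetI) (simp add: det_Gamma[OF that] Im_S)
 define F' where "F' ga = mob (adj2 ga) ` F" for ga
 have F'_borel [measurable]: "F' ga \<in> sets borel" if "ga \<in> \<Gamma>" for ga
  unfolding F'_def by (rule mobius_act_image_borel[OF _ F(2,1)]) (simp add: det_Gamma[OF that])
 note [measurable] = S(1) F(1) orbit_set_borel[OF S]
 have shift: "emeasure hyp_measure (S \<inter> F' ga) = emeasure hyp_measure (T ga \<inter> F)" if g: "ga \<in> \<Gamma>" for ga
 proof -
  have "mob ga ` (S \<inter> F' ga) = T ga \<inter> F"
  proof (intro equalityI subsetI)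
   fix w assume "w \<in> mob ga ` (S \<inter> F' ga)"
   then obtain z y where "z \<in> S" "y \<in> F" "z = mob (adj2 ga) y" "w = mob ga z" by (auto simp: F'_def)
   moreover have "0 < Im y" using F(2) \<open>y \<in> F\<close> by auto
   ultimately have "w = y" using det_Gamma[OF g] by simp
   thus "w \<in> T ga \<inter> F" using \<open>z \<in> S\<close> \<open>y \<in> F\<close> \<open>w = mob ga z\<close> unfolding T_def by blast
  next
   fix w assume w: "w \<in> T ga \<inter> F"
   then obtain z where z: "z \<in> S" "w = mob ga z" by (auto simp: T_def)
   have "mob (adj2 ga) w = z" using z Im_S[OF z(1)] det_Gamma[OF g] by simp
   hence "z \<in> F' ga" using w by (auto simp: F'_def)
   with z show "w \<in> mob ga ` (S \<inter> F' ga)" by blast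
  qed
  moreover have "S \<inter> F' ga \<subseteq> \<H>" using S(2) by blast
  moreover have "S \<inter> F' ga \<in> sets borel" using S(1) F'_borel[OF g] by blast
  ultimately show ?thesis using emeasure_hyp_mobius[OF det_Gamma[OF g], of "S \<inter> F' ga"] by simp
 qed
 \<comment> \<open>Unfolding: the translates \<open>F' ga\<close> cover \<open>S\<close>, each piece
   of \<open>S\<close> is moved into \<open>F\<close> without change of area, and the sum over
   \<open>\<Gamma>\<close> is exchanged with the integral before and after.\<close>
 have "emeasure hyp_measure S = (\<integral>\<^sup>+z. indicator S z \<partial>hyp_measure)" using S by simp
 also have "\<dots> \<le> (\<integral>\<^sup>+z. (\<integral>\<^sup>+ga. indicator (S \<inter> F' ga) z \<partial>count_space \<Gamma>) \<partial>hyp_measure)"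
 proof (rule nn_integral_mono)
  fix z
  show "indicator S z \<le> (\<integral>\<^sup>+ga. indicator (S \<inter> F' ga) z \<partial>count_space \<Gamma>)"
  proof (cases "z \<in> S")
   case True
   obtain ga0 where g0: "ga0 \<in> \<Gamma>" "mob ga0 z \<in> F" using F(3)[OF Im_S[OF True]] by blast
   have "mob (adj2 ga0) (mob ga0 z) = z" using Im_S[OF True] det_Gamma[OF g0(1)] by simp
   hence "z \<in> F' ga0" using g0(2) unfolding F'_def by (metis imageI)
   hence "indicator S z = (indicator (S \<inter> F' ga0) z :: ennreal)" using True by simp
   also have "\<dots> \<le> (\<integral>\<^sup>+ga. indicator (S \<inter> F' ga) z \<partial>count_space \<Gamma>)"
    by (rule nn_integral_ge_point[OF g0(1)])
   finally show ?thesis .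
  qed simp
 qed
 also have "\<dots> = (\<integral>\<^sup>+ga. (\<integral>\<^sup>+z. indicator (S \<inter> F' ga) z \<partial>hyp_measure) \<partial>count_space \<Gamma>)"
  by (rule nn_integral_count_space_nn_integral[OF countable_Gamma]) auto
 also have "\<dots> = (\<integral>\<^sup>+ga. (\<integral>\<^sup>+z. indicator (T ga \<inter> F) z \<partial>hyp_measure) \<partial>count_space \<Gamma>)"
  by (rule nn_integral_cong) (simp add: shift)
 also have "\<dots> = (\<integral>\<^sup>+z. (\<integral>\<^sup>+ga. indicator (T ga \<inter> F) z \<partial>count_space \<Gamma>) \<partial>hyp_measure)"
  by (rule nn_integral_count_space_nn_integral[OF countable_Gamma, symmetric]) auto
 also have "\<dots> \<le> (\<integral>\<^sup>+z. of_nat M * indicator (F \<inter> orbit_set S) z \<partial>hyp_measure)"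
 proof (rule nn_integral_mono)
  fix z
  show "(\<integral>\<^sup>+ga. indicator (T ga \<inter> F) z \<partial>count_space \<Gamma>) \<le> of_nat M * indicator (F \<inter> orbit_set S) z"
  proof (cases "z \<in> F \<inter> orbit_set S")
   case True
   then obtain ga0 where g0: "ga0 \<in> \<Gamma>" "z \<in> T ga0" by (auto simp: orbit_set_def T_def)
   then obtain s0 where s0: "s0 \<in> S" "z = mob ga0 s0" by (auto simp: T_def)
   define C where "C = {ga\<in>\<Gamma>. z \<in> T ga}"
   define D where "D = {ga\<in>\<Gamma>. mob ga ` S \<inter> S ~= {}}"
   \<comment> \<open>The translates of \<open>S\<close> through \<open>z\<close> are compared with
     one of them, given by \<open>ga0\<close>: this injects them into the set of elements for which
     \<open>S\<close> meets its translate.\<close>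
   have im: "(\<lambda>ga. adj2 ga ** ga0) ` C \<subseteq> D"
   proof (rule image_subsetI)
    fix ga assume "ga \<in> C"
    then obtain s where s: "ga \<in> \<Gamma>" "s \<in> S" "z = mob ga s" by (auto simp: C_def T_def)
    have "mob (adj2 ga ** ga0) s0 = mob (adj2 ga) z" using s0 g0 s Im_S by (simp add: mobius_act_mult det_Gamma)
    also have "\<dots> = s" using s Im_S det_Gamma by simp
    finally have "mob (adj2 ga ** ga0) s0 \<in> S" using s by simp
    moreover have "adj2 ga ** ga0 \<in> \<Gamma>" using s g0 by (intro mult_Gamma adj2_Gamma)
    ultimately show "adj2 ga ** ga0 \<in> D" unfolding D_def using s0(1) by blast
   qed
   have inj: "inj_on (\<lambda>ga. adj2 ga ** ga0) C"
   proof (rule inj_onI)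
    fix ga ga' assume "adj2 ga ** ga0 = adj2 ga' ** ga0"
    hence "adj2 ga ** ga0 ** adj2 ga0 = adj2 ga' ** ga0 ** adj2 ga0" by simp
    hence "adj2 ga = adj2 ga'" by (simp only: adj2_cancel(3) det_Gamma[OF g0(1)])
    thus "ga = ga'" by (metis adj2_adj2)
   qed
   have fin: "finite C" using inj im M(1) unfolding D_def[symmetric] by (rule inj_on_finite)
   have card: "card C \<le> M" using card_inj_on_le[OF inj im] M unfolding D_def[symmetric] by linarith
   have "(\<integral>\<^sup>+ga. indicator (T ga \<inter> F) z \<partial>count_space \<Gamma>) = (\<integral>\<^sup>+ga. indicator C ga \<partial>count_space \<Gamma>)"
    by (rule nn_integral_cong) (use True in \<open>auto simp: C_def indicator_def\<close>)
   also have "\<dots> = emeasure (count_space \<Gamma>) C" by (rule nn_integral_indicator) (auto simp: C_def)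
   also have "\<dots> = of_nat (card C)"
    by (subst emeasure_count_space_finite) (auto simp: fin C_def[symmetric], auto simp: C_def)
   also have "\<dots> \<le> of_nat M" using card by simp
   finally show ?thesis using True by simp
  next
   case False
   hence "indicator (T ga \<inter> F) z = (0::ennreal)" if "ga \<in> \<Gamma>" for ga
    using that by (auto simp: orbit_set_def T_def)
   hence "(\<integral>\<^sup>+ga. indicator (T ga \<inter> F) z \<partial>count_space \<Gamma>) = (\<integral>\<^sup>+ga. 0 \<partial>count_space \<Gamma>)"
    by (intro nn_integral_cong) auto
   thus ?thesis by simp
  qed
 qed
 also have "\<dots> = of_nat M * emeasure hyp_measure (F \<inter> orbit_set S)" by (subst nn_integral_cmult_indicator) auto
 finally show ?thesis .
qed

text \<open>Conjugation by \<open>g\<close> turns the elements counted into matrices of norm at most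
  17; thickness keeps these at mutual distance at least \<open>de / 17\<close>, so the bound
  \<open>M\<close> does not depend on \<open>g\<close>.\<close>

lemma thick_ball_multiplicity:
 assumes "de > 0"
 obtains M where "\<And>g. det g = 1 ==> thick \<Gamma> de g ==>
  finite {ga\<in>\<Gamma>. mob ga ` (mob g ` ball \<i> (1/2)) \<inter> mob g ` ball \<i> (1/2) ~= {}} \<and>
  card {ga\<in>\<Gamma>. mob ga ` (mob g ` ball \<i> (1/2)) \<inter> mob g ` ball \<i> (1/2) ~= {}} \<le> M"
proof -
 have uhp: "0 < Im z" if "z \<in> ball \<i> (1/2)" for z
 proof -
  have "\<bar>Im (\<i> - z)\<bar> \<le> cmod (\<i> - z)" by (rule abs_Im_le_cmod)
  thus ?thesis using that by (simp add: dist_norm abs_le_iff)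
 qed
 have "de / 17 > 0" using assms by simp
 then obtain M where M: "\<And>S::(real^2^2) set. S \<subseteq> cball 0 17 ==>
   (\<And>x y. x \<in> S ==> y \<in> S ==> x ~= y ==> de / 17 \<le> dist x y) ==> finite S \<and> card S \<le> M"
  by (rule separated_card_le) blast
 show thesis
 proof (rule that[of M])
  fix g assume g: "det g = 1" "thick \<Gamma> de g"
  define B where "B = ball \<i> (1/2)"
  define D where "D = {ga\<in>\<Gamma>. mob ga ` (mob g ` B) \<inter> mob g ` B ~= {}}"
  define c where "c ga = adj2 g ** ga ** g" for ga
  have c_inv: "g ** c ga ** adj2 g = ga" for ga by (simp add: c_def g matrix_mul_assoc adj2_right)
  have c_mult: "adj2 (c ga) ** c ga' = c (adj2 ga ** ga')" for ga ga'
   by (simp add: c_def adj2_mult matrix_mul_assoc[symmetric] g)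
  have det_c: "det (c ga) = 1" if "ga \<in> \<Gamma>" for ga using that g by (simp add: c_def det_mul det_Gamma)
  have inj: "inj c" by (rule injI) (metis c_inv)
  have nc: "norm (c ga) \<le> 17" if "ga \<in> D" for ga
  proof -
   from that obtain b b' where b: "b \<in> B" "b' \<in> B" "mob ga (mob g b) = mob g b'"
    and gam: "ga \<in> \<Gamma>" by (auto simp: D_def)
   have Im: "0 < Im b" "0 < Im b'" using b uhp by (auto simp: B_def)
   have "mob (c ga) b = mob (adj2 g) (mob ga (mob g b))" using Im g gam by (simp add: c_def mobius_act_mult det_mul det_Gamma)
   also have "\<dots> = b'" using b(3) Im g by simp
   finally show ?thesis using b by (intro norm_bound_of_ball_i[OF det_c[OF gam], of b]) (auto simp: B_def)
  qed
  have "finite (c ` D) \<and> card (c ` D) \<le> M"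
  proof (rule M)
   show "c ` D \<subseteq> cball 0 17" using nc by auto
   fix x y assume "x \<in> c ` D" "y \<in> c ` D" "x ~= y"
   then obtain ga ga' where gam: "ga \<in> D" "ga' \<in> D" "x = c ga" "y = c ga'" "ga ~= ga'" by auto
   have G: "ga \<in> \<Gamma>" "ga' \<in> \<Gamma>" using gam by (auto simp: D_def)
   have "adj2 ga ** ga' ~= mat 1"
   proof
    assume "adj2 ga ** ga' = mat 1"
    hence "ga ** (adj2 ga ** ga') = ga" by simp
    with G gam(5) show False by (simp add: det_Gamma)
   qed
   hence "de \<le> norm (c (adj2 ga ** ga') - mat 1)" using g(2) G mult_Gamma adj2_Gamma unfolding thick_def c_def by blast
   also have "\<dots> \<le> norm x * norm (y - x)"
    unfolding c_mult[symmetric] gam using norm_Gamma_diff[OF det_c det_c] G by blast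
   also have "\<dots> \<le> 17 * norm (y - x)" using nc[OF gam(1)] gam(3) by (intro mult_right_mono) auto
   finally show "de / 17 \<le> dist x y" by (simp add: dist_norm norm_minus_commute)
  qed
  hence "finite D \<and> card D \<le> M" using inj by (metis card_image finite_imageD inj_on_subset subset_UNIV)
  thus "finite {ga\<in>\<Gamma>. mob ga ` (mob g ` ball \<i> (1/2)) \<inter> mob g ` ball \<i> (1/2) ~= {}} \<and>
  card {ga\<in>\<Gamma>. mob ga ` (mob g ` ball \<i> (1/2)) \<inter> mob g ` ball \<i> (1/2) ~= {}} \<le> M"
   by (simp add: D_def B_def)
 qed
qed

end

lemma emeasure_hyp_ball_pos: "emeasure hyp_measure (ball \<i> (1/2)) > 0"
proof -
 \<comment> \<open>\<open>4/9\<close> is a lower bound of the density on the ball, where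
   \<open>Im z\<close> is at most \<open>3/2\<close>.\<close>
 have "0 < ennreal (4/9) * emeasure lborel (ball \<i> (1/2))"
  by (simp add: emeasure_ball ennreal_zero_less_mult_iff unit_ball_vol_pos)
 also have "\<dots> = (\<integral>\<^sup>+z. ennreal (4/9) * indicator (ball \<i> (1/2)) z \<partial>lborel)"
  by (subst nn_integral_cmult_indicator) auto
 also have "\<dots> \<le> (\<integral>\<^sup>+z\<in>ball \<i> (1/2). ennreal (1 / (Im z)\<^sup>2) \<partial>lborel)"
 proof (rule nn_integral_mono)
  fix z :: complex
  show "ennreal (4/9) * indicator (ball \<i> (1/2)) z \<le> ennreal (1 / (Im z)\<^sup>2) * indicator (ball \<i> (1/2)) z"
  proof (cases "z \<in> ball \<i> (1/2)")
   case True
   have "\<bar>Im (\<i> - z)\<bar> \<le> cmod (\<i> - z)" by (rule abs_Im_le_cmod)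
   hence Im: "0 < Im z" "Im z \<le> 3/2" using True by (simp_all add: dist_norm abs_le_iff)
   hence "(Im z)\<^sup>2 \<le> (3/2)\<^sup>2" by (intro power_mono) auto
   hence "1 / (3/2)\<^sup>2 \<le> 1 / (Im z)\<^sup>2" using Im by (intro divide_left_mono) auto
   hence "4/9 \<le> 1 / (Im z)\<^sup>2" by (simp add: power2_eq_square)
   thus ?thesis using True by (simp add: ennreal_leI)
  qed simp
 qed
 also have "\<dots> = emeasure hyp_measure (ball \<i> (1/2))" by (simp add: emeasure_hyp_measure)
 finally show ?thesis .
qed

lemma ball_i_uhp: "ball \<i> (1/2) \<subseteq> \<H>"
proof
 fix z assume "z \<in> ball \<i> (1/2)"
 moreover have "\<bar>Im (\<i> - z)\<bar> \<le> cmod (\<i> - z)" by (rule abs_Im_le_cmod)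
 ultimately show "z \<in> \<H>" by (simp add: dist_norm abs_le_iff)
qed

context fuchsian
begin

text \<open>A packing argument. Each ball moved by a thick frame uses at least the
  \<open>M\<close>-th part of a fixed area in a quotient of finite area, so a family of balls with
  disjoint orbits has bounded size. For a family of greatest size, the orbit of any further thick
  ball meets one of its orbits, which bounds the new frame modulo \<open>\<Gamma>\<close>.\<close>

lemma thick_part_compact:
 assumes "de > 0"
 obtains R where "\<And>g. det g = 1 ==> thick \<Gamma> de g ==> \<exists>ga\<in>\<Gamma>. norm (ga ** g) \<le> R"
proof -
 obtain M where M: "\<And>g. det g = 1 ==> thick \<Gamma> de g ==>
  finite {ga\<in>\<Gamma>. mob ga ` (mob g ` ball \<i> (1/2)) \<inter> mob g ` ball \<i> (1/2) ~= {}} \<and>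
  card {ga\<in>\<Gamma>. mob ga ` (mob g ` ball \<i> (1/2)) \<inter> mob g ` ball \<i> (1/2) ~= {}} \<le> M"
  using thick_ball_multiplicity[OF assms] by blast
 obtain F where F: "F \<in> sets borel" "F \<subseteq> \<H>" "emeasure hyp_measure F < \<infinity>"
  "\<And>z. 0 < Im z ==> \<exists>ga\<in>\<Gamma>. mob ga z \<in> F" using hyp_fundamental_set by blast
 define B where "B = ball \<i> (1/2)"
 define gB where "gB g = mob g ` B" for g
 define a where "a = emeasure hyp_measure B"
 have a: "a > 0" unfolding a_def B_def by (rule emeasure_hyp_ball_pos)
 have B: "B \<in> sets borel" "B \<subseteq> \<H>" using ball_i_uhp by (auto simp: B_def)
 have Im_B: "0 < Im b" if "b \<in> B" for b using B(2) that by auto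
 have gB: "gB g \<in> sets borel" "gB g \<subseteq> \<H>" "emeasure hyp_measure (gB g) = a" if "det g = 1" for g
  unfolding gB_def using that B mobius_act_image_borel emeasure_hyp_mobius by (auto simp: a_def image_subset_iff Im_B)
 define good where "good P \<longleftrightarrow> finite P \<and> (\<forall>g\<in>P. det g = 1 \<and> thick \<Gamma> de g) \<and>
  disjoint_family_on (\<lambda>g. orbit_set (gB g)) P" for P
 have Mtop: "(of_nat M :: ennreal) < \<infinity>" by (simp add: ennreal_of_nat_eq_real_of_nat)
 obtain N where N: "of_nat M * emeasure hyp_measure F < of_nat N * a"
 proof (cases "a = \<infinity>")
  case True
  thus ?thesis using F(3) that[of 1] Mtop by (simp add: ennreal_mult_less_top)
 next
  case False
  have "of_nat M * emeasure hyp_measure F < \<infinity>" using F(3) Mtop by (simp add: ennreal_mult_less_top)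
  then obtain m where m: "of_nat M * emeasure hyp_measure F = ennreal m" "0 \<le> m"
   by (metis ennreal_cases infinity_ennreal_def less_irrefl)
  obtain r where r: "a = ennreal r" "0 < r" using False a by (cases a) (auto simp: ennreal_less_zero_iff)
  obtain n where "m / r < real n" using reals_Archimedean2 by blast
  hence "m < real n * r" using r by (simp add: divide_less_eq)
  hence "ennreal m < of_nat n * a"
   using r m by (simp add: ennreal_of_nat_eq_real_of_nat ennreal_mult'[symmetric] ennreal_lessI)
  thus ?thesis using that[of n] m by simp
 qed
 have bound: "card P \<le> N" if "good P" for P
 proof (rule ccontr)
  assume "\<not> card P \<le> N"
  have P: "finite P" "\<And>g. g \<in> P ==> det g = 1" "\<And>g. g \<in> P ==> thick \<Gamma> de g"
   "disjoint_family_on (\<lambda>g. orbit_set (gB g)) P" using that by (auto simp: good_def)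
  have "of_nat (card P) * a = (\<Sum>g\<in>P. emeasure hyp_measure (gB g))" using P gB by simp
  also have "\<dots> \<le> (\<Sum>g\<in>P. of_nat M * emeasure hyp_measure (F \<inter> orbit_set (gB g)))"
  proof (rule sum_mono)
   fix g assume g: "g \<in> P"
   show "emeasure hyp_measure (gB g) \<le> of_nat M * emeasure hyp_measure (F \<inter> orbit_set (gB g))"
    using M[OF P(2)[OF g] P(3)[OF g], folded B_def gB_def] by (intro emeasure_ball_le_quotient F gB(1,2) P(2) g) auto
  qed
  also have "\<dots> = of_nat M * (\<Sum>g\<in>P. emeasure hyp_measure (F \<inter> orbit_set (gB g)))"
   by (simp add: sum_distrib_left)
  also have "(\<Sum>g\<in>P. emeasure hyp_measure (F \<inter> orbit_set (gB g))) =
    emeasure hyp_measure (\<Union>g\<in>P. F \<inter> orbit_set (gB g))"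
  proof (rule sum_emeasure)
   show "(\<lambda>g. F \<inter> orbit_set (gB g)) ` P \<subseteq> sets hyp_measure" using F(1) P orbit_set_borel gB by auto
   show "disjoint_family_on (\<lambda>g. F \<inter> orbit_set (gB g)) P" using P(4) by (auto simp: disjoint_family_on_def)
  qed (rule P)
  also have "\<dots> \<le> emeasure hyp_measure F" by (rule emeasure_mono) (use F in auto)
  also have "of_nat M * emeasure hyp_measure F < of_nat N * a" by (rule N)
  also have "\<dots> \<le> of_nat (card P) * a" using \<open>\<not> card P \<le> N\<close> by (intro mult_right_mono) auto
  finally show False by (simp add: mult_left_mono)
 qed
 have "good {}" by (simp add: good_def disjoint_family_on_def)
 then obtain P where P: "good P" "\<And>Q. good Q ==> card Q \<le> card P"
  using ex_has_greatest_nat[of good "{}" card "Suc N"] bound le_imp_less_Suc by blast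
 define R where "R = 17 * (\<Sum>g\<in>P. norm g) + 1"
 show thesis
 proof (rule that[of "R + (\<Sum>g\<in>P. norm g)"])
  fix g :: "real^2^2" assume g: "det g = 1" "thick \<Gamma> de g"
  have fin: "finite P" using P(1) by (simp add: good_def)
  have le: "norm p \<le> (\<Sum>g\<in>P. norm g)" if "p \<in> P" for p using fin that by (intro member_le_sum) auto
  show "\<exists>ga\<in>\<Gamma>. norm (ga ** g) \<le> R + (\<Sum>g\<in>P. norm g)"
  proof (cases "g \<in> P")
   case True
   have "0 \<le> (\<Sum>g\<in>P. norm g)" by (intro sum_nonneg) auto
   thus ?thesis using le[OF True] by (intro bexI[of _ "mat 1"]) (auto simp: R_def)
  next
   case False
   have "\<not> good (insert g P)" using P(2)[of "insert g P"] False fin by auto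
   then obtain p where p: "p \<in> P" "orbit_set (gB g) \<inter> orbit_set (gB p) ~= {}"
    using P(1) g False unfolding good_def disjoint_family_on_def by (auto simp: Int_commute)
   have detp: "det p = 1" using P(1) p by (auto simp: good_def)
   from p(2) obtain ga b ga' b' where b: "ga \<in> \<Gamma>" "ga' \<in> \<Gamma>" "b \<in> B" "b' \<in> B"
    "mob ga (mob g b) = mob ga' (mob p b')" by (auto simp: orbit_set_def gB_def)
   define h where "h = adj2 p ** (adj2 ga' ** ga ** g)"
   have dets: "det ga = 1" "det ga' = 1" using b det_Gamma by auto
   have "mob h b = mob (adj2 p) (mob (adj2 ga') (mob ga (mob g b)))"
    using Im_B[OF b(3)] g detp dets by (simp add: h_def mobius_act_mult det_mul)
   also have "\<dots> = b'" unfolding b(5) using Im_B[OF b(4)] detp dets by simp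
   finally have "norm h \<le> 17" using b g detp dets by (intro norm_bound_of_ball_i[of h b]) (auto simp: B_def h_def det_mul)
   moreover have "adj2 ga' ** ga ** g = p ** h" by (simp add: h_def detp)
   ultimately have "norm (adj2 ga' ** ga ** g) \<le> norm p * 17"
    using norm_mat2_mult[of p h] by (metis mult_left_mono norm_ge_zero order_trans)
   also have "\<dots> \<le> R + (\<Sum>g\<in>P. norm g)" using le[OF p(1)] by (simp add: R_def)
    (smt (verit) norm_ge_zero)
   finally show ?thesis using b mult_Gamma adj2_Gamma by blast
  qed
 qed
qed

end

section \<open>Small elements of a discrete group commute\<close>

text \<open>Modulo scalars a matrix is the vector of its two off-diagonal entries and the difference
  of its diagonal entries; the three equations say that the vectors of \<open>A\<close> and
  \<open>C\<close> are parallel.\<close>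

lemma commute_2x2_iff:
 fixes A C :: "real^2^2"
 shows "A ** C = C ** A \<longleftrightarrow> A$1$2 * C$2$1 = C$1$2 * A$2$1 \<and>
  A$1$2 * (C$1$1 - C$2$2) = C$1$2 * (A$1$1 - A$2$2) \<and>
  A$2$1 * (C$1$1 - C$2$2) = C$2$1 * (A$1$1 - A$2$2)" unfolding vec_eq_iff forall_2 mat2_mult_nth by (auto simp: algebra_simps)

text \<open>Two vectors parallel to a third one that is not zero are parallel to each other: the
  centralizer of a non-scalar matrix is commutative.\<close>

lemma commute_2x2_trans:
 fixes A B C :: "real^2^2"
 assumes "A ** C = C ** A" "B ** C = C ** B" "\<not> (C$1$2 = 0 \<and> C$2$1 = 0 \<and> C$1$1 = C$2$2)"
 shows "A ** B = B ** A"
proof -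
 define c1 c2 c3 a1 a2 a3 b1 b2 b3 where defs: "c1 = C$1$2" "c2 = C$2$1" "c3 = C$1$1 - C$2$2"
  "a1 = A$1$2" "a2 = A$2$1" "a3 = A$1$1 - A$2$2" "b1 = B$1$2" "b2 = B$2$1" "b3 = B$1$1 - B$2$2"
 have a: "a1 * c2 = c1 * a2" "a1 * c3 = c1 * a3" "a2 * c3 = c2 * a3"
  and b: "b1 * c2 = c1 * b2" "b1 * c3 = c1 * b3" "b2 * c3 = c2 * b3" using assms(1,2) unfolding commute_2x2_iff defs by auto
 have "c1 ~= 0 \<or> c2 ~= 0 \<or> c3 ~= 0" using assms(3) by (auto simp: defs)
 hence "a1 * b2 = b1 * a2 \<and> a1 * b3 = b1 * a3 \<and> a2 * b3 = b2 * a3"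
 proof (elim disjE)
  assume c: "c1 ~= 0"
  have "a2 = a1 * c2 / c1" "a3 = a1 * c3 / c1" "b2 = b1 * c2 / c1" "b3 = b1 * c3 / c1"
   using a b c by (simp_all add: field_simps)
  thus ?thesis by simp
 next
  assume c: "c2 ~= 0"
  have "a1 = a2 * c1 / c2" "a3 = a2 * c3 / c2" "b1 = b2 * c1 / c2" "b3 = b2 * c3 / c2"
   using a b c by (simp_all add: field_simps)
  thus ?thesis by simp
 next
  assume c: "c3 ~= 0"
  have "a1 = a3 * c1 / c3" "a2 = a3 * c2 / c3" "b1 = b3 * c1 / c3" "b2 = b3 * c2 / c3"
   using a b c by (simp_all add: field_simps)
  thus ?thesis by simp
 qed
 thus ?thesis unfolding commute_2x2_iff defs .
qed

text \<open>The scalar matrices of determinant 1 are 1 and -1, and the norm bound excludes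
  -1.\<close>

lemma scalar_near_one:
 fixes C :: "real^2^2"
 assumes "det C = 1" "norm (C - mat 1) < 2" "C$1$2 = 0" "C$2$1 = 0" "C$1$1 = C$2$2"
 shows "C = mat 1"
proof -
 have "(C$1$1)\<^sup>2 = 1" using assms by (simp add: det_2 power2_eq_square)
 hence "C$1$1 = 1 \<or> C$1$1 = -1" by (simp add: power2_eq_1_iff)
 moreover have "\<bar>C$1$1 - 1\<bar> < 2" using abs_nth_le_norm_mat2[of "C - mat 1" 1 1] assms(2) by simp
 ultimately have "C$1$1 = 1" by auto
 thus ?thesis using assms by (intro mat2_eqI) auto
qed

lemma norm_mat_1: "norm (mat 1 :: real^2^2) \<le> 3/2"
proof -
 have "(norm (mat 1 :: real^2^2))\<^sup>2 = 2" unfolding norm_mat2_sq by simp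
 also have "\<dots> \<le> (3/2)\<^sup>2" by (simp add: power2_eq_square)
 finally have "(norm (mat 1 :: real^2^2))\<^sup>2 \<le> (3/2)\<^sup>2" .
 thus ?thesis by (rule power2_le_imp_le) simp
qed

text \<open>
 Zassenhaus' lemma: for a non-commuting pair, the commutator is nearer to \<open>1\<close> than both
 entries, so by descent it commutes with both. As the centralizer of a non-scalar matrix is
 commutative, this is a contradiction.
\<close>

lemma zassenhaus:
 fixes \<Delta> :: "(real^2^2) set"
 assumes det: "\<And>A. A \<in> \<Delta> ==> det A = 1"
  and mult: "\<And>A B. A \<in> \<Delta> ==> B \<in> \<Delta> ==> A ** B \<in> \<Delta>"
  and inv: "\<And>A. A \<in> \<Delta> ==> adj2 A \<in> \<Delta>"
  and sep: "ep > 0" "\<And>A. A \<in> \<Delta> ==> norm (A - mat 1) < ep ==> A = mat 1"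
  and AB: "A \<in> \<Delta>" "B \<in> \<Delta>" "norm (A - mat 1) < 1/16" "norm (B - mat 1) < 1/16"
 shows "A ** B = B ** A"
proof -
 \<comment> \<open>Descent in units of \<open>ep / 2\<close>: replacing one member of a
   non-commuting pair by the commutator lowers the sum of the two norms by at least
   \<open>ep / 2\<close>, since the member replaced contributes at least \<open>ep\<close> and the
   commutator at most half of that contribution.\<close>
 have "A ** B = B ** A" if "A \<in> \<Delta>" "B \<in> \<Delta>" "norm (A - mat 1) < 1/16" "norm (B - mat 1) < 1/16"
  "norm (A - mat 1) + norm (B - mat 1) < real n * ep / 2" for n A B using that
 proof (induction n arbitrary: A B)
  case 0
  hence "norm (A - mat 1) + norm (B - mat 1) < 0" by simp
  thus ?case by (smt (verit) norm_ge_zero)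
 next
  case (Suc n)
  show ?case
  proof (rule ccontr)
   assume nc: "A ** B ~= B ** A"
   define a b where "a = A - mat 1" and "b = B - mat 1"
   have "A ~= mat 1" "B ~= mat 1" using nc by auto
   hence ge: "ep \<le> norm a" "ep \<le> norm b" using sep(2) Suc.prems(1,2) by (force simp: a_def b_def)+
   have lt: "norm a < 1/16" "norm b < 1/16" using Suc.prems by (auto simp: a_def b_def)
   define C where "C = A ** B ** adj2 A ** adj2 B"
   have C: "C \<in> \<Delta>" unfolding C_def using Suc.prems mult inv by blast
   have dA: "det A = 1" "det B = 1" using det Suc.prems by auto
   have CBA: "C ** B ** A = A ** B" unfolding C_def using dA by (simp add: matrix_mul_assoc[symmetric] adj2_left) 
   \<comment> \<open>The commutator minus 1 is quadratic in \<open>a\<close> and \<open>b\<close>: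
     its norm is at most \<open>8 * norm a * norm b\<close>, and the radius \<open>1/16\<close>
     turns this into half of either norm.\<close>
   have "C - mat 1 = (A ** B - B ** A) ** (adj2 A ** adj2 B)"
   proof -
    have "B ** A ** (adj2 A ** adj2 B) = mat 1" using dA by (simp add: matrix_mul_assoc[symmetric] adj2_right)
    moreover have "(A ** B - B ** A) ** (adj2 A ** adj2 B) = A ** B ** (adj2 A ** adj2 B) - B ** A ** (adj2 A ** adj2 B)"
     by (rule mat2_eqI) (simp_all add: algebra_simps)
    ultimately show ?thesis by (simp add: C_def matrix_mul_assoc)
   qed
   also have "A ** B - B ** A = a ** b - b ** a" by (rule mat2_eqI) (simp_all add: a_def b_def algebra_simps)
   finally have "norm (C - mat 1) \<le> norm (a ** b - b ** a) * norm (adj2 A ** adj2 B)" using norm_mat2_mult by metis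
   also have "\<dots> \<le> (2 * norm a * norm b) * (2 * 2)"
   proof (intro mult_mono)
    show "norm (a ** b - b ** a) \<le> 2 * norm a * norm b"
     using norm_triangle_ineq4[of "a ** b" "b ** a"] norm_mat2_mult[of a b] norm_mat2_mult[of b a]
     by (simp add: mult.commute[of "norm b"])
    have "norm A \<le> 2" "norm B \<le> 2"
     using norm_triangle_ineq[of a "mat 1"] norm_triangle_ineq[of b "mat 1"] lt norm_mat_1 by (auto simp: a_def b_def)
    hence "norm A * norm B \<le> 2 * 2" by (intro mult_mono) auto
    thus "norm (adj2 A ** adj2 B) \<le> 2 * 2" using norm_mat2_mult[of "adj2 A" "adj2 B"] by simp
   qed auto
   finally have le: "norm (C - mat 1) \<le> 8 * norm a * norm b" by simp
   have "norm a * norm b \<le> norm a * (1/16)" "norm b * norm a \<le> norm b * (1/16)"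
    using lt by (intro mult_left_mono; simp)+
   with le have Ca: "norm (C - mat 1) \<le> norm a / 2" and Cb: "norm (C - mat 1) \<le> norm b / 2"
    by (simp_all add: mult.commute[of "norm b"])
   have lt16: "norm (C - mat 1) < 1/16" using Ca lt by simp
   have IH: "norm a + norm b < real (Suc n) * ep / 2" using Suc.prems by (simp add: a_def b_def)
   have "A ** C = C ** A" using Suc.IH[of A C] Suc.prems C lt16 Cb ge IH by (simp add: a_def[symmetric] field_simps)
   moreover have "B ** C = C ** B" using Suc.IH[of B C] Suc.prems C lt16 Ca ge IH by (simp add: b_def[symmetric] field_simps)
   moreover have "C ~= mat 1" using CBA nc by auto
   hence "\<not> (C$1$2 = 0 \<and> C$2$1 = 0 \<and> C$1$1 = C$2$2)" using scalar_near_one[of C] det[OF C] lt16 by auto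
   ultimately show False using commute_2x2_trans nc by blast
  qed
 qed
 moreover obtain n where "(norm (A - mat 1) + norm (B - mat 1)) * 2 / ep < real n" using reals_Archimedean2 by blast
 hence "norm (A - mat 1) + norm (B - mat 1) < real n * ep / 2" using sep(1) by (simp add: field_simps)
 ultimately show ?thesis using AB by blast
qed

section \<open>Finite covolume implies compactness up to cusps\<close>

definition rot :: "real => real^2^2"
 where "rot t = mat2 (cos t) (- sin t) (sin t) (cos t)"

lemma det_rot [simp]: "det (rot t) = 1"
 unfolding rot_def det_mat2 using sin_cos_squared_add[of t] by (simp add: power2_eq_square algebra_simps)

lemma norm_mult_rot [simp]: "norm (A ** rot t) = norm A" "norm (adj2 (rot t) ** A) = norm A"
proof -
 have eq: "(c * x + s * y)\<^sup>2 + (c * y - s * x)\<^sup>2 = x\<^sup>2 + y\<^sup>2" if "c\<^sup>2 + s\<^sup>2 = 1" for c s x y :: real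
 proof -
  have "(c * x + s * y)\<^sup>2 + (c * y - s * x)\<^sup>2 = (c\<^sup>2 + s\<^sup>2) * (x\<^sup>2 + y\<^sup>2)"
   by (simp add: power2_eq_square algebra_simps)
  thus ?thesis using that by simp
 qed
 have t: "(cos t)\<^sup>2 + (sin t)\<^sup>2 = 1" by simp
 have "(norm (A ** rot t))\<^sup>2 = (norm A)\<^sup>2" unfolding norm_mat2_sq rot_def mat2_mult_nth mat2_nth
  using eq[OF t, of "A$1$1" "A$1$2"] eq[OF t, of "A$2$1" "A$2$2"] by (simp add: algebra_simps)
 thus "norm (A ** rot t) = norm A" by (metis norm_ge_zero power2_eq_iff_nonneg)
 have "(norm (adj2 (rot t) ** A))\<^sup>2 = (norm A)\<^sup>2" unfolding norm_mat2_sq rot_def mat2_mult_nth mat2_nth adj2_nth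
  using eq[OF t, of "A$1$1" "A$2$1"] eq[OF t, of "A$1$2" "A$2$2"] by (simp add: algebra_simps)
 thus "norm (adj2 (rot t) ** A) = norm A" by (metis norm_ge_zero power2_eq_iff_nonneg)
qed

lemma mobius_rot_i [simp]: "mob (rot t) \<i> = \<i>"
proof -
 have "automorphy (rot t) \<i> ~= 0" by (rule automorphy_nonzero) simp_all
 moreover have "of_real (rot t$1$1) * \<i> + of_real (rot t$1$2) = \<i> * automorphy (rot t) \<i>"
  by (simp add: automorphy_def rot_def algebra_simps)
 ultimately show ?thesis by (simp add: mobius_act_altdef)
qed

text \<open>Conjugation by the rotation of angle \<open>t\<close> turns the vector
  \<open>(p, q)\<close> by the angle \<open>2 t\<close> and fixes \<open>r\<close>. The angle is
  chosen so that the difference of the diagonal entries vanishes; this leaves a sign, which decides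
  which off-diagonal entry dominates.\<close>

lemma conj_rot_equal_diagonal:
 fixes A :: "real^2^2"
 obtains t where "(adj2 (rot t) ** A ** rot t)$1$1 = (adj2 (rot t) ** A ** rot t)$2$2"
  "\<bar>(adj2 (rot t) ** A ** rot t)$1$2\<bar> \<le> \<bar>(adj2 (rot t) ** A ** rot t)$2$1\<bar>"
proof -
 define p q r where "p = A$1$1 - A$2$2" and "q = A$1$2 + A$2$1" and "r = A$2$1 - A$1$2"
 \<comment> \<open>\<open>C\<close> and \<open>S\<close> will be cosine and sine of the double
   angle; the last condition will make the difference
   \<open>(B$2$1)\<^sup>2 - (B$1$2)\<^sup>2\<close> for the rotated matrix nonnegative.\<close>
 have "\<exists>C S. C\<^sup>2 + S\<^sup>2 = 1 \<and> p * C + q * S = 0 \<and> 0 \<le> r * (q * C - p * S)"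
 proof (cases "p = 0 \<and> q = 0")
  case True
  thus ?thesis by (intro exI[of _ 1] exI[of _ 0]) simp
 next
  case False
  define n where "n = sqrt (p\<^sup>2 + q\<^sup>2)"
  define sg :: real where "sg = (if 0 \<le> r then 1 else -1)"
  have n: "n\<^sup>2 = p\<^sup>2 + q\<^sup>2" "n > 0" using False by (auto simp: n_def sum_power2_gt_zero_iff)
  have s: "sg\<^sup>2 = 1" "0 \<le> r * sg" by (auto simp: sg_def)
  have n0: "p\<^sup>2 + q\<^sup>2 ~= 0" using False by (simp add: sum_power2_eq_zero_iff)
  have "(sg * q / n)\<^sup>2 + (- sg * p / n)\<^sup>2 = sg\<^sup>2 * (p\<^sup>2 + q\<^sup>2) / n\<^sup>2"
   by (simp add: power_mult_distrib power_divide add_divide_distrib[symmetric] algebra_simps)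
  moreover have "r * (q * (sg * q / n) - p * (- sg * p / n)) = r * sg * ((p\<^sup>2 + q\<^sup>2) / n)"
   by (simp add: power2_eq_square add_divide_distrib algebra_simps)
  moreover have "sg\<^sup>2 * (p\<^sup>2 + q\<^sup>2) / n\<^sup>2 = 1" using n s n0 by simp
  moreover have "0 \<le> r * sg * ((p\<^sup>2 + q\<^sup>2) / n)" by (rule mult_nonneg_nonneg[OF s(2)]) (use n in simp)
  ultimately show ?thesis by (intro exI[of _ "sg * q / n"] exI[of _ "- sg * p / n"]) auto
 qed
 then obtain C S where CS: "C\<^sup>2 + S\<^sup>2 = 1" "p * C + q * S = 0" "0 \<le> r * (q * C - p * S)" by blast
 obtain u where u: "C = cos u" "S = sin u" using sincos_total_2pi[OF CS(1)] by metis
 define t where "t = u / 2"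
 have C: "C = (cos t)\<^sup>2 - (sin t)\<^sup>2" using u cos_double[of t] by (simp add: t_def)
 have S: "S = 2 * sin t * cos t" using u sin_double[of t] by (simp add: t_def)
 have one: "(cos t)\<^sup>2 + (sin t)\<^sup>2 = 1" by simp
 define B where "B = adj2 (rot t) ** A ** rot t"
 have B: "B$1$1 - B$2$2 = p * C + q * S" "B$1$2 + B$2$1 = q * C - p * S"
  by (simp_all add: B_def rot_def C S p_def q_def algebra_simps power2_eq_square)
 have B3: "B$2$1 - B$1$2 = r"
 proof -
  have "B$2$1 - B$1$2 = r * ((cos t)\<^sup>2 + (sin t)\<^sup>2)"
  proof -
   have "(- s * a + c * e) * c + (- s * b + c * d) * s - ((c * a + - (- s) * e) * - s + (c * b + - (- s) * d) * c)
    = (e - b) * (c * c + s * s)" for a b c d e s :: real by (simp add: algebra_simps)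
   thus ?thesis unfolding B_def rot_def r_def mat2_mult_nth mat2_nth adj2_nth power2_eq_square .
  qed
  thus ?thesis by simp
 qed
 have "(B$2$1)\<^sup>2 - (B$1$2)\<^sup>2 = (B$2$1 - B$1$2) * (B$1$2 + B$2$1)" by (simp add: power2_eq_square algebra_simps)
 also have "\<dots> \<ge> 0" unfolding B3 B(2) by (rule CS(3))
 finally have "\<bar>B$1$2\<bar> \<le> \<bar>B$2$1\<bar>" by (simp add: abs_le_square_iff)
 moreover have "B$1$1 = B$2$2" using B(1) CS(2) by simp
 ultimately show thesis using that unfolding B_def by blast
qed

definition diag2 :: "real => real^2^2" where "diag2 s = mat2 s 0 0 (1/s)"

lemma det_diag2 [simp]: "s ~= 0 ==> det (diag2 s) = 1" by (simp add: diag2_def)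

text \<open>The squared displacement of \<open>B\<close> at the frame \<open>diag2 s\<close>, that
  is, along the geodesic from \<open>\<i>\<close> towards \<open>\<infinity>\<close>.\<close>

definition dil_dist :: "real^2^2 => real => real"
 where "dil_dist B s = (B$1$1 - 1)\<^sup>2 + (B$2$2 - 1)\<^sup>2 + (B$1$2)\<^sup>2 / s ^ 4 + (B$2$1)\<^sup>2 * s ^ 4"

lemma norm_dil:
 assumes "s > 0"
 shows "(norm (adj2 (diag2 s) ** B ** diag2 s - mat 1))\<^sup>2 = dil_dist B s"
proof -
 have "s ^ 4 = s * s * (s * s)" by (simp add: eval_nat_numeral)
 moreover have "(adj2 (diag2 s) ** B ** diag2 s)$1$1 = B$1$1" "(adj2 (diag2 s) ** B ** diag2 s)$2$2 = B$2$2"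
  "(adj2 (diag2 s) ** B ** diag2 s)$1$2 = B$1$2 / (s * s)" "(adj2 (diag2 s) ** B ** diag2 s)$2$1 = B$2$1 * (s * s)"
  using assms by (simp_all add: diag2_def)
 ultimately show ?thesis unfolding norm_mat2_sq dil_dist_def by (simp add: power_mult_distrib power_divide power2_eq_square)
qed

text \<open>The growth of the term with the dominant entry \<open>B$2$1\<close> outweighs the decay
  of the term with \<open>B$1$2\<close> as soon as \<open>s \<ge> 1\<close>.\<close>

lemma dil_dist_strict_mono:
 assumes "1 \<le> s" "s < t" "\<bar>B$1$2\<bar> \<le> \<bar>B$2$1\<bar>" "B$2$1 ~= 0"
 shows "dil_dist B s < dil_dist B t"
proof -
 define u v where "u = s ^ 4" and "v = t ^ 4"
 have "1 \<le> u" using assms(1) by (simp add: u_def)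
 have "u < v" unfolding u_def v_def using assms by (intro power_strict_mono) auto
 define x y where "x = (B$1$2)\<^sup>2" and "y = (B$2$1)\<^sup>2"
 have xy: "0 \<le> x" "x \<le> y" "0 < y" using assms(3,4) by (auto simp: x_def y_def abs_le_square_iff)
 have "x / u - x / v = x * (v - u) / (u * v)" using \<open>1 \<le> u\<close> \<open>u < v\<close> by (simp add: field_simps)
 also have "\<dots> \<le> y * (v - u) / (u * v)"
  using xy \<open>1 \<le> u\<close> \<open>u < v\<close> by (intro divide_right_mono mult_right_mono) auto
 also have "\<dots> < y * (v - u)"
 proof -
  have "1 * 1 < u * v" using \<open>1 \<le> u\<close> \<open>u < v\<close> by (intro mult_le_less_imp_less) auto
  thus ?thesis using xy \<open>u < v\<close> by (simp add: divide_less_eq)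
 qed
 finally show ?thesis by (simp add: dil_dist_def u_def[symmetric] v_def[symmetric] x_def[symmetric] y_def[symmetric] algebra_simps)
qed

lemma continuous_on_dil_dist: "continuous_on {0<..} (dil_dist B)"
 unfolding dil_dist_def[abs_def] by (intro continuous_intros) auto

lemma dil_dist_reaches:
 assumes "dil_dist B 1 < d" "B$2$1 ~= 0"
 obtains s where "s > 1" "dil_dist B s = d"
proof -
 define y where "y = (B$2$1)\<^sup>2"
 have y: "y > 0" using assms(2) by (simp add: y_def)
 \<comment> \<open>Large enough for the single term \<open>y * t ^ 4\<close> to reach
   \<open>d\<close>, so that the intermediate value theorem applies on
   \<open>{1..t}\<close>.\<close>
 define t where "t = 1 + \<bar>d\<bar> / y"
 have t: "1 \<le> t" using y by (simp add: t_def)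
 have "d \<le> y * t" using y by (simp add: t_def algebra_simps)
 also have "\<dots> \<le> y * t ^ 4" using t y by (intro mult_left_mono self_le_power) auto
 also have "\<dots> \<le> dil_dist B t" by (simp add: dil_dist_def y_def)
 finally have "d \<le> dil_dist B t" .
 moreover have "continuous_on {1..t} (dil_dist B)" by (rule continuous_on_subset[OF continuous_on_dil_dist]) auto
 ultimately obtain s where "1 \<le> s" "s \<le> t" "dil_dist B s = d" using IVT'[of "dil_dist B" 1 d t] assms(1) t by auto
 thus thesis using that[of s] assms(1) by (cases "s = 1") auto
qed

context fuchsian
begin

abbreviation SP where "SP \<equiv> surface_points \<Gamma>"

text \<open>
 Moving a thin point along a suitable geodesic, away from the axis or fixed point of its short
 elements, one reaches the thick part; there one of these elements has displacement exactly
 \<open>1/17\<close>.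
\<close>

lemma thin_reaches_thick:
 assumes g: "det g = 1" "\<not> thick \<Gamma> (1/17) g"
 obtains t s h ga where "det h = 1" "s \<ge> 1" "thick \<Gamma> (1/17) h" "ga \<in> \<Gamma>"
  "g ** rot t = h ** adj2 (diag2 s)"
  "(adj2 h ** ga ** h)$1$1 = (adj2 h ** ga ** h)$2$2"
  "\<bar>(adj2 h ** ga ** h)$1$2\<bar> * s ^ 4 \<le> \<bar>(adj2 h ** ga ** h)$2$1\<bar>"
  "norm (adj2 h ** ga ** h - mat 1) = 1/17"
proof -
 \<comment> \<open>Below the Zassenhaus radius \<open>1/16\<close>, so that all elements of
   displacement less than \<open>de\<close> at a common frame commute.\<close>
 define de :: real where "de = 1/17"
 from g(2) obtain ga0 where g0: "ga0 \<in> \<Gamma>" "ga0 ~= mat 1" "norm (adj2 g ** ga0 ** g - mat 1) < de"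
  by (auto simp: thick_def de_def not_le)
 obtain t where t: "(adj2 (rot t) ** (adj2 g ** ga0 ** g) ** rot t)$1$1 = (adj2 (rot t) ** (adj2 g ** ga0 ** g) ** rot t)$2$2"
  "\<bar>(adj2 (rot t) ** (adj2 g ** ga0 ** g) ** rot t)$1$2\<bar> \<le> \<bar>(adj2 (rot t) ** (adj2 g ** ga0 ** g) ** rot t)$2$1\<bar>"
  by (rule conj_rot_equal_diagonal)
 define g' where "g' = g ** rot t"
 have det_g': "det g' = 1" using g by (simp add: g'_def det_mul)
 define c where "c k ga = adj2 k ** ga ** k" for k ga :: "real^2^2"
 have cg': "c g' ga = adj2 (rot t) ** (adj2 g ** ga ** g) ** rot t" for ga
  by (simp add: c_def g'_def adj2_mult matrix_mul_assoc)
 define A where "A = c g' ga0"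
 have c_inv: "k ** c k ga ** adj2 k = ga" if "det k = 1" for k ga using that by (simp add: c_def matrix_mul_assoc adj2_right)
 have c_mult: "c k (ga ** ga') = c k ga ** c k ga'" if "det k = 1" for k ga ga'
  using that by (simp add: c_def matrix_mul_assoc[symmetric])
 have c_1: "c k (mat 1) = mat 1" if "det k = 1" for k using that by (simp add: c_def adj2_left)
 have c_det: "det (c k ga) = 1" if "det k = 1" "ga \<in> \<Gamma>" for k ga using that by (simp add: c_def det_mul det_Gamma)
 have c_inj: "ga = ga'" if "c k ga = c k ga'" "det k = 1" for k ga ga' using c_inv that by metis
 have c_norm: "norm (c k ga) \<le> norm k * norm k * norm ga" for k ga
 proof -
  have "norm (c k ga) \<le> norm (adj2 k ** ga) * norm k" unfolding c_def by (rule norm_mat2_mult)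
  also have "\<dots> \<le> (norm (adj2 k) * norm ga) * norm k" by (intro mult_right_mono norm_mat2_mult) auto
  finally show ?thesis by (simp add: algebra_simps)
 qed
 have c_back: "ga = c (adj2 k) (c k ga)" if "det k = 1" for k ga using c_inv[OF that] by (simp add: c_def)
 have dil: "c (g' ** diag2 s) ga = adj2 (diag2 s) ** c g' ga ** diag2 s" for s ga
  by (simp add: c_def adj2_mult matrix_mul_assoc)
 have dist: "(norm (c (g' ** diag2 s) ga - mat 1))\<^sup>2 = dil_dist (c g' ga) s" if "s > 0" for s ga
  unfolding dil by (rule norm_dil[OF that])
 have d1: "diag2 1 = mat 1" by (rule mat2_eqI) (simp_all add: diag2_def)
 have dist1: "(norm (c g' ga - mat 1))\<^sup>2 = dil_dist (c g' ga) 1" for ga using dist[of 1 ga] by (simp add: d1)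
 obtain ep where e: "ep > 0" "\<And>ga. ga \<in> \<Gamma> ==> norm (ga - mat 1) < ep ==> ga = mat 1"
  using Gamma_separated by blast
 \<comment> \<open>Zassenhaus' lemma in the frame \<open>k\<close>: it is applied to the conjugate
   of \<open>\<Gamma>\<close>, whose elements other than 1 keep the distance
   \<open>ep / (norm k * norm k + 1)\<close> from 1.\<close>
 have zas: "ga ** ga' = ga' ** ga"
  if k: "det k = 1" and gg: "ga \<in> \<Gamma>" "ga' \<in> \<Gamma>" "norm (c k ga - mat 1) < 1/16" "norm (c k ga' - mat 1) < 1/16" for k ga ga'
 proof -
  define e' where "e' = ep / (norm k * norm k + 1)"
  have e': "e' > 0" using e(1) by (simp add: e'_def add_nonneg_pos)
  have sep: "c k ga = mat 1" if "ga \<in> \<Gamma>" "norm (c k ga - mat 1) < e'" for ga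
  proof -
   have "ga - mat 1 = c (adj2 k) (c k ga) - c (adj2 k) (mat 1)" using c_back[OF k, of ga] c_1[of "adj2 k"] k by simp
   also have "\<dots> = c (adj2 k) (c k ga - mat 1)" by (rule mat2_eqI) (simp_all add: c_def algebra_simps)
   finally have "norm (ga - mat 1) \<le> norm k * norm k * norm (c k ga - mat 1)"
    using c_norm[of "adj2 k" "c k ga - mat 1"] by simp
   also have "\<dots> \<le> (norm k * norm k + 1) * norm (c k ga - mat 1)" by (intro mult_right_mono) auto
   also have "\<dots> < (norm k * norm k + 1) * e'" using that by (intro mult_strict_left_mono) (auto simp: add_nonneg_pos)
   also have "\<dots> = ep" by (simp add: e'_def add_nonneg_eq_0_iff)
   finally show ?thesis using e(2)[OF that(1)] c_1[OF k] by simp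
  qed
  have "c k ga ** c k ga' = c k ga' ** c k ga"
  proof (rule zassenhaus[where \<Delta> = "c k ` \<Gamma>" and ep = e'])
   show "det A = 1" if "A \<in> c k ` \<Gamma>" for A using that c_det[OF k] by auto
   show "A ** B \<in> c k ` \<Gamma>" if "A \<in> c k ` \<Gamma>" "B \<in> c k ` \<Gamma>" for A B
    using that mult_Gamma by (auto simp: c_mult[OF k, symmetric])
   show "adj2 A \<in> c k ` \<Gamma>" if "A \<in> c k ` \<Gamma>" for A
   proof -
    from that obtain ga1 where "ga1 \<in> \<Gamma>" "A = c k ga1" by auto
    moreover have "adj2 (c k ga1) = c k (adj2 ga1)" by (simp add: c_def adj2_mult matrix_mul_assoc)
    ultimately show ?thesis using adj2_Gamma by auto
   qed
   show "A = mat 1" if "A \<in> c k ` \<Gamma>" "norm (A - mat 1) < e'" for A using that(1)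
   proof (rule imageE)
    fix ga1 assume "A = c k ga1" "ga1 \<in> \<Gamma>"
    thus "A = mat 1" using sep[of ga1] that(2) by blast
   qed
   show "c k ga \<in> c k ` \<Gamma>" "c k ga' \<in> c k ` \<Gamma>" by (rule imageI[OF gg(1)], rule imageI[OF gg(2)])
  qed (fact e' gg)+
  hence "c k (ga ** ga') = c k (ga' ** ga)" by (simp only: c_mult[OF k])
  thus ?thesis by (rule c_inj[OF _ k])
 qed
 have nonscalar: "\<not> (c g' ga $1$2 = 0 \<and> c g' ga $2$1 = 0 \<and> c g' ga $1$1 = c g' ga $2$2)"
  if "ga \<in> \<Gamma>" "ga ~= mat 1" "norm (c g' ga - mat 1) < 2" for ga
 proof
  assume "c g' ga $1$2 = 0 \<and> c g' ga $2$1 = 0 \<and> c g' ga $1$1 = c g' ga $2$2"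
  hence "c g' ga = mat 1" using scalar_near_one[OF c_det[OF det_g' that(1)] that(3)] by blast
  hence "c g' ga = c g' (mat 1)" by (simp only: c_1[OF det_g'])
  thus False using c_inj[OF _ det_g'] that(2) by blast
 qed
 have Ad: "A$1$1 = A$2$2" "\<bar>A$1$2\<bar> \<le> \<bar>A$2$1\<bar>" using t by (auto simp: A_def cg')
 have "norm (A - mat 1) = norm (adj2 (rot t) ** (adj2 g ** ga0 ** g - mat 1) ** rot t)"
 proof -
  have "adj2 (rot t) ** (X - mat 1) ** rot t = adj2 (rot t) ** X ** rot t - adj2 (rot t) ** rot t" for X
   by (rule mat2_eqI) (simp_all add: algebra_simps)
  thus ?thesis by (simp add: A_def cg' adj2_left)
 qed
 also have "\<dots> < de" using g0 by simp
 finally have An: "norm (A - mat 1) < de" .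
 have d2: "de < 2" "de < 1/16" "de > 0" by (auto simp: de_def)
 have A21: "A$2$1 ~= 0" using nonscalar[OF g0(1,2)] An Ad d2 unfolding A_def[symmetric] by auto
 text \<open>Elements commuting with \<open>A\<close> have the same shape as \<open>A\<close>.\<close>
 have shape: "c g' ga $1$1 = c g' ga $2$2 \<and> \<bar>c g' ga $1$2\<bar> \<le> \<bar>c g' ga $2$1\<bar>"
  if "ga ** ga0 = ga0 ** ga" for ga
 proof -
  have "c g' ga ** A = A ** c g' ga" using that by (simp add: A_def c_mult[OF det_g', symmetric])
  hence *: "c g' ga$1$2 * A$2$1 = A$1$2 * c g' ga$2$1" "A$2$1 * (c g' ga$1$1 - c g' ga$2$2) = 0"
   unfolding commute_2x2_iff using Ad(1) by auto
  have "\<bar>c g' ga$1$2\<bar> * \<bar>A$2$1\<bar> = \<bar>A$1$2\<bar> * \<bar>c g' ga$2$1\<bar>" using *(1) by (metis abs_mult)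
  also have "\<dots> \<le> \<bar>A$2$1\<bar> * \<bar>c g' ga$2$1\<bar>" using Ad(2) by (intro mult_right_mono) auto
  finally have "\<bar>c g' ga$1$2\<bar> \<le> \<bar>c g' ga$2$1\<bar>" using A21 by (simp add: mult.commute[of "\<bar>A$2$1\<bar>"])
  thus ?thesis using *(2) A21 by auto
 qed
 have entry: "c g' ga$2$1 ~= 0" if "ga \<in> \<Gamma>" "ga ~= mat 1" "norm (c g' ga - mat 1) < 2" "ga ** ga0 = ga0 ** ga" for ga
  using nonscalar[OF that(1-3)] shape[OF that(4)] by auto
 \<comment> \<open>The short elements at the starting frame: finitely many, all commuting with
   \<open>ga0\<close> and hence of the same shape, so that each displacement increases along the
   geodesic until it equals \<open>de\<close>.\<close>
 define S where "S = {ga \<in> \<Gamma>. ga ~= mat 1 \<and> norm (c g' ga - mat 1) < de}"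
 have "S \<subseteq> {ga \<in> \<Gamma>. norm ga \<le> norm g' * norm g' * 4}"
 proof
  fix ga assume "ga \<in> S"
  hence s: "ga \<in> \<Gamma>" "norm (c g' ga - mat 1) < de" by (auto simp: S_def)
  have "norm (c g' ga) \<le> 4" using s(2) norm_mat_1 norm_triangle_ineq[of "c g' ga - mat 1" "mat 1"] d2 by simp
  moreover have "norm ga \<le> norm g' * norm g' * norm (c g' ga)"
   using c_norm[of "adj2 g'" "c g' ga"] c_back[OF det_g', of ga] by simp
  ultimately have "norm ga \<le> norm g' * norm g' * 4" by (meson mult_left_mono order_trans zero_le_mult_iff norm_ge_zero)
  with s show "ga \<in> {ga \<in> \<Gamma>. norm ga \<le> norm g' * norm g' * 4}" by simp
 qed
 hence finS: "finite S" using finite_Gamma_bounded finite_subset by blast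
 have g0S: "ga0 \<in> S" using g0 An by (simp add: S_def A_def)
 have commS: "ga ** ga0 = ga0 ** ga" if "ga \<in> S" for ga using zas[OF det_g', of ga ga0] that g0S d2 by (auto simp: S_def)
 have "\<exists>s>1. dil_dist (c g' ga) s = de\<^sup>2" if "ga \<in> S" for ga
 proof -
  have "c g' ga$2$1 ~= 0" using that commS[OF that] d2 by (intro entry) (auto simp: S_def)
  moreover have "dil_dist (c g' ga) 1 < de\<^sup>2"
   unfolding dist1[symmetric] using that by (intro power_strict_mono) (auto simp: S_def)
  ultimately show ?thesis by (metis dil_dist_reaches)
 qed
 then obtain sg where sig: "\<And>ga. ga \<in> S ==> sg ga > 1 \<and> dil_dist (c g' ga) (sg ga) = de\<^sup>2" by metis
 \<comment> \<open>\<open>ga1\<close> is the last one to reach displacement \<open>de\<close>; the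
   frame \<open>h\<close> at that moment will be thick.\<close>
 obtain ga1 where g1: "ga1 \<in> S" "\<And>ga. ga \<in> S ==> sg ga \<le> sg ga1"
 proof -
  have "Max (sg ` S) \<in> sg ` S" using finS g0S by (intro Max_in) auto
  then obtain ga1 where "ga1 \<in> S" "sg ga1 = Max (sg ` S)" by auto
  thus thesis using that[of ga1] finS by simp
 qed
 define s where "s = sg ga1"
 have s1: "s > 1" "dil_dist (c g' ga1) s = de\<^sup>2" using sig[OF g1(1)] by (auto simp: s_def)
 define h where "h = g' ** diag2 s"
 have det_h: "det h = 1" using det_g' s1 by (simp add: h_def det_mul)
 have entry1: "c g' ga1$2$1 ~= 0" using g1 commS[OF g1(1)] d2 by (intro entry) (auto simp: S_def)
 have G1: "ga1 \<in> \<Gamma>" "ga1 ~= mat 1" "norm (c g' ga1 - mat 1) < 2" using g1(1) d2 by (auto simp: S_def)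
 note shape1 = shape[OF commS[OF g1(1)]]
 have lt_iff: "norm X < de \<longleftrightarrow> (norm X)\<^sup>2 < de\<^sup>2" for X :: "real^2^2"
  using power_strict_mono[of "norm X" de 2] power2_less_imp_less[of "norm X" de] d2 by auto
 \<comment> \<open>An element that is short at \<open>h\<close> is also short just before, where
   \<open>ga1\<close> is short too; so it commutes with \<open>ga1\<close>, hence with
   \<open>ga0\<close>. Its displacement then increases as well: it already belonged to
   \<open>S\<close>, and would reach \<open>de\<close> only after \<open>ga1\<close>.\<close>
 have thick: "thick \<Gamma> de h" unfolding thick_def c_def[symmetric]
 proof (intro ballI impI, rule ccontr)
  fix ga assume gam: "ga \<in> \<Gamma>" "ga ~= mat 1" "\<not> de \<le> norm (c h ga - mat 1)"
  hence lt: "dil_dist (c g' ga) s < de\<^sup>2" using dist[of s ga] s1 lt_iff[of "c h ga - mat 1"] by (simp add: h_def)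
  have "isCont (dil_dist (c g' ga)) s" using continuous_on_dil_dist s1 by (auto simp: continuous_on_eq_continuous_at)
  hence "(dil_dist (c g' ga) \<longlongrightarrow> dil_dist (c g' ga) s) (at_left s)"
   unfolding isCont_def by (rule tendsto_within_subset) simp
  hence "\<forall>\<^sub>F x in at_left s. dil_dist (c g' ga) x < de\<^sup>2" using lt by (rule order_tendstoD(2))
  moreover have "\<forall>\<^sub>F x in at_left s. x \<in> {1<..<s}" using s1 by (intro eventually_at_left_real) auto
  ultimately have "\<forall>\<^sub>F x in at_left s. dil_dist (c g' ga) x < de\<^sup>2 \<and> x \<in> {1<..<s}"
   by (rule eventually_conj)
  then obtain x where x: "dil_dist (c g' ga) x < de\<^sup>2" "1 < x" "x < s" using eventually_happens'[of "at_left s"] by auto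
  have x1: "dil_dist (c g' ga1) x < de\<^sup>2" using dil_dist_strict_mono[of x s "c g' ga1"] x shape1 entry1 s1 by simp
  have "norm (c (g' ** diag2 x) ga - mat 1) < de" "norm (c (g' ** diag2 x) ga1 - mat 1) < de"
   unfolding lt_iff using dist[of x] x x1 by auto
  hence com1: "ga ** ga1 = ga1 ** ga" using d2 x gam G1 by (intro zas[of "g' ** diag2 x"]) (auto simp: det_mul det_g')
  have "c g' ga ** A = A ** c g' ga"
  proof (rule commute_2x2_trans)
   show "c g' ga ** c g' ga1 = c g' ga1 ** c g' ga" using com1 by (simp add: c_mult[OF det_g', symmetric])
   show "A ** c g' ga1 = c g' ga1 ** A" using commS[OF g1(1)] by (simp add: A_def c_mult[OF det_g', symmetric])
   show "\<not> (c g' ga1 $1$2 = 0 \<and> c g' ga1 $2$1 = 0 \<and> c g' ga1 $1$1 = c g' ga1 $2$2)" by (rule nonscalar[OF G1])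
  qed
  hence "c g' (ga ** ga0) = c g' (ga0 ** ga)" by (simp only: A_def c_mult[OF det_g'])
  hence com0: "ga ** ga0 = ga0 ** ga" by (rule c_inj[OF _ det_g'])
  note sh = shape[OF com0]
  have ent: "c g' ga$2$1 ~= 0"
  proof
   assume z: "c g' ga$2$1 = 0"
   hence "c g' ga$1$2 = 0" using sh by simp
   hence "norm (c g' ga - mat 1) < de" unfolding lt_iff dist1 using lt z by (simp add: dil_dist_def)
   thus False using nonscalar[OF gam(1,2)] sh z \<open>c g' ga$1$2 = 0\<close> d2 by auto
  qed
  have "dil_dist (c g' ga) 1 < de\<^sup>2" using dil_dist_strict_mono[of 1 s "c g' ga"] s1 sh ent lt by simp
  hence S: "ga \<in> S" using gam unfolding S_def lt_iff dist1 by simp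
  have "dil_dist (c g' ga) (sg ga) \<le> dil_dist (c g' ga) s"
   using dil_dist_strict_mono[of "sg ga" s "c g' ga"] g1(2)[OF S] sig[OF S] sh ent by (cases "sg ga = s") (auto simp: s_def)
  thus False using sig[OF S] lt by simp
 qed
 have M: "c h ga1 = adj2 (diag2 s) ** c g' ga1 ** diag2 s" by (simp add: h_def dil)
 have M_entries: "c h ga1$1$1 = c g' ga1$1$1" "c h ga1$2$2 = c g' ga1$2$2"
  "c h ga1$1$2 = c g' ga1$1$2 / s\<^sup>2" "c h ga1$2$1 = c g' ga1$2$1 * s\<^sup>2"
  using s1 by (simp_all add: M diag2_def power2_eq_square)
 show thesis
 proof (rule that[of h s ga1 t])
  show "g ** rot t = h ** adj2 (diag2 s)" using s1 by (simp add: h_def g'_def)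
  show "(adj2 h ** ga1 ** h)$1$1 = (adj2 h ** ga1 ** h)$2$2" using shape1 M_entries by (simp add: c_def)
  have "\<bar>c h ga1$1$2\<bar> * s ^ 4 = \<bar>c g' ga1$1$2\<bar> * s\<^sup>2"
   using s1 by (simp add: M_entries abs_mult field_simps eval_nat_numeral)
  also have "\<dots> \<le> \<bar>c h ga1$2$1\<bar>" using shape1 by (simp add: M_entries abs_mult mult_right_mono)
  finally show "\<bar>(adj2 h ** ga1 ** h)$1$2\<bar> * s ^ 4 \<le> \<bar>(adj2 h ** ga1 ** h)$2$1\<bar>" by (simp add: c_def)
  have "(norm (c h ga1 - mat 1))\<^sup>2 = de\<^sup>2" using dist[of s ga1] s1 by (simp add: h_def)
  hence "norm (c h ga1 - mat 1) = de" using d2 by (simp add: power2_eq_iff_nonneg)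
  thus "norm (adj2 h ** ga1 ** h - mat 1) = 1/17" by (simp add: c_def de_def)
 qed (use det_h s1 thick G1 in \<open>auto simp: de_def\<close>)
qed

end

section \<open>Parabolic elements and reduction to finitely many cusps\<close>

lemma upper_triangular_conj:
 fixes u :: "real^2^2"
 assumes "det u = 1" "U ** u = u ** U'"
  "U$1$1 = 1" "U$2$1 = 0" "U$2$2 = 1" "U'$1$1 = 1" "U'$2$1 = 0" "U'$2$2 = 1" "U'$1$2 ~= 0"
 shows "u$2$1 = 0"
proof -
 have "(U ** u)$2$2 = (u ** U')$2$2" using assms(2) by simp
 thus ?thesis using assms(3-9) by simp
qed

lemma trace_conj:
 fixes h ga :: "real^2^2"
 assumes "det h = 1"
 shows "trace (adj2 h ** ga ** h) = trace ga"
proof -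
 have "trace (adj2 h ** ga ** h) = det h * trace ga" by (simp add: trace_def sum_2 det_2 algebra_simps)
 thus ?thesis using assms by simp
qed

lemma conj_eq_central:
 fixes h ga c :: "real^2^2"
 assumes "det h = 1" "h ** c = c ** h"
 shows "adj2 h ** ga ** h = c \<longleftrightarrow> ga = c"
proof
 assume "adj2 h ** ga ** h = c"
 hence "h ** (adj2 h ** (ga ** h)) ** adj2 h = h ** c ** adj2 h" by (simp only: matrix_mul_assoc)
 thus "ga = c" using assms by simp
next
 assume "ga = c"
 hence "adj2 h ** ga ** h = adj2 h ** (h ** c)" by (simp only: matrix_mul_assoc[symmetric] assms(2))
 thus "adj2 h ** ga ** h = c" by (simp only: adj2_cancel(1)[OF assms(1)])
qed

lemma parabolic_conj:
 assumes "det h = 1"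
 shows "parabolic (adj2 h ** ga ** h) \<longleftrightarrow> parabolic ga"
proof -
 have "h ** mat 1 = mat 1 ** h" "h ** (- mat 1) = (- mat 1) ** h" by (auto intro!: mat2_eqI)
 thus ?thesis unfolding parabolic_def trace_conj[OF assms] using conj_eq_central[OF assms] by blast
qed

lemma trace_2_upper_triangular:
 fixes U :: "real^2^2"
 assumes "det U = 1" "trace U = 2" "U$2$1 = 0"
 shows "U$1$1 = 1 \<and> U$2$2 = 1"
proof -
 have "U$2$2 = 2 - U$1$1" "U$1$1 * U$2$2 = 1" using assms by (simp_all add: trace_def sum_2 det_2)
 hence "U$1$1 * (2 - U$1$1) = 1" by simp
 moreover have "(e - 1)\<^sup>2 = 1 - e * (2 - e)" for e :: real by (simp add: power2_eq_square algebra_simps)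
 ultimately have "(U$1$1 - 1)\<^sup>2 = 0" by simp
 thus ?thesis using \<open>U$2$2 = 2 - U$1$1\<close> by simp
qed

lemma norm_adj2_diag2_le:
 assumes "s \<ge> 1"
 shows "norm (adj2 (diag2 s)) \<le> 2 * s"
proof -
 have "(1 / s)\<^sup>2 \<le> 1\<^sup>2" using assms by (intro power_mono) (auto simp: divide_simps)
 moreover have "1\<^sup>2 \<le> s\<^sup>2" using assms by (intro power_mono) auto
 moreover have "(norm (adj2 (diag2 s)))\<^sup>2 = s\<^sup>2 + (1/s)\<^sup>2"
  unfolding norm_mat2_sq adj2_nth diag2_def mat2_nth by simp
 ultimately have "(norm (adj2 (diag2 s)))\<^sup>2 \<le> (2 * s)\<^sup>2" by (simp add: power_mult_distrib)
 thus ?thesis by (rule power2_le_imp_le) (use assms in simp)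
qed

context fuchsian
begin

text \<open>A thin frame \<open>g\<close> lies on a geodesic through a thick frame, which is bounded
  modulo \<open>\<Gamma>\<close>; so the element that is short there ranges over the finite set
  \<open>\<A>\<close>, up to conjugation. If its trace is not 2, the trace bounds the length
  \<open>s\<close> of the way; if it is 2, the element is parabolic and \<open>g\<close> lies high
  in its cusp once \<open>s\<close> is large. The set \<open>S\<close> is chosen before the height
  \<open>c\<close>, on which only \<open>R\<close> depends.\<close>

theorem siegel:
 obtains S where "finite S" "S \<subseteq> cusp_frames \<Gamma>"
  "\<And>c. \<exists>R. \<forall>g. det g = 1 --> (\<exists>ga\<in>\<Gamma>. norm (ga ** g) \<le> R \<or>
    (\<exists>sg\<in>S. c < Im (mob (adj2 sg ** (ga ** g)) \<i>)))"
proof -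
 obtain R0 where R0: "\<And>g. det g = 1 ==> thick \<Gamma> (1/17) g ==> \<exists>ga\<in>\<Gamma>. norm (ga ** g) \<le> R0"
  using thick_part_compact[of "1/17"] by auto
 define R where "R = max R0 1"
 have R: "\<exists>ga\<in>\<Gamma>. norm (ga ** g) \<le> R" if "det g = 1" "thick \<Gamma> (1/17) g" for g
  using R0[OF that] by (auto simp: R_def intro: max.coboundedI1)
 have R1: "1 \<le> R" by (simp add: R_def)
 \<comment> \<open>\<open>4\<close> bounds the norm of a matrix at distance \<open>1/17\<close> from
   1; conjugation by a frame of norm at most \<open>R\<close> costs the factor
   \<open>R * R\<close>.\<close>
 define \<A> where "\<A> = {ga\<in>\<Gamma>. norm ga \<le> R * R * 4}"
 have finA: "finite \<A>" unfolding \<A>_def by (rule finite_Gamma_bounded)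
 define frame where "frame ga sg \<longleftrightarrow> det sg = 1 \<and> (adj2 sg ** ga ** sg)$2$1 = 0" for ga sg
 define fr where "fr ga = (SOME sg. frame ga sg)" for ga
 define P where "P = {ga\<in>\<A>. parabolic ga \<and> trace ga = 2 \<and> (\<exists>sg. frame ga sg)}"
 have fr: "frame ga (fr ga)" if "ga \<in> P" for ga using that unfolding P_def fr_def by (auto intro: someI)
 define S where "S = fr ` P"
 have finP: "finite P" using finA by (auto simp: P_def intro: finite_subset)
 have S1: "finite S" using finP by (simp add: S_def)
 have S2: "S \<subseteq> cusp_frames \<Gamma>"
 proof
  fix sg assume "sg \<in> S"
  then obtain ga where "ga \<in> P" "sg = fr ga" by (auto simp: S_def)
  with fr[OF this(1)] show "sg \<in> cusp_frames \<Gamma>"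
   unfolding cusp_frames_def frame_def by (auto simp: inv_SL2R P_def \<A>_def simp del: mat2_mult_nth intro!: bexI[of _ ga])
 qed
 \<comment> \<open>A positive lower bound for the distances of squared half traces from 1, where
   they differ from 1, over the finite set \<open>\<A>\<close>; the inserted 1 keeps the set
   nonempty.\<close>
 define \<eta> where "\<eta> = Min (insert 1 ((\<lambda>ga. \<bar>(trace ga / 2)\<^sup>2 - 1\<bar>) ` {ga\<in>\<A>. \<bar>(trace ga / 2)\<^sup>2 - 1\<bar> ~= 0}))"
 have fin\<eta>: "finite ((\<lambda>ga. \<bar>(trace ga / 2)\<^sup>2 - 1\<bar>) ` {ga\<in>\<A>. \<bar>(trace ga / 2)\<^sup>2 - 1\<bar> ~= 0})"
  using finA by simp
 have eta: "\<eta> > 0" unfolding \<eta>_def using fin\<eta> by (subst Min_gr_iff) auto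
 have eta_le: "\<eta> \<le> \<bar>(trace ga / 2)\<^sup>2 - 1\<bar>" if "ga \<in> \<A>" "(trace ga / 2)\<^sup>2 ~= 1" for ga
  unfolding \<eta>_def using that fin\<eta> by (intro Min_le) auto
 define Y where "Y = (\<Sum>ga\<in>P. norm (fr ga)) * (R * 2) + 1"
 have Y: "Y \<ge> 1" using R1 by (auto simp: Y_def intro!: mult_nonneg_nonneg sum_nonneg)
 have Yle: "norm (fr ga) * (R * 2) \<le> Y" if "ga \<in> P" for ga
 proof -
  have "norm (fr ga) \<le> (\<Sum>ga\<in>P. norm (fr ga))" using finP that by (intro member_le_sum) auto
  hence "norm (fr ga) * (R * 2) \<le> (\<Sum>ga\<in>P. norm (fr ga)) * (R * 2)" using R1 by (intro mult_right_mono) auto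
  thus ?thesis unfolding Y_def by linarith
 qed
 show thesis
 proof (rule that[OF S1 S2])
  fix c :: real
  \<comment> \<open>For \<open>s\<close> above the first argument of \<open>max\<close> only
    parabolic elements remain; above the second one, the height \<open>(s / y)\<^sup>2\<close> in
    the cusp exceeds \<open>c\<close>.\<close>
  define s0 where "s0 = max (1 / \<eta> + 1) (\<bar>c\<bar> * Y\<^sup>2 + 1)"
  show "\<exists>R. \<forall>g. det g = 1 --> (\<exists>ga\<in>\<Gamma>. norm (ga ** g) \<le> R \<or>
    (\<exists>sg\<in>S. c < Im (mob (adj2 sg ** (ga ** g)) \<i>)))"
  proof (intro exI[of _ "R * (2 * s0)"] allI impI)
   fix g :: "real^2^2" assume g: "det g = 1"
   have s0: "s0 \<ge> 1" using eta by (auto simp: s0_def max_def)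
   show "\<exists>ga\<in>\<Gamma>. norm (ga ** g) \<le> R * (2 * s0) \<or>
    (\<exists>sg\<in>S. c < Im (mob (adj2 sg ** (ga ** g)) \<i>))"
   proof (cases "thick \<Gamma> (1/17) g")
    case True
    have "R * 1 \<le> R * (2 * s0)" using R1 s0 by (intro mult_left_mono) auto
    moreover obtain ga where "ga \<in> \<Gamma>" "norm (ga ** g) \<le> R" using R[OF g True] by blast
    ultimately show ?thesis by (intro bexI[of _ ga] disjI1) auto
   next
    case False
    obtain t s h ga1 where h: "det h = 1" "s \<ge> 1" "thick \<Gamma> (1/17) h" "ga1 \<in> \<Gamma>"
     "g ** rot t = h ** adj2 (diag2 s)"
     "(adj2 h ** ga1 ** h)$1$1 = (adj2 h ** ga1 ** h)$2$2"
     "\<bar>(adj2 h ** ga1 ** h)$1$2\<bar> * s ^ 4 \<le> \<bar>(adj2 h ** ga1 ** h)$2$1\<bar>"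
     "norm (adj2 h ** ga1 ** h - mat 1) = 1/17" by (rule thin_reaches_thick[OF g False]) blast
    obtain ga2 where g2: "ga2 \<in> \<Gamma>" "norm (ga2 ** h) \<le> R" using R[OF h(1,3)] by blast
    define w where "w = ga2 ** h"
    define M where "M = adj2 h ** ga1 ** h"
    have det_w: "det w = 1" using g2 h det_Gamma by (simp add: w_def det_mul)
    define A where "A = ga2 ** ga1 ** adj2 ga2"
    have AG: "A \<in> \<Gamma>" unfolding A_def using g2 h by (intro mult_Gamma adj2_Gamma)
    have MA: "M = adj2 w ** A ** w"
    proof -
     have "adj2 w ** A ** w = adj2 h ** (adj2 ga2 ** ga2) ** ga1 ** (adj2 ga2 ** ga2) ** h"
      by (simp add: w_def A_def adj2_mult matrix_mul_assoc)
     thus ?thesis using det_Gamma[OF g2(1)] by (simp add: adj2_left M_def)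
    qed
    have AM: "A = w ** M ** adj2 w" unfolding MA using det_w by (simp add: matrix_mul_assoc adj2_right)
    have Mn: "norm (M - mat 1) = 1/17" using h by (simp add: M_def)
    have "norm M \<le> 4" using Mn norm_mat_1 norm_triangle_ineq[of "M - mat 1" "mat 1"] by simp
    have "norm A \<le> norm (w ** M) * norm (adj2 w)" unfolding AM by (rule norm_mat2_mult)
    also have "\<dots> \<le> (norm w * norm M) * norm (adj2 w)" by (intro mult_right_mono norm_mat2_mult) auto
    also have "\<dots> \<le> (R * 4) * R" using g2(2) R1 \<open>norm M \<le> 4\<close> by (intro mult_mono) (auto simp: w_def)
    finally have "A \<in> \<A>" using AG by (simp add: \<A>_def algebra_simps)
    have det_M: "det M = 1" using h det_Gamma by (simp add: M_def det_mul)
    define x \<beta> ka where "x = M$1$1" and "\<beta> = M$1$2" and "ka = M$2$1"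
    have M22: "M$2$2 = x" using h(6) unfolding M_def x_def by simp
    have detx: "x\<^sup>2 - \<beta> * ka = 1" using det_M by (simp add: det_2 M22 x_def[symmetric] \<beta>_def ka_def power2_eq_square)
    have bk: "\<bar>\<beta>\<bar> * s ^ 4 \<le> \<bar>ka\<bar>" using h(7) unfolding \<beta>_def ka_def M_def .
    have k1: "\<bar>ka\<bar> \<le> 1/17" using abs_nth_le_norm_mat2[of "M - mat 1" 2 1] Mn by (simp add: ka_def)
    have x1: "\<bar>x - 1\<bar> \<le> 1/17" using abs_nth_le_norm_mat2[of "M - mat 1" 1 1] Mn by (simp add: x_def)
    have trM: "trace M = 2 * x" by (simp add: trace_def sum_2 x_def[symmetric] M22)
    have trA: "trace A = 2 * x" using trace_conj[OF det_w, of A] unfolding MA[symmetric] trM by simp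
    have g2g: "ga2 ** g ** rot t = w ** adj2 (diag2 s)" unfolding w_def matrix_mul_assoc[symmetric] h(5) ..
    have small: "norm (ga2 ** g) \<le> R * (2 * s0)" if "s \<le> s0"
    proof -
     have "norm (ga2 ** g) = norm (w ** adj2 (diag2 s))" unfolding g2g[symmetric] by simp
     also have "\<dots> \<le> norm w * norm (adj2 (diag2 s))" by (rule norm_mat2_mult)
     also have "\<dots> \<le> R * (2 * s)" using norm_adj2_diag2_le[OF h(2)] g2(2) R1 by (intro mult_mono) (auto simp: w_def)
     also have "\<dots> \<le> R * (2 * s0)" using that R1 by simp
     finally show ?thesis .
    qed
    \<comment> \<open>\<open>x\<close> is half the trace of \<open>A\<close> and lies near 1, which
      rules out trace -2.\<close>
    show ?thesis
    proof (cases "x = 1")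
     case False
     have "x\<^sup>2 ~= 1" using False x1 by (auto simp: power2_eq_1_iff)
     hence "\<eta> \<le> \<bar>\<beta> * ka\<bar>" using eta_le[OF \<open>A \<in> \<A>\<close>] trA detx by (simp add: algebra_simps)
     have "\<eta> * s \<le> \<eta> * s ^ 4" using eta h(2) by (intro mult_left_mono self_le_power) auto
     also have "\<dots> \<le> \<bar>\<beta> * ka\<bar> * s ^ 4" using \<open>\<eta> \<le> \<bar>\<beta> * ka\<bar>\<close> h(2) by (intro mult_right_mono) auto
     also have "\<dots> = (\<bar>\<beta>\<bar> * s ^ 4) * \<bar>ka\<bar>" by (simp add: abs_mult)
     also have "\<dots> \<le> \<bar>ka\<bar> * \<bar>ka\<bar>" using bk by (intro mult_right_mono) auto
     also have "\<dots> \<le> 1 * 1" using k1 by (intro mult_mono) auto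
     finally have "s \<le> 1 / \<eta>" using eta by (simp add: field_simps)
     hence "s \<le> s0" unfolding s0_def by simp
     thus ?thesis using small g2(1) by blast
    next
     case True
     have "\<beta> * ka = 0" using detx True by simp
     have "\<beta> = 0"
     proof (rule ccontr)
      assume "\<beta> ~= 0"
      hence "ka = 0" using \<open>\<beta> * ka = 0\<close> by simp
      thus False using bk \<open>\<beta> ~= 0\<close> h(2) by (simp add: mult_le_0_iff)
     qed
     have "ka ~= 0"
     proof
      assume "ka = 0"
      have "M = mat 1"
       by (rule mat2_eqI) (use \<open>\<beta> = 0\<close> \<open>ka = 0\<close> True M22 x_def \<beta>_def ka_def in simp_all)
      thus False using Mn by simp
     qed
     \<comment> \<open>\<open>M\<close> is lower triangular and fixes 0; the quarter turn
       \<open>J\<close> moves this fixed point to \<open>\<infinity>\<close>, so that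
       \<open>w ** J\<close> is a frame of the cusp fixed by \<open>A\<close>.\<close>
     define J where "J = mat2 0 (-1) 1 0"
     have det_J: "det J = 1" by (simp add: J_def)
     define U' where "U' = adj2 J ** M ** J"
     have "U'$1$1 = M$2$2" "U'$2$1 = - M$1$2" "U'$2$2 = M$1$1" "U'$1$2 = - M$2$1" by (simp_all add: U'_def J_def)
     hence U': "U'$1$1 = 1" "U'$2$1 = 0" "U'$2$2 = 1" "U'$1$2 = - ka"
      using True M22 \<open>\<beta> = 0\<close> by (simp_all add: x_def \<beta>_def ka_def)
     have det_wJ: "det (w ** J) = 1" using det_w det_J by (simp add: det_mul)
     have wJ: "adj2 (w ** J) ** A ** (w ** J) = U'" unfolding U'_def MA adj2_mult matrix_mul_assoc ..
     have "parabolic M"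
     proof -
      have "(mat 1 :: real^2^2)$2$1 = 0" "(- mat 1 :: real^2^2)$2$1 = 0" by simp_all
      hence "M ~= mat 1" "M ~= - mat 1" using \<open>ka ~= 0\<close> unfolding ka_def by metis+
      thus ?thesis using trM True by (simp add: parabolic_def)
     qed
     hence "parabolic A" unfolding MA parabolic_conj[OF det_w] .
     have "frame A (w ** J)" unfolding frame_def wJ using det_wJ U'(2) by simp
     hence AP: "A \<in> P" using \<open>parabolic A\<close> \<open>A \<in> \<A>\<close> trA True unfolding P_def by auto
     define sg where "sg = fr A"
     have sig: "det sg = 1" "(adj2 sg ** A ** sg)$2$1 = 0" using fr[OF AP] unfolding sg_def frame_def by blast+
     have sigS: "sg \<in> S" using AP by (auto simp: sg_def S_def)
     define U where "U = adj2 sg ** A ** sg"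
     have det_U: "det U = 1" using sig(1) det_Gamma[OF AG] by (simp add: U_def det_mul)
     have trU: "trace U = 2" unfolding U_def trace_conj[OF sig(1)] using trA True by simp
     have U21: "U$2$1 = 0" using sig(2) unfolding U_def .
     note U = trace_2_upper_triangular[OF det_U trU U21]
     \<comment> \<open>The transition between two frames of one cusp, \<open>w ** J\<close> and the
       chosen \<open>sg\<close>: it fixes \<open>\<infinity>\<close>, hence is upper triangular, and
       only its diagonal entry \<open>y\<close> affects heights.\<close>
     define u where "u = adj2 sg ** (w ** J)"
     have det_u: "det u = 1" using sig(1) det_wJ by (simp add: u_def det_mul)
     have "U ** u = u ** U'"
     proof -
      have "U ** u = adj2 sg ** A ** (sg ** adj2 sg) ** (w ** J)" by (simp only: U_def u_def matrix_mul_assoc)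
      also have "\<dots> = adj2 sg ** (((w ** J) ** adj2 (w ** J)) ** A ** (w ** J))"
       unfolding adj2_right[OF sig(1)] adj2_right[OF det_wJ] by (simp only: matrix_mul_assoc matrix_mul_lid matrix_mul_rid)
      also have "\<dots> = u ** U'" by (simp only: u_def wJ[symmetric] matrix_mul_assoc)
      finally show ?thesis .
     qed
     hence u21: "u$2$1 = 0" using upper_triangular_conj[OF det_u _ _ U21 _ U'(1-3)] U U'(4) \<open>ka ~= 0\<close> by simp
     define y where "y = u$2$2"
     have py: "u$1$1 * y = 1" using det_u u21 by (simp add: det_2 y_def)
     have "\<bar>y\<bar> \<le> norm u" unfolding y_def by (rule abs_nth_le_norm_mat2)
     also have "\<dots> \<le> norm (adj2 sg) * norm (w ** J)" unfolding u_def by (rule norm_mat2_mult)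
     also have "\<dots> \<le> norm sg * (norm w * norm J)" using norm_mat2_mult[of w J] by (simp add: mult_left_mono)
     also have "\<dots> \<le> norm sg * (R * 2)"
     proof -
      have "(norm J)\<^sup>2 = 2" unfolding norm_mat2_sq by (simp add: J_def)
      hence "(norm J)\<^sup>2 \<le> 2\<^sup>2" by simp
      hence "norm J \<le> 2" by (rule power2_le_imp_le) simp
      thus ?thesis using g2(2) R1 by (intro mult_left_mono mult_mono) (auto simp: w_def)
     qed
     also have "\<dots> \<le> Y" unfolding sg_def by (rule Yle[OF AP])
     finally have yY: "\<bar>y\<bar> \<le> Y" .
     have y0: "y ~= 0" using py by auto
     have s_pos: "s > 0" using h(2) by simp
     define V where "V = u ** (adj2 J ** adj2 (diag2 s))"
     have "mob (adj2 sg ** (ga2 ** g)) \<i> = mob (adj2 sg ** (ga2 ** g)) (mob (rot t) \<i>)" by simp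
     also have "\<dots> = mob (adj2 sg ** (ga2 ** g) ** rot t) \<i>"
      by (rule mobius_act_mult[symmetric]) (use sig(1) g det_Gamma[OF g2(1)] in \<open>simp_all add: det_mul\<close>)
     also have "adj2 sg ** (ga2 ** g) ** rot t = adj2 sg ** (w ** adj2 (diag2 s))"
      by (simp only: g2g[symmetric] matrix_mul_assoc)
     also have "adj2 sg ** (w ** adj2 (diag2 s)) = V" using det_J by (simp add: V_def u_def matrix_mul_assoc)
     finally have eq: "mob (adj2 sg ** (ga2 ** g)) \<i> = mob V \<i>" .
     have "V$2$1 = (u$2$2) * (-1/s) - u$2$1 * 0" "V$2$2 = u$2$1 * s" by (simp_all add: V_def J_def diag2_def)
     hence V2: "V$2$1 = - y / s" "V$2$2 = 0" using u21 by (simp_all add: y_def)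
     have det_V: "det V = 1" using det_u det_J s_pos by (simp add: V_def det_mul)
     have "Im (mob V \<i>) = 1 / (cmod (automorphy V \<i>))\<^sup>2" using Im_mobius_act[OF det_V, of \<i>] by simp
     also have "cmod (automorphy V \<i>) = \<bar>y\<bar> / s"
      using s_pos by (simp add: automorphy_def V2 norm_mult norm_divide)
     finally have Im: "Im (mob (adj2 sg ** (ga2 ** g)) \<i>) = (s / \<bar>y\<bar>)\<^sup>2"
      unfolding eq by (simp add: power_divide)
     show ?thesis
     proof (cases "s \<le> s0")
      case True
      thus ?thesis using small g2(1) by blast
     next
      case False
      have "c * y\<^sup>2 \<le> \<bar>c\<bar> * Y\<^sup>2"
      proof (rule mult_mono)
       show "y\<^sup>2 \<le> Y\<^sup>2" using yY Y by (simp add: abs_le_square_iff[symmetric])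
      qed auto
      also have "\<dots> < s" using False unfolding s0_def by simp
      also have "s \<le> s\<^sup>2" using h(2) by (simp add: power2_eq_square)
      finally have "c < (s / \<bar>y\<bar>)\<^sup>2" using y0 by (simp add: power_divide pos_less_divide_eq)
      thus ?thesis unfolding Im[symmetric] using sigS g2(1) by blast
     qed
    qed
   qed
  qed
 qed
qed

text \<open>Compactness of the surface in the form used everywhere: neighbourhoods of the cusps
  absorb all large heights, and what \<open>siegel\<close> leaves over is compact. A neighbourhood
  of \<open>at z\<close> may omit \<open>z\<close> itself; this is the reason for the alternative
  \<open>\<Phi> = at (mob ga z)\<close>.\<close>

lemma surface_points_finite_cover:
 assumes N: "\<And>\<Phi>. \<Phi> \<in> SP ==> eventually (\<lambda>z. z \<in> N \<Phi>) \<Phi>"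
 obtains S where "finite S" "S \<subseteq> SP"
  "\<And>z. 0 < Im z ==> \<exists>ga\<in>\<Gamma>. \<exists>\<Phi>\<in>S. mob ga z \<in> N \<Phi> \<or> \<Phi> = at (mob ga z)"
proof -
 obtain S0 where S0: "finite S0" "S0 \<subseteq> cusp_frames \<Gamma>"
  "\<And>c. \<exists>R. \<forall>g. det g = 1 --> (\<exists>ga\<in>\<Gamma>. norm (ga ** g) \<le> R \<or>
    (\<exists>sg\<in>S0. c < Im (mob (adj2 sg ** (ga ** g)) \<i>)))" using siegel by blast
 define cus where "cus sg = filtermap (mob sg) at_cusp" for sg
 have det_S0: "det sg = 1" if "sg \<in> S0" for sg using S0(2) that by (auto simp: cusp_frames_def)
 have "\<exists>c. \<forall>w. c \<le> Im w --> mob sg w \<in> N (cus sg)" if "sg \<in> S0" for sg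
 proof -
  have "cus sg \<in> SP" using S0(2) that by (auto simp: surface_points_def cus_def)
  from N[OF this] show ?thesis
   by (simp add: cus_def eventually_filtermap at_cusp_infinity_def eventually_filtercomap_at_top_linorder)
 qed
 then obtain c where c: "\<And>sg w. sg \<in> S0 ==> c sg \<le> Im w ==> mob sg w \<in> N (cus sg)" by metis
 define C where "C = Max (insert 0 (c ` S0))"
 have C: "c sg \<le> C" if "sg \<in> S0" for sg unfolding C_def using S0(1) that by (intro Max_ge) auto
 obtain R0 where R0: "\<And>g. det g = 1 ==> (\<exists>ga\<in>\<Gamma>. norm (ga ** g) \<le> R0 \<or>
    (\<exists>sg\<in>S0. C < Im (mob (adj2 sg ** (ga ** g)) \<i>)))" using S0(3)[of C] by blast
 define R where "R = max R0 1"
 define K where "K = {z. 1 / R\<^sup>2 \<le> Im z} \<inter> cball 0 (R\<^sup>2)"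
 have Rpos: "R > 0" by (simp add: R_def)
 have "compact K" unfolding K_def by (intro closed_Int_compact compact_cball closed_halfspace_Im_ge)
 have KH: "0 < Im z" if "z \<in> K" for z
 proof -
  have "0 < 1 / R\<^sup>2" using Rpos by simp
  moreover have "1 / R\<^sup>2 \<le> Im z" using that by (simp add: K_def)
  ultimately show ?thesis by linarith
 qed
 have "\<exists>d>0. \<forall>w. w ~= z \<and> dist w z < d --> w \<in> N (at z)" if "z \<in> K" for z
 proof -
  have "at z \<in> SP" using KH[OF that] by (simp add: surface_points_def)
  from N[OF this] show ?thesis by (simp add: eventually_at)
 qed
 then obtain d where d: "\<And>z. z \<in> K ==> d z > 0" "\<And>z w. z \<in> K ==> w ~= z ==> dist w z < d z ==> w \<in> N (at z)"
  by metis
 obtain T where T: "T \<subseteq> K" "finite T" "K \<subseteq> (\<Union>z\<in>T. ball z (d z))"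
 proof (rule compactE_image[OF \<open>compact K\<close>, of K "\<lambda>z. ball z (d z)"])
  show "K \<subseteq> (\<Union>z\<in>K. ball z (d z))" using d(1) by (meson UN_I centre_in_ball subsetI)
 qed auto
 show thesis
 proof (rule that[of "cus ` S0 \<union> at ` T"])
  show "finite (cus ` S0 \<union> at ` T)" using S0(1) T(2) by simp
  show "cus ` S0 \<union> at ` T \<subseteq> SP" using S0(2) T(1) KH by (auto simp: surface_points_def cus_def)
  fix z :: complex assume z: "0 < Im z"
  define g where "g = point_mat z"
  have g: "det g = 1" "mob g \<i> = z" using point_mat[OF z] by (auto simp: g_def)
  obtain ga where gam: "ga \<in> \<Gamma>" "norm (ga ** g) \<le> R0 \<or>
    (\<exists>sg\<in>S0. C < Im (mob (adj2 sg ** (ga ** g)) \<i>))" using R0[OF g(1)] by blast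
  note det_gam = det_Gamma[OF gam(1)]
  have gz: "mob (ga ** g) \<i> = mob ga z" using g det_gam by (simp add: mobius_act_mult)
  have pos: "0 < Im (mob ga z)" using det_gam z by simp
  show "\<exists>ga\<in>\<Gamma>. \<exists>\<Phi>\<in>cus ` S0 \<union> at ` T. mob ga z \<in> N \<Phi> \<or> \<Phi> = at (mob ga z)"
   using gam(2)
  proof
   assume "norm (ga ** g) \<le> R0"
   hence "norm (ga ** g) \<le> R" by (simp add: R_def)
   hence "mob ga z \<in> K" using mobius_act_i_bounds[of "ga ** g" R] g det_gam unfolding gz by (simp add: K_def det_mul)
   then obtain t where t: "t \<in> T" "dist (mob ga z) t < d t" using T(3) by (auto simp: dist_commute)
   hence "mob ga z \<in> N (at t) \<or> at t = at (mob ga z)" using d(2)[of t "mob ga z"] T(1) by auto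
   thus ?thesis using gam(1) t(1) by blast
  next
   assume "\<exists>sg\<in>S0. C < Im (mob (adj2 sg ** (ga ** g)) \<i>)"
   then obtain sg where sig: "sg \<in> S0" "C < Im (mob (adj2 sg ** (ga ** g)) \<i>)" by blast
   have "mob (adj2 sg ** (ga ** g)) \<i> = mob (adj2 sg) (mob ga z)"
    unfolding gz[symmetric] by (rule mobius_act_mult) (use det_S0[OF sig(1)] g det_gam in \<open>simp_all add: det_mul\<close>)
   hence "c sg \<le> Im (mob (adj2 sg) (mob ga z))" using sig C[OF sig(1)] by simp
   from c[OF sig(1) this] have "mob ga z \<in> N (cus sg)" using det_S0[OF sig(1)] pos by simp
   thus ?thesis using gam(1) sig(1) by blast
  qed
 qed
qed

end

section \<open>Local coordinates at points and cusps\<close>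

text \<open>\<open>T q\<close> is \<open>\<phi>\<close> at a multiple of a logarithm of
  \<open>q\<close>; periodicity makes the choice of the logarithm irrelevant, so near each point a
  branch that is holomorphic there may be used.\<close>

lemma holomorphic_on_periodic_imp_exp:
 assumes b: "b > 0" and hol: "\<phi> holomorphic_on {z. c < Im z}"
  and per: "\<And>z. c < Im z ==> \<phi> (z + of_real b) = \<phi> z"
 obtains T where "T holomorphic_on (ball 0 (exp (- 2 * pi * c / b)) - {0})"
  "\<And>z. c < Im z ==> \<phi> z = T (cusp_param b z)"
proof -
 have per_nat: "\<phi> (z + of_nat n * of_real b) = \<phi> z" if "c < Im z" for z n
 proof (induction n)
  case (Suc n)
  have "\<phi> (z + of_nat (Suc n) * of_real b) = \<phi> ((z + of_nat n * of_real b) + of_real b)"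
   by (simp add: algebra_simps)
  also have "\<dots> = \<phi> (z + of_nat n * of_real b)" by (rule per) (use that in simp)
  finally show ?case using Suc by simp
 qed simp
 have per_int: "\<phi> (z + of_int n * of_real b) = \<phi> z" if "c < Im z" for z n
 proof (cases "n \<ge> 0")
  case True
  thus ?thesis using per_nat[OF that, of "nat n"] by simp
 next
  case False
  have "\<phi> ((z + of_int n * of_real b) + of_nat (nat (- n)) * of_real b) = \<phi> (z + of_int n * of_real b)"
   by (rule per_nat) (use that in simp)
  thus ?thesis using False by (simp add: algebra_simps)
 qed
 define ka :: complex where "ka = of_real b / (2 * of_real pi * \<i>)"
 have ka_Im: "Im (ka * w) = - b / (2 * pi) * Re w" for w
 proof -
  have "ka = - of_real (b / (2 * pi)) * \<i>" by (simp add: ka_def field_simps)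
  thus ?thesis by simp
 qed
 define T where "T q = \<phi> (ka * Ln q)" for q
 have same: "\<phi> (ka * u) = \<phi> (ka * v)" if "exp u = exp v" "c < Im (ka * v)" for u v
 proof -
  obtain n :: int where "u = v + (of_int (2 * n) * pi) * \<i>" using \<open>exp u = exp v\<close> unfolding exp_eq by blast
  hence n: "u = v + 2 * of_int n * of_real pi * \<i>" by simp
  have "ka * u = ka * v + of_int n * of_real b" unfolding n by (simp add: ka_def field_simps)
  thus ?thesis using per_int[OF that(2), of n] by simp
 qed
 have dom: "c < Im (ka * u)" if "exp u = q" "q ~= 0" "cmod q < exp (- 2 * pi * c / b)" for u q
 proof -
  have "exp (Re u) < exp (- 2 * pi * c / b)" using that by (auto simp: norm_exp_eq_Re)
  hence "Re u < - 2 * pi * c / b" by simp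
  hence "b / (2 * pi) * Re u < b / (2 * pi) * (- 2 * pi * c / b)" using b by (intro mult_strict_left_mono) auto
  thus ?thesis unfolding ka_Im using b by simp
 qed
 show thesis
 proof (rule that[of T])
  define D where "D = ball (0::complex) (exp (- 2 * pi * c / b)) - {0}"
  have "T analytic_on {q0}" if q0: "q0 \<in> D" for q0
  proof -
   have nz: "q0 ~= 0" using q0 by (simp add: D_def)
   define U where "U = ball q0 (cmod q0) \<inter> D"
   have "open U" by (auto simp: U_def D_def)
   \<comment> \<open>A branch of the logarithm centred at \<open>q0\<close>; unlike
     \<open>Ln\<close> it is holomorphic near \<open>q0\<close> even when \<open>q0\<close> is on
     the negative axis.\<close>
   define L where "L q = Ln (q / q0) + Ln q0" for q
   have pos: "0 < Re (q / q0)" if "q \<in> U" for q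
   proof -
    have "cmod (1 - q / q0) < 1"
    proof -
     have "1 - q / q0 = (q0 - q) / q0" using nz by (simp add: field_simps)
     hence "cmod (1 - q / q0) = cmod (q0 - q) / cmod q0" by (simp add: norm_divide)
     thus ?thesis using that nz by (simp add: U_def dist_norm)
    qed
    moreover have "Re (1 - q / q0) \<le> cmod (1 - q / q0)" by (rule complex_Re_le_cmod)
    ultimately show ?thesis by simp
   qed
   have eL: "exp (L q) = q" if "q \<in> U" for q
   proof -
    have "q / q0 ~= 0" using pos[OF that] by auto
    thus ?thesis using nz by (simp add: L_def exp_add)
   qed
   have holL: "L holomorphic_on U"
    unfolding L_def using pos nz by (auto intro!: holomorphic_intros simp: complex_nonpos_Reals_iff)
     (smt (verit) pos)
   have "(\<lambda>q. \<phi> (ka * L q)) holomorphic_on U"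
   proof -
    have "(\<phi> \<circ> (\<lambda>q. ka * L q)) holomorphic_on U"
    proof (rule holomorphic_on_compose_gen[OF _ hol])
     show "(\<lambda>q. ka * L q) holomorphic_on U" by (intro holomorphic_intros holL)
     show "(\<lambda>q. ka * L q) ` U \<subseteq> {z. c < Im z}" using dom[OF eL] by (auto simp: U_def D_def)
    qed
    thus ?thesis by (simp add: o_def)
   qed
   moreover have "\<phi> (ka * L q) = T q" if "q \<in> U" for q
   proof -
    have "q ~= 0" "cmod q < exp (- 2 * pi * c / b)" using that by (auto simp: U_def D_def)
    thus ?thesis unfolding T_def by (intro same dom[of _ q]) (use eL[OF that] in auto)
   qed
   ultimately have "T holomorphic_on U" by (simp cong: holomorphic_cong)
   moreover have "q0 \<in> U" using q0 nz by (simp add: U_def)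
   ultimately show ?thesis using \<open>open U\<close> analytic_at by blast
  qed
  hence "T analytic_on D" using analytic_on_analytic_at by blast
  thus "T holomorphic_on (ball 0 (exp (- 2 * pi * c / b)) - {0})" by (simp add: analytic_imp_holomorphic D_def)
  fix z assume z: "c < Im z"
  have *: "ka * (2 * of_real pi * \<i> * z / of_real b) = z" using b by (simp add: ka_def)
  have "\<phi> (ka * Ln (cusp_param b z)) = \<phi> (ka * (2 * of_real pi * \<i> * z / of_real b))"
   by (rule same) (use z * in \<open>auto simp: cusp_param_def\<close>)
  thus "\<phi> z = T (cusp_param b z)" by (simp only: T_def *)
 qed
qed

lemma norm_cusp_param: "cmod (cusp_param b z) = exp (- 2 * pi * Im z / b)"
 by (simp add: cusp_param_def norm_exp_eq_Re Re_divide_of_real)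

lemma cusp_param_nonzero [simp]: "cusp_param b z ~= 0" by (simp add: cusp_param_def)

lemma cusp_param_surj:
 assumes "b > 0" "t ~= 0"
 obtains z where "cusp_param b z = t"
proof
 show "cusp_param b (of_real b * Ln t / (2 * of_real pi * \<i>)) = t" using assms by (simp add: cusp_param_def)
qed

text \<open>\<open>t ^ n * T t\<close> is bounded, so Riemann's theorem on removable singularities
  extends it over 0.\<close>

lemma growth_imp_meromorphic:
 assumes "ro > 0" "T holomorphic_on ball 0 ro - {0}"
  "\<And>t. t ~= 0 ==> cmod t < ro ==> cmod (T t) \<le> C / cmod t ^ n"
 shows "T meromorphic_on {0}"
proof -
 have "(\<lambda>t. t ^ n * T t) holomorphic_on ball 0 ro - {0}" by (intro holomorphic_intros assms)
 moreover have "\<exists>B. \<forall>\<^sub>F t in at 0. cmod (t ^ n * T t) \<le> B"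
 proof (intro exI[of _ C])
  have "\<forall>\<^sub>F t in at 0. t \<in> ball 0 ro - {0}" using assms(1) by (intro eventually_at_in_open) auto
  thus "\<forall>\<^sub>F t in at 0. cmod (t ^ n * T t) \<le> C"
  proof eventually_elim
   case (elim t)
   hence "cmod (t ^ n * T t) \<le> cmod t ^ n * (C / cmod t ^ n)"
    unfolding norm_mult norm_power using assms(3)[of t] by (intro mult_left_mono) auto
   also have "cmod t ^ n * (C / cmod t ^ n) = C" using elim by simp
   finally show ?case .
  qed
 qed
 ultimately obtain G where G: "G holomorphic_on ball 0 ro" "\<And>t. t \<in> ball 0 ro - {0} ==> G t = t ^ n * T t"
  using holomorphic_on_extend_bounded[of "\<lambda>t. t ^ n * T t" "ball 0 ro" 0] assms(1) by (auto simp: interior_open)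
 have "G analytic_on {0}" using G(1) assms(1) by (intro holomorphic_on_imp_analytic_at[of _ "ball 0 ro"]) auto
 hence "(\<lambda>t. G t / t ^ n) meromorphic_on {0}" by (intro meromorphic_intros analytic_on_imp_meromorphic_on)
 moreover have "\<forall>\<^sub>F t in at 0. G t / t ^ n = T t"
 proof -
  have "\<forall>\<^sub>F t in at 0. t \<in> ball 0 ro - {0}" using assms(1) by (intro eventually_at_in_open) auto
  thus ?thesis by eventually_elim (simp add: G)
 qed
 ultimately show ?thesis by (subst meromorphic_on_cong[of _ _ "\<lambda>t. G t / t ^ n"]) (auto elim: eventually_mono)
qed

lemma meromorphic_normal_form:
 fixes F :: cfn
 assumes "F meromorphic_on {0}"
 obtains (zero) ro where "ro > 0" "\<And>t. t ~= 0 ==> cmod t < ro ==> F t = 0"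
  | (nonzero) ro U m where "ro > 0" "U holomorphic_on ball 0 ro" "\<And>t. cmod t < ro ==> U t ~= 0"
   "\<And>t. t ~= 0 ==> cmod t < ro ==> F t = U t * t powi m"
proof (cases "\<exists>\<^sub>F t in at 0. F t ~= 0")
 case False
 hence "\<forall>\<^sub>F t in at 0. F t = 0" by (simp add: frequently_def)
 then obtain ro where "ro > 0" "\<And>t. t ~= 0 ==> dist t 0 < ro ==> F t = 0" unfolding eventually_at by auto
 thus ?thesis using zero by auto
next
 case True
 have "isolated_singularity_at F 0" "not_essential F 0"
  using assms by (auto intro: meromorphic_on_isolated_singularity meromorphic_on_not_essential)
 from zorder_exist[OF this True] obtain r where r: "zor_poly F 0 0 ~= 0" "r > 0"
  "zor_poly F 0 holomorphic_on cball 0 r"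
  "\<forall>w\<in>cball 0 r - {0}. F w = zor_poly F 0 w * (w - 0) powi zorder F 0 \<and> zor_poly F 0 w ~= 0" by auto
 show ?thesis
 proof (rule nonzero[of r "zor_poly F 0" "zorder F 0"])
  show "zor_poly F 0 holomorphic_on ball 0 r" using r(3) by (rule holomorphic_on_subset) auto
  show "zor_poly F 0 t ~= 0" if "cmod t < r" for t using r(1,4) that by (cases "t = 0") auto
  show "F t = zor_poly F 0 t * t powi zorder F 0" if "t ~= 0" "cmod t < r" for t using r(4) that by auto
 qed (fact r(2))
qed

lemma meromorphic_growth:
 fixes F :: cfn
 assumes "F meromorphic_on {0}"
 obtains ro C n where "ro > 0" "F holomorphic_on ball 0 ro - {0}" "C \<ge> 0"
  "\<And>t. t ~= 0 ==> cmod t < ro ==> cmod (F t) \<le> C / cmod t ^ n" using assms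
proof (cases rule: meromorphic_normal_form)
 case (zero ro)
 have "F holomorphic_on ball 0 ro - {0}" by (rule holomorphic_transform[of "\<lambda>_. 0"]) (use zero in auto)
 thus ?thesis using zero by (intro that[of ro 0 0]) auto
next
 case (nonzero ro U m)
 have "F holomorphic_on ball 0 ro - {0}" by (rule holomorphic_transform[of "\<lambda>t. U t * t powi m"])
   (use nonzero in \<open>auto intro!: holomorphic_intros holomorphic_on_subset[OF nonzero(2)]\<close>)
 have "continuous_on (cball 0 (ro/2)) U"
  by (rule continuous_on_subset[OF holomorphic_on_imp_continuous_on[OF nonzero(2)]]) (use nonzero(1) in auto)
 hence "bounded (U ` cball 0 (ro/2))" by (intro compact_imp_bounded compact_continuous_image) auto
 then obtain B where B: "B > 0" "\<And>t. cmod t \<le> ro/2 ==> cmod (U t) \<le> B" unfolding bounded_pos by auto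
 define r where "r = min (ro/2) 1"
 show ?thesis
 proof (rule that[of r B "nat (- m)"])
  show "r > 0" using nonzero(1) by (simp add: r_def)
  show "F holomorphic_on ball 0 r - {0}" by (rule holomorphic_on_subset[OF \<open>F holomorphic_on ball 0 ro - {0}\<close>])
    (use nonzero(1) in \<open>auto simp: r_def\<close>)
  show "cmod (F t) \<le> B / cmod t ^ nat (- m)" if t: "t ~= 0" "cmod t < r" for t
  proof -
   have t1: "cmod t < ro" "cmod t \<le> ro/2" "cmod t \<le> 1" using t(2) nonzero(1) by (auto simp: r_def)
   have "cmod (t powi m) \<le> 1 / cmod t ^ nat (- m)"
   proof (cases "m \<ge> 0")
    case True
    thus ?thesis using t1(3) by (simp add: power_int_def norm_power power_le_one)
   next
    case False
    thus ?thesis by (simp add: norm_power_int power_int_def divide_inverse norm_inverse norm_power power_inverse)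
   qed
   hence "cmod (U t) * cmod (t powi m) \<le> B * (1 / cmod t ^ nat (- m))" using B(2)[OF t1(2)] B(1) by (intro mult_mono) auto
   thus ?thesis using nonzero(4)[OF t(1) t1(1)] by (simp add: norm_mult)
  qed
 qed (use B in auto)
qed

section \<open>Coordinates common to points and cusps\<close>

definition coord_nbhd :: "cfn => real => complex set"
 where "coord_nbhd q ro = {z. 0 < Im z \<and> q z ~= 0 \<and> cmod (q z) < ro}"

definition invariant_under :: "(real^2^2) set => cfn => bool"
 where "invariant_under \<Gamma> \<psi> \<longleftrightarrow> (\<forall>ga\<in>\<Gamma>. \<forall>z. 0 < Im z --> \<psi> (mob ga z) = \<psi> z)"

text \<open>One notion for points and cusps: the punctured discs of \<open>q\<close> generate the
  filter, \<open>q\<close> takes every small nonzero value, and invariant functions factor through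
  \<open>q\<close>. At a cusp \<open>q\<close> is not injective, which is why the last clause asks
  for invariance. At an elliptic point \<open>q\<close> is a coordinate of the half-plane, not of
  the quotient; growth can be read off from it all the same.\<close>

definition uniformizer :: "(real^2^2) set => complex filter => cfn => real => bool"
 where "uniformizer \<Gamma> \<Phi> q r \<longleftrightarrow> r > 0 \<and> q holomorphic_on \<H> \<and>
  (\<forall>P. eventually P \<Phi> \<longleftrightarrow> (\<exists>ro>0. ro \<le> r \<and> (\<forall>z\<in>coord_nbhd q ro. P z))) \<and>
  (\<forall>t. t ~= 0 \<and> cmod t < r --> (\<exists>z. 0 < Im z \<and> q z = t)) \<and>
  (\<forall>ro \<psi>. 0 < ro \<and> ro \<le> r \<and> \<psi> holomorphic_on coord_nbhd q ro \<and> invariant_under \<Gamma> \<psi> -->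
   (\<exists>T. T holomorphic_on ball 0 ro - {0} \<and> (\<forall>z\<in>coord_nbhd q ro. \<psi> z = T (q z))))"

lemma cmod_cusp_param_less_iff:
 assumes "b > 0" "ro > 0"
 shows "cmod (cusp_param b w) < ro \<longleftrightarrow> - b * ln ro / (2 * pi) < Im w"
proof -
 have "cmod (cusp_param b w) < ro \<longleftrightarrow> - 2 * pi * Im w / b < ln ro"
  unfolding norm_cusp_param using assms(2) by (metis exp_less_cancel_iff exp_ln)
 also have "\<dots> \<longleftrightarrow> - 2 * pi * Im w < ln ro * b" by (rule pos_divide_less_eq[OF assms(1)])
 also have "\<dots> \<longleftrightarrow> - b * ln ro < Im w * (2 * pi)" by (simp add: algebra_simps) linarith
 also have "\<dots> \<longleftrightarrow> - b * ln ro / (2 * pi) < Im w" by (rule pos_divide_less_eq[symmetric]) simp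
 finally show ?thesis .
qed

lemma uniformizer_at:
 assumes "0 < Im z0"
 shows "uniformizer \<Gamma> (at z0) (\<lambda>z. z - z0) (Im z0)"
proof -
 have uhp: "0 < Im z" if "cmod (z - z0) < Im z0" for z using abs_Im_le_cmod[of "z - z0"] that by simp
 have nb: "coord_nbhd (\<lambda>z. z - z0) ro = ball z0 ro - {z0}" if "ro \<le> Im z0" for ro
  using uhp that by (force simp: coord_nbhd_def dist_norm norm_minus_commute)
 show ?thesis unfolding uniformizer_def
 proof (intro conjI allI impI)
  fix P
  show "eventually P (at z0) \<longleftrightarrow> (\<exists>ro>0. ro \<le> Im z0 \<and> (\<forall>z\<in>coord_nbhd (\<lambda>z. z - z0) ro. P z))"
  proof
   assume "eventually P (at z0)"
   then obtain d where d: "d > 0" "\<And>z. z ~= z0 ==> dist z z0 < d ==> P z" unfolding eventually_at by auto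
   thus "\<exists>ro>0. ro \<le> Im z0 \<and> (\<forall>z\<in>coord_nbhd (\<lambda>z. z - z0) ro. P z)"
    using assms by (intro exI[of _ "min d (Im z0)"]) (auto simp: nb dist_commute)
  next
   assume "\<exists>ro>0. ro \<le> Im z0 \<and> (\<forall>z\<in>coord_nbhd (\<lambda>z. z - z0) ro. P z)"
   then obtain ro where "ro > 0" "ro \<le> Im z0" "\<forall>z\<in>ball z0 ro - {z0}. P z" by (auto simp: nb)
   thus "eventually P (at z0)" unfolding eventually_at by (auto simp: dist_commute)
  qed
 next
  fix t :: complex assume "t ~= 0 \<and> cmod t < Im z0"
  thus "\<exists>z. 0 < Im z \<and> z - z0 = t" using uhp[of "t + z0"] by (intro exI[of _ "t + z0"]) auto
 next
  fix ro \<psi>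
  assume *: "0 < ro \<and> ro \<le> Im z0 \<and> \<psi> holomorphic_on coord_nbhd (\<lambda>z. z - z0) ro \<and> invariant_under \<Gamma> \<psi>"
  hence hol: "\<psi> holomorphic_on (ball z0 ro - {z0})" using nb[of ro] by metis
  have "(\<psi> \<circ> (\<lambda>t. t + z0)) holomorphic_on ball 0 ro - {0}"
   by (rule holomorphic_on_compose_gen[OF _ hol]) (auto intro!: holomorphic_intros simp: dist_norm)
  thus "\<exists>T. T holomorphic_on ball 0 ro - {0} \<and> (\<forall>z\<in>coord_nbhd (\<lambda>z. z - z0) ro. \<psi> z = T (z - z0))"
   by (intro exI[of _ "\<psi> \<circ> (\<lambda>t. t + z0)"]) auto
 qed (use assms in \<open>auto intro!: holomorphic_intros\<close>)
qed

lemma holomorphic_on_mobius_act: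
 assumes "det A = 1"
 shows "mob A holomorphic_on \<H>" unfolding holomorphic_on_def field_differentiable_def
 using has_field_derivative_at_within[OF has_field_derivative_mobius_act[OF assms]] by (metis uhp_iff)

context fuchsian
begin

lemma det_cusp_frame: "sg \<in> cusp_frames \<Gamma> ==> det sg = 1" by (simp add: cusp_frames_def)

text \<open>In the frame \<open>sg\<close> a parabolic element fixing the cusp is upper triangular
  with both diagonal entries 1 or both -1, hence a translation; the inverse is taken if it goes to
  the left. \<open>b\<close> is some period, not necessarily the smallest.\<close>

lemma cusp_period:
 assumes "sg \<in> cusp_frames \<Gamma>"
 obtains b where "b > 0"
  "\<And>w. 0 < Im w ==> \<exists>ga\<in>\<Gamma>. mob ga (mob sg w) = mob sg (w + of_real b)"
proof -
 have det: "det sg = 1" using assms by (rule det_cusp_frame)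
 obtain ga where g: "ga \<in> \<Gamma>" "parabolic ga" "(adj2 sg ** ga ** sg)$2$1 = 0"
  using assms det by (auto simp: cusp_frames_def inv_SL2R simp del: mat2_mult_nth)
 define U where "U = adj2 sg ** ga ** sg"
 have U21: "U$2$1 = 0" using g(3) by (simp only: U_def)
 have dg: "det ga = 1" using g(1) by (rule det_Gamma)
 have detU: "det U = 1" using det dg by (simp add: U_def det_mul)
 have parU: "parabolic U" using g(2) unfolding U_def parabolic_conj[OF det] .
 have ef: "U$1$1 * U$2$2 = 1" using detU U21 by (simp add: det_2)
 have "\<bar>U$1$1 + U$2$2\<bar> = 2" using parU by (simp add: parabolic_def trace_def sum_2)
 hence "(U$1$1 + U$2$2)\<^sup>2 = 2\<^sup>2" by (metis power2_abs)
 moreover have "(U$1$1 - U$2$2)\<^sup>2 = (U$1$1 + U$2$2)\<^sup>2 - 4 * (U$1$1 * U$2$2)"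
  by (simp add: power2_eq_square algebra_simps)
 ultimately have "(U$1$1 - U$2$2)\<^sup>2 = 0" using ef by simp
 hence eq: "U$2$2 = U$1$1" by simp
 hence "(U$1$1)\<^sup>2 = 1" using ef by (simp add: power2_eq_square)
 hence e: "U$1$1 = 1 \<or> U$1$1 = -1" by (simp add: power2_eq_1_iff)
 have "U$1$2 ~= 0"
 proof
  assume "U$1$2 = 0"
  hence "U = mat 1 \<or> U = - mat 1" using e eq U21 by (auto intro!: mat2_eqI)
  thus False using parU by (auto simp: parabolic_def)
 qed
 define x where "x = U$1$2 / U$1$1"
 have x0: "x ~= 0" using \<open>U$1$2 ~= 0\<close> e by (auto simp: x_def)
 have actU: "mob U w = w + of_real x" for w using e eq U21 by (auto simp: mobius_act_def x_def)
 have act: "mob ga (mob sg w) = mob sg (w + of_real x)" if "0 < Im w" for w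
 proof -
  have "sg ** U = ga ** sg" using det by (simp add: U_def matrix_mul_assoc[symmetric])
  hence "mob (sg ** U) w = mob (ga ** sg) w" by (simp only:)
  thus ?thesis unfolding mobius_act_mult[OF det detU that] mobius_act_mult[OF dg det that] actU by simp
 qed
 show thesis
 proof (cases "x > 0")
  case True
  thus ?thesis using that[of x] act g(1) by blast
 next
  case False
  have "mob (adj2 ga) (mob sg w) = mob sg (w + of_real (- x))" if w: "0 < Im w" for w
  proof -
   have w': "0 < Im (w + of_real (- x))" using w by simp
   have "mob sg w = mob ga (mob sg (w + of_real (- x)))" using act[OF w'] by simp
   thus ?thesis using dg det w' by simp
  qed
  thus ?thesis using that[of "- x"] adj2_Gamma[OF g(1)] False x0 by (metis less_le neg_0_less_iff_less not_less)
 qed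
qed

lemma uniformizer_cusp:
 assumes "sg \<in> cusp_frames \<Gamma>"
 obtains b where "b > 0" "uniformizer \<Gamma> (filtermap (mob sg) at_cusp)
  (\<lambda>z. cusp_param b (mob (adj2 sg) z)) 1"
proof -
 have det: "det sg = 1" using assms by (rule det_cusp_frame)
 obtain b where b: "b > 0"
  "\<And>w. 0 < Im w ==> \<exists>ga\<in>\<Gamma>. mob ga (mob sg w) = mob sg (w + of_real b)"
  using cusp_period[OF assms] by blast
 define q where "q z = cusp_param b (mob (adj2 sg) z)" for z
 \<comment> \<open>The height above which \<open>cusp_param b\<close> has modulus less than
   \<open>ro\<close>.\<close>
 define h where "h ro = - b * ln ro / (2 * pi)" for ro :: real
 have h0: "0 \<le> h ro" if "0 < ro" "ro \<le> 1" for ro using that b(1) by (auto simp: h_def divide_le_0_iff mult_le_0_iff)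
 have q_sig: "q (mob sg w) = cusp_param b w" if "0 < Im w" for w using that det by (simp add: q_def)
 have nb: "coord_nbhd q ro = mob sg ` {w. h ro < Im w}" if "0 < ro" "ro \<le> 1" for ro
 proof (intro equalityI subsetI)
  fix z assume "z \<in> coord_nbhd q ro"
  hence z: "0 < Im z" "cmod (q z) < ro" by (auto simp: coord_nbhd_def)
  hence "h ro < Im (mob (adj2 sg) z)" using cmod_cusp_param_less_iff[OF b(1) that(1)] by (simp add: q_def h_def)
  moreover have "z = mob sg (mob (adj2 sg) z)" using det z(1) by simp
  ultimately show "z \<in> mob sg ` {w. h ro < Im w}" by blast
 next
  fix z assume "z \<in> mob sg ` {w. h ro < Im w}"
  then obtain w where w: "h ro < Im w" "z = mob sg w" by blast
  hence "0 < Im w" using h0[OF that] by simp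
  thus "z \<in> coord_nbhd q ro" using w cmod_cusp_param_less_iff[OF b(1) that(1), of w] det
   by (simp add: coord_nbhd_def q_sig h_def)
 qed
 have "uniformizer \<Gamma> (filtermap (mob sg) at_cusp) q 1" unfolding uniformizer_def
 proof (intro conjI allI impI)
  have "cusp_param b holomorphic_on UNIV" unfolding cusp_param_def[abs_def] by (intro holomorphic_intros) (use b in auto)
  hence "(cusp_param b \<circ> mob (adj2 sg)) holomorphic_on \<H>"
   by (intro holomorphic_on_compose_gen[OF holomorphic_on_mobius_act]) (use det in auto)
  thus "q holomorphic_on \<H>" by (simp add: q_def[abs_def] o_def)
  fix P
  have "eventually P (filtermap (mob sg) at_cusp) \<longleftrightarrow> (\<exists>c. \<forall>w. c \<le> Im w --> P (mob sg w))"
   by (simp add: eventually_filtermap at_cusp_infinity_def eventually_filtercomap_at_top_linorder)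
  also have "\<dots> \<longleftrightarrow> (\<exists>ro>0. ro \<le> 1 \<and> (\<forall>z\<in>coord_nbhd q ro. P z))"
  proof
   assume "\<exists>c. \<forall>w. c \<le> Im w --> P (mob sg w)"
   then obtain c where c: "\<And>w. c \<le> Im w ==> P (mob sg w)" by blast
   define ro where "ro = exp (- 2 * pi * max c 0 / b)"
   have "h ro = max c 0" using b(1) by (simp add: h_def ro_def)
   moreover have "0 < ro" "ro \<le> 1" using b(1) by (auto simp: ro_def divide_le_0_iff mult_le_0_iff)
   ultimately show "\<exists>ro>0. ro \<le> 1 \<and> (\<forall>z\<in>coord_nbhd q ro. P z)"
    by (intro exI[of _ ro]) (auto simp: nb intro!: c)
  next
   assume "\<exists>ro>0. ro \<le> 1 \<and> (\<forall>z\<in>coord_nbhd q ro. P z)"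
   then obtain ro where r: "0 < ro" "ro \<le> 1" "\<forall>z\<in>coord_nbhd q ro. P z" by blast
   thus "\<exists>c. \<forall>w. c \<le> Im w --> P (mob sg w)" by (intro exI[of _ "h ro + 1"]) (auto simp: nb)
  qed
  finally show "eventually P (filtermap (mob sg) at_cusp) \<longleftrightarrow> (\<exists>ro>0. ro \<le> 1 \<and> (\<forall>z\<in>coord_nbhd q ro. P z))" .
 next
  fix t :: complex assume t: "t ~= 0 \<and> cmod t < 1"
  obtain w where w: "cusp_param b w = t" using cusp_param_surj[OF b(1)] t by metis
  hence "0 < Im w" using cmod_cusp_param_less_iff[OF b(1), of 1 w] t by simp
  thus "\<exists>z. 0 < Im z \<and> q z = t" using w det by (intro exI[of _ "mob sg w"]) (simp add: q_sig)
 next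
  fix ro \<psi>
  assume "0 < ro \<and> ro \<le> 1 \<and> \<psi> holomorphic_on coord_nbhd q ro \<and> invariant_under \<Gamma> \<psi>"
  hence r: "0 < ro" "ro \<le> 1" and hol: "\<psi> holomorphic_on coord_nbhd q ro" and inv: "invariant_under \<Gamma> \<psi>" by auto
  have sub: "0 < Im w" if "h ro < Im w" for w using that h0[OF r] by simp
  have "(\<psi> \<circ> mob sg) holomorphic_on {w. h ro < Im w}"
   by (rule holomorphic_on_compose_gen[OF holomorphic_on_subset[OF holomorphic_on_mobius_act[OF det]] hol])
    (use sub in \<open>auto simp: nb[OF r]\<close>)
  moreover have "(\<psi> \<circ> mob sg) (w + of_real b) = (\<psi> \<circ> mob sg) w" if "h ro < Im w" for w
  proof -
   obtain ga where "ga \<in> \<Gamma>" "mob ga (mob sg w) = mob sg (w + of_real b)"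
    using b(2)[OF sub] \<open>h ro < Im w\<close> by blast
   moreover have "0 < Im (mob sg w)" using det sub \<open>h ro < Im w\<close> by simp
   ultimately show ?thesis using inv unfolding invariant_under_def o_def by metis
  qed
  ultimately obtain T where T: "T holomorphic_on (ball 0 (exp (- 2 * pi * h ro / b)) - {0})"
   "\<And>w. h ro < Im w ==> (\<psi> \<circ> mob sg) w = T (cusp_param b w)"
   using holomorphic_on_periodic_imp_exp[OF b(1)] by blast
  have "exp (- 2 * pi * h ro / b) = ro" using b(1) r by (simp add: h_def)
  thus "\<exists>T. T holomorphic_on ball 0 ro - {0} \<and> (\<forall>z\<in>coord_nbhd q ro. \<psi> z = T (q z))"
   using T sub by (intro exI[of _ T]) (auto simp: nb[OF r] q_sig)
 qed simp
 thus thesis using that[OF b(1)] unfolding q_def by blast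
qed

end

section \<open>The field of automorphic functions\<close>

text \<open>Meromorphy at a cusp without reference to a parameter: the expansions of two functions
  may come in parameters of different widths, while exponential bounds in \<open>Im w\<close> can be
  added and multiplied at once. Invariance recovers an expansion in
  \<open>on_uhp_in_carrier_FF\<close>.\<close>

definition cusp_tame :: "real^2^2 => cfn => bool"
 where "cusp_tame sg u \<longleftrightarrow> (\<exists>A\<ge>0. \<exists>C\<ge>0. \<forall>\<^sub>F w in at_cusp.
  u analytic_on {mob sg w} \<and> cmod (u (mob sg w)) \<le> C * exp (A * Im w))"

lemma cusp_tameI:
 assumes "A \<ge> 0" "C \<ge> 0" "\<forall>\<^sub>F w in at_cusp.
  u analytic_on {mob sg w} \<and> cmod (u (mob sg w)) \<le> C * exp (A * Im w)"
 shows "cusp_tame sg u" using assms unfolding cusp_tame_def by blast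

lemma eventually_cusp_pos: "\<forall>\<^sub>F w in at_cusp. 1 \<le> Im w"
 unfolding at_cusp_infinity_def by (intro eventually_filtercomapI eventually_ge_at_top)

lemma cusp_tame_add:
 assumes "cusp_tame sg u" "cusp_tame sg v"
 shows "cusp_tame sg (\<lambda>z. u z + v z)"
proof -
 obtain A C where u: "A \<ge> 0" "C \<ge> 0" "\<forall>\<^sub>F w in at_cusp.
  u analytic_on {mob sg w} \<and> cmod (u (mob sg w)) \<le> C * exp (A * Im w)" using assms(1) by (auto simp: cusp_tame_def)
 obtain B D where v: "B \<ge> 0" "D \<ge> 0" "\<forall>\<^sub>F w in at_cusp.
  v analytic_on {mob sg w} \<and> cmod (v (mob sg w)) \<le> D * exp (B * Im w)" using assms(2) by (auto simp: cusp_tame_def)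
 show ?thesis
 proof (rule cusp_tameI)
  show "\<forall>\<^sub>F w in at_cusp. (\<lambda>z. u z + v z) analytic_on {mob sg w} \<and>
    cmod (u (mob sg w) + v (mob sg w)) \<le> (C + D) * exp ((A + B) * Im w)" using u(3) v(3) eventually_cusp_pos
  proof eventually_elim
   case (elim w)
   have "A * Im w \<le> (A + B) * Im w" "B * Im w \<le> (A + B) * Im w" using elim u(1) v(1) by (intro mult_right_mono; simp)+
   hence "C * exp (A * Im w) \<le> C * exp ((A + B) * Im w)" "D * exp (B * Im w) \<le> D * exp ((A + B) * Im w)"
    using u(2) v(2) by (intro mult_left_mono; simp)+
   moreover have "cmod (u (mob sg w) + v (mob sg w)) \<le> C * exp (A * Im w) + D * exp (B * Im w)"
    using elim by (intro order_trans[OF norm_triangle_ineq] add_mono) auto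
   ultimately show ?case using elim by (auto intro!: analytic_intros simp: distrib_right)
  qed
 qed (use u v in auto)
qed

lemma cusp_tame_mult:
 assumes "cusp_tame sg u" "cusp_tame sg v"
 shows "cusp_tame sg (\<lambda>z. u z * v z)"
proof -
 obtain A C where u: "A \<ge> 0" "C \<ge> 0" "\<forall>\<^sub>F w in at_cusp.
  u analytic_on {mob sg w} \<and> cmod (u (mob sg w)) \<le> C * exp (A * Im w)" using assms(1) by (auto simp: cusp_tame_def)
 obtain B D where v: "B \<ge> 0" "D \<ge> 0" "\<forall>\<^sub>F w in at_cusp.
  v analytic_on {mob sg w} \<and> cmod (v (mob sg w)) \<le> D * exp (B * Im w)" using assms(2) by (auto simp: cusp_tame_def)
 show ?thesis
 proof (rule cusp_tameI)
  show "\<forall>\<^sub>F w in at_cusp. (\<lambda>z. u z * v z) analytic_on {mob sg w} \<and>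
    cmod (u (mob sg w) * v (mob sg w)) \<le> C * D * exp ((A + B) * Im w)" using u(3) v(3)
  proof eventually_elim
   case (elim w)
   have "cmod (u (mob sg w)) * cmod (v (mob sg w)) \<le> (C * exp (A * Im w)) * (D * exp (B * Im w))"
    using elim u(2) by (intro mult_mono) auto
   thus ?case using elim by (auto intro!: analytic_intros simp: norm_mult distrib_right exp_add algebra_simps)
  qed
 qed (use u v in auto)
qed

lemma cusp_tame_const: "cusp_tame sg (\<lambda>z. c)" by (rule cusp_tameI[of 0 "cmod c"]) auto

section \<open>Normal forms of meromorphic functions\<close>

lemma on_uhp_cong:
 assumes "AEH z. u z = v z"
 shows "on_uhp u = on_uhp v"
proof
 fix z
 show "on_uhp u z = on_uhp v z" using eventually_cosparse_imp_eventually_at[OF assms, of z UNIV]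
  by (auto simp: on_uhp_def intro!: remove_sings_cong)
qed

lemma on_uhp_ae:
 assumes "u meromorphic_on \<H>"
 shows "AEH z. on_uhp u z = u z"
proof -
 have "AEH z. z \<in> \<H>" by (rule eventually_in_cosparse) (auto simp: open_uhp)
 with eventually_remove_sings_eq[OF assms] show ?thesis by eventually_elim (simp add: on_uhp_def)
qed

lemma on_uhp_analytic:
 assumes "u analytic_on {z}" "0 < Im z"
 shows "on_uhp u z = u z" "on_uhp u analytic_on {z}"
proof -
 show "on_uhp u z = u z" using assms by (simp add: on_uhp_def)
 have "\<forall>\<^sub>F w in nhds z. w \<in> \<H>" using assms(2) by (intro eventually_nhds_in_open) (auto simp: open_uhp)
 hence "\<forall>\<^sub>F w in nhds z. on_uhp u w = u w"
  using eventually_remove_sings_eq_nhds[OF assms(1)] by eventually_elim (simp add: on_uhp_def)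
 thus "on_uhp u analytic_on {z}" using assms(1) analytic_at_cong by blast
qed

lemma on_uhp_nicely:
 assumes "u meromorphic_on \<H>"
 shows "on_uhp u nicely_meromorphic_on \<H>"
proof -
 have n: "remove_sings u nicely_meromorphic_on \<H>" by (rule remove_sings_nicely_meromorphic[OF assms])
 have ev: "\<forall>\<^sub>F w in at z. on_uhp u w = remove_sings u w" if "z \<in> \<H>" for z
 proof -
  have "\<forall>\<^sub>F w in at z. w \<in> \<H>" using that by (intro eventually_at_in_open') (auto simp: open_uhp)
  thus ?thesis by eventually_elim (simp add: on_uhp_def)
 qed
 show ?thesis unfolding nicely_meromorphic_on_def
 proof (intro conjI ballI)
  show "on_uhp u meromorphic_on \<H>"
   using n ev by (subst meromorphic_on_cong[where g = "remove_sings u"]) (auto simp: nicely_meromorphic_on_def)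
  fix z assume z: "z \<in> \<H>"
  have "on_uhp u z = remove_sings u z" using z by (simp add: on_uhp_def)
  moreover have "is_pole (on_uhp u) z = is_pole (remove_sings u) z" by (rule is_pole_cong) (use ev[OF z] in auto)
  moreover have "on_uhp u \<midarrow>z\<rightarrow> c \<longleftrightarrow> remove_sings u \<midarrow>z\<rightarrow> c" for c
   by (rule tendsto_cong[OF ev[OF z]])
  ultimately show "is_pole (on_uhp u) z \<and> on_uhp u z = 0 \<or> on_uhp u \<midarrow>z\<rightarrow> on_uhp u z"
   using n z unfolding nicely_meromorphic_on_def by metis
 qed
qed

lemma filtermap_mobius_act_at:
 assumes "det A = 1" "0 < Im z"
 shows "filtermap (mob A) (at z) = at (mob A z)"
proof -
 have lim: "filterlim (mob A) (at (mob A z)) (at z)" if "det A = 1" "0 < Im z" for A z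
 proof -
  have "isCont (mob A) z" using has_field_derivative_mobius_act[OF that] by (rule DERIV_isCont)
  moreover have "\<forall>\<^sub>F w in at z. mob A w ~= mob A z"
  proof -
   have "\<forall>\<^sub>F w in at z. w \<in> \<H> - {z}" using that by (intro eventually_at_in_open) (auto simp: open_uhp)
   thus ?thesis
   proof eventually_elim
    case (elim w)
    thus ?case using inj_onD[OF inj_on_mobius_act[OF that(1)], of w z] that by auto
   qed
  qed
  ultimately show ?thesis by (simp add: filterlim_at isCont_def)
 qed
 show ?thesis
 proof (rule antisym)
  show "filtermap (mob A) (at z) \<le> at (mob A z)" using lim[OF assms] by (simp add: filterlim_def)
  have pos: "0 < Im (mob A z)" using assms by simp
  have "filterlim (mob (adj2 A)) (at z) (at (mob A z))" using lim[of "adj2 A" "mob A z"] assms by simp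
  hence "filtermap (mob A) (filtermap (mob (adj2 A)) (at (mob A z))) \<le> filtermap (mob A) (at z)"
   unfolding filterlim_def by (rule filtermap_mono)
  moreover have "filtermap (mob A) (filtermap (mob (adj2 A)) (at (mob A z))) = at (mob A z)"
  proof -
   have "\<forall>\<^sub>F w in at (mob A z). w \<in> \<H>" using pos by (intro eventually_at_in_open') (auto simp: open_uhp)
   hence "\<forall>\<^sub>F w in at (mob A z). mob A (mob (adj2 A) w) = w" by eventually_elim (use assms in simp)
   hence "filtermap (\<lambda>w. mob A (mob (adj2 A) w)) (at (mob A z)) =
     filtermap (\<lambda>w. w) (at (mob A z))" by (intro filter_eqI) (auto simp: eventually_filtermap elim: eventually_elim2)
   thus ?thesis by (simp add: filtermap_filtermap filtermap_ident)
  qed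
  ultimately show "at (mob A z) \<le> filtermap (mob A) (at z)" by simp
 qed
qed

text \<open>Growth like \<open>1 / |t| ^ n\<close> in the parameter
  \<open>t = cusp_param b w\<close> is growth like
  \<open>exp (2 * pi * n / b * Im w)\<close>.\<close>

lemma cusp_tame_of_param:
 assumes det: "det sg = 1" and b: "b > 0" and H: "H meromorphic_on {0}"
  and ev: "\<forall>\<^sub>F w in at_cusp. u (mob sg w) = H (cusp_param b w)"
 shows "cusp_tame sg u"
proof -
 obtain c where u: "\<And>w. c \<le> Im w ==> u (mob sg w) = H (cusp_param b w)"
  using ev unfolding at_cusp_infinity_def eventually_filtercomap_at_top_linorder by blast
 show ?thesis
 proof -
  obtain ro C n where H': "ro > 0" "H holomorphic_on ball 0 ro - {0}" "C \<ge> 0"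
   "\<And>t. t ~= 0 ==> cmod t < ro ==> cmod (H t) \<le> C / cmod t ^ n" using meromorphic_growth[OF H] by blast
  define d where "d = max (max c 0) (- b * ln ro / (2 * pi))"
  have small: "cmod (cusp_param b w) < ro" if "d < Im w" for w
   using cmod_cusp_param_less_iff[OF b H'(1)] that by (simp add: d_def)
  define D where "D = {z. 0 < Im z \<and> d < Im (mob (adj2 sg) z)}"
  have hol_adj: "mob (adj2 sg) holomorphic_on \<H>" by (rule holomorphic_on_mobius_act) (use det in simp)
  have "open D"
  proof -
   have "open (mob (adj2 sg) -` {z. d < Im z} \<inter> \<H>)"
    using continuous_open_preimage[OF holomorphic_on_imp_continuous_on[OF hol_adj] open_uhp open_halfspace_Im_gt[of d]]
    by (simp add: Int_commute)
   moreover have "D = mob (adj2 sg) -` {z. d < Im z} \<inter> \<H>" by (auto simp: D_def)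
   ultimately show ?thesis by simp
  qed
  have "u holomorphic_on D"
  proof (rule holomorphic_transform)
   have "(H \<circ> (cusp_param b \<circ> mob (adj2 sg))) holomorphic_on D"
   proof (rule holomorphic_on_compose_gen[OF _ H'(2)])
    have "cusp_param b holomorphic_on UNIV" unfolding cusp_param_def[abs_def] by (intro holomorphic_intros) (use b in auto)
    thus "(cusp_param b \<circ> mob (adj2 sg)) holomorphic_on D"
     by (intro holomorphic_on_compose_gen[OF holomorphic_on_subset[OF hol_adj]]) (auto simp: D_def)
    show "(cusp_param b \<circ> mob (adj2 sg)) ` D \<subseteq> ball 0 ro - {0}" using small by (auto simp: D_def)
   qed
   thus "(\<lambda>z. H (cusp_param b (mob (adj2 sg) z))) holomorphic_on D" by (simp add: o_def)
   fix z assume z: "z \<in> D"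
   hence "c \<le> Im (mob (adj2 sg) z)" "0 < Im z" by (auto simp: D_def d_def)
   thus "H (cusp_param b (mob (adj2 sg) z)) = u z" using u[of "mob (adj2 sg) z"] det by simp
  qed
  show ?thesis
  proof (rule cusp_tameI)
   show "\<forall>\<^sub>F w in at_cusp. u analytic_on {mob sg w} \<and>
    cmod (u (mob sg w)) \<le> C * exp (2 * pi * real n / b * Im w)"
    unfolding at_cusp_infinity_def eventually_filtercomap_at_top_linorder
   proof (intro exI[of _ "d + 1"] allI impI conjI)
    fix w assume w: "d + 1 \<le> Im w"
    hence pos: "0 < Im w" by (simp add: d_def)
    have "mob sg w \<in> D" using w pos det by (simp add: D_def)
    thus "u analytic_on {mob sg w}" using \<open>open D\<close> \<open>u holomorphic_on D\<close> analytic_at by blast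
    have "u (mob sg w) = H (cusp_param b w)" using u w by (simp add: d_def)
    also have "cmod \<dots> \<le> C / cmod (cusp_param b w) ^ n" using small[of w] w by (intro H'(4)) auto
    also have "\<dots> = C * exp (2 * pi * real n / b * Im w)"
     unfolding norm_cusp_param by (simp add: exp_of_nat_mult[symmetric] divide_inverse exp_minus[symmetric] algebra_simps)
    finally show "cmod (u (mob sg w)) \<le> C * exp (2 * pi * real n / b * Im w)" .
   qed
  qed (use b H' in auto)
 qed
qed

context fuchsian
begin

abbreviation FF where "FF \<equiv> function_field \<Gamma>"
abbreviation CF where "CF \<equiv> carrier FF"
abbreviation FF0 where "FF0 \<equiv> \<zero>\<^bsub>FF\<^esub>"

lemma carrier_FF:
 "\<psi> \<in> CF \<longleftrightarrow> \<psi> nicely_meromorphic_on \<H> \<and> (\<forall>z. z \<notin> \<H> --> \<psi> z = 0) \<and>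
  invariant_under \<Gamma> \<psi> \<and> meromorphic_at_cusps \<Gamma> \<psi>"
 unfolding function_field_def invariant_under_def by auto

lemma carrier_FF_meromorphic: "\<psi> \<in> CF ==> \<psi> meromorphic_on \<H>"
 by (simp add: carrier_FF nicely_meromorphic_on_def)

lemma carrier_FF_invariant: "\<psi> \<in> CF ==> invariant_under \<Gamma> \<psi>" by (simp add: carrier_FF)

lemma on_uhp_carrier_FF:
 assumes "\<psi> \<in> CF"
 shows "on_uhp \<psi> = \<psi>"
proof
 fix z
 show "on_uhp \<psi> z = \<psi> z"
 proof (cases "z \<in> \<H>")
  case True
  hence "is_pole \<psi> z \<and> \<psi> z = 0 \<or> \<psi> \<midarrow>z\<rightarrow> \<psi> z"
   using assms by (auto simp: carrier_FF nicely_meromorphic_on_def)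
  thus ?thesis using True by (auto simp: on_uhp_def)
 qed (use assms in \<open>auto simp: on_uhp_def carrier_FF\<close>)
qed

lemma carrier_FF_cusp:
 assumes psi: "\<psi> \<in> CF" and sig: "sg \<in> cusp_frames \<Gamma>"
 shows "cusp_tame sg \<psi>" "cusp_tame sg (\<lambda>z. inverse (\<psi> z))"
proof -
 obtain b F where b: "b > 0" "F meromorphic_on {0}"
  "\<forall>\<^sub>F w in at_cusp. \<psi> (mob sg w) = F (cusp_param b w)"
  using psi sig unfolding carrier_FF meromorphic_at_cusps_def by blast
 show "cusp_tame sg \<psi>" by (rule cusp_tame_of_param[OF det_cusp_frame[OF sig] b])
 show "cusp_tame sg (\<lambda>z. inverse (\<psi> z))"
 proof (rule cusp_tame_of_param[OF det_cusp_frame[OF sig] b(1)])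
  show "(\<lambda>t. inverse (F t)) meromorphic_on {0}" by (intro meromorphic_intros b)
  show "\<forall>\<^sub>F w in at_cusp. inverse (\<psi> (mob sg w)) = inverse (F (cusp_param b w))"
   using b(3) by eventually_elim simp
 qed
qed

text \<open>Invariance supplies a period at the cusp and thus a function \<open>T\<close> of the
  parameter on a punctured disc; exponential growth in \<open>Im w\<close> bounds \<open>T\<close>
  by a negative power of the parameter, which makes it meromorphic.\<close>

lemma on_uhp_in_carrier_FF:
 assumes mero: "u meromorphic_on \<H>" and inv: "invariant_under \<Gamma> u"
  and tame: "\<And>sg. sg \<in> cusp_frames \<Gamma> ==> cusp_tame sg u"
 shows "on_uhp u \<in> CF" unfolding carrier_FF
proof (intro conjI)
 show "on_uhp u nicely_meromorphic_on \<H>" by (rule on_uhp_nicely[OF mero])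
 show "\<forall>z. z \<notin> \<H> --> on_uhp u z = 0" by (simp add: on_uhp_def)
 show inv': "invariant_under \<Gamma> (on_uhp u)" unfolding invariant_under_def
 proof (intro ballI allI impI)
  fix ga z assume g: "ga \<in> \<Gamma>" and z: "0 < Im z"
  note det = det_Gamma[OF g]
  have "remove_sings u (mob ga z) = remove_sings (u \<circ> mob ga) z"
   by (rule remove_sings_compose[symmetric, OF filtermap_mobius_act_at[OF det z]])
  also have "\<dots> = remove_sings u z"
  proof (rule remove_sings_cong)
   have "\<forall>\<^sub>F w in at z. w \<in> \<H>" using z by (intro eventually_at_in_open') (auto simp: open_uhp)
   thus "\<forall>\<^sub>F w in at z. (u \<circ> mob ga) w = u w"
    by eventually_elim (use inv g in \<open>auto simp: invariant_under_def\<close>)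
  qed simp
  finally show "on_uhp u (mob ga z) = on_uhp u z" using z det by (simp add: on_uhp_def)
 qed
 show "meromorphic_at_cusps \<Gamma> (on_uhp u)" unfolding meromorphic_at_cusps_def
 proof
  fix sg assume sig: "sg \<in> cusp_frames \<Gamma>"
  note det = det_cusp_frame[OF sig]
  obtain A C where tm: "A \<ge> 0" "C \<ge> 0" "\<forall>\<^sub>F w in at_cusp.
   u analytic_on {mob sg w} \<and> cmod (u (mob sg w)) \<le> C * exp (A * Im w)"
   using tame[OF sig] unfolding cusp_tame_def by blast
  obtain b where b: "b > 0" "\<And>w. 0 < Im w ==> \<exists>ga\<in>\<Gamma>. mob ga (mob sg w) = mob sg (w + of_real b)"
   using cusp_period[OF sig] by blast
  obtain c where c: "\<And>w. c \<le> Im w ==> u analytic_on {mob sg w} \<and> cmod (u (mob sg w)) \<le> C * exp (A * Im w)"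
   using tm(3) unfolding at_cusp_infinity_def eventually_filtercomap_at_top_linorder by blast
  define d where "d = max c 0"
  have val: "on_uhp u (mob sg w) = u (mob sg w)" if "d < Im w" for w
   using c[of w] that det by (intro on_uhp_analytic) (auto simp: d_def)
  have "(on_uhp u \<circ> mob sg) holomorphic_on {w. d < Im w}"
  proof (rule holomorphic_on_compose_gen)
   show "mob sg holomorphic_on {w. d < Im w}"
    by (rule holomorphic_on_subset[OF holomorphic_on_mobius_act[OF det]]) (auto simp: d_def)
   show "on_uhp u holomorphic_on (mob sg ` {w. d < Im w})" by (rule analytic_imp_holomorphic, subst analytic_on_analytic_at)
     (use c det in \<open>auto simp: d_def intro!: on_uhp_analytic(2)\<close>)
  qed auto
  moreover have "(on_uhp u \<circ> mob sg) (w + of_real b) = (on_uhp u \<circ> mob sg) w" if "d < Im w" for w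
  proof -
   have "0 < Im w" using that by (simp add: d_def)
   then obtain ga where "ga \<in> \<Gamma>" "mob ga (mob sg w) = mob sg (w + of_real b)" using b(2) by blast
   moreover have "0 < Im (mob sg w)" using det \<open>0 < Im w\<close> by simp
   ultimately show ?thesis using inv' unfolding invariant_under_def o_def by metis
  qed
  ultimately obtain T where T: "T holomorphic_on (ball 0 (exp (- 2 * pi * d / b)) - {0})"
   "\<And>w. d < Im w ==> (on_uhp u \<circ> mob sg) w = T (cusp_param b w)"
   using holomorphic_on_periodic_imp_exp[OF b(1)] by blast
  \<comment> \<open>The least exponent for which the \<open>n\<close>-th power of the reciprocal of
    \<open>|cusp_param b w|\<close> dominates \<open>exp (A * Im w)\<close>.\<close>
  define n where "n = nat \<lceil>A * b / (2 * pi)\<rceil>"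
  have "T meromorphic_on {0}"
  proof (rule growth_imp_meromorphic[OF _ T(1)])
   fix t :: complex assume t: "t ~= 0" "cmod t < exp (- 2 * pi * d / b)"
   obtain w where w: "cusp_param b w = t" using cusp_param_surj[OF b(1) t(1)] by metis
   have "- 2 * pi * Im w / b < - 2 * pi * d / b" using t(2) unfolding w[symmetric] norm_cusp_param by simp
   hence dw: "d < Im w" using b(1) by (simp add: divide_less_cancel)
   have "cmod (T t) = cmod (u (mob sg w))" using T(2)[OF dw] val[OF dw] w by simp
   also have "\<dots> \<le> C * exp (A * Im w)" using c[of w] dw by (simp add: d_def)
   also have "\<dots> \<le> C * exp (real n * (2 * pi * Im w / b))"
   proof -
    have "A * b / (2 * pi) \<le> real n" unfolding n_def by (rule real_nat_ceiling_ge)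
    hence "A * b / (2 * pi) * (2 * pi * Im w / b) \<le> real n * (2 * pi * Im w / b)"
     using b(1) dw by (intro mult_right_mono) (auto simp: d_def)
    moreover have "A * b / (2 * pi) * (2 * pi * Im w / b) = A * Im w" using b(1) by simp
    ultimately show ?thesis using tm(2) by (intro mult_left_mono) auto
   qed
   also have "\<dots> = C / cmod t ^ n" unfolding w[symmetric] norm_cusp_param
    by (simp add: exp_of_nat_mult[symmetric] divide_inverse exp_minus[symmetric] algebra_simps)
   finally show "cmod (T t) \<le> C / cmod t ^ n" .
  qed simp
  moreover have "\<forall>\<^sub>F z in at_cusp. on_uhp u (mob sg z) = T (cusp_param b z)"
   unfolding at_cusp_infinity_def eventually_filtercomap_at_top_linorder by (intro exI[of _ "d + 1"]) (use T(2) in auto)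
  ultimately show "\<exists>w>0. \<exists>F. F meromorphic_on {0} \<and>
    (\<forall>\<^sub>F z in at_cusp. on_uhp u (mob sg z) = F (cusp_param w z))" using b(1) by blast
 qed
qed

end

lemma cusp_tame_cong:
 assumes "det sg = 1" "cusp_tame sg u" "\<And>z. 0 < Im z ==> u z = v z"
 shows "cusp_tame sg v"
proof -
 obtain A C where u: "A \<ge> 0" "C \<ge> 0" "\<forall>\<^sub>F w in at_cusp.
  u analytic_on {mob sg w} \<and> cmod (u (mob sg w)) \<le> C * exp (A * Im w)" using assms(2) by (auto simp: cusp_tame_def)
 show ?thesis
 proof (rule cusp_tameI[OF u(1,2)])
  show "\<forall>\<^sub>F w in at_cusp. v analytic_on {mob sg w} \<and> cmod (v (mob sg w)) \<le> C * exp (A * Im w)"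
   using u(3) eventually_cusp_pos
  proof eventually_elim
   case (elim w)
   have pos: "0 < Im (mob sg w)" using assms(1) elim by simp
   have "\<forall>\<^sub>F z in nhds (mob sg w). z \<in> \<H>"
    using pos by (intro eventually_nhds_in_open) (auto simp: open_uhp)
   hence "\<forall>\<^sub>F z in nhds (mob sg w). u z = v z" by eventually_elim (use assms(3) in auto)
   hence "u analytic_on {mob sg w} \<longleftrightarrow> v analytic_on {mob sg w}" by (intro analytic_at_cong) auto
   thus ?case using elim assms(3)[OF pos] by auto
  qed
 qed
qed

context fuchsian
begin

text \<open>A representative of an element of the field that need not be in normal form. Identities
  are proved for such functions pointwise, off a discrete set, and transported by
  \<open>on_uhp\<close>.\<close>

definition mf :: "cfn => bool"
 where "mf u \<longleftrightarrow> u meromorphic_on \<H> \<and> on_uhp u \<in> CF"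

lemma mf_meromorphic: "mf u ==> u meromorphic_on \<H>" by (simp add: mf_def)

lemma mf_carrier: "mf u ==> on_uhp u \<in> CF" by (simp add: mf_def)

lemma mf_ae: "mf u ==> AEH z. on_uhp u z = u z" by (intro on_uhp_ae mf_meromorphic)

lemma carrier_imp_mf: "\<psi> \<in> CF ==> mf \<psi>" by (simp add: mf_def on_uhp_carrier_FF carrier_FF_meromorphic)

lemma mfI:
 assumes "u meromorphic_on \<H>" "invariant_under \<Gamma> u"
  "\<And>sg. sg \<in> cusp_frames \<Gamma> ==> cusp_tame sg u"
 shows "mf u" unfolding mf_def using on_uhp_in_carrier_FF[OF assms] assms(1) by blast

lemma mf_cong:
 assumes "mf u" "AEH z. u z = v z"
 shows "mf v" unfolding mf_def on_uhp_cong[OF assms(2), symmetric]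
 using assms(1) meromorphic_on_cong'[OF assms(2) refl] by (auto simp: mf_def)

lemma mf_const: "mf (\<lambda>z. c)" by (rule mfI) (auto simp: invariant_under_def cusp_tame_const)

lemma mf_add:
 assumes "mf u" "mf v"
 shows "mf (\<lambda>z. u z + v z)"
proof (rule mf_cong)
 note uv = mf_carrier[OF assms(1)] mf_carrier[OF assms(2)]
 show "mf (\<lambda>z. on_uhp u z + on_uhp v z)"
 proof (rule mfI)
  show "(\<lambda>z. on_uhp u z + on_uhp v z) meromorphic_on \<H>" by (intro meromorphic_intros carrier_FF_meromorphic uv)
  show "invariant_under \<Gamma> (\<lambda>z. on_uhp u z + on_uhp v z)"
   using carrier_FF_invariant[OF uv(1)] carrier_FF_invariant[OF uv(2)] by (simp add: invariant_under_def)
 qed (intro cusp_tame_add carrier_FF_cusp uv)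
 show "AEH z. on_uhp u z + on_uhp v z = u z + v z" using mf_ae[OF assms(1)] mf_ae[OF assms(2)] by eventually_elim simp
qed

lemma mf_mult:
 assumes "mf u" "mf v"
 shows "mf (\<lambda>z. u z * v z)"
proof (rule mf_cong)
 note uv = mf_carrier[OF assms(1)] mf_carrier[OF assms(2)]
 show "mf (\<lambda>z. on_uhp u z * on_uhp v z)"
 proof (rule mfI)
  show "(\<lambda>z. on_uhp u z * on_uhp v z) meromorphic_on \<H>" by (intro meromorphic_intros carrier_FF_meromorphic uv)
  show "invariant_under \<Gamma> (\<lambda>z. on_uhp u z * on_uhp v z)"
   using carrier_FF_invariant[OF uv(1)] carrier_FF_invariant[OF uv(2)] by (simp add: invariant_under_def)
 qed (intro cusp_tame_mult carrier_FF_cusp uv)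
 show "AEH z. on_uhp u z * on_uhp v z = u z * v z" using mf_ae[OF assms(1)] mf_ae[OF assms(2)] by eventually_elim simp
qed

lemma mf_inverse:
 assumes "mf u"
 shows "mf (\<lambda>z. inverse (u z))"
proof (rule mf_cong)
 note u = mf_carrier[OF assms]
 show "mf (\<lambda>z. inverse (on_uhp u z))"
 proof (rule mfI)
  show "(\<lambda>z. inverse (on_uhp u z)) meromorphic_on \<H>" by (intro meromorphic_intros carrier_FF_meromorphic u)
  show "invariant_under \<Gamma> (\<lambda>z. inverse (on_uhp u z))"
   using carrier_FF_invariant[OF u] by (simp add: invariant_under_def)
 qed (intro carrier_FF_cusp u)
 show "AEH z. inverse (on_uhp u z) = inverse (u z)" using mf_ae[OF assms] by eventually_elim simp
qed

lemma mf_uminus: "mf u ==> mf (\<lambda>z. - u z)" using mf_mult[OF mf_const[of "-1"], of u] by simp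

lemma mf_divide: "mf u ==> mf v ==> mf (\<lambda>z. u z / v z)"
 using mf_mult[OF _ mf_inverse, of u v] by (simp add: divide_inverse)

lemma mf_power: "mf u ==> mf (\<lambda>z. u z ^ n)" by (induction n) (auto intro: mf_const mf_mult)

lemma mf_sum: "(\<And>i. i \<in> I ==> mf (u i)) ==> mf (\<lambda>z. \<Sum>i\<in>I. u i z)"
 by (induction I rule: infinite_finite_induct) (auto intro: mf_const mf_add)

lemma mf_poly: "mf u ==> mf (\<lambda>z. poly p (u z))" by (induction p) (auto intro: mf_const mf_add mf_mult)

lemma mf_zero_or_nonzero:
 assumes "mf u"
 shows "(AEH z. u z = c) \<or> (AEH z. u z ~= c)"
 by (rule meromorphic_imp_constant_or_avoid[OF mf_meromorphic[OF assms] open_uhp connected_uhp])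

lemma FF_simps:
 "a \<otimes>\<^bsub>FF\<^esub> b = on_uhp (\<lambda>z. a z * b z)" "a \<oplus>\<^bsub>FF\<^esub> b = on_uhp (\<lambda>z. a z + b z)"
 "\<one>\<^bsub>FF\<^esub> = on_uhp (\<lambda>z. 1)" "FF0 = on_uhp (\<lambda>z. 0)" by (simp_all add: function_field_def)

lemma on_uhp_const [simp]: "on_uhp (\<lambda>z. c) = (\<lambda>z. if 0 < Im z then c else 0)" by (auto simp: on_uhp_def)

lemma on_uhp_add: "mf u ==> mf v ==> on_uhp u \<oplus>\<^bsub>FF\<^esub> on_uhp v = on_uhp (\<lambda>z. u z + v z)"
 unfolding FF_simps by (rule on_uhp_cong, rule eventually_mono[OF eventually_conj[OF mf_ae[of u] mf_ae[of v]]]) auto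

lemma on_uhp_mult: "mf u ==> mf v ==> on_uhp u \<otimes>\<^bsub>FF\<^esub> on_uhp v = on_uhp (\<lambda>z. u z * v z)"
 unfolding FF_simps by (rule on_uhp_cong, rule eventually_mono[OF eventually_conj[OF mf_ae[of u] mf_ae[of v]]]) auto

lemma on_uhp_eq_iff:
 assumes "mf u" "mf v"
 shows "on_uhp u = on_uhp v \<longleftrightarrow> (AEH z. u z = v z)"
proof
 assume eq: "on_uhp u = on_uhp v"
 show "AEH z. u z = v z" using mf_ae[OF assms(1)] mf_ae[OF assms(2)] by eventually_elim (simp add: eq)
qed (rule on_uhp_cong)

lemma cosparse_uhp_neq_bot: "cosparse \<H> ~= bot"
proof
 assume "cosparse \<H> = bot"
 hence "AEH z. False" by simp
 from eventually_cosparse_imp_eventually_at[OF this, of \<i> UNIV] show False by simp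
qed

text \<open>Every element is \<open>on_uhp\<close> of a representative, on which the operations are
  the pointwise ones. A representative of a nonzero element is nonzero almost everywhere, so its
  pointwise reciprocal represents the inverse.\<close>

lemma field_FF: "field FF"
proof (rule cring.cring_fieldI)
 note carr = mf_carrier
 have rep: "\<exists>u. mf u \<and> a = on_uhp u" if "a \<in> CF" for a
  using carrier_imp_mf[OF that] on_uhp_carrier_FF[OF that] by metis
 have zero: "FF0 = on_uhp (\<lambda>z. 0)" and one: "\<one>\<^bsub>FF\<^esub> = on_uhp (\<lambda>z. 1)"
  by (simp_all only: FF_simps)
 show cr: "cring FF"
 proof (rule cringI)
  show "abelian_group FF"
  proof (rule abelian_groupI)
   fix x y assume "x \<in> CF" "y \<in> CF"
   then obtain u v where "mf u" "mf v" "x = on_uhp u" "y = on_uhp v" using rep by metis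
   thus "x \<oplus>\<^bsub>FF\<^esub> y \<in> CF" "x \<oplus>\<^bsub>FF\<^esub> y = y \<oplus>\<^bsub>FF\<^esub> x"
    by (auto simp: on_uhp_add add.commute intro: carr mf_add)
  next
   show "FF0 \<in> CF" unfolding zero by (intro carr mf_const)
  next
   fix x y z assume "x \<in> CF" "y \<in> CF" "z \<in> CF"
   then obtain u v w where "mf u" "mf v" "mf w" "x = on_uhp u" "y = on_uhp v" "z = on_uhp w" using rep by metis
   thus "x \<oplus>\<^bsub>FF\<^esub> y \<oplus>\<^bsub>FF\<^esub> z = x \<oplus>\<^bsub>FF\<^esub> (y \<oplus>\<^bsub>FF\<^esub> z)"
    by (simp only: on_uhp_add mf_add add.assoc)
  next
   fix x assume "x \<in> CF"
   then obtain u where u: "mf u" "x = on_uhp u" using rep by metis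
   show "FF0 \<oplus>\<^bsub>FF\<^esub> x = x" unfolding u zero by (simp only: on_uhp_add mf_const u add_0)
   show "\<exists>y\<in>CF. y \<oplus>\<^bsub>FF\<^esub> x = FF0" unfolding u zero using u(1)
    by (intro bexI[of _ "on_uhp (\<lambda>z. - u z)"]) (simp_all only: on_uhp_add mf_uminus carr left_minus)
  qed
  show "comm_monoid FF"
  proof (rule comm_monoidI)
   fix x y assume "x \<in> CF" "y \<in> CF"
   then obtain u v where "mf u" "mf v" "x = on_uhp u" "y = on_uhp v" using rep by metis
   thus "x \<otimes>\<^bsub>FF\<^esub> y \<in> CF" "x \<otimes>\<^bsub>FF\<^esub> y = y \<otimes>\<^bsub>FF\<^esub> x"
    by (auto simp: on_uhp_mult mult.commute intro: carr mf_mult)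
  next
   show "\<one>\<^bsub>FF\<^esub> \<in> CF" unfolding one by (intro carr mf_const)
  next
   fix x y z assume "x \<in> CF" "y \<in> CF" "z \<in> CF"
   then obtain u v w where "mf u" "mf v" "mf w" "x = on_uhp u" "y = on_uhp v" "z = on_uhp w" using rep by metis
   thus "x \<otimes>\<^bsub>FF\<^esub> y \<otimes>\<^bsub>FF\<^esub> z = x \<otimes>\<^bsub>FF\<^esub> (y \<otimes>\<^bsub>FF\<^esub> z)"
    by (simp only: on_uhp_mult mf_mult mult.assoc)
  next
   fix x assume "x \<in> CF"
   then obtain u where u: "mf u" "x = on_uhp u" using rep by metis
   show "\<one>\<^bsub>FF\<^esub> \<otimes>\<^bsub>FF\<^esub> x = x" unfolding u one by (simp only: on_uhp_mult mf_const u mult_1)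
  qed
  fix x y z assume "x \<in> CF" "y \<in> CF" "z \<in> CF"
  then obtain u v w where "mf u" "mf v" "mf w" "x = on_uhp u" "y = on_uhp v" "z = on_uhp w" using rep by metis
  thus "(x \<oplus>\<^bsub>FF\<^esub> y) \<otimes>\<^bsub>FF\<^esub> z = x \<otimes>\<^bsub>FF\<^esub> z \<oplus>\<^bsub>FF\<^esub> y \<otimes>\<^bsub>FF\<^esub> z"
   by (simp only: on_uhp_mult on_uhp_add mf_mult mf_add distrib_right)
 qed
 show "Units FF = CF - {FF0}"
 proof (intro equalityI subsetI)
  fix x assume x: "x \<in> Units FF"
  have "FF0 ~= \<one>\<^bsub>FF\<^esub>"
  proof
   assume "FF0 = \<one>\<^bsub>FF\<^esub>"
   hence "(\<lambda>z. if 0 < Im z then 0 else 0) = (\<lambda>z. if 0 < Im z then 1 else (0::complex))"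
    unfolding zero one on_uhp_const .
   from fun_cong[OF this, of \<i>] show False by simp
  qed
  moreover have "x = FF0 ==> \<one>\<^bsub>FF\<^esub> = FF0"
   using x cr by (auto simp: Units_def cring_def ring.ring_simprules)
  ultimately show "x \<in> CF - {FF0}" using x by (auto simp: Units_def)
 next
  fix x assume x: "x \<in> CF - {FF0}"
  then obtain u where u: "mf u" "x = on_uhp u" using rep by blast
  have "\<not> (AEH z. u z = 0)" using x u on_uhp_eq_iff[OF u(1) mf_const[of 0]] by (simp only: zero) blast
  hence nz: "AEH z. u z ~= 0" using mf_zero_or_nonzero[OF u(1), of 0] by blast
  have 1: "AEH z. inverse (u z) * u z = 1" using nz by eventually_elim simp
  hence 2: "AEH z. u z * inverse (u z) = 1" by (simp add: mult.commute)
  have "on_uhp (\<lambda>z. inverse (u z)) \<otimes>\<^bsub>FF\<^esub> x = \<one>\<^bsub>FF\<^esub>" "x \<otimes>\<^bsub>FF\<^esub> on_uhp (\<lambda>z. inverse (u z)) = \<one>\<^bsub>FF\<^esub>"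
   unfolding one u(2) using on_uhp_cong[OF 1] on_uhp_cong[OF 2] by (simp_all only: on_uhp_mult u mf_inverse)
  thus "x \<in> Units FF" unfolding Units_def using x carr[OF mf_inverse[OF u(1)]] by blast
 qed
qed

text \<open>The automorphy factors of numerator and denominator cancel. At a cusp each of the two
  has an expansion only after division by the factor \<open>j\<close>, possibly in parameters of
  different widths; tameness of the two quotients is enough.\<close>

lemma mf_quotient:
 assumes f: "f \<in> modular_forms m \<Gamma> chi" and g: "g \<in> modular_forms m \<Gamma> chi"
  and chi: "\<And>ga. ga \<in> \<Gamma> ==> chi ga ~= 0"
 shows "mf (\<lambda>z. g z / f z)"
proof (rule mfI)
 have hol: "f holomorphic_on \<H>" "g holomorphic_on \<H>" using f g by (auto simp: modular_forms_def)
 show "(\<lambda>z. g z / f z) meromorphic_on \<H>"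
  using hol open_uhp by (intro meromorphic_intros analytic_on_imp_meromorphic_on) (auto simp: analytic_on_open)
 have trans: "k (mob ga z) = chi ga * automorphy ga z ^ m * k z"
  if "k = f \<or> k = g" "ga \<in> \<Gamma>" "0 < Im z" for k ga z using that f g by (auto simp: modular_forms_def)
 show "invariant_under \<Gamma> (\<lambda>z. g z / f z)" unfolding invariant_under_def
 proof (intro ballI allI impI)
  fix ga z assume *: "ga \<in> \<Gamma>" "0 < Im z"
  have "chi ga * automorphy ga z ^ m ~= 0" using chi * automorphy_nonzero det_Gamma by simp
  thus "g (mob ga z) / f (mob ga z) = g z / f z"
   unfolding trans[OF disjI1[OF refl] *] trans[OF disjI2[OF refl] *] by (rule mult_divide_mult_cancel_left)
 qed
 fix sg assume sig: "sg \<in> cusp_frames \<Gamma>"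
 note det = det_cusp_frame[OF sig]
 define j where "j z = automorphy sg (mob (adj2 sg) z) ^ m" for z
 have j_sig: "j (mob sg w) = automorphy sg w ^ m" if "0 < Im w" for w using that det by (simp add: j_def)
 have rep: "\<exists>b>0. \<exists>F. F meromorphic_on {0} \<and> (\<forall>\<^sub>F w in at_cusp. k (mob sg w) / j (mob sg w) = F (cusp_param b w))"
  if k: "k = f \<or> k = g" for k
 proof -
  have "holomorphic_at_cusps m \<Gamma> k" using k f g by (auto simp: modular_forms_def)
  then obtain b F where bF: "b > 0" "F analytic_on {0}"
   "\<forall>\<^sub>F w in at_cusp. k (mob sg w) / automorphy sg w ^ m = F (cusp_param b w)"
   using sig unfolding holomorphic_at_cusps_def by blast
  have "\<forall>\<^sub>F w in at_cusp. k (mob sg w) / j (mob sg w) = F (cusp_param b w)"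
   using bF(3) eventually_cusp_pos by eventually_elim (simp add: j_sig)
  thus ?thesis using bF(1,2) analytic_on_imp_meromorphic_on by blast
 qed
 obtain b G where G: "b > 0" "G meromorphic_on {0}"
  "\<forall>\<^sub>F w in at_cusp. g (mob sg w) / j (mob sg w) = G (cusp_param b w)" using rep[of g] by blast
 obtain c F where F: "c > 0" "F meromorphic_on {0}"
  "\<forall>\<^sub>F w in at_cusp. f (mob sg w) / j (mob sg w) = F (cusp_param c w)" using rep[of f] by blast
 have tg: "cusp_tame sg (\<lambda>z. g z / j z)" by (rule cusp_tame_of_param[OF det G])
 have "(\<lambda>t. inverse (F t)) meromorphic_on {0}" by (intro meromorphic_intros F)
 hence tf: "cusp_tame sg (\<lambda>z. inverse (f z / j z))"
  by (rule cusp_tame_of_param[OF det F(1)]) (rule eventually_mono[OF F(3)], simp only:)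
 show "cusp_tame sg (\<lambda>z. g z / f z)"
 proof (rule cusp_tame_cong[OF det cusp_tame_mult[OF tg tf]])
  fix z :: complex assume "0 < Im z"
  hence "j z ~= 0" using det by (simp add: j_def automorphy_nonzero)
  thus "g z / j z * inverse (f z / j z) = g z / f z" by (simp add: field_simps)
 qed
qed

end

section \<open>Orders and growth at the points of the surface\<close>

lemma open_coord_nbhd:
 assumes "q holomorphic_on \<H>"
 shows "open (coord_nbhd q ro)"
proof -
 have "open (q -` (ball 0 ro - {0}) \<inter> \<H>)"
  using continuous_open_preimage[OF holomorphic_on_imp_continuous_on[OF assms] open_uhp, of "ball 0 ro - {0}"]
  by (simp add: Int_commute open_delete)
 moreover have "coord_nbhd q ro = q -` (ball 0 ro - {0}) \<inter> \<H>" by (auto simp: coord_nbhd_def)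
 ultimately show ?thesis by simp
qed

lemma uniformizerD:
 assumes "uniformizer \<Gamma> \<Phi> q r"
 shows "r > 0" "q holomorphic_on \<H>"
  "eventually P \<Phi> \<longleftrightarrow> (\<exists>ro>0. ro \<le> r \<and> (\<forall>z\<in>coord_nbhd q ro. P z))"
  "t ~= 0 ==> cmod t < r ==> \<exists>z. 0 < Im z \<and> q z = t"
  "0 < ro ==> ro \<le> r ==> \<psi> holomorphic_on coord_nbhd q ro ==> invariant_under \<Gamma> \<psi> ==>
   \<exists>T. T holomorphic_on ball 0 ro - {0} \<and> (\<forall>z\<in>coord_nbhd q ro. \<psi> z = T (q z))"
 using assms unfolding uniformizer_def by blast+

lemma uniformizer_nonempty:
 assumes "uniformizer \<Gamma> \<Phi> q r" "0 < ro" "ro \<le> r"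
 shows "coord_nbhd q ro ~= {}"
proof -
 have "of_real (ro / 2) ~= (0::complex)" "cmod (of_real (ro / 2)) < r" using assms by auto
 then obtain z where "0 < Im z" "q z = of_real (ro / 2)" using uniformizerD(4)[OF assms(1)] by blast
 have "cmod (q z) = ro / 2" unfolding \<open>q z = of_real (ro / 2)\<close> norm_of_real using assms(2) by simp
 hence "z \<in> coord_nbhd q ro" using assms(2) \<open>0 < Im z\<close> by (auto simp: coord_nbhd_def)
 thus ?thesis by blast
qed

lemma bounded_holomorphic_extension:
 fixes T :: cfn
 assumes "ro > 0" "T holomorphic_on ball 0 ro - {0}" "\<And>t. t ~= 0 ==> cmod t < ro ==> cmod (T t) \<le> M"
 obtains G where "G holomorphic_on ball 0 ro" "\<And>t. t ~= 0 ==> cmod t < ro ==> G t = T t"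
proof -
 have "\<forall>\<^sub>F t in at 0. t \<in> ball 0 ro - {0}" using assms(1) by (intro eventually_at_in_open) auto
 hence "\<forall>\<^sub>F t in at 0. cmod (T t) \<le> M" by eventually_elim (use assms(3) in auto)
 hence "\<exists>B. \<forall>\<^sub>F t in at 0. cmod (T t) \<le> B" by blast
 then obtain G where "G holomorphic_on ball 0 ro" "\<forall>t\<in>ball 0 ro - {0}. G t = T t"
  using holomorphic_on_extend_bounded[OF assms(2)] assms(1) by (auto simp: interior_open)
 thus thesis by (intro that[of G]) auto
qed

context fuchsian
begin

text \<open>
 Near a cusp, the exponential growth in the imaginary part is polynomial growth in the
 reciprocal of the coordinate.
\<close>

lemma chart_exists:
 assumes "\<Phi> \<in> SP"
 obtains q r where "uniformizer \<Gamma> \<Phi> q r"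
  "\<And>\<psi>. \<psi> \<in> CF ==> \<exists>C n. \<forall>\<^sub>F z in \<Phi>. \<psi> analytic_on {z} \<and> cmod (\<psi> z) \<le> C / cmod (q z) ^ n"
proof (cases "\<Phi> \<in> at ` \<H>")
 case True
 then obtain p where p: "0 < Im p" "\<Phi> = at p" by auto
 show ?thesis
 proof (rule that[of "\<lambda>z. z - p" "Im p"])
  show "uniformizer \<Gamma> \<Phi> (\<lambda>z. z - p) (Im p)" unfolding p(2) by (rule uniformizer_at[OF p(1)])
  fix \<psi> assume psi: "\<psi> \<in> CF"
  have "\<psi> meromorphic_on {p}" using carrier_FF_meromorphic[OF psi] by (rule meromorphic_on_subset) (use p in auto)
  hence "(\<lambda>t. \<psi> (p + t)) meromorphic_on {0}" by (rule meromorphic_on_compose) (auto intro!: analytic_intros)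
  then obtain ro C n where F: "ro > 0" "C \<ge> 0"
   "\<And>t. t ~= 0 ==> cmod t < ro ==> cmod (\<psi> (p + t)) \<le> C / cmod t ^ n" by (rule meromorphic_growth) blast
  have "isolated_singularity_at \<psi> p" using \<open>\<psi> meromorphic_on {p}\<close> by (rule meromorphic_on_isolated_singularity)
  then obtain s where s: "s > 0" "\<psi> analytic_on ball p s - {p}" by (auto simp: isolated_singularity_at_def)
  have "\<forall>\<^sub>F z in at p. z \<in> ball p (min ro s) - {p}" using F s by (intro eventually_at_in_open) auto
  hence "\<forall>\<^sub>F z in \<Phi>. \<psi> analytic_on {z} \<and> cmod (\<psi> z) \<le> C / cmod (z - p) ^ n"
   unfolding p(2)
  proof eventually_elim
   case (elim z)
   hence "\<psi> analytic_on {z}" using s(2) by (auto intro: analytic_on_subset)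
   moreover have "cmod (\<psi> (p + (z - p))) \<le> C / cmod (z - p) ^ n"
    using elim by (intro F(3)) (auto simp: dist_norm norm_minus_commute)
   ultimately show ?case by simp
  qed
  thus "\<exists>C n. \<forall>\<^sub>F z in \<Phi>. \<psi> analytic_on {z} \<and> cmod (\<psi> z) \<le> C / cmod (z - p) ^ n" by blast
 qed
next
 case False
 then obtain sg where s: "sg \<in> cusp_frames \<Gamma>" "\<Phi> = filtermap (mob sg) at_cusp"
  using assms by (auto simp: surface_points_def)
 note det = det_cusp_frame[OF s(1)]
 obtain b where b: "b > 0" "uniformizer \<Gamma> \<Phi> (\<lambda>z. cusp_param b (mob (adj2 sg) z)) 1"
  using uniformizer_cusp[OF s(1)] unfolding s(2) by metis
 show ?thesis
 proof (rule that[OF b(2)])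
  fix \<psi> assume psi: "\<psi> \<in> CF"
  obtain A C where tm: "A \<ge> 0" "C \<ge> 0" "\<forall>\<^sub>F w in at_cusp.
   \<psi> analytic_on {mob sg w} \<and> cmod (\<psi> (mob sg w)) \<le> C * exp (A * Im w)"
   using carrier_FF_cusp(1)[OF psi s(1)] unfolding cusp_tame_def by blast
  define n where "n = nat \<lceil>A * b / (2 * pi)\<rceil>"
  have "\<forall>\<^sub>F w in at_cusp. \<psi> analytic_on {mob sg w} \<and>
   cmod (\<psi> (mob sg w)) \<le> C / cmod (cusp_param b (mob (adj2 sg) (mob sg w))) ^ n" using tm(3) eventually_cusp_pos
  proof eventually_elim
   case (elim w)
   have "A * b / (2 * pi) \<le> real n" unfolding n_def by (rule real_nat_ceiling_ge)
   hence "A * b / (2 * pi) * (2 * pi * Im w / b) \<le> real n * (2 * pi * Im w / b)"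
    using b(1) elim by (intro mult_right_mono) auto
   moreover have "A * b / (2 * pi) * (2 * pi * Im w / b) = A * Im w" using b(1) by simp
   ultimately have "C * exp (A * Im w) \<le> C * exp (real n * (2 * pi * Im w / b))"
    using tm(2) by (intro mult_left_mono) auto
   also have "\<dots> = C / cmod (cusp_param b w) ^ n" unfolding norm_cusp_param
    by (simp add: exp_of_nat_mult[symmetric] divide_inverse exp_minus[symmetric] algebra_simps)
   finally have "C * exp (A * Im w) \<le> C / cmod (cusp_param b w) ^ n" .
   moreover have "mob (adj2 sg) (mob sg w) = w" using det elim by simp
   ultimately show ?case using elim by simp
  qed
  hence "\<forall>\<^sub>F z in \<Phi>. \<psi> analytic_on {z} \<and> cmod (\<psi> z) \<le> C / cmod (cusp_param b (mob (adj2 sg) z)) ^ n"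
   unfolding s(2) eventually_filtermap .
  thus "\<exists>C n. \<forall>\<^sub>F z in \<Phi>. \<psi> analytic_on {z} \<and> cmod (\<psi> z) \<le> C / cmod (cusp_param b (mob (adj2 sg) z)) ^ n" by blast
 qed
qed

lemma carrier_FF_zero_on_open:
 assumes "\<psi> \<in> CF" "open D" "D \<subseteq> \<H>" "D ~= {}" "\<And>z. z \<in> D ==> \<psi> z = c"
 shows "\<forall>z. 0 < Im z --> \<psi> z = c"
proof -
 obtain p where p: "p \<in> D" using assms(4) by blast
 have "(\<forall>x\<in>\<H>. \<psi> x = c) \<or> (AEH x. \<psi> x ~= c)"
  using assms(1) by (intro nicely_meromorphic_imp_constant_or_avoid open_uhp connected_uhp) (simp add: carrier_FF)
 thus ?thesis
 proof
  assume "AEH x. \<psi> x ~= c"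
  hence "\<forall>\<^sub>F x in at p. \<psi> x ~= c" by (rule eventually_cosparse_imp_eventually_at) (use p assms(3) in auto)
  moreover have "\<forall>\<^sub>F x in at p. x \<in> D" using p assms(2) by (intro eventually_at_in_open')
  ultimately have "\<forall>\<^sub>F x in at p. False" by eventually_elim (use assms(5) in auto)
  thus ?thesis by simp
 qed auto
qed

text \<open>The growth bound makes the local function \<open>T\<close> meromorphic, and
  \<open>m\<close> is its order. \<open>T\<close> cannot vanish identically near 0, because the
  identity theorem would make \<open>\<psi>\<close> zero.\<close>

lemma chart_normal_form:
 assumes u: "uniformizer \<Gamma> \<Phi> q r"
  and gr: "\<exists>C n. \<forall>\<^sub>F z in \<Phi>. \<psi> analytic_on {z} \<and> cmod (\<psi> z) \<le> C / cmod (q z) ^ n"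
  and psi: "\<psi> \<in> CF" "\<psi> ~= FF0"
 obtains ro U m where "0 < ro" "ro \<le> r" "U holomorphic_on ball 0 ro" "\<And>t. cmod t < ro ==> U t ~= 0"
  "\<And>z. z \<in> coord_nbhd q ro ==> \<psi> analytic_on {z}"
  "\<And>z. z \<in> coord_nbhd q ro ==> \<psi> z = U (q z) * (q z) powi m"
proof -
 note uD = uniformizerD[OF u]
 obtain C n ro where g: "ro > 0" "ro \<le> r" "\<And>z. z \<in> coord_nbhd q ro ==> \<psi> analytic_on {z} \<and> cmod (\<psi> z) \<le> C / cmod (q z) ^ n"
  using gr unfolding uD(3) by blast
 have "\<psi> holomorphic_on coord_nbhd q ro"
  by (rule analytic_imp_holomorphic, subst analytic_on_analytic_at) (use g in auto)
 then obtain T where T: "T holomorphic_on ball 0 ro - {0}" "\<And>z. z \<in> coord_nbhd q ro ==> \<psi> z = T (q z)"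
  using uD(5)[OF g(1,2) _ carrier_FF_invariant[OF psi(1)]] by blast
 have "T meromorphic_on {0}"
 proof (rule growth_imp_meromorphic[OF g(1) T(1)])
  fix t :: complex assume t: "t ~= 0" "cmod t < ro"
  then obtain z where z: "0 < Im z" "q z = t" using uD(4)[of t] g(2) by force
  hence "z \<in> coord_nbhd q ro" using t by (simp add: coord_nbhd_def)
  thus "cmod (T t) \<le> C / cmod t ^ n" using g(3) T(2) z(2) by metis
 qed
 thus ?thesis
 proof (cases rule: meromorphic_normal_form)
  case (zero s)
  define s' where "s' = min s ro"
  have s': "0 < s'" "s' \<le> r" using zero(1) g by (auto simp: s'_def)
  have "\<psi> z = 0" if "z \<in> coord_nbhd q s'" for z
   using that T(2)[of z] zero(2)[of "q z"] by (auto simp: coord_nbhd_def s'_def)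
  hence "\<forall>z. 0 < Im z --> \<psi> z = 0"
   by (intro carrier_FF_zero_on_open[OF psi(1) open_coord_nbhd[OF uD(2), of s'] _ uniformizer_nonempty[OF u s']])
    (auto simp: coord_nbhd_def)
  hence "\<psi> = FF0" using psi(1) by (auto simp: FF_simps carrier_FF fun_eq_iff)
  with psi(2) show ?thesis by simp
 next
  case (nonzero s U m)
  define s' where "s' = min s ro"
  show ?thesis
  proof (rule that[of s' U m])
   show "U holomorphic_on ball 0 s'" by (rule holomorphic_on_subset[OF nonzero(2)]) (auto simp: s'_def)
   fix z assume z: "z \<in> coord_nbhd q s'"
   hence z': "z \<in> coord_nbhd q ro" by (auto simp: coord_nbhd_def s'_def)
   show "\<psi> analytic_on {z}" using g(3)[OF z'] by blast
   show "\<psi> z = U (q z) * (q z) powi m" using T(2)[OF z'] nonzero(4)[of "q z"] z by (auto simp: coord_nbhd_def s'_def)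
  qed (use nonzero g in \<open>auto simp: s'_def\<close>)
 qed
qed

lemma ae_le_imp_le_analytic:
 assumes "AEH z. cmod (u z) \<le> K * (1 + cmod (v z)) ^ k"
  and "u analytic_on {z}" "v analytic_on {z}" "0 < Im z"
 shows "cmod (u z) \<le> K * (1 + cmod (v z)) ^ k"
proof (rule tendsto_le[of "at z"])
 have "isCont u z" "isCont v z" using assms(2,3) by (auto intro: analytic_at_imp_isCont)
 thus "((\<lambda>w. cmod (u w)) \<longlongrightarrow> cmod (u z)) (at z)" "((\<lambda>w. K * (1 + cmod (v w)) ^ k) \<longlongrightarrow> K * (1 + cmod (v z)) ^ k) (at z)"
  by (auto simp: isCont_def intro!: tendsto_intros)
 show "\<forall>\<^sub>F w in at z. cmod (u w) \<le> K * (1 + cmod (v w)) ^ k"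
  by (rule eventually_cosparse_imp_eventually_at[OF assms(1)]) (use assms(4) in auto)
qed simp

text \<open>The cover is given in advance and the estimates hold on all of \<open>N \<Phi>\<close>:
  thus one finite cover can serve infinitely many functions \<open>u\<close>. At a centre missing
  from its punctured neighbourhood the estimate follows by continuity if \<open>u\<close> and
  \<open>v\<close> are analytic there, which is so almost everywhere.\<close>

lemma cover_to_global:
 fixes N :: "complex filter => complex set" and k :: nat
 assumes u: "u \<in> CF" and v: "v \<in> CF"
  and S: "finite S"
   "\<And>z. 0 < Im z ==> \<exists>ga\<in>\<Gamma>. \<exists>\<Phi>\<in>S. mob ga z \<in> N \<Phi> \<or> \<Phi> = at (mob ga z)"
   "\<And>\<Phi>. \<Phi> \<in> S ==> \<forall>\<^sub>F z in \<Phi>. z \<in> N \<Phi>"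
  and loc: "\<And>\<Phi>. \<Phi> \<in> S ==> \<exists>K. \<forall>z\<in>N \<Phi>. cmod (u z) \<le> K * (1 + cmod (v z)) ^ k"
 shows "\<exists>K. AEH z. cmod (u z) \<le> K * (1 + cmod (v z)) ^ k"
proof -
 obtain K where K: "\<And>\<Phi> z. \<Phi> \<in> S ==> z \<in> N \<Phi> ==> cmod (u z) \<le> K \<Phi> * (1 + cmod (v z)) ^ k"
  using loc by metis
 have evK: "\<forall>\<^sub>F z in \<Phi>. cmod (u z) \<le> K \<Phi> * (1 + cmod (v z)) ^ k" if "\<Phi> \<in> S" for \<Phi>
  using S(3)[OF that] by eventually_elim (use K that in blast)
 define M where "M = Max (insert 0 (K ` S))"
 have M: "K \<Phi> * (1 + cmod (v z)) ^ k \<le> M * (1 + cmod (v z)) ^ k" if "\<Phi> \<in> S" for \<Phi> z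
  unfolding M_def using S(1) that by (intro mult_right_mono Max_ge) auto
 have inv: "u (mob ga z) = u z" "v (mob ga z) = v z" if "ga \<in> \<Gamma>" "0 < Im z" for ga z
  using carrier_FF_invariant[OF u] carrier_FF_invariant[OF v] that by (auto simp: invariant_under_def)
 have "AEH z. z \<in> \<H>" by (rule eventually_in_cosparse) (auto simp: open_uhp)
 moreover note meromorphic_on_imp_analytic_cosparse[OF carrier_FF_meromorphic[OF u]]
  meromorphic_on_imp_analytic_cosparse[OF carrier_FF_meromorphic[OF v]]
 ultimately have "AEH z. cmod (u z) \<le> M * (1 + cmod (v z)) ^ k"
 proof eventually_elim
  case (elim z)
  hence z: "0 < Im z" by simp
  obtain ga \<Phi> where g: "ga \<in> \<Gamma>" "\<Phi> \<in> S"
   "cmod (u (mob ga z)) \<le> K \<Phi> * (1 + cmod (v (mob ga z))) ^ k \<or> \<Phi> = at (mob ga z)"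
   using S(2)[OF z] K by blast
  have "cmod (u z) \<le> K \<Phi> * (1 + cmod (v z)) ^ k" using g(3)
  proof
   assume "\<Phi> = at (mob ga z)"
   hence ev: "\<forall>\<^sub>F w in at (mob ga z). cmod (u w) \<le> K \<Phi> * (1 + cmod (v w)) ^ k"
    using evK[OF g(2)] by blast
   have "\<forall>\<^sub>F w in at z. cmod (u (mob ga w)) \<le> K \<Phi> * (1 + cmod (v (mob ga w))) ^ k"
    using ev unfolding filtermap_mobius_act_at[OF det_Gamma[OF g(1)] z, symmetric] eventually_filtermap .
   moreover have "\<forall>\<^sub>F w in at z. w \<in> \<H>" using z by (intro eventually_at_in_open') (auto simp: open_uhp)
   ultimately have ev': "\<forall>\<^sub>F w in at z. cmod (u w) \<le> K \<Phi> * (1 + cmod (v w)) ^ k"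
    by eventually_elim (use inv[OF g(1)] in auto)
   show ?thesis
   proof (rule tendsto_le[OF _ _ _ ev'])
    have "isCont u z" "isCont v z" using elim by (auto intro: analytic_at_imp_isCont)
    thus "((\<lambda>w. cmod (u w)) \<longlongrightarrow> cmod (u z)) (at z)"
     "((\<lambda>w. K \<Phi> * (1 + cmod (v w)) ^ k) \<longlongrightarrow> K \<Phi> * (1 + cmod (v z)) ^ k) (at z)"
     by (auto simp: isCont_def intro!: tendsto_intros)
   qed simp
  qed (use inv[OF g(1) z] in simp)
  also have "\<dots> \<le> M * (1 + cmod (v z)) ^ k" by (rule M[OF g(2)])
  finally show ?case .
 qed
 thus ?thesis by blast
qed

lemma local_to_global:
 assumes u: "u \<in> CF" and v: "v \<in> CF"
  and loc: "\<And>\<Phi>. \<Phi> \<in> SP ==> \<exists>K. \<forall>\<^sub>F z in \<Phi>. cmod (u z) \<le> K * (1 + cmod (v z)) ^ k"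
 shows "\<exists>K. AEH z. cmod (u z) \<le> K * (1 + cmod (v z)) ^ k"
proof -
 obtain K where K: "\<And>\<Phi>. \<Phi> \<in> SP ==> \<forall>\<^sub>F z in \<Phi>. cmod (u z) \<le> K \<Phi> * (1 + cmod (v z)) ^ k"
  using loc by metis
 define N where "N \<Phi> = {z. cmod (u z) \<le> K \<Phi> * (1 + cmod (v z)) ^ k}" for \<Phi>
 have N: "\<forall>\<^sub>F z in \<Phi>. z \<in> N \<Phi>" if "\<Phi> \<in> SP" for \<Phi>
  using K[OF that] by (simp add: N_def)
 obtain S where S: "finite S" "S \<subseteq> SP"
  "\<And>z. 0 < Im z ==> \<exists>ga\<in>\<Gamma>. \<exists>\<Phi>\<in>S. mob ga z \<in> N \<Phi> \<or> \<Phi> = at (mob ga z)"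
  using surface_points_finite_cover[OF N] by blast
 show ?thesis
  proof (rule cover_to_global[OF u v S(1,3)])
  show "\<forall>\<^sub>F z in \<Phi>. z \<in> N \<Phi>" if "\<Phi> \<in> S" for \<Phi> using that S(2) N by blast
  show "\<exists>K. \<forall>z\<in>N \<Phi>. cmod (u z) \<le> K * (1 + cmod (v z)) ^ k" for \<Phi> unfolding N_def by blast
 qed
qed

text \<open>Liouville's theorem on the compact surface. If \<open>\<psi>\<close> is not constant and
  \<open>M\<close> is the supremum of its modulus, the maximum modulus principle in each coordinate
  keeps \<open>|\<psi>|\<close> below some \<open>m < M\<close> near every point; by the finite
  cover the largest of finitely many such \<open>m\<close> would bound \<open>|\<psi>|\<close>
  everywhere.\<close>

lemma bounded_imp_constant:
 assumes psi: "\<psi> \<in> CF" and bd: "AEH z. cmod (\<psi> z) \<le> K"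
 shows "\<exists>c. \<forall>z. 0 < Im z --> \<psi> z = c"
proof (rule ccontr)
 assume nc: "\<not> ?thesis"
 have nice: "\<psi> nicely_meromorphic_on \<H>" using psi by (simp add: carrier_FF)
 have an: "\<psi> analytic_on {z}" if z: "0 < Im z" for z
 proof (rule nicely_meromorphic_on_imp_analytic_at[OF nice])
  show "\<not> is_pole \<psi> z"
  proof
   assume "is_pole \<psi> z"
   hence "\<forall>\<^sub>F w in at z. K + 1 \<le> cmod (\<psi> w)"
    unfolding is_pole_def filterlim_at_infinity[OF order_refl] filterlim_at_infinity_conv_norm_at_top
    by (metis eventually_gt_at_top filterlim_at_top filterlim_at_infinity_conv_norm_at_top is_pole_def \<open>is_pole \<psi> z\<close>)
   moreover have "\<forall>\<^sub>F w in at z. cmod (\<psi> w) \<le> K"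
    by (rule eventually_cosparse_imp_eventually_at[OF bd]) (use z in auto)
   ultimately have "\<forall>\<^sub>F w in at z. False" by eventually_elim simp
   thus False by simp
  qed
 qed (use z in auto)
 have le: "cmod (\<psi> z) \<le> K" if "0 < Im z" for z
  using ae_le_imp_le_analytic[of \<psi> K \<psi> 0 z] bd an[OF that] that by simp
 define M where "M = Sup ((\<lambda>z. cmod (\<psi> z)) ` \<H>)"
 have bdd: "bdd_above ((\<lambda>z. cmod (\<psi> z)) ` \<H>)" using le by (auto intro!: bdd_aboveI[of _ K])
 have leM: "cmod (\<psi> z) \<le> M" if "0 < Im z" for z unfolding M_def using that by (intro cSup_upper bdd) auto
 have "\<exists>m<M. \<forall>\<^sub>F z in \<Phi>. cmod (\<psi> z) \<le> m" if Phi: "\<Phi> \<in> SP" for \<Phi>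
 proof -
  obtain q r where u: "uniformizer \<Gamma> \<Phi> q r" using chart_exists[OF Phi] by metis
  note uD = uniformizerD[OF u]
  have "\<psi> holomorphic_on coord_nbhd q r"
   by (rule analytic_imp_holomorphic, subst analytic_on_analytic_at) (use an in \<open>auto simp: coord_nbhd_def\<close>)
  then obtain T where T: "T holomorphic_on ball 0 r - {0}" "\<And>z. z \<in> coord_nbhd q r ==> \<psi> z = T (q z)"
   using uD(5)[OF uD(1) order_refl _ carrier_FF_invariant[OF psi]] by blast
  have TM: "cmod (T t) \<le> M" if t: "t ~= 0" "cmod t < r" for t
  proof -
   obtain z where z: "0 < Im z" "q z = t" using uD(4)[OF t] by blast
   thus ?thesis using T(2)[of z] leM[OF z(1)] t by (auto simp: coord_nbhd_def)
  qed
  obtain G where G: "G holomorphic_on ball 0 r" "\<And>t. t ~= 0 ==> cmod t < r ==> G t = T t"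
   using bounded_holomorphic_extension[OF uD(1) T(1) TM] by blast
  have contG: "isCont G 0"
   using holomorphic_on_imp_continuous_on[OF G(1)] uD(1) by (auto simp: continuous_on_eq_continuous_at)
  have near: "\<forall>\<^sub>F t in at 0. t \<in> ball 0 r - {0::complex}" using uD(1) by (intro eventually_at_in_open) auto
  have G0: "cmod (G 0) \<le> M"
  proof (rule tendsto_upperbound[of "\<lambda>t. cmod (G t)" _ "at 0"])
   show "((\<lambda>t. cmod (G t)) \<longlongrightarrow> cmod (G 0)) (at 0)" using contG by (auto simp: isCont_def intro!: tendsto_intros)
   show "\<forall>\<^sub>F t in at 0. cmod (G t) \<le> M" using near by eventually_elim (use G(2) TM in auto)
  qed simp
  have "cmod (G 0) ~= M"
  proof
   assume eq: "cmod (G 0) = M"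
   have "G constant_on ball 0 r"
   proof (rule maximum_modulus_principle[OF G(1)])
    show "0 \<in> ball 0 r" using uD(1) by simp
    fix t assume "t \<in> ball (0::complex) r"
    thus "cmod (G t) \<le> cmod (G 0)" using G(2)[of t] TM[of t] eq by (cases "t = 0") auto
   qed auto
   then obtain c where c: "\<And>t. cmod t < r ==> G t = c" unfolding constant_on_def by auto
   have "\<psi> z = c" if "z \<in> coord_nbhd q r" for z
    using that T(2)[OF that] G(2)[of "q z"] c[of "q z"] by (auto simp: coord_nbhd_def)
   hence "\<forall>z. 0 < Im z --> \<psi> z = c"
    by (intro carrier_FF_zero_on_open[OF psi open_coord_nbhd[OF uD(2), of r] _ uniformizer_nonempty[OF u uD(1) order_refl]])
     (auto simp: coord_nbhd_def)
   thus False using nc by blast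
  qed
  with G0 have lt: "cmod (G 0) < M" by simp
  define m where "m = (cmod (G 0) + M) / 2"
  have m: "cmod (G 0) < m" "m < M" using lt by (auto simp: m_def)
  have "((\<lambda>t. cmod (G t)) \<longlongrightarrow> cmod (G 0)) (nhds 0)"
   using contG by (intro tendsto_intros) (simp add: isCont_def tendsto_at_iff_tendsto_nhds)
  hence "\<forall>\<^sub>F t in nhds 0. cmod (G t) < m" using m(1) by (rule order_tendstoD)
  then obtain d where d: "d > 0" "\<And>t. dist t 0 < d ==> cmod (G t) < m" unfolding eventually_nhds_metric by blast
  have "\<forall>\<^sub>F z in \<Phi>. cmod (\<psi> z) \<le> m" unfolding uD(3)
  proof (intro exI[of _ "min d r"] conjI ballI)
   fix z assume z: "z \<in> coord_nbhd q (min d r)"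
   hence "\<psi> z = T (q z)" using T(2)[of z] by (auto simp: coord_nbhd_def)
   also have "\<dots> = G (q z)" using G(2)[of "q z"] z by (auto simp: coord_nbhd_def)
   finally show "cmod (\<psi> z) \<le> m" using d(2)[of "q z"] z by (auto simp: coord_nbhd_def)
  qed (use d(1) uD(1) in auto)
  with m(2) show ?thesis by blast
 qed
 then obtain m where m: "\<And>\<Phi>. \<Phi> \<in> SP ==> m \<Phi> < M \<and> (\<forall>\<^sub>F z in \<Phi>. cmod (\<psi> z) \<le> m \<Phi>)" by metis
 obtain S where S: "finite S" "S \<subseteq> SP"
  "\<And>z. 0 < Im z ==> \<exists>ga\<in>\<Gamma>. \<exists>\<Phi>\<in>S. mob ga z \<in> {z. cmod (\<psi> z) \<le> m \<Phi>} \<or> \<Phi> = at (mob ga z)"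
  using surface_points_finite_cover[of "\<lambda>\<Phi>. {z. cmod (\<psi> z) \<le> m \<Phi>}"] m by auto
 obtain \<Phi>0 where "\<Phi>0 \<in> S" using S(3)[of \<i>] by auto
 define N where "N = Max (m ` S)"
 have N: "N < M" unfolding N_def using S(1,2) \<open>\<Phi>0 \<in> S\<close> m by (subst Max_less_iff) auto
 have "cmod (\<psi> z) \<le> N" if z: "0 < Im z" for z
 proof -
  obtain ga \<Phi> where g: "ga \<in> \<Gamma>" "\<Phi> \<in> S" "cmod (\<psi> (mob ga z)) \<le> m \<Phi> \<or> \<Phi> = at (mob ga z)"
   using S(3)[OF z] by blast
  have pos: "0 < Im (mob ga z)" using z det_Gamma[OF g(1)] by simp
  have "cmod (\<psi> (mob ga z)) \<le> m \<Phi>" using g(3)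
  proof
   assume "\<Phi> = at (mob ga z)"
   hence ev: "\<forall>\<^sub>F w in at (mob ga z). cmod (\<psi> w) \<le> m \<Phi>" using m g(2) S(2) by blast
   have "isCont \<psi> (mob ga z)" using an[OF pos] by (rule analytic_at_imp_isCont)
   hence "((\<lambda>w. cmod (\<psi> w)) \<longlongrightarrow> cmod (\<psi> (mob ga z))) (at (mob ga z))"
    by (auto simp: isCont_def intro!: tendsto_intros)
   thus ?thesis using ev by (rule tendsto_upperbound) simp
  qed
  also have "\<psi> (mob ga z) = \<psi> z" using carrier_FF_invariant[OF psi] g(1) z by (auto simp: invariant_under_def)
  also have "m \<Phi> \<le> N" unfolding N_def using S(1) g(2) by simp
  finally show ?thesis .
 qed
 moreover have "\<i> \<in> \<H>" by simp
 ultimately have "M \<le> N" unfolding M_def by (intro cSup_least) (blast, auto)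
 with N show False by simp
qed

end

section \<open>Finite generation over a rational function field\<close>

text \<open>Division by \<open>t\<close> after removal of the constant term: for holomorphic
  \<open>T\<close>, \<open>(diff_quot ^^ j) T 0\<close> is the \<open>j\<close>-th Taylor
  coefficient at 0, and the iterates also provide the cofactor of \<open>t ^ n\<close> in
  \<open>diff_quot_vanish\<close>.\<close>

definition diff_quot :: "cfn => complex => complex"
 where "diff_quot T t = (if t = 0 then deriv T 0 else (T t - T 0) / t)"

lemma diff_quot_holomorphic:
 assumes "T holomorphic_on ball 0 ro" "ro > 0"
 shows "diff_quot T holomorphic_on ball 0 ro"
proof -
 have "(\<lambda>z. if z = 0 then deriv T 0 else (T z - T 0) / (z - 0)) holomorphic_on ball 0 ro"
  by (rule pole_lemma_open[OF assms(1)]) simp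
 thus ?thesis by (rule holomorphic_transform) (simp add: diff_quot_def)
qed

lemma diff_quot_linear:
 assumes "T holomorphic_on ball 0 ro" "T' holomorphic_on ball 0 ro" "ro > 0"
 shows "diff_quot (\<lambda>t. a * T t + b * T' t) = (\<lambda>t. a * diff_quot T t + b * diff_quot T' t)"
proof
 fix t
 have "T field_differentiable (at 0)" "T' field_differentiable (at 0)"
  using assms by (auto intro!: holomorphic_on_imp_differentiable_at[of _ "ball 0 ro"])
 hence "deriv (\<lambda>t. a * T t + b * T' t) 0 = a * deriv T 0 + b * deriv T' 0"
  by (simp add: deriv_add field_differentiable_mult deriv_cmult)
 thus "diff_quot (\<lambda>t. a * T t + b * T' t) t = a * diff_quot T t + b * diff_quot T' t"
  by (simp add: diff_quot_def diff_divide_distrib add_divide_distrib algebra_simps)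
qed

lemma diff_quot_iterate:
 assumes "T holomorphic_on ball 0 ro" "T' holomorphic_on ball 0 ro" "ro > 0"
 shows "(diff_quot ^^ n) T holomorphic_on ball 0 ro"
  "(diff_quot ^^ n) (\<lambda>t. a * T t + b * T' t) = (\<lambda>t. a * (diff_quot ^^ n) T t + b * (diff_quot ^^ n) T' t)"
proof -
 have hol: "(diff_quot ^^ n) T holomorphic_on ball 0 ro" if "T holomorphic_on ball 0 ro" for n T
  using that by (induction n) (auto intro: diff_quot_holomorphic[OF _ assms(3)])
 show "(diff_quot ^^ n) T holomorphic_on ball 0 ro" by (rule hol[OF assms(1)])
 show "(diff_quot ^^ n) (\<lambda>t. a * T t + b * T' t) = (\<lambda>t. a * (diff_quot ^^ n) T t + b * (diff_quot ^^ n) T' t)"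
 proof (induction n)
  case (Suc n)
  thus ?case using diff_quot_linear[OF hol[OF assms(1)] hol[OF assms(2)] assms(3)] by simp
 qed simp
qed

lemma diff_quot_vanish:
 assumes "\<And>j. j < n ==> (diff_quot ^^ j) T 0 = 0"
 shows "t ~= 0 ==> T t = t ^ n * (diff_quot ^^ n) T t" using assms
proof (induction n)
 case (Suc n)
 have z: "(diff_quot ^^ n) T 0 = 0" by (rule Suc.prems(2)) simp
 have "T t = t ^ n * (diff_quot ^^ n) T t" using Suc.IH[OF Suc.prems(1)] Suc.prems(2) by simp
 also have "(diff_quot ^^ n) T t = t * (diff_quot ^^ Suc n) T t"
  using Suc.prems(1) z by (simp add: diff_quot_def[of "(diff_quot ^^ n) T"])
 finally show ?case by (simp add: algebra_simps)
qed simp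

text \<open>Each functional that does not vanish on the common kernel of the previous ones costs one
  more vector \<open>w\<close>, by a multiple of which it is corrected to 0. Linearity is required
  on \<open>A\<close> only, since the functionals to come are meaningful only there.\<close>

lemma finite_codim_kernel:
 fixes A :: "cfn set" and La :: "'i => cfn => complex"
 assumes "finite I" and zero: "(\<lambda>z. 0) \<in> A"
  and sub: "\<And>u v a b. u \<in> A ==> v \<in> A ==> (\<lambda>z. a * u z + b * v z) \<in> A"
  and lin: "\<And>i u v a b. i \<in> I ==> u \<in> A ==> v \<in> A ==> La i (\<lambda>z. a * u z + b * v z) = a * La i u + b * La i v"
 shows "\<exists>(n::nat) e. (\<forall>s<n. e s \<in> A) \<and> (\<forall>u\<in>A. \<exists>c. (\<lambda>z. u z - (\<Sum>s<n. c s * e s z)) \<in> A \<and>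
  (\<forall>i\<in>I. La i (\<lambda>z. u z - (\<Sum>s<n. c s * e s z)) = 0))" using assms(1) lin
proof (induction I rule: finite_induct)
 case empty
 show ?case by (intro exI[of _ 0] exI[of _ "\<lambda>_ _. 0"]) auto
next
 case (insert i I)
 then obtain n :: nat and e where ne: "\<And>s. s < n ==> e s \<in> A"
  "\<And>u. u \<in> A ==> \<exists>c. (\<lambda>z. u z - (\<Sum>s<n. c s * e s z)) \<in> A \<and>
   (\<forall>i\<in>I. La i (\<lambda>z. u z - (\<Sum>s<n. c s * e s z)) = 0)" by blast
 show ?case
 proof (cases "\<forall>u\<in>A. (\<forall>j\<in>I. La j u = 0) --> La i u = 0")
  case True
  thus ?thesis using ne by (intro exI[of _ n] exI[of _ e]) blast
 next
  case False
  then obtain w where w: "w \<in> A" "\<And>j. j \<in> I ==> La j w = 0" "La i w ~= 0" by blast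
  define e' where "e' = e(n := w)"
  have "\<exists>c. (\<lambda>z. u z - (\<Sum>s<Suc n. c s * e' s z)) \<in> A \<and>
   (\<forall>j\<in>insert i I. La j (\<lambda>z. u z - (\<Sum>s<Suc n. c s * e' s z)) = 0)" if u: "u \<in> A" for u
  proof -
   obtain c where c: "(\<lambda>z. u z - (\<Sum>s<n. c s * e s z)) \<in> A"
    "\<And>j. j \<in> I ==> La j (\<lambda>z. u z - (\<Sum>s<n. c s * e s z)) = 0" using ne(2)[OF u] by blast
   define u' where "u' = (\<lambda>z. u z - (\<Sum>s<n. c s * e s z))"
   define x where "x = La i u' / La i w"
   have eq: "(\<lambda>z. u z - (\<Sum>s<Suc n. (c(n := x)) s * e' s z)) = (\<lambda>z. 1 * u' z + (- x) * w z)"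
   proof
    fix z
    have "(\<Sum>s<n. (c(n := x)) s * e' s z) = (\<Sum>s<n. c s * e s z)" by (intro sum.cong) (auto simp: e'_def)
    thus "u z - (\<Sum>s<Suc n. (c(n := x)) s * e' s z) = 1 * u' z + (- x) * w z" by (simp add: u'_def e'_def)
   qed
   have u'A: "u' \<in> A" using c(1) by (simp add: u'_def)
   have "La j (\<lambda>z. 1 * u' z + (- x) * w z) = 0" if "j \<in> insert i I" for j unfolding insert.prems[OF that u'A w(1)]
    using that c(2) w(2,3) by (auto simp: x_def u'_def)
   thus ?thesis using sub[OF u'A w(1), of 1 "- x"] unfolding eq[symmetric] by blast
  qed
  moreover have "e' s \<in> A" if "s < Suc n" for s using that ne(1)[of s] w(1) by (auto simp: e'_def less_Suc_eq)
  ultimately show ?thesis by blast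
 qed
qed

context fuchsian
begin

section \<open>Growth spaces relative to \<open>\<phi>\<close>\<close>

lemma bounded_near_imp_analytic:
 assumes "a \<in> CF" "0 < Im z" "\<forall>\<^sub>F w in at z. cmod (a w) \<le> B"
 shows "a analytic_on {z}" "cmod (a z) \<le> B"
proof -
 show an: "a analytic_on {z}"
 proof (rule nicely_meromorphic_on_imp_analytic_at)
  show "a nicely_meromorphic_on \<H>" using assms(1) by (simp add: carrier_FF)
  show "\<not> is_pole a z"
  proof
   assume "is_pole a z"
   hence "filterlim (\<lambda>w. cmod (a w)) at_top (at z)" unfolding is_pole_def filterlim_at_infinity_conv_norm_at_top .
   hence "\<forall>\<^sub>F w in at z. B + 1 \<le> cmod (a w)" by (simp add: filterlim_at_top)
   with assms(3) have "\<forall>\<^sub>F w in at z. False" by eventually_elim simp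
   thus False by simp
  qed
 qed (use assms in auto)
 have "isCont a z" using an by (rule analytic_at_imp_isCont)
 hence "((\<lambda>w. cmod (a w)) \<longlongrightarrow> cmod (a z)) (at z)" by (auto simp: isCont_def intro!: tendsto_intros)
 thus "cmod (a z) \<le> B" using assms(3) by (rule tendsto_upperbound) simp
qed

text \<open>The Riemann-Roch space of \<open>k\<close> times the polar divisor of
  \<open>\<phi>\<close>, described by growth.\<close>

definition Lsp :: "cfn => nat => cfn set"
 where "Lsp \<phi> k = {u. mf u \<and> (\<exists>K\<ge>0. AEH z. cmod (u z) \<le> K * (1 + cmod (\<phi> z)) ^ k)}"

text \<open>The quotients \<open>u / \<phi> ^ k\<close> with \<open>u\<close> in
  \<open>Lsp \<phi> k\<close>: bounded near the poles of \<open>\<phi>\<close>, with poles only over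
  its zeros. In this normalisation multiplication by \<open>\<phi>\<close> from
  \<open>Lsp \<phi> k\<close> to \<open>Lsp \<phi> (Suc k)\<close> becomes an inclusion, so one
  family of functionals serves all \<open>k\<close>.\<close>

definition Asp :: "cfn => nat => cfn set"
 where "Asp \<phi> k = {\<alpha>. mf \<alpha> \<and> (\<lambda>z. \<alpha> z * \<phi> z ^ k) \<in> Lsp \<phi> k}"

lemma LspI:
 assumes "mf u" "AEH z. cmod (u z) \<le> K * (1 + cmod (\<phi> z)) ^ k"
 shows "u \<in> Lsp \<phi> k"
proof -
 have "AEH z. cmod (u z) \<le> max K 0 * (1 + cmod (\<phi> z)) ^ k"
  using assms(2) by eventually_elim (smt (verit) mult_right_mono zero_le_power norm_ge_zero)
 thus ?thesis unfolding Lsp_def using assms(1) by (auto intro!: exI[of _ "max K 0"])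
qed

lemma Lsp_lin:
 assumes "u \<in> Lsp \<phi> k" "v \<in> Lsp \<phi> k"
 shows "(\<lambda>z. a * u z + b * v z) \<in> Lsp \<phi> k"
proof -
 obtain K K' where K: "AEH z. cmod (u z) \<le> K * (1 + cmod (\<phi> z)) ^ k"
  "AEH z. cmod (v z) \<le> K' * (1 + cmod (\<phi> z)) ^ k" using assms by (auto simp: Lsp_def)
 have m: "mf u" "mf v" using assms by (auto simp: Lsp_def)
 show ?thesis
 proof (rule LspI)
  show "mf (\<lambda>z. a * u z + b * v z)" by (intro mf_add mf_mult mf_const m)
  show "AEH z. cmod (a * u z + b * v z) \<le> (cmod a * K + cmod b * K') * (1 + cmod (\<phi> z)) ^ k" using K
  proof eventually_elim
   case (elim z)
   have "cmod (a * u z + b * v z) \<le> cmod a * cmod (u z) + cmod b * cmod (v z)" by (metis norm_mult norm_triangle_ineq)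
   also have "\<dots> \<le> cmod a * (K * (1 + cmod (\<phi> z)) ^ k) + cmod b * (K' * (1 + cmod (\<phi> z)) ^ k)"
    using elim by (intro add_mono mult_left_mono) auto
   finally show ?case by (simp add: algebra_simps)
  qed
 qed
qed

lemma Lsp_zero: "(\<lambda>z. 0) \<in> Lsp \<phi> k" by (rule LspI[of _ 0]) (auto intro: mf_const)

lemma Lsp_sum: "(\<And>i. i \<in> I ==> u i \<in> Lsp \<phi> k) ==> (\<lambda>z. \<Sum>i\<in>I. c i * u i z) \<in> Lsp \<phi> k"
proof (induction I rule: infinite_finite_induct)
 case (insert i I)
 thus ?case using Lsp_lin[of "u i" \<phi> k "\<lambda>z. \<Sum>i\<in>I. c i * u i z" "c i" 1] by simp
qed (auto intro: Lsp_zero)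

lemma Lsp_cong:
 assumes "u \<in> Lsp \<phi> k" "AEH z. u z = v z"
 shows "v \<in> Lsp \<phi> k"
proof -
 obtain K where K: "AEH z. cmod (u z) \<le> K * (1 + cmod (\<phi> z)) ^ k" "mf u" using assms by (auto simp: Lsp_def)
 show ?thesis
 proof (rule LspI)
  show "mf v" by (rule mf_cong[OF K(2) assms(2)])
  show "AEH z. cmod (v z) \<le> K * (1 + cmod (\<phi> z)) ^ k" using K(1) assms(2) by eventually_elim simp
 qed
qed

lemma Lsp_mult:
 assumes "u \<in> Lsp \<phi> k" "v \<in> Lsp \<phi> l"
 shows "(\<lambda>z. u z * v z) \<in> Lsp \<phi> (k + l)"
proof -
 obtain K K' where K: "AEH z. cmod (u z) \<le> K * (1 + cmod (\<phi> z)) ^ k"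
  "AEH z. cmod (v z) \<le> K' * (1 + cmod (\<phi> z)) ^ l" using assms by (auto simp: Lsp_def)
 show ?thesis
 proof (rule LspI)
  show "mf (\<lambda>z. u z * v z)" using assms by (auto simp: Lsp_def intro: mf_mult)
  show "AEH z. cmod (u z * v z) \<le> (K * K') * (1 + cmod (\<phi> z)) ^ (k + l)" using K
  proof eventually_elim
   case (elim z)
   have "cmod (u z) * cmod (v z) \<le> (K * (1 + cmod (\<phi> z)) ^ k) * (K' * (1 + cmod (\<phi> z)) ^ l)"
    using elim by (intro mult_mono) (auto intro: order_trans[OF norm_ge_zero])
   thus ?case by (simp add: norm_mult power_add algebra_simps)
  qed
 qed
qed

lemma Lsp_one: "(\<lambda>z. c) \<in> Lsp \<phi> k"
proof (rule LspI[OF mf_const, of _ "cmod c"])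
 have "cmod c * 1 \<le> cmod c * (1 + cmod (\<phi> z)) ^ k" for z by (intro mult_left_mono one_le_power) auto
 thus "AEH z. cmod c \<le> cmod c * (1 + cmod (\<phi> z)) ^ k" by simp
qed

lemma Lsp_self: "mf \<phi> ==> \<phi> \<in> Lsp \<phi> 1" by (rule LspI[of _ 1]) auto

lemma Lsp_mono: "u \<in> Lsp \<phi> k ==> k \<le> l ==> u \<in> Lsp \<phi> l"
 using Lsp_mult[OF _ Lsp_one[of 1 \<phi> "l - k"], of u k] by simp

lemma Lsp_power: "u \<in> Lsp \<phi> k ==> (\<lambda>z. u z ^ n) \<in> Lsp \<phi> (n * k)"
proof (induction n)
 case (Suc n)
 thus ?case using Lsp_mult[of u \<phi> k "\<lambda>z. u z ^ n" "n * k"] by simp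
qed (use Lsp_one[of 1] in simp)

lemma Asp_lin:
 assumes "u \<in> Asp \<phi> k" "v \<in> Asp \<phi> k"
 shows "(\<lambda>z. a * u z + b * v z) \<in> Asp \<phi> k"
proof -
 have m: "mf u" "mf v" using assms by (auto simp: Asp_def)
 have "(\<lambda>z. a * (u z * \<phi> z ^ k) + b * (v z * \<phi> z ^ k)) \<in> Lsp \<phi> k"
  using assms by (intro Lsp_lin) (auto simp: Asp_def)
 moreover have "(\<lambda>z. a * (u z * \<phi> z ^ k) + b * (v z * \<phi> z ^ k)) = (\<lambda>z. (a * u z + b * v z) * \<phi> z ^ k)"
  by (simp add: algebra_simps)
 ultimately show ?thesis unfolding Asp_def by (auto intro!: mf_add mf_mult mf_const m)
qed

lemma Asp_zero: "(\<lambda>z. 0) \<in> Asp \<phi> k" unfolding Asp_def using Lsp_zero by (auto intro: mf_const)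

lemma Asp_Suc: "mf \<phi> ==> u \<in> Asp \<phi> k ==> u \<in> Asp \<phi> (Suc k)"
 unfolding Asp_def using Lsp_mult[of "\<lambda>z. u z * \<phi> z ^ k" \<phi> k \<phi> 1] Lsp_self[of \<phi>]
 by (auto simp: algebra_simps)

lemma Asp_mono: "mf \<phi> ==> u \<in> Asp \<phi> k ==> k \<le> l ==> u \<in> Asp \<phi> l"
 by (rule dec_induct[of k l "\<lambda>l. u \<in> Asp \<phi> l"]) (auto intro: Asp_Suc)

lemma Asp_sum: "(\<And>i. i \<in> I ==> u i \<in> Asp \<phi> k) ==> (\<lambda>z. \<Sum>i\<in>I. c i * u i z) \<in> Asp \<phi> k"
proof (induction I rule: infinite_finite_induct)
 case (insert i I)
 thus ?case using Asp_lin[of "u i" \<phi> k "\<lambda>z. \<Sum>i\<in>I. c i * u i z" "c i" 1] by simp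
qed (auto intro: Asp_zero)

text \<open>
 At a pole of order \<open>n\<close> of \<open>\<phi>\<close>, the functionals are the first \<open>n\<close> Taylor coefficients; the
 neighbourhood on which they control the function depends on \<open>\<phi>\<close> only.
\<close>

lemma local_functionals:
 assumes Phi: "\<Phi> \<in> SP" and phi: "\<phi> \<in> CF" "\<phi> ~= FF0"
 shows "\<exists>N n La. (\<forall>\<^sub>F z in \<Phi>. z \<in> N) \<and>
  (\<forall>k u v a b j. u \<in> Asp \<phi> k --> v \<in> Asp \<phi> k -->
    La j (\<lambda>z. a * u z + b * v z) = a * La j u + (b::complex) * La j v) \<and>
  (\<forall>k u. u \<in> Asp \<phi> (Suc k) --> (\<forall>j<(n::nat). La j u = 0) -->
    (\<exists>K. \<forall>z\<in>N. cmod (on_uhp (\<lambda>z. u z * \<phi> z ^ Suc k) z) \<le> K * (1 + cmod (\<phi> z)) ^ k))"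
proof -
 obtain q r where u: "uniformizer \<Gamma> \<Phi> q r"
  and gr: "\<And>\<psi>. \<psi> \<in> CF ==> \<exists>C n. \<forall>\<^sub>F z in \<Phi>. \<psi> analytic_on {z} \<and> cmod (\<psi> z) \<le> C / cmod (q z) ^ n"
  using chart_exists[OF Phi] by metis
 note uD = uniformizerD[OF u]
 obtain ro0 U m where nf: "0 < ro0" "ro0 \<le> r" "U holomorphic_on ball 0 ro0" "\<And>t. cmod t < ro0 ==> U t ~= 0"
  "\<And>z. z \<in> coord_nbhd q ro0 ==> \<phi> analytic_on {z}"
  "\<And>z. z \<in> coord_nbhd q ro0 ==> \<phi> z = U (q z) * (q z) powi m"
  using chart_normal_form[OF u gr[OF phi(1)] phi] by metis
 have contU: "continuous_on (cball 0 (ro0/2)) U"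
  by (rule continuous_on_subset[OF holomorphic_on_imp_continuous_on[OF nf(3)]]) (use nf(1) in auto)
 have "bounded (U ` cball 0 (ro0/2))" by (intro compact_imp_bounded compact_continuous_image contU) auto
 then obtain C where C: "C > 0" "\<And>t. cmod t \<le> ro0/2 ==> cmod (U t) \<le> C" unfolding bounded_pos by auto
 have phi_mf: "mf \<phi>" by (rule carrier_imp_mf[OF phi(1)])
 have an_u: "on_uhp (\<lambda>z. w z * \<phi> z ^ k) z = on_uhp w z * \<phi> z ^ k"
  if "mf w" "on_uhp w analytic_on {z}" "\<phi> analytic_on {z}" "0 < Im z" for w k z
 proof -
  have "on_uhp (\<lambda>z. w z * \<phi> z ^ k) = on_uhp (\<lambda>z. on_uhp w z * \<phi> z ^ k)"
   by (rule on_uhp_cong, rule eventually_mono[OF mf_ae[OF that(1)]]) simp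
  moreover have "(\<lambda>z. on_uhp w z * \<phi> z ^ k) analytic_on {z}" by (intro analytic_intros that)
  ultimately show ?thesis using on_uhp_analytic(1) that(4) by metis
 qed
 have evz: "\<forall>\<^sub>F w in at z. P w" if "AEH w. P w" "0 < Im z" for P z
  by (rule eventually_cosparse_imp_eventually_at[OF that(1)]) (use that(2) in auto)
 show ?thesis
 proof (cases "m \<ge> 0")
  case True
  define N where "N = coord_nbhd q (ro0/2)"
  have evN: "\<forall>\<^sub>F z in \<Phi>. z \<in> N" unfolding uD(3) N_def using nf by (intro exI[of _ "ro0/2"]) auto
  define B where "B = C * ro0 ^ nat m"
  have B: "cmod (\<phi> z) \<le> B" if "z \<in> N" for z
  proof -
   have z: "z \<in> coord_nbhd q ro0" "cmod (q z) \<le> ro0/2" "cmod (q z) \<le> ro0"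
    using that nf(1) by (auto simp: N_def coord_nbhd_def)
   have "cmod (\<phi> z) = cmod (U (q z)) * cmod (q z) ^ nat m"
    unfolding nf(6)[OF z(1)] using True by (simp add: norm_mult power_int_def norm_power)
   also have "\<dots> \<le> C * ro0 ^ nat m" using C(1) C(2)[OF z(2)] z(3) by (intro mult_mono power_mono) auto
   finally show ?thesis by (simp add: B_def)
  qed
  have "\<exists>K. \<forall>z\<in>N. cmod (on_uhp (\<lambda>z. w z * \<phi> z ^ Suc k) z) \<le> K * (1 + cmod (\<phi> z)) ^ k"
   if w: "w \<in> Asp \<phi> (Suc k)" for w k
  proof -
   define v where "v = on_uhp (\<lambda>z. w z * \<phi> z ^ Suc k)"
   obtain K where K: "K \<ge> 0" "AEH z. cmod (w z * \<phi> z ^ Suc k) \<le> K * (1 + cmod (\<phi> z)) ^ Suc k"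
    using w unfolding Asp_def Lsp_def by blast
   have mfw: "mf (\<lambda>z. w z * \<phi> z ^ Suc k)" using w unfolding Asp_def Lsp_def by blast
   have aev: "AEH z. cmod (v z) \<le> K * (1 + cmod (\<phi> z)) ^ Suc k"
    unfolding v_def using K(2) mf_ae[OF mfw] by eventually_elim simp
   have vc: "v \<in> CF" unfolding v_def by (rule mf_carrier[OF mfw])
   show ?thesis unfolding v_def[symmetric]
   proof (intro exI[of _ "K * (1 + B)"] ballI)
    fix z assume z: "z \<in> N"
    hence z0: "0 < Im z" "z \<in> coord_nbhd q ro0" using nf(1) by (auto simp: N_def coord_nbhd_def)
    have "\<forall>\<^sub>F w in at z. w \<in> N"
     using z by (intro eventually_at_in_open') (auto simp: N_def intro: open_coord_nbhd[OF uD(2)])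
    with evz[OF aev z0(1)] have "\<forall>\<^sub>F w in at z. cmod (v w) \<le> K * (1 + B) ^ Suc k"
    proof eventually_elim
     case (elim w)
     have "K * (1 + cmod (\<phi> w)) ^ Suc k \<le> K * (1 + B) ^ Suc k"
      using B[OF elim(2)] K(1) by (intro mult_left_mono power_mono) auto
     with elim show ?case by simp
    qed
    hence an: "v analytic_on {z}" by (rule bounded_near_imp_analytic(1)[OF vc z0(1)])
    have "cmod (v z) \<le> K * (1 + cmod (\<phi> z)) ^ Suc k" by (rule ae_le_imp_le_analytic[OF aev an nf(5)[OF z0(2)] z0(1)])
    also have "\<dots> = K * (1 + cmod (\<phi> z)) * (1 + cmod (\<phi> z)) ^ k" by simp
    also have "\<dots> \<le> K * (1 + B) * (1 + cmod (\<phi> z)) ^ k"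
     using B[OF z] K(1) by (intro mult_right_mono mult_left_mono) auto
    finally show "cmod (v z) \<le> K * (1 + B) * (1 + cmod (\<phi> z)) ^ k" .
   qed
  qed
  thus ?thesis using evN by (intro exI[of _ N] exI[of _ 0] exI[of _ "\<lambda>_ _. 0"]) auto
 next
  case False
  define n where "n = nat (- m)"
  have n: "n \<ge> 1" using False by (simp add: n_def)
  have "\<exists>t\<in>cball 0 (ro0/2). \<forall>s\<in>cball 0 (ro0/2). cmod (U t) \<le> cmod (U s)"
   by (rule continuous_attains_inf) (use nf(1) contU in \<open>auto intro!: continuous_intros\<close>)
  then obtain t0 where t0: "cmod t0 \<le> ro0/2" "\<And>s. cmod s \<le> ro0/2 ==> cmod (U t0) \<le> cmod (U s)" by auto
  define c where "c = cmod (U t0)"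
  have c: "c > 0" using nf(4)[of t0] t0(1) nf(1) by (simp add: c_def)
  \<comment> \<open>On this disc \<open>|\<phi>| \<ge> 1\<close>, because
    \<open>|q| ^ n \<le> |q| < c \<le> |U|\<close>.\<close>
  define ro where "ro = min (ro0/2) (min c 1)"
  have rho: "0 < ro" "ro \<le> r" "ro \<le> ro0/2" "ro \<le> ro0" "ro \<le> c" "ro \<le> 1" using nf c by (auto simp: ro_def)
  have sub: "z \<in> coord_nbhd q ro0" if "z \<in> coord_nbhd q ro" for z using that rho by (auto simp: coord_nbhd_def)
  have absphi: "cmod (\<phi> z) = cmod (U (q z)) / cmod (q z) ^ n" if "z \<in> coord_nbhd q ro" for z
   unfolding nf(6)[OF sub[OF that]] using False
   by (simp add: norm_mult power_int_def norm_power n_def norm_inverse divide_inverse power_inverse)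
  have phi1: "1 \<le> cmod (\<phi> z)" if z: "z \<in> coord_nbhd q ro" for z
  proof -
   have qz: "0 < cmod (q z)" "cmod (q z) < ro" using z by (auto simp: coord_nbhd_def)
   have "cmod (q z) ^ n \<le> cmod (q z) ^ 1" using qz rho n by (intro power_decreasing) auto
   also have "\<dots> \<le> c" using qz rho by simp
   also have "\<dots> \<le> cmod (U (q z))" unfolding c_def using t0(2) qz rho by simp
   finally show ?thesis unfolding absphi[OF z] using qz by simp
  qed
  \<comment> \<open>The value 0 outside the disc makes the local function \<open>G\<close> unique,
    so that the functionals defined from it by choice are linear.\<close>
  define rep where "rep w G \<longleftrightarrow> G holomorphic_on ball 0 ro \<and> (\<forall>t. ro \<le> cmod t --> G t = 0) \<and>
    (\<forall>z\<in>coord_nbhd q ro. on_uhp w z = G (q z))" for w G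
  have A: "\<exists>K. \<forall>z\<in>coord_nbhd q ro. on_uhp w analytic_on {z} \<and> cmod (on_uhp w z) \<le> K"
   if w: "w \<in> Asp \<phi> k" for w k
  proof -
   obtain K where K: "K \<ge> 0" "AEH z. cmod (w z * \<phi> z ^ k) \<le> K * (1 + cmod (\<phi> z)) ^ k"
    using w unfolding Asp_def Lsp_def by blast
   have mfw: "mf w" using w unfolding Asp_def by blast
   have "on_uhp w analytic_on {z} \<and> cmod (on_uhp w z) \<le> K * 2 ^ k" if z: "z \<in> coord_nbhd q ro" for z
   proof -
    have z0: "0 < Im z" using z by (simp add: coord_nbhd_def)
    have "\<forall>\<^sub>F y in at z. y \<in> coord_nbhd q ro"
     using z by (intro eventually_at_in_open') (auto intro: open_coord_nbhd[OF uD(2)])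
    with evz[OF K(2) z0] evz[OF mf_ae[OF mfw] z0]
    have "\<forall>\<^sub>F y in at z. cmod (on_uhp w y) \<le> K * 2 ^ k"
    proof eventually_elim
     case (elim y)
     have p1: "1 \<le> cmod (\<phi> y)" by (rule phi1[OF elim(3)])
     have "cmod (w y) * cmod (\<phi> y) ^ k \<le> K * (1 + cmod (\<phi> y)) ^ k"
      using elim(1) by (simp add: norm_mult norm_power)
     also have "\<dots> \<le> K * (2 * cmod (\<phi> y)) ^ k" using p1 K(1) by (intro mult_left_mono power_mono) auto
     also have "\<dots> = (K * 2 ^ k) * cmod (\<phi> y) ^ k" by (simp add: power_mult_distrib)
     finally have "cmod (w y) \<le> K * 2 ^ k"
      by (rule mult_right_le_imp_le) (use p1 in \<open>auto intro!: zero_less_power simp: less_le_trans[OF zero_less_one]\<close>)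
     thus ?case using elim(2) by simp
    qed
    thus ?thesis using bounded_near_imp_analytic[OF mf_carrier[OF mfw] z0] by blast
   qed
   thus ?thesis by blast
  qed
  have ex: "\<exists>G. rep w G" if w: "w \<in> Asp \<phi> k" for w k
  proof -
   obtain K where K: "\<And>z. z \<in> coord_nbhd q ro ==> on_uhp w analytic_on {z} \<and> cmod (on_uhp w z) \<le> K"
    using A[OF w] by blast
   have wc: "on_uhp w \<in> CF" using w by (auto simp: Asp_def intro: mf_carrier)
   have "on_uhp w holomorphic_on coord_nbhd q ro"
    by (rule analytic_imp_holomorphic, subst analytic_on_analytic_at) (use K in auto)
   then obtain T where T: "T holomorphic_on ball 0 ro - {0}" "\<And>z. z \<in> coord_nbhd q ro ==> on_uhp w z = T (q z)"
    using uD(5)[OF rho(1,2) _ carrier_FF_invariant[OF wc]] by blast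
   have "cmod (T t) \<le> K" if t: "t ~= 0" "cmod t < ro" for t
   proof -
    obtain z where z: "0 < Im z" "q z = t" using uD(4)[of t] t rho(2) by force
    hence "z \<in> coord_nbhd q ro" using t by (simp add: coord_nbhd_def)
    thus ?thesis using K T(2) z(2) by metis
   qed
   then obtain G where G: "G holomorphic_on ball 0 ro" "\<And>t. t ~= 0 ==> cmod t < ro ==> G t = T t"
    using bounded_holomorphic_extension[OF rho(1) T(1)] by blast
   have "rep w (\<lambda>t. if cmod t < ro then G t else 0)" unfolding rep_def
   proof (intro conjI)
    show "(\<lambda>t. if cmod t < ro then G t else 0) holomorphic_on ball 0 ro" by (rule holomorphic_transform[OF G(1)]) simp
   qed (use G(2) T(2) in \<open>auto simp: coord_nbhd_def\<close>)
   thus ?thesis by blast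
  qed
  have uniq: "G = G'" if "rep w G" "rep w G'" for w G G'
  proof
   fix t
   have ne: "G t = G' t" if t: "t ~= 0" "cmod t < ro" for t
   proof -
    obtain z where z: "0 < Im z" "q z = t" using uD(4)[of t] t rho(2) by force
    hence "z \<in> coord_nbhd q ro" using t by (simp add: coord_nbhd_def)
    thus ?thesis using \<open>rep w G\<close> \<open>rep w G'\<close> z(2) unfolding rep_def by metis
   qed
   have "G 0 = G' 0"
   proof -
    have "isCont G 0" "isCont G' 0" using that rho(1) unfolding rep_def
     by (auto intro!: continuous_on_interior[OF holomorphic_on_imp_continuous_on] simp: interior_open)
    hence l: "(G \<longlongrightarrow> G 0) (at 0)" "(G' \<longlongrightarrow> G' 0) (at 0)" by (auto simp: isCont_def)
    have "\<forall>\<^sub>F t in at 0. t \<in> ball 0 ro - {0::complex}" using rho(1) by (intro eventually_at_in_open) auto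
    hence "\<forall>\<^sub>F t in at 0. G t = G' t" by eventually_elim (use ne in auto)
    hence "(G \<longlongrightarrow> G' 0) (at 0)" using l(2) by (simp add: tendsto_cong)
    thus ?thesis using l(1) tendsto_unique by (metis at_neq_bot)
   qed
   thus "G t = G' t" using ne[of t] that by (cases "t = 0"; cases "cmod t < ro") (auto simp: rep_def not_less)
  qed
  define T where "T w = (SOME G. rep w G)" for w
  have T: "rep w (T w)" if "w \<in> Asp \<phi> k" for w k unfolding T_def using ex[OF that] by (rule someI_ex)
  define La where "La j w = (diff_quot ^^ j) (T w) 0" for j w
  define N where "N = coord_nbhd q (ro/2)"
  have evN: "\<forall>\<^sub>F z in \<Phi>. z \<in> N" unfolding uD(3) N_def using rho by (intro exI[of _ "ro/2"]) auto
  have lin: "La j (\<lambda>z. a * w z + b * v z) = a * La j w + b * La j v"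
   if w: "w \<in> Asp \<phi> k" and v: "v \<in> Asp \<phi> k" for w v a b j k
  proof -
   note Tw = T[OF w, unfolded rep_def] and Tv = T[OF v, unfolded rep_def]
   have "rep (\<lambda>z. a * w z + b * v z) (\<lambda>t. a * T w t + b * T v t)" unfolding rep_def
   proof (intro conjI ballI allI impI)
    show "(\<lambda>t. a * T w t + b * T v t) holomorphic_on ball 0 ro" using Tw Tv by (intro holomorphic_intros) auto
    show "a * T w t + b * T v t = 0" if "ro \<le> cmod t" for t using Tw Tv that by simp
    fix z assume z: "z \<in> coord_nbhd q ro"
    have an: "on_uhp w analytic_on {z}" "on_uhp v analytic_on {z}" using A[OF w] A[OF v] z by auto
    have "on_uhp (\<lambda>z. a * w z + b * v z) = on_uhp (\<lambda>z. a * on_uhp w z + b * on_uhp v z)"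
     by (rule on_uhp_cong, rule eventually_mono[OF eventually_conj[OF mf_ae[of w] mf_ae[of v]]])
      (use w v in \<open>auto simp: Asp_def\<close>)
    moreover have "(\<lambda>z. a * on_uhp w z + b * on_uhp v z) analytic_on {z}" by (intro analytic_intros an)
    ultimately have "on_uhp (\<lambda>z. a * w z + b * v z) z = a * on_uhp w z + b * on_uhp v z"
     using on_uhp_analytic(1) z by (metis (no_types, lifting) coord_nbhd_def mem_Collect_eq)
    thus "on_uhp (\<lambda>z. a * w z + b * v z) z = a * T w (q z) + b * T v (q z)" using Tw Tv z by simp
   qed
   hence "T (\<lambda>z. a * w z + b * v z) = (\<lambda>t. a * T w t + b * T v t)" using uniq T[OF Asp_lin[OF w v]] by blast
   thus ?thesis unfolding La_def using diff_quot_iterate(2)[of "T w" ro "T v" j a b] Tw Tv rho(1) by simp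
  qed
  \<comment> \<open>If the first \<open>n\<close> coefficients vanish, \<open>w\<close> is divisible
    by \<open>q ^ n\<close>, which cancels the pole of one factor \<open>\<phi>\<close>; the
    remaining \<open>k\<close> factors give the growth claimed.\<close>
  have ker: "\<exists>K. \<forall>z\<in>N. cmod (on_uhp (\<lambda>z. w z * \<phi> z ^ Suc k) z) \<le> K * (1 + cmod (\<phi> z)) ^ k"
   if w: "w \<in> Asp \<phi> (Suc k)" and van: "\<And>j. j < n ==> La j w = 0" for w k
  proof -
   note Tw = T[OF w, unfolded rep_def]
   define V where "V = (diff_quot ^^ n) (T w)"
   have V: "V holomorphic_on ball 0 ro" unfolding V_def by (rule diff_quot_iterate(1)) (use Tw rho in auto)
   have "continuous_on (cball 0 (ro/2)) V"
    by (rule continuous_on_subset[OF holomorphic_on_imp_continuous_on[OF V]]) (use rho in auto)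
   hence "bounded (V ` cball 0 (ro/2))" by (intro compact_imp_bounded compact_continuous_image) auto
   then obtain B where B: "B > 0" "\<And>t. cmod t \<le> ro/2 ==> cmod (V t) \<le> B" unfolding bounded_pos by auto
   show ?thesis
   proof (intro exI[of _ "B * C"] ballI)
    fix z assume zN: "z \<in> N"
    hence z: "z \<in> coord_nbhd q ro" "cmod (q z) \<le> ro/2" "q z ~= 0" "0 < Im z" "cmod (q z) \<le> ro0/2"
     using rho by (auto simp: N_def coord_nbhd_def)
    have anw: "on_uhp w analytic_on {z}" using A[OF w] z(1) by blast
    have "on_uhp w z = T w (q z)" using Tw z(1) by blast
    also have "\<dots> = q z ^ n * V (q z)" unfolding V_def using van z(3) by (intro diff_quot_vanish) (auto simp: La_def)
    finally have "cmod (on_uhp w z) * cmod (\<phi> z) = cmod (q z) ^ n * cmod (V (q z)) * (cmod (U (q z)) / cmod (q z) ^ n)"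
     using absphi[OF z(1)] by (simp add: norm_mult norm_power)
    also have "\<dots> = cmod (V (q z)) * cmod (U (q z))" using z(3) by simp
    also have "\<dots> \<le> B * C" using B(1) B(2)[OF z(2)] C(2)[OF z(5)] by (intro mult_mono) auto
    finally have le: "cmod (on_uhp w z) * cmod (\<phi> z) \<le> B * C" .
    have "on_uhp (\<lambda>z. w z * \<phi> z ^ Suc k) z = on_uhp w z * \<phi> z ^ Suc k"
     by (rule an_u[OF _ anw nf(5)[OF sub[OF z(1)]] z(4)]) (use w in \<open>auto simp: Asp_def\<close>)
    hence "cmod (on_uhp (\<lambda>z. w z * \<phi> z ^ Suc k) z) = (cmod (on_uhp w z) * cmod (\<phi> z)) * cmod (\<phi> z) ^ k"
     by (simp add: norm_mult norm_power)
    also have "\<dots> \<le> (B * C) * (1 + cmod (\<phi> z)) ^ k" using B(1) C(1) by (intro mult_mono[OF le] power_mono) auto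
    finally show "cmod (on_uhp (\<lambda>z. w z * \<phi> z ^ Suc k) z) \<le> B * C * (1 + cmod (\<phi> z)) ^ k" .
   qed
  qed
  have "\<forall>k u v a b j. u \<in> Asp \<phi> k --> v \<in> Asp \<phi> k -->
    La j (\<lambda>z. a * u z + b * v z) = a * La j u + b * La j v" by (intro allI impI) (rule lin)
  moreover have "\<forall>k u. u \<in> Asp \<phi> (Suc k) --> (\<forall>j<n. La j u = 0) -->
    (\<exists>K. \<forall>z\<in>N. cmod (on_uhp (\<lambda>z. u z * \<phi> z ^ Suc k) z) \<le> K * (1 + cmod (\<phi> z)) ^ k)"
   by (intro allI impI) (rule ker, assumption, blast)
  ultimately show ?thesis by (intro exI[of _ N, OF exI[of _ n, OF exI[of _ La]]] conjI evN)
 qed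
qed

lemma evz_ae: "AEH z. P z ==> 0 < Im z ==> \<forall>\<^sub>F w in at z. P w"
 by (rule eventually_cosparse_imp_eventually_at) auto

text \<open>The union of the local functionals over a finite cover obtained from
  \<open>\<phi>\<close> alone. They do not depend on \<open>k\<close>; this uniformity is what makes
  the growth spaces finitely generated over the polynomials in \<open>\<phi>\<close>.\<close>

lemma global_functionals:
 assumes phi: "\<phi> \<in> CF" "\<phi> ~= FF0"
 shows "\<exists>(I :: (complex filter \<times> nat) set) La. finite I \<and>
  (\<forall>k u v a b i. u \<in> Asp \<phi> k --> v \<in> Asp \<phi> k -->
    La i (\<lambda>z. a * u z + b * v z) = a * La i u + (b::complex) * La i v) \<and>
  (\<forall>k u. u \<in> Asp \<phi> (Suc k) --> (\<forall>i\<in>I. La i u = 0) --> (\<lambda>z. u z * \<phi> z ^ Suc k) \<in> Lsp \<phi> k)"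
proof -
 define good where "good \<Phi> N n La \<longleftrightarrow> (\<forall>\<^sub>F z in \<Phi>. z \<in> N) \<and>
  (\<forall>k u v a b j. u \<in> Asp \<phi> k --> v \<in> Asp \<phi> k -->
    La j (\<lambda>z. a * u z + b * v z) = a * La j u + (b::complex) * La j v) \<and>
  (\<forall>k u. u \<in> Asp \<phi> (Suc k) --> (\<forall>j<(n::nat). La j u = 0) -->
    (\<exists>K. \<forall>z\<in>N. cmod (on_uhp (\<lambda>z. u z * \<phi> z ^ Suc k) z) \<le> K * (1 + cmod (\<phi> z)) ^ k))" for \<Phi> N n La
 have "\<forall>\<Phi>\<in>SP. \<exists>N n La. good \<Phi> N n La" unfolding good_def by (intro ballI local_functionals phi)
 then obtain N n La where "\<forall>\<Phi>\<in>SP. good \<Phi> (N \<Phi>) (n \<Phi>) (La \<Phi>)" by metis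
 hence F: "\<forall>\<^sub>F z in \<Phi>. z \<in> N \<Phi>"
  "u \<in> Asp \<phi> k ==> v \<in> Asp \<phi> k ==>
    La \<Phi> j (\<lambda>z. a * u z + b * v z) = a * La \<Phi> j u + (b::complex) * La \<Phi> j v"
  "u \<in> Asp \<phi> (Suc k) ==> (\<forall>j<n \<Phi>. La \<Phi> j u = 0) ==>
    \<exists>K. \<forall>z\<in>N \<Phi>. cmod (on_uhp (\<lambda>z. u z * \<phi> z ^ Suc k) z) \<le> K * (1 + cmod (\<phi> z)) ^ k"
  if "\<Phi> \<in> SP" for \<Phi> k u v a b j using that unfolding good_def by blast+
 obtain S where S: "finite S" "S \<subseteq> SP"
  "\<And>z. 0 < Im z ==> \<exists>ga\<in>\<Gamma>. \<exists>\<Phi>\<in>S. mob ga z \<in> N \<Phi> \<or> \<Phi> = at (mob ga z)"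
  using surface_points_finite_cover[of N, OF F(1)] by blast
 define La' where "La' i u = (if fst i \<in> S then La (fst i) (snd i) u else 0)" for i u
 show ?thesis
 proof (intro exI[of _ "Sigma S (\<lambda>\<Phi>. {..<n \<Phi>})"] exI[of _ La'] conjI allI impI)
  show "finite (SIGMA \<Phi>:S. {..<n \<Phi>})" using S(1) by blast
  show "La' i (\<lambda>z. a * u z + b * v z) = a * La' i u + b * La' i v"
   if "u \<in> Asp \<phi> k" "v \<in> Asp \<phi> k" for k u v a b i
  proof (cases "fst i \<in> S")
   case True
   thus ?thesis using F(2)[OF _ that, of "fst i"] S(2) by (auto simp: La'_def)
  qed (simp add: La'_def)
  fix k u assume u: "u \<in> Asp \<phi> (Suc k)" and van: "\<forall>i\<in>SIGMA \<Phi>:S. {..<n \<Phi>}. La' i u = 0"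
  have m: "mf (\<lambda>z. u z * \<phi> z ^ Suc k)" using u unfolding Asp_def Lsp_def by blast
  have "\<exists>K. AEH z. cmod (on_uhp (\<lambda>z. u z * \<phi> z ^ Suc k) z) \<le> K * (1 + cmod (\<phi> z)) ^ k"
  proof (rule cover_to_global[OF mf_carrier[OF m] phi(1) S(1,3)])
   fix \<Phi> assume Phi: "\<Phi> \<in> S"
   thus "\<forall>\<^sub>F z in \<Phi>. z \<in> N \<Phi>" using S(2) F(1) by blast
   have "\<forall>j<n \<Phi>. La \<Phi> j u = 0" using van Phi unfolding La'_def by force
   thus "\<exists>K. \<forall>z\<in>N \<Phi>. cmod (on_uhp (\<lambda>z. u z * \<phi> z ^ Suc k) z) \<le> K * (1 + cmod (\<phi> z)) ^ k"
    by (rule F(3)[OF subsetD[OF S(2) Phi] u])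
  qed
  then obtain K where "AEH z. cmod (on_uhp (\<lambda>z. u z * \<phi> z ^ Suc k) z) \<le> K * (1 + cmod (\<phi> z)) ^ k" ..
  hence "on_uhp (\<lambda>z. u z * \<phi> z ^ Suc k) \<in> Lsp \<phi> k" by (intro LspI carrier_imp_mf mf_carrier[OF m])
  thus "(\<lambda>z. u z * \<phi> z ^ Suc k) \<in> Lsp \<phi> k" by (rule Lsp_cong[OF _ mf_ae[OF m]])
 qed
qed

lemma FF_nonzero_ae:
 assumes "\<phi> \<in> CF" "\<phi> ~= FF0"
 shows "AEH z. \<phi> z ~= 0"
proof (rule ccontr)
 assume "\<not> ?thesis"
 hence ae: "AEH z. \<phi> z = 0" using mf_zero_or_nonzero[OF carrier_imp_mf[OF assms(1)], of 0] by blast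
 have "on_uhp \<phi> = on_uhp (\<lambda>z. 0)" by (rule on_uhp_cong[OF ae])
 thus False using assms on_uhp_carrier_FF[OF assms(1)] by (simp add: FF_simps)
qed

lemma Asp_of_Lsp:
 assumes phi: "\<phi> \<in> CF" "\<phi> ~= FF0" and u: "u \<in> Lsp \<phi> k"
 shows "(\<lambda>z. u z / \<phi> z ^ k) \<in> Asp \<phi> k"
proof -
 have mu: "mf u" using u by (simp add: Lsp_def)
 have "(\<lambda>z. u z / \<phi> z ^ k * \<phi> z ^ k) \<in> Lsp \<phi> k"
  by (rule Lsp_cong[OF u], rule eventually_mono[OF FF_nonzero_ae[OF phi]]) simp
 thus ?thesis unfolding Asp_def using mu carrier_imp_mf[OF phi(1)] by (auto intro: mf_divide mf_power)
qed

text \<open>By induction: \<open>Lsp \<phi> 0\<close> consists of constants, and finitely many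
  functions \<open>e s * \<phi> ^ Suc k\<close> span \<open>Lsp \<phi> (Suc k)\<close> modulo
  \<open>Lsp \<phi> k\<close>, since whatever all functionals annihilate has growth of order
  \<open>k\<close>.\<close>

lemma Lsp_finite_span:
 assumes phi: "\<phi> \<in> CF" "\<phi> ~= FF0"
 shows "\<exists>(n::nat) e. (\<forall>s<n. e s \<in> Lsp \<phi> k) \<and>
  (\<forall>u\<in>Lsp \<phi> k. \<exists>c. AEH z. u z = (\<Sum>s<n. c s * e s z))"
proof (induction k)
 case 0
 have "\<exists>c. AEH z. u z = (\<Sum>s<(1::nat). c s * 1)" if u: "u \<in> Lsp \<phi> 0" for u
 proof -
  have mu: "mf u" using u by (simp add: Lsp_def)
  obtain K where "AEH z. cmod (u z) \<le> K" using u by (auto simp: Lsp_def)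
  hence "AEH z. cmod (on_uhp u z) \<le> K" using mf_ae[OF mu] by eventually_elim simp
  then obtain c where c: "\<And>z. 0 < Im z ==> on_uhp u z = c" using bounded_imp_constant[OF mf_carrier[OF mu]] by blast
  have "AEH z. z \<in> \<H>" by (rule eventually_in_cosparse) (auto simp: open_uhp)
  with mf_ae[OF mu] have "AEH z. u z = (\<Sum>s<(1::nat). (\<lambda>_. c) s * 1)" by eventually_elim (use c in auto)
  thus ?thesis by (rule exI[of _ "\<lambda>_. c"])
 qed
 thus ?case using Lsp_one[of 1 \<phi> 0] by (intro exI[of _ "1::nat"] exI[of _ "\<lambda>_ _. 1"]) auto
next
 case (Suc k)
 obtain n0 e0 where e0: "\<And>s. s < (n0::nat) ==> e0 s \<in> Lsp \<phi> k"
  "\<And>u. u \<in> Lsp \<phi> k ==> \<exists>c. AEH z. u z = (\<Sum>s<n0. c s * e0 s z)" using Suc by blast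
 obtain I :: "(complex filter \<times> nat) set" and La where L: "finite I"
  "\<And>k u v a b i. u \<in> Asp \<phi> k ==> v \<in> Asp \<phi> k ==>
    La i (\<lambda>z. a * u z + b * v z) = a * La i u + (b::complex) * La i v"
  "\<And>k u. u \<in> Asp \<phi> (Suc k) ==> (\<forall>i\<in>I. La i u = 0) ==> (\<lambda>z. u z * \<phi> z ^ Suc k) \<in> Lsp \<phi> k"
  using global_functionals[OF phi] by blast
 obtain n :: nat and e where e: "\<And>s. s < n ==> e s \<in> Asp \<phi> (Suc k)"
  "\<And>u. u \<in> Asp \<phi> (Suc k) ==> \<exists>c. (\<lambda>z. u z - (\<Sum>s<n. c s * e s z)) \<in> Asp \<phi> (Suc k) \<and>
   (\<forall>i\<in>I. La i (\<lambda>z. u z - (\<Sum>s<n. c s * e s z)) = 0)"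
 proof -
  have "\<exists>(n::nat) e. (\<forall>s<n. e s \<in> Asp \<phi> (Suc k)) \<and> (\<forall>u\<in>Asp \<phi> (Suc k).
    \<exists>c. (\<lambda>z. u z - (\<Sum>s<n. c s * e s z)) \<in> Asp \<phi> (Suc k) \<and>
   (\<forall>i\<in>I. La i (\<lambda>z. u z - (\<Sum>s<n. c s * e s z)) = 0))"
   by (rule finite_codim_kernel[OF L(1) Asp_zero]) (assumption | rule Asp_lin L(2))+
  thus ?thesis using that by blast
 qed
 define E where "E s = (if s < n then (\<lambda>z. e s z * \<phi> z ^ Suc k) else e0 (s - n))" for s
 have EL: "E s \<in> Lsp \<phi> (Suc k)" if "s < n + n0" for s
  using that e(1)[of s] Lsp_mono[OF e0(1)[of "s - n"], of "Suc k"] by (auto simp: E_def Asp_def)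
 have "\<exists>c. AEH z. u z = (\<Sum>s<n+n0. c s * E s z)" if u: "u \<in> Lsp \<phi> (Suc k)" for u
 proof -
  define \<alpha> where "\<alpha> = (\<lambda>z. u z / \<phi> z ^ Suc k)"
  have "\<alpha> \<in> Asp \<phi> (Suc k)" unfolding \<alpha>_def by (rule Asp_of_Lsp[OF phi u])
  then obtain c where c: "(\<lambda>z. \<alpha> z - (\<Sum>s<n. c s * e s z)) \<in> Asp \<phi> (Suc k)"
   "\<forall>i\<in>I. La i (\<lambda>z. \<alpha> z - (\<Sum>s<n. c s * e s z)) = 0" using e(2) by blast
  obtain d where d: "AEH z. (\<alpha> z - (\<Sum>s<n. c s * e s z)) * \<phi> z ^ Suc k = (\<Sum>s<n0. d s * e0 s z)"
   using e0(2)[OF L(3)[OF c]] by blast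
  define c' where "c' s = (if s < n then c s else d (s - n))" for s
  have split: "(\<Sum>s<n+n0. c' s * E s z) = (\<Sum>s<n. c s * e s z) * \<phi> z ^ Suc k + (\<Sum>s<n0. d s * e0 s z)" for z
  proof -
   have "(\<Sum>s<n+n0. c' s * E s z) = (\<Sum>s<n. c' s * E s z) + (\<Sum>s=n..<n+n0. c' s * E s z)"
    using sum.atLeastLessThan_concat[of 0 n "n + n0" "\<lambda>s. c' s * E s z"] by (simp add: atLeast0LessThan)
   also have "(\<Sum>s=n..<n+n0. c' s * E s z) = (\<Sum>s<n0. c' (s + n) * E (s + n) z)"
    using sum.shift_bounds_nat_ivl[of "\<lambda>s. c' s * E s z" 0 n n0] by (simp add: atLeast0LessThan add.commute)
   finally show ?thesis by (simp add: c'_def E_def sum_distrib_right mult.assoc)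
  qed
  have "AEH z. u z = (\<Sum>s<n+n0. c' s * E s z)" using d FF_nonzero_ae[OF phi]
  proof eventually_elim
   case (elim z)
   have "u z = (\<Sum>s<n. c s * e s z) * \<phi> z ^ Suc k + (\<alpha> z - (\<Sum>s<n. c s * e s z)) * \<phi> z ^ Suc k"
    using elim(2) by (simp add: \<alpha>_def distrib_right[symmetric] del: power_Suc)
   thus ?case unfolding elim(1) split .
  qed
  thus ?thesis by blast
 qed
 thus ?case using EL by blast
qed

text \<open>The functionals are split off once for all, on the union \<open>A\<close> of the spaces
  \<open>Asp \<phi> k\<close>. The finitely many correcting functions lie in one
  \<open>Asp \<phi> k0\<close>. For \<open>k \<ge> k0\<close> the corrected part of \<open>u\<close>
  loses one order of growth, and the correction is \<open>\<phi>\<close> times an element of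
  \<open>Lsp \<phi> k\<close>.\<close>

lemma Lsp_step:
 assumes phi: "\<phi> \<in> CF" "\<phi> ~= FF0"
 shows "\<exists>k0. \<forall>k\<ge>k0. \<forall>u\<in>Lsp \<phi> (Suc k). \<exists>v\<in>Lsp \<phi> k. \<exists>w\<in>Lsp \<phi> k.
  AEH z. u z = v z + \<phi> z * w z"
proof -
 have mphi: "mf \<phi>" by (rule carrier_imp_mf[OF phi(1)])
 obtain I :: "(complex filter \<times> nat) set" and La where L: "finite I"
  "\<And>k u v a b i. u \<in> Asp \<phi> k ==> v \<in> Asp \<phi> k ==>
    La i (\<lambda>z. a * u z + b * v z) = a * La i u + (b::complex) * La i v"
  "\<And>k u. u \<in> Asp \<phi> (Suc k) ==> (\<forall>i\<in>I. La i u = 0) ==> (\<lambda>z. u z * \<phi> z ^ Suc k) \<in> Lsp \<phi> k"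
  using global_functionals[OF phi] by blast
 define A where "A = (\<Union>k. Asp \<phi> k)"
 have common: "\<exists>k. u \<in> Asp \<phi> k \<and> v \<in> Asp \<phi> k" if uv: "u \<in> A" "v \<in> A" for u v
 proof -
  obtain k l where "u \<in> Asp \<phi> k" "v \<in> Asp \<phi> l" using uv by (auto simp: A_def)
  thus ?thesis using Asp_mono[OF mphi, of _ _ "max k l"] by (intro exI[of _ "max k l"]) auto
 qed
 have Asub: "(\<lambda>z. a * u z + b * v z) \<in> A" if uv: "u \<in> A" "v \<in> A" for u v a b
 proof -
  obtain k where "u \<in> Asp \<phi> k" "v \<in> Asp \<phi> k" using common[OF uv] by blast
  hence "(\<lambda>z. a * u z + b * v z) \<in> Asp \<phi> k" by (rule Asp_lin)
  thus ?thesis unfolding A_def by blast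
 qed
 have Alin: "La i (\<lambda>z. a * u z + b * v z) = a * La i u + (b::complex) * La i v" if uv: "u \<in> A" "v \<in> A" for u v a b i
 proof -
  obtain k where "u \<in> Asp \<phi> k" "v \<in> Asp \<phi> k" using common[OF uv] by blast
  thus ?thesis by (rule L(2))
 qed
 have A0: "(\<lambda>z. 0) \<in> A" using Asp_zero by (auto simp: A_def)
 obtain n :: nat and e where e: "\<And>s. s < n ==> e s \<in> A"
  "\<And>u. u \<in> A ==> \<exists>c. (\<lambda>z. u z - (\<Sum>s<n. c s * e s z)) \<in> A \<and>
   (\<forall>i\<in>I. La i (\<lambda>z. u z - (\<Sum>s<n. c s * e s z)) = 0)"
 proof -
  have "\<exists>(n::nat) e. (\<forall>s<n. e s \<in> A) \<and> (\<forall>u\<in>A. \<exists>c. (\<lambda>z. u z - (\<Sum>s<n. c s * e s z)) \<in> A \<and>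
   (\<forall>i\<in>I. La i (\<lambda>z. u z - (\<Sum>s<n. c s * e s z)) = 0))"
   by (rule finite_codim_kernel[OF L(1) A0]) (assumption | rule Asub Alin)+
  thus ?thesis using that by blast
 qed
 obtain kk where kk: "\<And>s. s < n ==> e s \<in> Asp \<phi> (kk s)" proof -
  have "\<forall>s\<in>{..<n}. \<exists>k. e s \<in> Asp \<phi> k" using e(1) unfolding A_def by blast
  from bchoice[OF this] show ?thesis using that by auto
 qed
 define k0 where "k0 = Max (insert 0 (kk ` {..<n}))"
 have ek: "e s \<in> Asp \<phi> k" if "s < n" "k0 \<le> k" for s k
  by (rule Asp_mono[OF mphi kk[OF that(1)]], rule order_trans[OF _ that(2)]) (use that in \<open>auto simp: k0_def\<close>)
 show ?thesis
 proof (intro exI[of _ k0] allI impI ballI)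
  fix k u assume k: "k0 \<le> k" and u: "u \<in> Lsp \<phi> (Suc k)"
  define \<alpha> where "\<alpha> = (\<lambda>z. u z / \<phi> z ^ Suc k)"
  have al: "\<alpha> \<in> Asp \<phi> (Suc k)" unfolding \<alpha>_def by (rule Asp_of_Lsp[OF phi u])
  hence "\<alpha> \<in> A" unfolding A_def by blast
  from e(2)[OF this] obtain c where c: "\<forall>i\<in>I. La i (\<lambda>z. \<alpha> z - (\<Sum>s<n. c s * e s z)) = 0" by blast
  define \<beta> where "\<beta> = (\<lambda>z. \<Sum>s<n. c s * e s z)"
  have be: "\<beta> \<in> Asp \<phi> k" unfolding \<beta>_def by (intro Asp_sum ek k) simp
  have ab: "(\<lambda>z. \<alpha> z - \<beta> z) \<in> Asp \<phi> (Suc k)"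
   using Asp_lin[OF al Asp_Suc[OF mphi be], of 1 "-1"] by simp
  have v: "(\<lambda>z. (\<alpha> z - \<beta> z) * \<phi> z ^ Suc k) \<in> Lsp \<phi> k"
   by (rule L(3)[OF ab]) (use c in \<open>unfold \<beta>_def\<close>)
  have w: "(\<lambda>z. \<beta> z * \<phi> z ^ k) \<in> Lsp \<phi> k" using be by (simp add: Asp_def)
  have "AEH z. u z = (\<alpha> z - \<beta> z) * \<phi> z ^ Suc k + \<phi> z * (\<beta> z * \<phi> z ^ k)"
   using FF_nonzero_ae[OF phi] by eventually_elim (simp add: \<alpha>_def field_simps)
  thus "\<exists>v\<in>Lsp \<phi> k. \<exists>w\<in>Lsp \<phi> k. AEH z. u z = v z + \<phi> z * w z"
   by (intro bexI[OF _ v] bexI[OF _ w])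
 qed
qed

text \<open>Iteration of \<open>Lsp_step\<close> down to \<open>k0\<close>, where each step costs at
  most one factor \<open>\<phi>\<close>. The degree bound \<open>j\<close> is what later limits the
  total degrees of relations.\<close>

theorem Lsp_generators:
 assumes phi: "\<phi> \<in> CF" "\<phi> ~= FF0"
 shows "\<exists>k0 (n::nat) e. (\<forall>s<n. e s \<in> Lsp \<phi> k0) \<and>
  (\<forall>j. \<forall>u\<in>Lsp \<phi> (k0 + j). \<exists>p. (\<forall>s<n. degree (p s) \<le> j) \<and>
   (AEH z. u z = (\<Sum>s<n. poly (p s) (\<phi> z) * e s z)))"
proof -
 obtain k0 where k0: "\<And>k u. k0 \<le> k ==> u \<in> Lsp \<phi> (Suc k) ==> \<exists>v\<in>Lsp \<phi> k. \<exists>w\<in>Lsp \<phi> k.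
  AEH z. u z = v z + \<phi> z * w z" using Lsp_step[OF phi] by blast
 obtain n e where e: "\<And>s. s < (n::nat) ==> e s \<in> Lsp \<phi> k0"
  "\<And>u. u \<in> Lsp \<phi> k0 ==> \<exists>c. AEH z. u z = (\<Sum>s<n. c s * e s z)"
  using Lsp_finite_span[OF phi, of k0] by blast
 have "\<exists>p. (\<forall>s<n. degree (p s) \<le> j) \<and> (AEH z. u z = (\<Sum>s<n. poly (p s) (\<phi> z) * e s z))"
  if "u \<in> Lsp \<phi> (k0 + j)" for u j using that
 proof (induction j arbitrary: u)
  case 0
  then obtain c where "AEH z. u z = (\<Sum>s<n. c s * e s z)" using e(2)[of u] by auto
  thus ?case by (intro exI[of _ "\<lambda>s. [:c s:]"]) simp
 next
  case (Suc j)
  obtain v w where vw: "v \<in> Lsp \<phi> (k0 + j)" "w \<in> Lsp \<phi> (k0 + j)"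
   "AEH z. u z = v z + \<phi> z * w z" using k0[of "k0 + j" u] Suc.prems by (auto simp del: ex_simps)
  obtain p where p: "\<forall>s<n. degree (p s) \<le> j" "AEH z. v z = (\<Sum>s<n. poly (p s) (\<phi> z) * e s z)"
   using Suc.IH[OF vw(1)] by (elim exE conjE)
  obtain q where q: "\<forall>s<n. degree (q s) \<le> j" "AEH z. w z = (\<Sum>s<n. poly (q s) (\<phi> z) * e s z)"
   using Suc.IH[OF vw(2)] by (elim exE conjE)
  have "\<forall>s<n. degree (p s + pCons 0 (q s)) \<le> Suc j"
   using p(1) q(1) by (auto intro!: degree_add_le order_trans[OF degree_pCons_le])
  moreover have "AEH z. u z = (\<Sum>s<n. poly (p s + pCons 0 (q s)) (\<phi> z) * e s z)" using vw(3) p(2) q(2)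
   by eventually_elim (simp add: sum_distrib_left sum.distrib[symmetric] algebra_simps)
  ultimately show ?case by (intro exI[of _ "\<lambda>s. p s + pCons 0 (q s)"] conjI)
 qed
 thus ?thesis by (intro exI[of _ k0, OF exI[of _ n, OF exI[of _ e]]] conjI allI ballI impI e(1))
qed

lemma poly_growth:
 fixes p :: "complex poly"
 shows "\<exists>K\<ge>0. \<forall>x. cmod (poly p x) \<le> K * (1 + cmod x) ^ degree p"
proof -
 have "cmod (poly p x) \<le> (\<Sum>i\<le>degree p. cmod (coeff p i)) * (1 + cmod x) ^ degree p" for x
 proof -
  have "cmod (poly p x) \<le> (\<Sum>i\<le>degree p. cmod (coeff p i * x ^ i))" unfolding poly_altdef by (rule norm_sum)
  also have "\<dots> \<le> (\<Sum>i\<le>degree p. cmod (coeff p i) * (1 + cmod x) ^ degree p)"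
  proof (rule sum_mono)
   fix i assume "i \<in> {..degree p}"
   hence "cmod x ^ i \<le> (1 + cmod x) ^ degree p" by (intro order_trans[OF power_mono power_increasing]) auto
   thus "cmod (coeff p i * x ^ i) \<le> cmod (coeff p i) * (1 + cmod x) ^ degree p"
    by (simp add: norm_mult norm_power mult_left_mono)
  qed
  finally show ?thesis by (simp add: sum_distrib_right)
 qed
 thus ?thesis by (intro exI[of _ "\<Sum>i\<le>degree p. cmod (coeff p i)"]) (auto intro: sum_nonneg)
qed

text \<open>Where \<open>\<phi>\<close> is finite with value \<open>V 0\<close>, the difference
  \<open>\<phi> - V 0\<close> vanishes, so its \<open>n\<close>-th power cancels growth of order
  \<open>n\<close> of \<open>u\<close>. At a pole of \<open>\<phi>\<close> the growth of
  \<open>u\<close> is bounded by that of a power of \<open>\<phi>\<close>, and \<open>p = 1\<close>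
  will do.\<close>

lemma denominator_local:
 assumes Phi: "\<Phi> \<in> SP" and phi: "\<phi> \<in> CF" "\<phi> ~= FF0" and u: "u \<in> CF"
 shows "\<exists>p K k. p ~= 0 \<and> (\<forall>\<^sub>F z in \<Phi>. 0 < Im z \<and> \<phi> analytic_on {z} \<and> u analytic_on {z} \<and>
  cmod (poly p (\<phi> z) * u z) \<le> K * (1 + cmod (\<phi> z)) ^ k)"
proof -
 obtain q r where q: "uniformizer \<Gamma> \<Phi> q r"
  and gr: "\<And>\<psi>. \<psi> \<in> CF ==> \<exists>C n. \<forall>\<^sub>F z in \<Phi>. \<psi> analytic_on {z} \<and> cmod (\<psi> z) \<le> C / cmod (q z) ^ n"
  by (rule chart_exists[OF Phi], rule that)
 note uD = uniformizerD[OF q]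
 obtain ro U m where nf: "0 < ro" "ro \<le> r" "U holomorphic_on ball 0 ro" "\<And>t. cmod t < ro ==> U t ~= 0"
  "\<And>z. z \<in> coord_nbhd q ro ==> \<phi> analytic_on {z}"
  "\<And>z. z \<in> coord_nbhd q ro ==> \<phi> z = U (q z) * (q z) powi m"
  by (rule chart_normal_form[OF q gr[OF phi(1)] phi], rule that)
 obtain C0 n where C0: "\<forall>\<^sub>F z in \<Phi>. u analytic_on {z} \<and> cmod (u z) \<le> C0 / cmod (q z) ^ n" using gr[OF u] by (elim exE)
 define C where "C = max C0 0"
 have C: "C \<ge> 0" "\<forall>\<^sub>F z in \<Phi>. u analytic_on {z} \<and> cmod (u z) \<le> C / cmod (q z) ^ n"
 proof -
  show "\<forall>\<^sub>F z in \<Phi>. u analytic_on {z} \<and> cmod (u z) \<le> C / cmod (q z) ^ n" using C0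
  proof eventually_elim
   case (elim z)
   have "C0 / cmod (q z) ^ n \<le> C / cmod (q z) ^ n" by (intro divide_right_mono) (simp_all add: C_def)
   with elim show ?case by linarith
  qed
 qed (simp add: C_def)
 have small: "\<forall>\<^sub>F z in \<Phi>. z \<in> coord_nbhd q de" if "de > 0" for de
  unfolding uD(3) using that uD(1) by (intro exI[of _ "min de r"]) (auto simp: coord_nbhd_def)
 show ?thesis
 proof (cases "m \<ge> 0")
  case True
  define V where "V t = U t * t ^ nat m" for t
  have V: "V holomorphic_on ball 0 ro" unfolding V_def by (intro holomorphic_intros nf)
  have "continuous_on (cball 0 (ro/2)) (diff_quot V)"
   by (rule continuous_on_subset[OF holomorphic_on_imp_continuous_on[OF diff_quot_holomorphic[OF V nf(1)]]]) (use nf(1) in auto)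
  hence "bounded (diff_quot V ` cball 0 (ro/2))" by (intro compact_imp_bounded compact_continuous_image) auto
  then obtain L where L: "L > 0" "\<And>t. cmod t \<le> ro/2 ==> cmod (diff_quot V t) \<le> L" unfolding bounded_pos by auto
  have "\<forall>\<^sub>F z in \<Phi>. 0 < Im z \<and> \<phi> analytic_on {z} \<and> u analytic_on {z} \<and>
   cmod (poly ([:- V 0, 1:] ^ n) (\<phi> z) * u z) \<le> (L ^ n * C) * (1 + cmod (\<phi> z)) ^ 0"
   using C(2) small[OF half_gt_zero[OF nf(1)]] small[OF nf(1)]
  proof eventually_elim
   case (elim z)
   have z: "0 < Im z" "q z ~= 0" "cmod (q z) \<le> ro/2" using elim(2) by (auto simp: coord_nbhd_def)
   have "\<phi> z = V (q z)" unfolding nf(6)[OF elim(3)] V_def using True by (simp add: power_int_def)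
   hence "\<phi> z - V 0 = q z * diff_quot V (q z)" using z(2) by (simp add: diff_quot_def)
   hence "cmod (\<phi> z - V 0) \<le> cmod (q z) * L" using L(2)[OF z(3)] by (simp add: norm_mult mult_left_mono)
   hence "cmod (\<phi> z - V 0) ^ n * cmod (u z) \<le> (cmod (q z) * L) ^ n * (C / cmod (q z) ^ n)"
    using elim(1) L(1) by (intro mult_mono power_mono) auto
   also have "\<dots> = L ^ n * C" using z(2) by (simp add: power_mult_distrib)
   finally show ?case using elim(1) nf(5)[OF elim(3)] z(1) by (simp add: norm_mult norm_power)
  qed
  moreover have "[:- V 0, 1:] ^ n ~= 0" by simp
  ultimately show ?thesis by (intro exI[of _ "[:- V 0, 1:] ^ n", OF exI[of _ "L ^ n * C", OF exI[of _ 0]]] conjI)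
 next
  case False
  have "isCont U 0" using holomorphic_on_imp_continuous_on[OF nf(3)] nf(1) by (auto simp: continuous_on_eq_continuous_at)
  hence "\<forall>\<^sub>F t in at 0. dist (U t) (U 0) < cmod (U 0) / 2"
   unfolding isCont_def by (rule tendstoD) (use nf in auto)
  then obtain de where d: "de > 0" "\<And>t. t ~= 0 ==> cmod t < de ==> dist (U t) (U 0) < cmod (U 0) / 2"
   unfolding eventually_at by (auto simp: dist_norm)
  define c where "c = cmod (U 0) / 2"
  have c: "c > 0" using nf(1,4) by (simp add: c_def)
  have U: "c \<le> cmod (U t)" if "t ~= 0" "cmod t < de" for t
   using d(2)[OF that] norm_triangle_ineq2[of "U 0" "U 0 - U t"] by (simp add: c_def dist_norm norm_minus_commute)
  have small1: "\<forall>\<^sub>F z in \<Phi>. z \<in> coord_nbhd q 1" by (rule small) simp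
  have "\<forall>\<^sub>F z in \<Phi>. 0 < Im z \<and> \<phi> analytic_on {z} \<and> u analytic_on {z} \<and>
   cmod (poly 1 (\<phi> z) * u z) \<le> (C / c ^ n) * (1 + cmod (\<phi> z)) ^ n"
   using C(2) small[OF d(1)] small[OF nf(1)] small1
  proof eventually_elim
   case (elim z)
   have z: "0 < Im z" "q z ~= 0" "cmod (q z) < de" "cmod (q z) < 1" using elim(2,4) by (auto simp: coord_nbhd_def)
   have "cmod (q z) ^ nat (- m) \<le> cmod (q z) ^ 1" using z False by (intro power_decreasing) auto
   hence "c * (1 / cmod (q z)) \<le> cmod (U (q z)) * (1 / cmod (q z) ^ nat (- m))"
    using z c by (intro mult_mono U frac_le) auto
   also have "\<dots> = cmod (\<phi> z)" unfolding nf(6)[OF elim(3)] using False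
    by (simp add: norm_mult power_int_def norm_power norm_inverse divide_inverse power_inverse)
   finally have "1 / cmod (q z) \<le> cmod (\<phi> z) / c" using c by (simp add: field_simps)
   hence "(1 / cmod (q z)) ^ n \<le> (cmod (\<phi> z) / c) ^ n" by (intro power_mono) auto
   hence "C * (1 / cmod (q z)) ^ n \<le> C * (cmod (\<phi> z) / c) ^ n" by (intro mult_left_mono C)
   also have "\<dots> = (C / c ^ n) * cmod (\<phi> z) ^ n" by (simp add: power_divide)
   also have "\<dots> \<le> (C / c ^ n) * (1 + cmod (\<phi> z)) ^ n" using C c by (intro mult_left_mono power_mono) auto
   finally show ?case using elim(1) nf(5)[OF elim(3)] z(1) by (simp add: power_divide)
  qed
  thus ?thesis by (intro exI[of _ "1", OF exI[of _ "C / c ^ n", OF exI[of _ n]]] conjI one_neq_zero)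
 qed
qed

theorem denominator_exists:
 assumes phi: "\<phi> \<in> CF" "\<phi> ~= FF0" and "mf w"
 shows "\<exists>p k. p ~= 0 \<and> (\<lambda>z. poly p (\<phi> z) * w z) \<in> Lsp \<phi> k"
proof -
 define u where "u = on_uhp w"
 have u: "u \<in> CF" unfolding u_def by (rule mf_carrier[OF assms(3)])
 define good where "good \<Phi> p K k \<longleftrightarrow> p ~= 0 \<and> (\<forall>\<^sub>F z in \<Phi>. 0 < Im z \<and> \<phi> analytic_on {z} \<and> u analytic_on {z} \<and>
  cmod (poly p (\<phi> z) * u z) \<le> K * (1 + cmod (\<phi> z)) ^ k)" for \<Phi> p K k
 have "\<forall>\<Phi>\<in>SP. \<exists>p K k. good \<Phi> p K k" unfolding good_def by (intro ballI denominator_local phi u)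
 then obtain p K k where "\<forall>\<Phi>\<in>SP. good \<Phi> (p \<Phi>) (K \<Phi>) (k \<Phi>)" by metis
 hence F: "p \<Phi> ~= 0"
  "\<forall>\<^sub>F z in \<Phi>. 0 < Im z \<and> \<phi> analytic_on {z} \<and> u analytic_on {z} \<and>
  cmod (poly (p \<Phi>) (\<phi> z) * u z) \<le> K \<Phi> * (1 + cmod (\<phi> z)) ^ k \<Phi>"
  if "\<Phi> \<in> SP" for \<Phi> using that unfolding good_def by blast+
 define N where "N \<Phi> = {z. 0 < Im z \<and> \<phi> analytic_on {z} \<and> u analytic_on {z} \<and>
  cmod (poly (p \<Phi>) (\<phi> z) * u z) \<le> K \<Phi> * (1 + cmod (\<phi> z)) ^ k \<Phi>}" for \<Phi>
 have N: "\<forall>\<^sub>F z in \<Phi>. z \<in> N \<Phi>" if "\<Phi> \<in> SP" for \<Phi> using F(2)[OF that] by (simp add: N_def)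
 obtain S where S: "finite S" "S \<subseteq> SP"
  "\<And>z. 0 < Im z ==> \<exists>ga\<in>\<Gamma>. \<exists>\<Phi>\<in>S. mob ga z \<in> N \<Phi> \<or> \<Phi> = at (mob ga z)"
  using surface_points_finite_cover[OF N] by blast
 define P where "P = (\<Prod>\<Phi>\<in>S. p \<Phi>)"
 define l where "l = degree P + (\<Sum>\<Phi>\<in>S. k \<Phi>)"
 have P0: "P ~= 0" unfolding P_def using S F(1) by auto
 have mP: "mf (\<lambda>z. poly P (\<phi> z) * u z)" by (intro mf_mult mf_poly carrier_imp_mf phi u)
 have "\<exists>K. AEH z. cmod (on_uhp (\<lambda>z. poly P (\<phi> z) * u z) z) \<le> K * (1 + cmod (\<phi> z)) ^ l"
 proof (rule cover_to_global[OF mf_carrier[OF mP] phi(1) S(1,3)])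
  fix \<Phi> assume Phi: "\<Phi> \<in> S"
  thus "\<forall>\<^sub>F z in \<Phi>. z \<in> N \<Phi>" using S(2) N by (metis subsetD)
  define Q where "Q = (\<Prod>\<Phi>\<in>S - {\<Phi>}. p \<Phi>)"
  have PQ: "P = p \<Phi> * Q" unfolding P_def Q_def using S(1) Phi by (simp add: prod.remove)
  obtain B where B: "B \<ge> 0" "\<And>x. cmod (poly Q x) \<le> B * (1 + cmod x) ^ degree Q" using poly_growth by blast
  have "degree Q \<le> degree P" using P0 by (simp add: PQ degree_mult_eq)
  moreover have "k \<Phi> \<le> (\<Sum>\<Phi>\<in>S. k \<Phi>)" using S(1) Phi by (intro member_le_sum) auto
  ultimately have dl: "degree Q + k \<Phi> \<le> l" by (simp add: l_def)
  show "\<exists>K. \<forall>z\<in>N \<Phi>. cmod (on_uhp (\<lambda>z. poly P (\<phi> z) * u z) z) \<le> K * (1 + cmod (\<phi> z)) ^ l"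
  proof (intro exI[of _ "B * max 0 (K \<Phi>)"] ballI)
   fix z assume "z \<in> N \<Phi>"
   hence z: "0 < Im z" "\<phi> analytic_on {z}" "u analytic_on {z}"
    "cmod (poly (p \<Phi>) (\<phi> z) * u z) \<le> K \<Phi> * (1 + cmod (\<phi> z)) ^ k \<Phi>" by (auto simp: N_def)
   have "(\<lambda>z. poly P (\<phi> z) * u z) analytic_on {z}" unfolding poly_altdef by (intro analytic_intros z)
   hence "on_uhp (\<lambda>z. poly P (\<phi> z) * u z) z = poly P (\<phi> z) * u z" by (rule on_uhp_analytic(1)[OF _ z(1)])
   hence "cmod (on_uhp (\<lambda>z. poly P (\<phi> z) * u z) z) = cmod (poly Q (\<phi> z)) * cmod (poly (p \<Phi>) (\<phi> z) * u z)"
    by (simp add: PQ norm_mult)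
   also have "\<dots> \<le> (B * (1 + cmod (\<phi> z)) ^ degree Q) * (max 0 (K \<Phi>) * (1 + cmod (\<phi> z)) ^ k \<Phi>)"
    by (intro mult_mono B order_trans[OF z(4)] mult_right_mono) (use B(1) in auto)
   also have "\<dots> = B * max 0 (K \<Phi>) * (1 + cmod (\<phi> z)) ^ (degree Q + k \<Phi>)" by (simp add: power_add)
   also have "\<dots> \<le> B * max 0 (K \<Phi>) * (1 + cmod (\<phi> z)) ^ l"
    using B(1) by (intro mult_left_mono power_increasing dl) auto
   finally show "cmod (on_uhp (\<lambda>z. poly P (\<phi> z) * u z) z) \<le> B * max 0 (K \<Phi>) * (1 + cmod (\<phi> z)) ^ l" .
  qed
 qed
 then obtain K' where K': "AEH z. cmod (on_uhp (\<lambda>z. poly P (\<phi> z) * u z) z) \<le> K' * (1 + cmod (\<phi> z)) ^ l" ..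
 have "on_uhp (\<lambda>z. poly P (\<phi> z) * u z) \<in> Lsp \<phi> l"
  by (rule LspI[OF carrier_imp_mf[OF mf_carrier[OF mP]] K'])
 moreover have "AEH z. on_uhp (\<lambda>z. poly P (\<phi> z) * u z) z = poly P (\<phi> z) * w z"
  using mf_ae[OF mP] mf_ae[OF assms(3)] by eventually_elim (simp add: u_def)
 ultimately have "(\<lambda>z. poly P (\<phi> z) * w z) \<in> Lsp \<phi> l" by (rule Lsp_cong)
 thus ?thesis using P0 by blast
qed

end

section \<open>Polynomials in two variables\<close>

text \<open>Bezout over the field of fractions, with denominators cleared. By pseudo-division an
  element \<open>d\<close> of least degree in the ideal of \<open>p\<close> and \<open>r\<close>
  divides every element up to a factor free of the outer variable. Apply this to \<open>p\<close>:
  if \<open>p\<close> divides \<open>d\<close>, it also divides \<open>r\<close> up to such a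
  factor, which is excluded; otherwise \<open>p\<close> divides the cofactor, and \<open>d\<close>
  is constant in the outer variable.\<close>

lemma prime_elem_combination_const:
 fixes p r :: "complex poly poly"
 assumes p: "prime_elem p" "1 \<le> degree p" and r: "\<not> p dvd r"
 shows "\<exists>a b c. a * p + b * r = [:c:] \<and> c ~= 0"
proof -
 define I where "I = {d. \<exists>a b. d = a * p + b * r}"
 have pI: "p \<in> I" "r \<in> I" unfolding I_def by (auto intro: exI[of _ 1, OF exI[of _ 0]] exI[of _ 0, OF exI[of _ 1]])
 have Isub: "f * x - y * g \<in> I" if fg: "f \<in> I" "g \<in> I" for f g x y
 proof -
  obtain a b a' b' where "f = a * p + b * r" "g = a' * p + b' * r" using fg unfolding I_def by blast
  hence "f * x - y * g = (a * x - y * a') * p + (b * x - y * b') * r" by (simp add: algebra_simps)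
  thus ?thesis unfolding I_def by blast
 qed
 have p0: "p ~= 0" using p by auto
 obtain d where d: "d \<in> I" "d ~= 0" "\<And>y. y \<in> I ==> y ~= 0 ==> degree d \<le> degree y"
  using ex_has_least_nat[of "\<lambda>d. d \<in> I \<and> d ~= 0" p degree] pI(1) p0 by blast
 have quot: "\<exists>c q. c ~= 0 \<and> smult c f = d * q" if f: "f \<in> I" for f
 proof -
  obtain c q where c: "c ~= 0" "smult c f = d * q + pseudo_mod f d" using pseudo_mod(1)[OF d(2)] by blast
  have "pseudo_mod f d = f * [:c:] - q * d" using c(2) by (simp add: algebra_simps)
  hence "pseudo_mod f d \<in> I" using Isub[OF f d(1)] by metis
  hence "pseudo_mod f d = 0" using d(3) pseudo_mod(2)[OF d(2), of f] by fastforce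
  thus ?thesis using c by auto
 qed
 have "degree d = 0"
 proof -
  obtain c q where c: "c ~= 0" "smult c p = d * q" using quot[OF pI(1)] by blast
  have "p dvd d * q" unfolding c(2)[symmetric] by (rule dvd_smult) simp
  then consider "p dvd d" | "p dvd q" using prime_elem_dvd_mult_iff[OF p(1)] by blast
  thus ?thesis
  proof cases
   case 1
   obtain c' q' where c': "c' ~= 0" "smult c' r = d * q'" using quot[OF pI(2)] by blast
   have "p dvd [:c':] * r" using 1 c'(2) by simp
   hence "p dvd [:c':]" using prime_elem_dvd_mult_iff[OF p(1)] r by blast
   hence "degree p \<le> 0" using dvd_imp_degree_le[of p "[:c':]"] c'(1) by simp
   thus ?thesis using p(2) by simp
  next
   case 2
   then obtain q' where "q = p * q'" by blast
   hence "p * (d * q') = p * [:c:]" using c(2) by (simp add: algebra_simps)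
   hence e: "d * q' = [:c:]" using p0 mult_left_cancel by blast
   hence "q' ~= 0" using c(1) by auto
   hence "degree d + degree q' = 0" using degree_mult_eq[OF d(2)] e by (metis degree_pCons_0)
   thus ?thesis by simp
  qed
 qed
 then obtain c where c: "d = [:c:]" by (metis degree_eq_zeroE)
 obtain a b where "d = a * p + b * r" using d(1) unfolding I_def by blast
 thus ?thesis using c d(2) by (metis pCons_0_0)
qed

text \<open>The outer variable is \<open>w\<close>, that of the coefficients is \<open>t\<close>;
  they stand for \<open>\<psi>\<close> and \<open>\<phi>\<close>, so \<open>degree\<close> is the
  degree in \<open>\<psi>\<close>.\<close>

definition ev2 :: "complex poly poly => complex => complex => complex"
 where "ev2 R t w = poly (poly R [:w:]) t"

lemma ev2_simps [simp]:
 "ev2 (A * B) t w = ev2 A t w * ev2 B t w" "ev2 (A + B) t w = ev2 A t w + ev2 B t w"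
 "ev2 (A - B) t w = ev2 A t w - ev2 B t w" "ev2 0 t w = 0" "ev2 1 t w = 1"
 "ev2 [:c:] t w = poly c t" "ev2 (pCons a A) t w = poly a t + w * ev2 A t w"
 "ev2 (- A) t w = - ev2 A t w" "ev2 (smult c A) t w = poly c t * ev2 A t w" by (simp_all add: ev2_def)

lemma ev2_eq_poly_map: "ev2 R t w = poly (map_poly (\<lambda>c. poly c t) R) w"
 by (induction R) (simp_all add: map_poly_pCons)

lemma ev2_sum: "ev2 (\<Sum>i\<in>I. A i) t w = (\<Sum>i\<in>I. ev2 (A i) t w)"
 by (induction I rule: infinite_finite_induct) auto

lemma ev2_altdef: "degree R \<le> n ==> ev2 R t w = (\<Sum>i\<le>n. poly (coeff R i) t * w ^ i)"
proof -
 assume "degree R \<le> n"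
 hence "R = (\<Sum>i\<le>n. monom (coeff R i) i)" by (rule poly_as_sum_of_monoms'[symmetric])
 hence "ev2 R t w = (\<Sum>i\<le>n. ev2 (monom (coeff R i) i) t w)" by (metis ev2_sum)
 thus ?thesis by (simp add: ev2_def poly_monom poly_const_pow mult.commute)
qed

lemma ev2_all_zero: "(\<And>t w. ev2 R t w = 0) ==> R = 0"
proof (rule poly_eqI)
 fix i assume *: "\<And>t w. ev2 R t w = 0"
 have "map_poly (\<lambda>c. poly c t) R = 0" for t
  using * by (intro poly_all_0_iff_0[THEN iffD1]) (simp add: ev2_eq_poly_map)
 hence "poly (coeff R i) t = 0" for t by (metis coeff_map_poly coeff_0 poly_0)
 thus "coeff R i = coeff 0 i" using poly_all_0_iff_0 by auto
qed

section \<open>Total degree and leading forms\<close>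

definition tdeg_le :: "nat => complex poly poly => bool"
 where "tdeg_le l R \<longleftrightarrow> (\<forall>i. coeff R i ~= 0 --> degree (coeff R i) + i \<le> l)"

lemma tdeg_le_degree: "tdeg_le l R ==> degree R \<le> l"
 by (cases "R = 0") (auto simp: tdeg_le_def dest!: spec[of _ "degree R"])

lemma tdeg_le_0 [simp]: "tdeg_le l 0" by (simp add: tdeg_le_def)

lemma tdeg_le_mono: "tdeg_le l R ==> l \<le> k ==> tdeg_le k R" unfolding tdeg_le_def by (meson order_trans)

lemma tdeg_le_coeff: "tdeg_le l R ==> degree (coeff R i) \<le> l - i" "tdeg_le l R ==> l < i ==> coeff R i = 0"
 by (cases "coeff R i = 0"; force simp: tdeg_le_def)+

lemma tdeg_leI: "(\<And>i. degree (coeff R i) \<le> l - i) ==> (\<And>i. l < i ==> coeff R i = 0) ==> tdeg_le l R"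
 unfolding tdeg_le_def by (metis le_add_diff_inverse2 not_le add_le_cancel_right)

lemma tdeg_le_add: "tdeg_le l A ==> tdeg_le l B ==> tdeg_le l (A + B)"
 by (rule tdeg_leI) (simp_all add: tdeg_le_coeff degree_add_le)

lemma tdeg_le_const: "degree c \<le> l ==> tdeg_le l [:c:]" by (auto simp: tdeg_le_def coeff_pCons split: nat.split)

lemma tdeg_le_mult:
 assumes "tdeg_le a A" "tdeg_le b B"
 shows "tdeg_le (a + b) (A * B)"
proof -
 have nz: "degree (coeff A i * coeff B (n - i)) + n \<le> a + b" if "i \<le> n" "coeff A i * coeff B (n - i) ~= 0" for i n
 proof -
  have "coeff A i ~= 0" "coeff B (n - i) ~= 0" using that by auto
  hence "degree (coeff A i) + i \<le> a" "degree (coeff B (n - i)) + (n - i) \<le> b" using assms by (auto simp: tdeg_le_def)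
  thus ?thesis using degree_mult_le[of "coeff A i" "coeff B (n - i)"] that(1) by linarith
 qed
 show ?thesis unfolding tdeg_le_def
 proof (intro allI impI)
  fix n assume n0: "coeff (A * B) n ~= 0"
  then obtain i where "i \<le> n" "coeff A i * coeff B (n - i) ~= 0" unfolding coeff_mult by (meson atMost_iff sum.neutral)
  hence n: "n \<le> a + b" using nz by fastforce
  have "degree (coeff A i * coeff B (n - i)) \<le> a + b - n" if "i \<in> {..n}" for i
   using nz[of i n] that n by (cases "coeff A i * coeff B (n - i) = 0") auto
  hence "degree (coeff (A * B) n) \<le> a + b - n" unfolding coeff_mult by (intro degree_sum_le) auto
  thus "degree (coeff (A * B) n) + n \<le> a + b" using n by simp
 qed
qed

lemma tdeg_le_sum: "(\<And>i. i \<in> I ==> tdeg_le l (A i)) ==> tdeg_le l (\<Sum>i\<in>I. A i)"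
 by (induction I rule: infinite_finite_induct) (auto intro: tdeg_le_add)

lemma tdeg_le_prod: "finite I ==> (\<And>i. i \<in> I ==> tdeg_le 1 (A i)) ==> tdeg_le (card I) (\<Prod>i\<in>I. A i)"
proof (induction I rule: finite_induct)
 case empty
 thus ?case using tdeg_le_const[of 1 0] by (simp add: one_pCons)
next
 case (insert i I)
 thus ?case using tdeg_le_mult[of 1 "A i" "card I"] by simp
qed

text \<open>The homogeneous part of total degree \<open>l\<close>, with \<open>t\<close> set to
  1.\<close>

definition top_form :: "nat => complex poly poly => complex poly"
 where "top_form l R = (\<Sum>i\<le>l. monom (coeff (coeff R i) (l - i)) i)"

lemma coeff_top_form: "coeff (top_form l R) i = (if i \<le> l then coeff (coeff R i) (l - i) else 0)"
 by (simp add: top_form_def coeff_sum)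

text \<open>On the line \<open>w = \<omega> t\<close> the terms of total degree \<open>l\<close>
  become those in \<open>t ^ l\<close>; this reduces the multiplicativity of leading forms to
  leading coefficients in one variable.\<close>

lemma poly_on_line:
 assumes "tdeg_le l R"
 shows "degree (poly R [:0, \<omega>:]) \<le> l" "coeff (poly R [:0, \<omega>:]) l = poly (top_form l R) \<omega>"
proof -
 have eq: "poly R [:0, \<omega>:] = (\<Sum>i\<le>l. monom (\<omega> ^ i) i * coeff R i)"
 proof -
  have "poly R [:0, \<omega>:] = (\<Sum>i\<le>l. coeff R i * [:0, \<omega>:] ^ i)"
   unfolding poly_altdef using tdeg_le_degree[OF assms] by (intro sum.mono_neutral_left) (auto simp: coeff_eq_0)
  moreover have "[:0, \<omega>:] ^ i = monom (\<omega> ^ i) i" for i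
   using monom_power[of \<omega> 1 i] by (simp add: monom_altdef)
  ultimately show ?thesis by (simp add: mult.commute)
 qed
 show "coeff (poly R [:0, \<omega>:]) l = poly (top_form l R) \<omega>"
  unfolding eq by (auto simp: coeff_sum coeff_monom_mult top_form_def poly_sum poly_monom intro!: sum.cong)
 show "degree (poly R [:0, \<omega>:]) \<le> l" unfolding eq
 proof (intro degree_sum_le)
  fix i assume "i \<in> {..l}"
  thus "degree (monom (\<omega> ^ i) i * coeff R i) \<le> l"
   using degree_mult_le[of "monom (\<omega> ^ i) i" "coeff R i"] degree_monom_le[of "\<omega> ^ i" i] tdeg_le_coeff(1)[OF assms, of i]
   by simp
 qed simp
qed

lemma coeff_mult_degree_le:
 assumes "degree p \<le> a" "degree q \<le> b"
 shows "coeff (p * q) (a + b) = coeff p a * coeff q b"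
proof (cases "degree p = a \<and> degree q = b")
 case False
 hence "degree (p * q) < a + b" using assms degree_mult_le[of p q] by linarith
 moreover have "degree p < a \<or> degree q < b" using False assms by linarith
 ultimately show ?thesis by (auto simp: coeff_eq_0)
qed (use coeff_mult_degree_sum[of p q] in auto)

lemma top_form_mult:
 assumes "tdeg_le a A" "tdeg_le b B"
 shows "top_form (a + b) (A * B) = top_form a A * top_form b B"
proof -
 have "poly (top_form (a + b) (A * B)) \<omega> = poly (top_form a A * top_form b B) \<omega>" for \<omega>
  using poly_on_line(2)[OF tdeg_le_mult[OF assms], of \<omega>] poly_on_line[OF assms(1), of \<omega>] poly_on_line[OF assms(2), of \<omega>]
  by (simp add: coeff_mult_degree_le)
 thus ?thesis by (simp add: poly_eq_poly_eq_iff[symmetric] fun_eq_iff)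
qed

lemma tdeg_exists:
 assumes "R ~= 0"
 obtains l where "tdeg_le l R" "top_form l R ~= 0"
proof -
 define N where "N = (\<Sum>i\<le>degree R. degree (coeff R i) + i)"
 have "tdeg_le N R" unfolding tdeg_le_def N_def
 proof (intro allI impI)
  fix i assume "coeff R i ~= 0"
  hence "i \<in> {..degree R}" by (simp add: le_degree)
  thus "degree (coeff R i) + i \<le> (\<Sum>i\<le>degree R. degree (coeff R i) + i)"
   by (intro member_le_sum[of i _ "\<lambda>i. degree (coeff R i) + i"]) auto
 qed
 then obtain l where l: "tdeg_le l R" "\<And>k. k < l ==> \<not> tdeg_le k R"
  using exists_least_iff[of "\<lambda>l. tdeg_le l R"] by blast
 have "top_form l R ~= 0"
 proof
  assume z: "top_form l R = 0"
  have c: "coeff (coeff R i) (l - i) = 0" if "i \<le> l" for i using coeff_top_form[of l R i] that by (simp add: z)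
  have lt: "degree (coeff R i) + i < l" if nz: "coeff R i ~= 0" for i
  proof -
   have le: "degree (coeff R i) + i \<le> l" using l(1) nz by (simp add: tdeg_le_def)
   moreover have "degree (coeff R i) ~= l - i" using c[of i] le nz leading_coeff_0_iff by (metis add_leD2)
   ultimately show ?thesis by linarith
  qed
  obtain i where "coeff R i ~= 0" using assms by (metis poly_eqI coeff_0)
  hence "l ~= 0" using lt by force
  moreover have "tdeg_le (l - 1) R" unfolding tdeg_le_def using lt by fastforce
  ultimately show False using l(2)[of "l - 1"] by simp
 qed
 thus ?thesis using l(1) that by blast
qed

text \<open>For the exact total degrees of the factors both leading forms are nonzero, hence so is
  their product, which is the part of degree \<open>a + b\<close> of \<open>A * B\<close>.\<close>

lemma tdeg_factors:
 assumes "tdeg_le l (A * B)" "A ~= 0" "B ~= 0"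
 obtains a b where "tdeg_le a A" "tdeg_le b B" "a + b \<le> l"
proof -
 obtain a where a: "tdeg_le a A" "top_form a A ~= 0" using tdeg_exists[OF assms(2)] .
 obtain b where b: "tdeg_le b B" "top_form b B ~= 0" using tdeg_exists[OF assms(3)] .
 have "top_form (a + b) (A * B) ~= 0" using top_form_mult[OF a(1) b(1)] a(2) b(2) by simp
 then obtain i where "coeff (top_form (a + b) (A * B)) i ~= 0" by (metis poly_eqI coeff_0)
 hence i: "i \<le> a + b" "coeff (coeff (A * B) i) (a + b - i) ~= 0" by (auto simp: coeff_top_form split: if_splits)
 hence "a + b - i \<le> degree (coeff (A * B) i)" "coeff (A * B) i ~= 0" by (auto intro: le_degree)
 hence "a + b \<le> l" using assms(1) i(1) unfolding tdeg_le_def by fastforce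
 thus ?thesis using a(1) b(1) that by blast
qed

text \<open>The coefficient of \<open>w ^ N\<close> in the leading form of \<open>r\<close> is 1,
  and it is the product of the corresponding coefficients for the two factors. When \<open>p\<close>
  is the equation of the curve, the conclusion says that \<open>(0 : 0 : 1)\<close> does not satisfy
  it.\<close>

lemma dvd_monic_top:
 assumes "tdeg_le N r" "coeff r N = 1" "r = p * s" "tdeg_le l p" "\<And>k. tdeg_le k p ==> l \<le> k"
 shows "coeff (coeff p l) 0 ~= 0"
proof -
 have ps: "p ~= 0" "s ~= 0" using assms(2,3) by auto
 obtain a b where ab: "tdeg_le a p" "tdeg_le b s" "a + b \<le> N" using tdeg_factors assms(1,3) ps by metis
 have tb: "tdeg_le (N - l) s" by (rule tdeg_le_mono[OF ab(2)]) (use assms(5)[OF ab(1)] ab(3) in simp)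
 have lN: "l + (N - l) = N" using assms(5)[OF ab(1)] ab(3) by simp
 have "coeff (top_form N r) N = 1" using assms(2) by (simp add: coeff_top_form)
 moreover have "top_form N r = top_form l p * top_form (N - l) s" using top_form_mult[OF assms(4) tb] lN assms(3) by simp
 moreover have "degree (top_form k q) \<le> k" for k q by (rule degree_le) (simp add: coeff_top_form)
 ultimately have "coeff (top_form l p) l * coeff (top_form (N - l) s) (N - l) = 1"
  using coeff_mult_degree_le[of "top_form l p" l "top_form (N - l) s" "N - l"] lN by simp
 thus ?thesis by (auto simp: coeff_top_form)
qed

lemma card_roots_of_coprime_deriv:
 fixes p :: "complex poly"
 assumes "\<And>x. poly p x = 0 ==> poly (pderiv p) x ~= 0"
 shows "card {x. poly p x = 0} = degree p"
proof -
 have sf: "rsquarefree p" using assms by (auto simp: rsquarefree_roots)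
 have p0: "p ~= 0" using sf by (simp add: rsquarefree_def)
 have eq: "smult (lead_coeff p) (\<Prod>z | poly p z = 0. [:- z, 1:]) = p" by (rule complex_poly_decompose_rsquarefree[OF sf])
 have "degree p = degree (\<Prod>z | poly p z = 0. [:- z, 1:])" by (subst eq[symmetric]) (simp add: p0)
 also have "\<dots> = (\<Sum>z | poly p z = 0. degree [:- z, 1:])" by (rule degree_prod_eq_sum_degree) auto
 finally show ?thesis by simp
qed

section \<open>Forms in three variables\<close>

text \<open>Ternary forms as functions, generated by multiplication with linear forms and by sums,
  so that homogeneity, continuity, linear substitution and restriction to lines take one induction
  each.\<close>

inductive HP :: "nat => (complex^3 => complex) => bool" where
 HP_const: "HP 0 (\<lambda>x. c)"
| HP_lin: "HP l F ==> HP (Suc l) (\<lambda>x. (\<Sum>i\<in>UNIV. a$i * x$i) * F x)"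
| HP_add: "HP l F ==> HP l G ==> HP l (\<lambda>x. F x + G x)"

lemma HP_zero: "HP l (\<lambda>x. 0)"
proof (induction l)
 case (Suc l)
 from HP_lin[OF this, of 0] show ?case by simp
qed (rule HP_const)

lemma HP_coord: "HP l F ==> HP (Suc l) (\<lambda>x. x$k * F x)"
proof -
 assume "HP l F"
 from HP_lin[OF this, of "axis k 1"] show ?thesis by (simp add: axis_def if_distrib[of "\<lambda>c. c * _"] cong: if_cong)
qed

lemma HP_smult: "HP l F ==> HP l (\<lambda>x. c * F x)"
proof (induction rule: HP.induct)
 case (HP_lin l F a)
 from HP.HP_lin[OF HP_lin.IH, of a] show ?case by (simp add: algebra_simps)
next
 case (HP_add l F G)
 from HP.HP_add[OF HP_add.IH] show ?case by (simp add: algebra_simps)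
qed (rule HP_const)

lemma HP_sum: "(\<And>i. i \<in> I ==> HP l (F i)) ==> HP l (\<lambda>x. \<Sum>i\<in>I. F i x)"
 by (induction I rule: infinite_finite_induct) (auto intro: HP_zero HP_add)

lemma HP_monomial: "HP (a + b + c) (\<lambda>x. x$1 ^ a * x$2 ^ b * x$3 ^ c)"
proof -
 have p: "HP (n + l) (\<lambda>x. x$k ^ n * F x)" if "HP l F" for n l k F
  using that by (induction n) (auto dest: HP_coord simp: mult.assoc)
 have "HP (a + (b + (c + 0))) (\<lambda>x. x$1 ^ a * (x$2 ^ b * (x$3 ^ c * 1)))" by (intro p HP_const)
 thus ?thesis by (simp add: ac_simps)
qed

lemma HP_homogeneous: "HP l F ==> F (c *s x) = c ^ l * F x"
proof (induction rule: HP.induct)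
 case (HP_lin l F a)
 have "(\<Sum>i\<in>UNIV. a$i * (c *s x)$i) = c * (\<Sum>i\<in>UNIV. a$i * x$i)" by (simp add: sum_distrib_left algebra_simps)
 thus ?case using HP_lin.IH by simp
qed (simp_all add: algebra_simps)

lemma HP_continuous: "HP l F ==> isCont F x" by (induction rule: HP.induct) (auto intro!: continuous_intros)

lemma HP_linear_subst: "HP l F ==> HP l (\<lambda>x. F (B *v x))"
proof (induction rule: HP.induct)
 case (HP_lin l F a)
 have "(\<Sum>i\<in>UNIV. a$i * (B *v x)$i) = (\<Sum>j\<in>UNIV. (\<chi> j. \<Sum>i\<in>UNIV. a$i * B$i$j) $ j * x$j)" for x
  unfolding matrix_vector_mult_def by (simp add: sum_distrib_left sum_distrib_right mult.assoc) (rule sum.swap)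
 thus ?case using HP.HP_lin[OF HP_lin.IH, of "\<chi> j. \<Sum>i\<in>UNIV. a$i * B$i$j"] by simp
qed (auto intro: HP.intros)

text \<open>The affine part is \<open>x$1 = 1\<close>; the value at the point
  \<open>(0 : 0 : 1)\<close> at infinity survives as the coefficient of
  \<open>w ^ l\<close>.\<close>

lemma HP_dehomogenize:
 "HP l F ==> \<exists>R. tdeg_le l R \<and> (\<forall>t w. F (vector [1, t, w]) = ev2 R t w) \<and> F (vector [0, 0, 1]) = coeff (coeff R l) 0"
proof (induction rule: HP.induct)
 case (HP_const c)
 show ?case by (intro exI[of _ "[:[:c:]:]"]) (simp add: tdeg_le_const)
next
 case (HP_lin l F a)
 then obtain R where R: "tdeg_le l R" "\<And>t w. F (vector [1, t, w]) = ev2 R t w" "F (vector [0, 0, 1]) = coeff (coeff R l) 0"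
  by blast
 define A where "A = [:[:a$1, a$2:], [:a$3:]:]"
 have A: "tdeg_le 1 A" unfolding A_def tdeg_le_def by (auto simp: coeff_pCons split: nat.splits)
 have "coeff (A * R) (Suc l) = smult (a$3) (coeff R l)" unfolding A_def using tdeg_le_coeff(2)[OF R(1), of "Suc l"] by simp
 thus ?case using tdeg_le_mult[OF A R(1)] R(2,3) by (intro exI[of _ "A * R"]) (auto simp: A_def sum_3 vector_3 algebra_simps)
next
 case (HP_add l F G)
 then obtain R S where "tdeg_le l R" "\<And>t w. F (vector [1, t, w]) = ev2 R t w" "F (vector [0, 0, 1]) = coeff (coeff R l) 0"
  "tdeg_le l S" "\<And>t w. G (vector [1, t, w]) = ev2 S t w" "G (vector [0, 0, 1]) = coeff (coeff S l) 0" by blast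
 thus ?case by (intro exI[of _ "R + S"]) (auto intro: tdeg_le_add)
qed

lemma HP_homogenize:
 assumes "tdeg_le l R"
 shows "\<exists>F. HP l F \<and> (\<forall>t w. F (vector [1, t, w]) = ev2 R t w)"
proof -
 define F where "F = (\<lambda>x::complex^3. \<Sum>i\<le>l. \<Sum>j\<le>l-i. coeff (coeff R i) j * (x$1 ^ (l-i-j) * x$2 ^ j * x$3 ^ i))"
 have "HP l (\<lambda>x::complex^3. coeff (coeff R i) j * (x$1 ^ (l-i-j) * x$2 ^ j * x$3 ^ i))"
  if "i \<in> {..l}" "j \<in> {..l-i}" for i j
  using HP_smult[OF HP_monomial[of "l-i-j" j i], of "coeff (coeff R i) j"] that by simp
 hence "HP l F" unfolding F_def by (intro HP_sum)
 moreover have "F (vector [1, t, w]) = ev2 R t w" for t w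
 proof -
  have "poly (coeff R i) t = (\<Sum>j\<le>l-i. coeff (coeff R i) j * t ^ j)" for i
   unfolding poly_altdef using tdeg_le_coeff(1)[OF assms, of i] by (intro sum.mono_neutral_left) (auto simp: coeff_eq_0)
  thus ?thesis unfolding ev2_altdef[OF tdeg_le_degree[OF assms]] F_def by (simp add: vector_3 sum_distrib_right mult.assoc)
 qed
 ultimately show ?thesis by blast
qed

text \<open>Homogeneity covers the points with \<open>x$1 \<noteq> 0\<close>, continuity the
  others.\<close>

lemma HP_eq_iff_dehomogenized:
 assumes "HP l F" "\<And>t w. F (vector [1, t, w]) = 0"
 shows "F x = 0"
proof -
 have nz: "F y = 0" if "y$1 ~= 0" for y
 proof -
  have "y = y$1 *s vector [1, y$2 / y$1, y$3 / y$1]" using that by (simp add: vec_eq_iff forall_3 vector_3)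
  thus ?thesis using HP_homogeneous[OF assms(1)] assms(2) by (metis mult_zero_right)
 qed
 have "((\<lambda>s. F (x + s *s axis 1 1)) \<longlongrightarrow> F x) (at 0)"
  by (rule isCont_tendsto_compose[OF HP_continuous[OF assms(1)]], rule vec_tendstoI)
   (auto intro!: tendsto_eq_intros)
 moreover have "\<forall>\<^sub>F s in at 0. F (x + s *s axis 1 1) = 0"
 proof (cases "x$1 = 0")
  case True
  have "\<forall>\<^sub>F s in at (0::complex). s ~= 0" by (simp add: eventually_at_filter)
  thus ?thesis by eventually_elim (rule nz, simp add: True axis_def)
 next
  case False
  have "\<forall>\<^sub>F s in at (0::complex). s \<in> - {- x$1}" using False by (intro eventually_at_in_open') auto
  thus ?thesis by eventually_elim (rule nz, auto simp: axis_def add_eq_0_iff2)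
 qed
 ultimately have "((\<lambda>s::complex. 0) \<longlongrightarrow> F x) (at 0)" by (rule Lim_transform_eventually)
 thus ?thesis by (simp add: tendsto_const_iff)
qed

section \<open>Zariski closed sets\<close>

lemma closedin_zariski:
 "closedin (zariski sc V) C \<longleftrightarrow> (\<exists>P \<subseteq> polynomial_functions sc V. C = {x \<in> V. \<forall>p\<in>P. p x = 0})"
proof
 assume "closedin (zariski sc V) C"
 hence C: "C \<subseteq> V" "openin (zariski sc V) (V - C)" by (auto simp: closedin_def topspace_zariski)
 have "V - (V - C) = C" using C(1) by blast
 with C(2) show "\<exists>P \<subseteq> polynomial_functions sc V. C = {x \<in> V. \<forall>p\<in>P. p x = 0}"
  unfolding openin_zariski by (elim conjE) simp
next
 assume "\<exists>P \<subseteq> polynomial_functions sc V. C = {x \<in> V. \<forall>p\<in>P. p x = 0}"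
 then obtain P where P: "P \<subseteq> polynomial_functions sc V" "C = {x \<in> V. \<forall>p\<in>P. p x = 0}" by blast
 have CV: "C \<subseteq> V" using P(2) by simp
 hence VC: "V - (V - C) = C" by blast
 show "closedin (zariski sc V) C" unfolding closedin_def topspace_zariski openin_zariski VC
  by (intro conjI CV Diff_subset exI[of _ P] P)
qed

lemma polynomial_functions_diff:
 assumes "p \<in> polynomial_functions sc V" "q \<in> polynomial_functions sc V"
 shows "(\<lambda>x. p x - q x) \<in> polynomial_functions sc V"
proof -
 have "(\<lambda>x. p x + (-1) * q x) \<in> polynomial_functions sc V"
  by (intro polynomial_functions.add polynomial_functions.mult polynomial_functions.const assms)
 thus ?thesis by simp
qed

lemma polynomial_functions_power:
 "p \<in> polynomial_functions sc V ==> (\<lambda>x. p x ^ n) \<in> polynomial_functions sc V"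
 by (induction n) (auto intro: polynomial_functions.intros)

definition dep :: "nat => (nat => 'z => 'a::field) => 'z set => bool"
 where "dep n m Z \<longleftrightarrow> (\<exists>c. (\<exists>i<n. c i ~= 0) \<and> (\<forall>z\<in>Z. (\<Sum>i<n. c i * m i z) = 0))"

text \<open>Fraction-free elimination with the pivot \<open>m n z\<close>.\<close>

lemma dep_Suc:
 "dep (Suc n) m Z \<longleftrightarrow> (\<forall>z\<in>Z. m n z = 0 \<or> dep n (\<lambda>i y. m i y * m n z - m i z * m n y) Z)" (is "?L \<longleftrightarrow> ?R")
proof
 assume ?L
 then obtain c where c: "\<exists>i<Suc n. c i ~= 0" "\<And>z. z \<in> Z ==> (\<Sum>i<n. c i * m i z) = - c n * m n z"
  unfolding dep_def by (auto simp: add_eq_0_iff2)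
 show ?R
 proof (intro ballI disjCI)
  fix z assume z: "z \<in> Z" and nd: "\<not> dep n (\<lambda>i y. m i y * m n z - m i z * m n y) Z"
  have "(\<Sum>i<n. c i * (m i y * m n z - m i z * m n y)) = 0" if y: "y \<in> Z" for y
  proof -
   have "(\<Sum>i<n. c i * (m i y * m n z - m i z * m n y)) = (\<Sum>i<n. c i * m i y) * m n z - (\<Sum>i<n. c i * m i z) * m n y"
    unfolding sum_distrib_right sum_subtractf[symmetric] by (intro sum.cong) (auto simp: algebra_simps)
   thus ?thesis unfolding c(2)[OF y] c(2)[OF z] by simp
  qed
  hence "c i = 0" if "i < n" for i using nd that unfolding dep_def by blast
  hence "c n ~= 0" "(\<Sum>i<n. c i * m i z) = 0" using c(1) by (auto simp: less_Suc_eq)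
  thus "m n z = 0" using c(2)[OF z] by simp
 qed
next
 assume R: ?R
 show ?L
 proof (cases "\<forall>z\<in>Z. m n z = 0")
  case True
  thus ?thesis unfolding dep_def by (intro exI[of _ "\<lambda>i. if i = n then 1 else 0"]) auto
 next
  case False
  then obtain z where z: "z \<in> Z" "m n z ~= 0" by blast
  then obtain c where c: "\<exists>i<n. c i ~= 0" "\<And>y. y \<in> Z ==> (\<Sum>i<n. c i * (m i y * m n z - m i z * m n y)) = 0"
   using R unfolding dep_def by blast
  define c' where "c' i = (if i < n then c i * m n z else - (\<Sum>i<n. c i * m i z))" for i
  have "(\<Sum>i<Suc n. c' i * m i y) = 0" if y: "y \<in> Z" for y
   using c(2)[OF y] by (simp add: c'_def sum_subtractf sum_distrib_right sum_distrib_left algebra_simps)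
  moreover have "\<exists>i<Suc n. c' i ~= 0" using c(1) z(2) by (auto simp: c'_def intro: less_SucI)
  ultimately show ?thesis unfolding dep_def by blast
 qed
qed

text \<open>A homogeneous linear system with more unknowns than equations, where \<open>Z\<close>
  indexes the equations; the elimination of \<open>dep_Suc\<close> removes one of each.\<close>

lemma dep_of_card: "finite Z ==> card Z < n ==> dep n m Z"
proof (induction n arbitrary: Z m)
 case (Suc n)
 show ?case unfolding dep_Suc
 proof (intro ballI disjCI)
  fix z assume z: "z \<in> Z"
  have "dep n (\<lambda>i y. m i y * m n z - m i z * m n y) (Z - {z})"
   by (rule Suc.IH) (use Suc.prems card_Diff1_less[OF Suc.prems(1) z] in auto)
  thus "m n z = 0" if "\<not> dep n (\<lambda>i y. m i y * m n z - m i z * m n y) Z" using that unfolding dep_def by force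
 qed
qed simp

text \<open>By \<open>dep_Suc\<close> the set is an intersection of unions of two closed sets, and
  fraction-free elimination keeps the entries polynomial in \<open>h\<close>. \<open>Z\<close> may
  be infinite, so no finite system of minors has to be singled out.\<close>

lemma closedin_dep:
 "(\<And>i z. i < n ==> z \<in> Z ==> (\<lambda>h. m h i z) \<in> polynomial_functions sc V) ==>
  closedin (zariski sc V) {h \<in> V. dep n (m h) Z}"
proof (induction n arbitrary: m)
 case 0
 thus ?case by (simp add: dep_def)
next
 case (Suc n)
 define D where "D z = {h \<in> V. m h n z = 0} \<union> {h \<in> V. dep n (\<lambda>i y. m h i y * m h n z - m h i z * m h n y) Z}" for z
 have "closedin (zariski sc V) (D z)" if z: "z \<in> Z" for z unfolding D_def
 proof (rule closedin_Un)
  show "closedin (zariski sc V) {h \<in> V. m h n z = 0}"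
   unfolding closedin_zariski using Suc.prems[of n z] z by (intro exI[of _ "{\<lambda>h. m h n z}"]) auto
  show "closedin (zariski sc V) {h \<in> V. dep n (\<lambda>i y. m h i y * m h n z - m h i z * m h n y) Z}"
   by (rule Suc.IH) (intro polynomial_functions_diff polynomial_functions.mult Suc.prems z; simp)
 qed
 hence "closedin (zariski sc V) (\<Inter> (insert V (D ` Z)))"
  by (intro closedin_Inter) (auto simp: closedin_topspace[of "zariski sc V", unfolded topspace_zariski])
 moreover have "\<Inter> (insert V (D ` Z)) = {h \<in> V. dep (Suc n) (m h) Z}" unfolding dep_Suc D_def by blast
 ultimately show ?case by simp
qed

lemma polynomial_function_on_line:
 assumes "p \<in> polynomial_functions (*s) (UNIV :: (complex^3) set)"
 shows "\<exists>q. \<forall>s. p (a + s *s b) = poly q s" using assms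
proof induction
 case (const c)
 show ?case by (intro exI[of _ "[:c:]"]) simp
next
 case (linear \<phi>)
 thus ?case by (intro exI[of _ "[:\<phi> a, \<phi> b:]"]) simp
next
 case (add p q)
 then obtain p' q' where "\<forall>s. p (a + s *s b) = poly p' s" "\<forall>s. q (a + s *s b) = poly q' s" by blast
 thus ?case by (intro exI[of _ "p' + q'"]) simp
next
 case (mult p q)
 then obtain p' q' where "\<forall>s. p (a + s *s b) = poly p' s" "\<forall>s. q (a + s *s b) = poly q' s" by blast
 thus ?case by (intro exI[of _ "p' * q'"]) simp
qed

lemma zariski_open_basic:
 assumes "openin (zariski sc V) U" "a \<in> U"
 obtains p where "p \<in> polynomial_functions sc V" "p a ~= 0" "\<And>x. x \<in> V ==> p x ~= 0 ==> x \<in> U"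
proof -
 obtain P where P: "P \<subseteq> polynomial_functions sc V" "V - U = {x \<in> V. \<forall>p\<in>P. p x = 0}" "U \<subseteq> V"
  using assms(1) unfolding openin_zariski by (elim conjE exE)
 hence "a \<notin> {x \<in> V. \<forall>p\<in>P. p x = 0}" "a \<in> V" using assms(2) by auto
 then obtain p where p: "p \<in> P" "p a ~= 0" by blast
 show ?thesis
 proof (rule that)
  show "x \<in> U" if "x \<in> V" "p x ~= 0" for x using that p(1) P(2) by (metis (mono_tags, lifting) DiffI mem_Collect_eq)
 qed (use p P(1) in auto)
qed

text \<open>The affine space is irreducible: on the line through a point of each set, both functions
  restrict to nonzero polynomials in one variable, whose product has a non-root.\<close>

lemma zariski_open_inter:
 assumes "openin (zariski (*s) (UNIV :: (complex^3) set)) U" "U ~= {}"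
  and "openin (zariski (*s) (UNIV :: (complex^3) set)) U'" "U' ~= {}"
 shows "U \<inter> U' ~= {}"
proof -
 obtain a b where ab: "a \<in> U" "b \<in> U'" using assms by blast
 obtain p where p: "p \<in> polynomial_functions (*s) (UNIV :: (complex^3) set)" "p a ~= 0" "\<And>x. p x ~= 0 ==> x \<in> U"
  by (rule zariski_open_basic[OF assms(1) ab(1)]) simp
 obtain q where q: "q \<in> polynomial_functions (*s) (UNIV :: (complex^3) set)" "q b ~= 0" "\<And>x. q x ~= 0 ==> x \<in> U'"
  by (rule zariski_open_basic[OF assms(3) ab(2)]) simp
 obtain r where r: "\<And>s. p (a + s *s (b - a)) * q (a + s *s (b - a)) = poly r s"
  using polynomial_function_on_line[OF polynomial_functions.mult[OF p(1) q(1)], of a "b - a"] by blast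
 obtain p' where p': "\<And>s. p (a + s *s (b - a)) = poly p' s" using polynomial_function_on_line[OF p(1)] by blast
 obtain q' where q': "\<And>s. q (a + s *s (b - a)) = poly q' s" using polynomial_function_on_line[OF q(1)] by blast
 have "p' ~= 0" "q' ~= 0" using p(2) q(2) p'[of 0] q'[of 1] by auto
 hence "p' * q' ~= 0" by simp
 then obtain s where "poly (p' * q') s ~= 0" using poly_all_0_iff_0 by blast
 hence "p (a + s *s (b - a)) ~= 0" "q (a + s *s (b - a)) ~= 0" using p' q' by auto
 thus ?thesis using p(3) q(3) by blast
qed

section \<open>Lines meeting a plane curve\<close>

text \<open>The cross product; the vectors \<open>cx a u\<close> represent points of the line
  \<open>a\<close>.\<close>

definition cx :: "complex^3 => complex^3 => complex^3"
 where "cx a u = vector [a$2 * u$3 - a$3 * u$2, a$3 * u$1 - a$1 * u$3, a$1 * u$2 - a$2 * u$1]"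

definition dt :: "complex^3 => complex^3 => complex"
 where "dt a v = (\<Sum>i\<in>UNIV. a$i * v$i)"

lemma dt_3: "dt a v = a$1 * v$1 + a$2 * v$2 + a$3 * v$3" by (simp add: dt_def sum_3)

lemma cx_nth [simp]: "cx a u $ 1 = a$2 * u$3 - a$3 * u$2" "cx a u $ 2 = a$3 * u$1 - a$1 * u$3"
 "cx a u $ 3 = a$1 * u$2 - a$2 * u$1" by (simp_all add: cx_def vector_3)

lemma vec3_eq: "x = y \<longleftrightarrow> x$1 = y$1 \<and> x$2 = y$2 \<and> x$3 = (y::'a^3)$3"
 by (simp add: vec_eq_iff forall_3)

text \<open>Cramer's rule for the basis \<open>cx a u1\<close>, \<open>cx a u2\<close> of the plane
  annihilated by \<open>a\<close>.\<close>

lemma line_coordinates: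
 assumes "dt a v = 0" "dt a (cx u1 u2) ~= 0"
 shows "v = (dt v u2 / dt a (cx u1 u2)) *s cx a u1 + (- dt v u1 / dt a (cx u1 u2)) *s cx a u2"
proof -
 define de where "de = dt a (cx u1 u2)"
 have "de * v$k = dt v u2 * cx a u1 $ k - dt v u1 * cx a u2 $ k + dt a v * cx u1 u2 $ k" for k
  using exhaust_3[of k] by (auto simp: de_def dt_3 algebra_simps)
 hence "v$k = (dt v u2 * cx a u1 $ k - dt v u1 * cx a u2 $ k) / de" for k using assms by (simp add: de_def field_simps)
 thus ?thesis by (simp add: vec_eq_iff de_def diff_divide_distrib)
qed

lemma dt_cx: "dt (x *s cx a u1 + y *s cx a u2) u1 = - y * dt a (cx u1 u2)"
 "dt (x *s cx a u1 + y *s cx a u2) u2 = x * dt a (cx u1 u2)" by (simp_all add: dt_3 algebra_simps)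

lemma proj_point_eq_iff:
 assumes "v ~= 0"
 shows "proj_point v = proj_point w \<longleftrightarrow> (\<exists>c. c ~= 0 \<and> v = c *s w)"
proof
 assume "proj_point v = proj_point w"
 hence "v \<in> vec.span {w}" unfolding proj_point_def using vec.span_base[of v "{v}"] by auto
 then obtain c where "v = c *s w" unfolding vec.span_singleton by blast
 thus "\<exists>c. c ~= 0 \<and> v = c *s w" using assms by (intro exI[of _ c]) auto
next
 assume "\<exists>c. c ~= 0 \<and> v = c *s w"
 then obtain c where c: "c ~= 0" "v = c *s w" by blast
 show "proj_point v = proj_point w" unfolding proj_point_def vec.span_singleton
 proof (intro equalityI image_subsetI)
  fix k
  show "k *s v \<in> range (\<lambda>k. k *s w)" using c(2) by (auto intro!: image_eqI[of _ _ "k * c"] simp: vector_smult_assoc)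
  show "k *s w \<in> range (\<lambda>k. k *s v)" using c by (auto intro!: image_eqI[of _ _ "k / c"] simp: vector_smult_assoc)
 qed
qed

definition zero_set :: "(complex^3 => complex) => (complex^3) set set"
 where "zero_set F = {proj_point v | v. v ~= 0 \<and> F v = 0}"

text \<open>The parameter \<open>x\<close> misses exactly one point of the line,
  \<open>cx a u1\<close>, and this one is not a zero of \<open>F\<close> by assumption.\<close>

lemma zero_set_inter_line:
 assumes F: "HP l F" and u: "dt a (cx u1 u2) ~= 0" "F (cx a u1) ~= 0"
 shows "bij_betw (\<lambda>x. proj_point (x *s cx a u1 + cx a u2)) {x. F (x *s cx a u1 + cx a u2) = 0} (zero_set F \<inter> proj_line a)"
proof -
 define de where "de = dt a (cx u1 u2)"
 define y where "y x = x *s cx a u1 + cx a u2" for x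
 have d: "de ~= 0" using u by (simp add: de_def)
 have dty: "dt (y x) u1 = - de" "dt (y x) u2 = x * de" for x using dt_cx[of x a u1 1 u2] by (simp_all add: y_def de_def)
 have y0: "y x ~= 0" for x using dty(1)[of x] d by (auto simp: dt_3)
 have ya: "dt a (y x) = 0" for x by (simp add: y_def dt_3 algebra_simps)
 have inj: "x = x'" if eq: "proj_point (y x) = proj_point (y x')" for x x'
 proof -
  obtain c where c: "y x = c *s y x'" using proj_point_eq_iff[OF y0, THEN iffD1, OF eq] by (elim exE conjE)
  have sc: "dt (c *s v) w = c * dt v w" for v w by (simp add: dt_3 algebra_simps)
  have "c = 1" using dty(1)[of x] dty(1)[of x'] d unfolding c sc by simp
  thus ?thesis using dty(2)[of x] dty(2)[of x'] d unfolding c sc by simp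
 qed
 have "\<exists>x. F (y x) = 0 \<and> proj_point v = proj_point (y x)" if v: "v ~= 0" "F v = 0" "dt a v = 0" for v
 proof -
  define \<alpha> \<beta> where "\<alpha> = dt v u2 / de" and "\<beta> = - dt v u1 / de"
  have veq: "v = \<alpha> *s cx a u1 + \<beta> *s cx a u2"
   unfolding \<alpha>_def \<beta>_def de_def by (rule line_coordinates[OF v(3) u(1)])
  have "\<beta> ~= 0"
  proof
   assume "\<beta> = 0"
   hence e: "v = \<alpha> *s cx a u1" using veq by simp
   hence "\<alpha> ~= 0" using v(1) by auto
   moreover have "\<alpha> ^ l * F (cx a u1) = 0" using v(2) HP_homogeneous[OF F, of \<alpha> "cx a u1"] e by metis
   ultimately show False using u(2) by simp
  qed
  hence e: "v = \<beta> *s y (\<alpha> / \<beta>)" by (subst veq) (simp add: y_def vec_eq_iff algebra_simps)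
  hence "\<beta> ^ l * F (y (\<alpha> / \<beta>)) = 0" using v(2) HP_homogeneous[OF F, of \<beta> "y (\<alpha> / \<beta>)"] by metis
  hence "F (y (\<alpha> / \<beta>)) = 0" using \<open>\<beta> ~= 0\<close> by simp
  moreover have "proj_point v = proj_point (y (\<alpha> / \<beta>))" unfolding proj_point_eq_iff[OF v(1)] by (rule exI[of _ \<beta>]) (rule conjI[OF \<open>\<beta> ~= 0\<close> e])
  ultimately show ?thesis by blast
 qed
 moreover have "\<exists>v. w = proj_point v \<and> v ~= 0 \<and> F v = 0 \<and> dt a v = 0" if w: "w \<in> zero_set F \<inter> proj_line a" for w
 proof -
  obtain v where v: "w = proj_point v" "v ~= 0" "F v = 0" using w by (auto simp: zero_set_def)
  obtain v' where v': "w = proj_point v'" "dt a v' = 0" using w by (auto simp: proj_line_def dt_def)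
  have "proj_point v = proj_point v'" using v(1) v'(1) by simp
  then obtain c where c: "v = c *s v'" unfolding proj_point_eq_iff[OF v(2)] by blast
  have "dt a (c *s v') = c * dt a v'" by (simp add: dt_3 algebra_simps)
  hence "dt a v = 0" using c v'(2) by simp
  thus ?thesis using v by blast
 qed
 ultimately have "w \<in> (\<lambda>x. proj_point (y x)) ` {x. F (y x) = 0}" if "w \<in> zero_set F \<inter> proj_line a" for w
  using that by (metis (mono_tags, lifting) image_eqI mem_Collect_eq)
 hence "zero_set F \<inter> proj_line a \<subseteq> (\<lambda>x. proj_point (y x)) ` {x. F (y x) = 0}" by (rule subsetI)
 moreover have "(\<lambda>x. proj_point (y x)) ` {x. F (y x) = 0} \<subseteq> zero_set F \<inter> proj_line a"
  using y0 ya unfolding zero_set_def proj_line_def dt_def by blast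
 ultimately show ?thesis unfolding y_def[symmetric] by (intro bij_betw_imageI inj_onI equalityI) (rule inj)
qed

text \<open>The coefficients of the restriction to a line have to be polynomial in \<open>a\<close>,
  so that the absence of multiple roots becomes a Zariski open condition on the line.\<close>

lemma form_on_lines:
 assumes "HP l F"
 shows "\<exists>B. \<forall>a. degree (B a) \<le> l \<and> coeff (B a) l = F (cx a u1) \<and>
  (\<forall>x. poly (B a) x = F (x *s cx a u1 + cx a u2)) \<and>
  (\<forall>i. (\<lambda>a. coeff (B a) i) \<in> PF)" using assms
proof induction
 case (HP_const c)
 show ?case by (intro exI[of _ "\<lambda>_. [:c:]"]) (auto intro: polynomial_functions.const)
next
 case (HP_lin l F b)
 from HP_lin.IH obtain B where "\<forall>a. degree (B a) \<le> l \<and> coeff (B a) l = F (cx a u1) \<and>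
  (\<forall>x. poly (B a) x = F (x *s cx a u1 + cx a u2)) \<and>
  (\<forall>i. (\<lambda>a. coeff (B a) i) \<in> PF)" ..
 hence B: "degree (B a) \<le> l" "coeff (B a) l = F (cx a u1)" "poly (B a) x = F (x *s cx a u1 + cx a u2)"
  "(\<lambda>a. coeff (B a) i) \<in> PF" for a x i by simp_all
 define q where "q a = [:dt b (cx a u2), dt b (cx a u1):]" for a
 have lin: "(\<lambda>a. dt b (cx a u)) \<in> PF" for u
  by (rule polynomial_functions.linear) (auto simp: dt_3 algebra_simps)
 have cf: "coeff (q a * B a) i = dt b (cx a u2) * coeff (B a) i + (case i of 0 => 0 | Suc j => dt b (cx a u1) * coeff (B a) j)" for a i
  by (cases i) (simp_all add: q_def)
 have "coeff (B a) (Suc l) = 0" for a using B(1)[of a] by (simp add: coeff_eq_0)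
 hence "coeff (q a * B a) (Suc l) = dt b (cx a u1) * F (cx a u1)" for a by (simp add: cf B(2))
 moreover have "degree (q a * B a) \<le> Suc l" for a
 proof -
  have "degree (q a) \<le> 1" by (simp add: q_def)
  thus ?thesis using degree_mult_le[of "q a" "B a"] B(1)[of a] by linarith
 qed
 moreover have "poly (q a * B a) x = dt b (x *s cx a u1 + cx a u2) * F (x *s cx a u1 + cx a u2)" for a x
 proof -
  have "dt b (x *s cx a u1 + cx a u2) = poly (q a) x" by (simp add: q_def dt_3 algebra_simps)
  thus ?thesis by (simp add: B(3))
 qed
 moreover have "(\<lambda>a. coeff (q a * B a) i) \<in> PF" for i
  unfolding cf by (cases i) (auto intro!: polynomial_functions.intros(3,4) lin B(4) polynomial_functions.const)
 ultimately show ?case unfolding dt_def[symmetric] by (intro exI[of _ "\<lambda>a. q a * B a"] allI conjI)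
next
 case (HP_add l F G)
 from HP_add.IH(1) obtain A where "\<forall>a. degree (A a) \<le> l \<and> coeff (A a) l = F (cx a u1) \<and>
  (\<forall>x. poly (A a) x = F (x *s cx a u1 + cx a u2)) \<and>
  (\<forall>i. (\<lambda>a. coeff (A a) i) \<in> PF)" ..
 hence A: "degree (A a) \<le> l" "coeff (A a) l = F (cx a u1)" "poly (A a) x = F (x *s cx a u1 + cx a u2)"
  "(\<lambda>a. coeff (A a) i) \<in> PF" for a x i by simp_all
 from HP_add.IH(2) obtain B where "\<forall>a. degree (B a) \<le> l \<and> coeff (B a) l = G (cx a u1) \<and>
  (\<forall>x. poly (B a) x = G (x *s cx a u1 + cx a u2)) \<and>
  (\<forall>i. (\<lambda>a. coeff (B a) i) \<in> PF)" ..
 hence B: "degree (B a) \<le> l" "coeff (B a) l = G (cx a u1)" "poly (B a) x = G (x *s cx a u1 + cx a u2)"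
  "(\<lambda>a. coeff (B a) i) \<in> PF" for a x i by simp_all
 show ?case by (intro exI[of _ "\<lambda>a. A a + B a"] allI conjI degree_add_le A B)
   (simp_all add: A B polynomial_functions.add)
qed

section \<open>The discriminant as a linear dependence\<close>

lemma sum_lessThan_add: "(\<Sum>i<(a::nat)+b. f i) = (\<Sum>i<a. f i) + (\<Sum>j<b. f (a + j))"
 by (induction b) (auto simp: add.assoc)

text \<open>The rows of the Sylvester matrix of \<open>p\<close> and its derivative: first the
  multiples of \<open>pderiv p\<close> by the powers below \<open>l\<close>, then multiples of
  \<open>p\<close>.\<close>

definition syl :: "nat => complex poly => nat => nat => complex"
 where "syl l p i k = (if i < l then coeff (monom 1 i * pderiv p) k else coeff (monom 1 (i - l) * p) k)"

lemma syl_combination: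
 "(\<Sum>i<l+(l-1). c i * syl l p i k) =
  coeff ((\<Sum>i<l. monom (c i) i) * pderiv p + (\<Sum>j<l-1. monom (c (l + j)) j) * p) k"
proof -
 have m: "monom x i * q = smult x (monom 1 i * q)" for x i and q :: "complex poly"
  by (metis mult.right_neutral mult_smult_left smult_monom)
 show ?thesis unfolding sum_lessThan_add by (simp add: syl_def coeff_sum sum_distrib_right m[of "c _"])
qed

text \<open>A dependence is an identity \<open>A * pderiv p + C * p = 0\<close> with
  \<open>degree A < l\<close>. Without common roots \<open>p\<close> has \<open>l\<close> distinct
  roots, all of them roots of \<open>A\<close>, which forces \<open>A = 0\<close>; conversely a
  common linear factor yields the two cofactors.\<close>

lemma dep_syl_iff:
 assumes l: "degree p = l" "1 \<le> l"
 shows "dep (l + (l - 1)) (syl l p) UNIV \<longleftrightarrow> (\<exists>x. poly p x = 0 \<and> poly (pderiv p) x = 0)"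
proof
 assume "\<exists>x. poly p x = 0 \<and> poly (pderiv p) x = 0"
 then obtain x where "[:-x, 1:] dvd p" "[:-x, 1:] dvd pderiv p" by (auto simp: poly_eq_0_iff_dvd)
 then obtain A C where AC: "p = [:-x, 1:] * A" "pderiv p = [:-x, 1:] * C" by (elim dvdE)
 have dm: "degree ([:-x, 1:] * q) = Suc (degree q)" if "q ~= 0" for q using degree_mult_eq[OF _ that, of "[:-x, 1:]"] by simp
 have p0: "p ~= 0" using l by auto
 hence A0: "A ~= 0" using AC(1) by auto
 have dA: "degree A < l" using dm[OF A0] l(1) unfolding AC(1)[symmetric] by simp
 have dC: "C = 0 \<or> degree C < l - 1" using dm[of C] degree_pderiv[of p] l unfolding AC(2)[symmetric] by fastforce
 define c where "c i = (if i < l then coeff A i else - coeff C (i - l))" for i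
 have "(\<Sum>i<l. monom (c i) i) = A" by (rule poly_eqI) (use dA in \<open>auto simp: coeff_sum c_def coeff_eq_0\<close>)
 moreover have "(\<Sum>j<l-1. monom (c (l + j)) j) = - C"
  by (rule poly_eqI) (use dC in \<open>auto simp: coeff_sum c_def coeff_eq_0\<close>)
 moreover have "A * pderiv p - C * p = 0" by (simp add: AC(2)) (simp add: AC(1) algebra_simps)
 ultimately have "(\<Sum>i<l+(l-1). c i * syl l p i k) = 0" for k unfolding syl_combination by simp
 moreover have "\<exists>i<l+(l-1). c i ~= 0" using A0 dA by (intro exI[of _ "degree A"]) (auto simp: c_def)
 ultimately show "dep (l + (l - 1)) (syl l p) UNIV" unfolding dep_def by blast
next
 assume "dep (l + (l - 1)) (syl l p) UNIV"
 then obtain c where c: "\<exists>i<l+(l-1). c i ~= 0" "\<And>k. (\<Sum>i<l+(l-1). c i * syl l p i k) = 0"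
  unfolding dep_def by blast
 define A C where "A = (\<Sum>i<l. monom (c i) i)" and "C = (\<Sum>j<l-1. monom (c (l + j)) j)"
 have eq: "A * pderiv p + C * p = 0" using c(2) unfolding syl_combination A_def C_def by (simp add: poly_eq_iff)
 show "\<exists>x. poly p x = 0 \<and> poly (pderiv p) x = 0"
 proof (rule ccontr)
  assume "\<not> ?thesis"
  hence nr: "poly (pderiv p) x ~= 0" if "poly p x = 0" for x using that by blast
  have p0: "p ~= 0" using l by auto
  have rA: "poly A x = 0" if "poly p x = 0" for x using arg_cong[OF eq, of "\<lambda>q. poly q x"] that nr[OF that] by simp
  have cA: "coeff A i = (if i < l then c i else 0)" for i by (simp add: A_def coeff_sum)
  have cC: "coeff C i = (if i < l - 1 then c (l + i) else 0)" for i by (simp add: C_def coeff_sum)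
  have "A = 0"
  proof (rule ccontr)
   assume A0: "A ~= 0"
   have "card {x. poly p x = 0} \<le> card {x. poly A x = 0}" by (intro card_mono poly_roots_finite A0) (use rA in auto)
   also have "\<dots> \<le> degree A" by (rule card_poly_roots_bound[OF A0])
   also have "\<dots> < l" using l(2) cA by (intro degree_lessI) auto
   finally show False using card_roots_of_coprime_deriv[of p] nr l by simp
  qed
  hence "C = 0" using eq p0 by simp
  have "c i = 0" if "i < l + (l - 1)" for i
  proof (cases "i < l")
   case False
   hence "l + (i - l) = i" "i - l < l - 1" using that by auto
   thus ?thesis using cC[of "i - l"] \<open>C = 0\<close> by simp
  qed (use cA[of i] \<open>A = 0\<close> in simp)
  thus False using c(1) by blast
 qed
qed

text \<open>Outside the closed sets where the discriminant or the leading coefficient vanishes or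
  the parametrization degenerates, a line meets the curve in \<open>l\<close> distinct points; the
  hypotheses place \<open>a0\<close> outside.\<close>

lemma generic_line_open:
 assumes F: "HP l F" "1 \<le> l" and a0: "dt a0 (cx u1 u2) ~= 0" "F (cx a0 u1) ~= 0"
  and simple: "card {x. F (x *s cx a0 u1 + cx a0 u2) = 0} = l"
 shows "\<exists>U. openin (zariski (*s) UNIV) U \<and> a0 \<in> U \<and>
  (\<forall>a\<in>U. finite (zero_set F \<inter> proj_line a) \<and> card (zero_set F \<inter> proj_line a) = l)"
proof -
 from form_on_lines[OF F(1)] obtain B where "\<forall>a. degree (B a) \<le> l \<and> coeff (B a) l = F (cx a u1) \<and>
  (\<forall>x. poly (B a) x = F (x *s cx a u1 + cx a u2)) \<and>
  (\<forall>i. (\<lambda>a. coeff (B a) i) \<in> PF)" ..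
 hence B: "degree (B a) \<le> l" "coeff (B a) l = F (cx a u1)" "poly (B a) x = F (x *s cx a u1 + cx a u2)"
  "(\<lambda>a. coeff (B a) i) \<in> PF" for a x i by simp_all
 have deg: "degree (B a) = l" if "F (cx a u1) ~= 0" for a using B(1,2) that by (metis le_antisym le_degree)
 have syl: "(\<lambda>a. syl l (B a) i k) \<in> PF" for i k
 proof -
  have "(\<lambda>a. coeff (monom 1 j * pderiv (B a)) k) \<in> PF" for j
   unfolding coeff_monom_mult coeff_pderiv
   by (cases "k < j") (auto intro!: polynomial_functions.mult polynomial_functions.const B(4))
  moreover have "(\<lambda>a. coeff (monom 1 j * B a) k) \<in> PF" for j
   unfolding coeff_monom_mult by (cases "k < j") (auto intro!: polynomial_functions.mult polynomial_functions.const B(4))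
  ultimately show ?thesis unfolding syl_def by (cases "i < l") simp_all
 qed
 define D where "D = {a. dep (l + (l - 1)) (syl l (B a)) UNIV}"
 define E where "E = {a. dt a (cx u1 u2) * coeff (B a) l = 0}"
 have "closedin (zariski (*s) UNIV) {a \<in> UNIV. dep (l + (l - 1)) (syl l (B a)) UNIV}" by (rule closedin_dep) (rule syl)
 moreover have "closedin (zariski (*s) UNIV) E" unfolding closedin_zariski
 proof (intro exI[of _ "{\<lambda>a. dt a (cx u1 u2) * coeff (B a) l}"] conjI)
  have "(\<lambda>a. dt a (cx u1 u2)) \<in> PF"
   by (rule polynomial_functions.linear) (auto simp: dt_3 algebra_simps)
  thus "{\<lambda>a. dt a (cx u1 u2) * coeff (B a) l} \<subseteq> PF"
   by (auto intro: polynomial_functions.mult B(4))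
 qed (auto simp: E_def)
 ultimately have "openin (zariski (*s) UNIV) (topspace (zariski (*s) UNIV) - (D \<union> E))"
  by (intro openin_diff openin_topspace closedin_Un) (simp_all add: D_def)
 hence op: "openin (zariski (*s) UNIV) (UNIV - (D \<union> E))" by (simp add: topspace_zariski)
 have good: "finite (zero_set F \<inter> proj_line a) \<and> card (zero_set F \<inter> proj_line a) = l" if a: "a \<notin> D \<union> E" for a
 proof -
  have nz: "dt a (cx u1 u2) ~= 0" "F (cx a u1) ~= 0" using a B(2) by (auto simp: E_def)
  have d: "degree (B a) = l" by (rule deg[OF nz(2)])
  have "poly (pderiv (B a)) x ~= 0" if "poly (B a) x = 0" for x using dep_syl_iff[OF d F(2)] a that by (auto simp: D_def)
  hence "card {x. poly (B a) x = 0} = l" using card_roots_of_coprime_deriv[of "B a"] d by blast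
  moreover have "finite {x. poly (B a) x = 0}" using d F(2) by (intro poly_roots_finite) auto
  ultimately show ?thesis
   using bij_betw_finite[OF zero_set_inter_line[OF F(1) nz]] bij_betw_same_card[OF zero_set_inter_line[OF F(1) nz]]
   by (simp add: B(3))
 qed
 have "a0 \<notin> D"
 proof
  assume "a0 \<in> D"
  then obtain x where x: "poly (B a0) x = 0" "poly (pderiv (B a0)) x = 0"
   using dep_syl_iff[OF deg[OF a0(2)] F(2)] by (auto simp: D_def)
  then obtain A where A: "B a0 = [:-x, 1:] * A" by (auto simp: poly_eq_0_iff_dvd)
  have "pderiv (B a0) = A + [:-x, 1:] * pderiv A" unfolding A pderiv_mult by (simp add: pderiv_pCons algebra_simps)
  hence "poly A x = 0" using x(2) by simp
  hence sub: "{y. poly (B a0) y = 0} \<subseteq> {y. poly A y = 0}" unfolding A by auto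
  have A0: "A ~= 0" using deg[OF a0(2)] F(2) A by auto
  have "l \<le> card {y. poly A y = 0}" using card_mono[OF poly_roots_finite[OF A0] sub] simple by (simp add: B(3))
  also have "\<dots> \<le> degree A" by (rule card_poly_roots_bound[OF A0])
  also have "\<dots> < l"
  proof -
   have "degree ([:-x, 1:] * A) = Suc (degree A)" using degree_mult_eq[OF _ A0, of "[:-x, 1:]"] by simp
   thus ?thesis using deg[OF a0(2)] unfolding A[symmetric] by simp
  qed
  finally show False by simp
 qed
 hence "a0 \<in> UNIV - (D \<union> E)" using a0 B(2) by (auto simp: E_def)
 thus ?thesis using op good by blast
qed

text \<open>\<open>v\<close> is completed to a basis as third column; the determinant is
  \<open>dt v (cx a b)\<close>, and some pair of coordinate vectors makes it nonzero.\<close>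

lemma frame_exists:
 assumes "v ~= (0 :: complex^3)"
 obtains M M' :: "complex^3^3" where "M ** M' = mat 1" "M' ** M = mat 1" "M *v vector [0, 0, 1] = v"
proof -
 define w where "w = (\<lambda>a b. transpose (vector [a, b, v] :: complex^3^3))"
 have col: "w a b *v vector [0, 0, 1] = v" for a b
  by (simp add: w_def vec3_eq matrix_vector_mult_def transpose_def sum_3 vector_3)
 have detw: "Determinants.det (w a b) = dt v (cx a b)" for a b
  by (simp add: w_def Finite_Cartesian_Product.transpose_def det_3 vector_3 dt_3 algebra_simps)
 have "\<exists>a b. dt v (cx a b) ~= 0"
 proof -
  have "dt v (cx (vector [0,1,0]) (vector [0,0,1])) = v$1" "dt v (cx (vector [0,0,1]) (vector [1,0,0])) = v$2"
   "dt v (cx (vector [1,0,0]) (vector [0,1,0])) = v$3" by (simp_all add: dt_3 vector_3)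
  moreover have "v$1 ~= 0 \<or> v$2 ~= 0 \<or> v$3 ~= 0" using assms by (auto simp: vec3_eq)
  ultimately show ?thesis by metis
 qed
 then obtain a b where "invertible (w a b)" unfolding invertible_det_nz detw by (elim exE)
 then obtain M' where "w a b ** M' = mat 1" "M' ** w a b = mat 1" unfolding invertible_def by blast
 thus ?thesis by (rule that[OF _ _ col])
qed

text \<open>Through a point off the curve, irreducibility provides a line without multiple intersections.\<close>

lemma generic_line_exists:
 fixes M M' :: "complex^3^3"
 assumes F: "HP l F" "1 \<le> l" and M: "M' ** M = mat 1"
  and R: "\<And>t w. F (M *v vector [1, t, w]) = ev2 R t w" "coeff (coeff R l) 0 ~= 0" "tdeg_le l R" "irreducible R"
  and FM: "F (M *v vector [0, 0, 1]) ~= 0"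
 shows "\<exists>U. openin (zariski (*s) UNIV) U \<and> U ~= {} \<and>
  (\<forall>a\<in>U. finite (zero_set F \<inter> proj_line a) \<and> card (zero_set F \<inter> proj_line a) = l)"
proof -
 have R0: "coeff R l ~= 0" using R(2) by auto
 have dR: "degree R = l" using R0 tdeg_le_degree[OF R(3)] by (simp add: le_antisym le_degree)
 have "degree (coeff R l) = 0" using tdeg_le_coeff(1)[OF R(3), of l] by simp
 then obtain c0 where c0: "coeff R l = [:c0:]" "c0 ~= 0" using R(2) by (metis degree_eq_zeroE coeff_pCons_0)
 have pR: "prime_elem R" using irreducible_imp_prime_elem[OF R(4)] .
 have "pderiv R ~= 0" using dR F(2) by (simp add: pderiv_eq_0_iff)
 moreover have "degree (pderiv R) < degree R" using dR F(2) by (simp add: degree_pderiv)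
 ultimately have "\<not> R dvd pderiv R" using dvd_imp_degree_le[of R "pderiv R"] by auto
 \<comment> \<open>\<open>c\<close> plays the role of the discriminant: the line
   \<open>t = t0\<close> passes through the point \<open>(0 : 0 : 1)\<close> of the frame and meets
   the curve simply if \<open>poly c t0\<close> is not zero.\<close>
 then obtain a b c where abc: "a * R + b * pderiv R = [:c:]" "c ~= 0"
  using prime_elem_combination_const[OF pR] dR F(2) by metis
 obtain t0 where t0: "poly c t0 ~= 0" using abc(2) poly_all_0_iff_0 by blast
 define q where "q = map_poly (\<lambda>c. poly c t0) R"
 have q: "poly q x = ev2 R t0 x" for x by (simp add: q_def ev2_eq_poly_map)
 have "map_poly (\<lambda>c. poly c t0) (pderiv R) = pderiv q"
  by (rule poly_eqI) (simp add: q_def coeff_map_poly coeff_pderiv)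
 hence q': "poly (pderiv q) x = ev2 (pderiv R) t0 x" for x by (simp add: ev2_eq_poly_map)
 have "poly (pderiv q) x ~= 0" if "poly q x = 0" for x
  using arg_cong[OF abc(1), of "\<lambda>A. ev2 A t0 x"] that t0 by (auto simp: q q')
 hence "card {x. poly q x = 0} = degree q" by (rule card_roots_of_coprime_deriv)
 moreover have "coeff q l = c0" using c0 by (simp add: q_def coeff_map_poly)
 hence "degree q = l" using c0(2) dR map_poly_degree_leq[of "\<lambda>c. poly c t0" R] unfolding q_def
  by (metis le_antisym le_degree)
 ultimately have cardq: "card {x. poly q x = 0} = l" by simp
 define y1 y2 where "y1 = M *v vector [0, 0, 1]" and "y2 = M *v vector [1, t0, 0]"
 define a0 where "a0 = cx y1 y2"
 have line: "x *s y1 + y2 = M *v vector [1, t0, x]" for x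
  by (simp add: y1_def y2_def vec3_eq matrix_vector_mult_def sum_3 vector_3 algebra_simps)
 have "a0 ~= 0"
 proof
  assume z: "a0 = 0"
  have "y1 ~= 0"
  proof
   assume "y1 = 0"
   hence "F y1 = 0" using HP_homogeneous[OF F(1), of 0 y1] F(2) by (simp add: power_0_left)
   thus False using FM by (simp add: y1_def)
  qed
  then obtain k where k: "y1 $ k ~= 0" by (auto simp: vec_eq_iff)
  have "y1 $ k * y2 $ i = y2 $ k * y1 $ i" for i
   using z exhaust_3[of k] exhaust_3[of i] by (auto simp: a0_def vec3_eq algebra_simps)
  hence "y2 = (y2 $ k / y1 $ k) *s y1" using k by (simp add: vec_eq_iff field_simps)
  hence "M' *v y2 = (y2 $ k / y1 $ k) *s (M' *v y1)" by (metis vector_scalar_commute)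
  hence "vector [1, t0, 0] = (y2 $ k / y1 $ k) *s (vector [0, 0, 1] :: complex^3)"
   unfolding y1_def y2_def matrix_vector_mul_assoc M by simp
  thus False by (simp add: vec3_eq vector_3)
 qed
 then obtain j where j: "a0 $ j ~= 0" by (auto simp: vec_eq_iff)
 \<comment> \<open>With \<open>dt a0 d = 1\<close> the triple product formula gives
   \<open>cx a0 (cx y d) = y\<close> for \<open>y\<close> on the line, so that \<open>u1\<close> and
   \<open>u2\<close> parametrize the line by \<open>y1\<close> and \<open>y2\<close>.\<close>
 define d where "d = axis j (1 / a0 $ j)"
 have ad: "dt a0 d = 1" using j exhaust_3[of j] by (auto simp: d_def dt_3 axis_def)
 define u1 u2 where "u1 = cx y1 d" and "u2 = cx y2 d"
 have "cx a0 (cx y d) = dt a0 d *s y - dt a0 y *s d" for y by (simp add: vec3_eq dt_3 algebra_simps)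
 moreover have "dt a0 y1 = 0" "dt a0 y2 = 0" by (simp_all add: a0_def dt_3 algebra_simps)
 ultimately have cxu: "cx a0 u1 = y1" "cx a0 u2 = y2" by (simp_all add: u1_def u2_def ad)
 have "dt a0 (cx u1 u2) = dt (cx a0 u1) u2" by (simp add: dt_3 algebra_simps)
 also have "\<dots> = dt a0 d" unfolding cxu by (simp add: u2_def a0_def dt_3 algebra_simps)
 finally have "dt a0 (cx u1 u2) ~= 0" using ad by simp
 moreover have "F (cx a0 u1) ~= 0" unfolding cxu y1_def by (rule FM)
 moreover have "card {x. F (x *s cx a0 u1 + cx a0 u2) = 0} = l" unfolding cxu line R(1) using cardq by (simp add: q)
 ultimately obtain U where "openin (zariski (*s) UNIV) U" "a0 \<in> U"
  "\<forall>a\<in>U. finite (zero_set F \<inter> proj_line a) \<and> card (zero_set F \<inter> proj_line a) = l"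
  using generic_line_open[OF F] by blast
 thus ?thesis by blast
qed

text \<open>Two nonempty open sets of lines intersect, so the number is unique; the further
  intersection with \<open>W\<close> avoids the zero vector, for which the definition claims
  nothing.\<close>

lemma plane_degree_eqI:
 assumes "openin (zariski (*s) UNIV) U" "U ~= {}" "\<And>a. a \<in> U ==> finite (C \<inter> proj_line a) \<and> card (C \<inter> proj_line a) = l"
 shows "plane_degree C = l" unfolding plane_degree_def
proof (rule the_equality)
 show "\<exists>U. openin (zariski (*s) UNIV) U \<and> U ~= {} \<and> (\<forall>a\<in>U - {0}. finite (C \<inter> proj_line a) \<and> card (C \<inter> proj_line a) = l)"
  using assms by blast
 fix n assume "\<exists>U. openin (zariski (*s) UNIV) U \<and> U ~= {} \<and> (\<forall>a\<in>U - {0}. finite (C \<inter> proj_line a) \<and> card (C \<inter> proj_line a) = n)"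
 then obtain U' where U': "openin (zariski (*s) UNIV) U'" "U' ~= {}" "\<And>a. a \<in> U' - {0} ==> card (C \<inter> proj_line a) = n" by blast
 define W :: "(complex^3) set" where "W = {a. a$1 ~= 0}"
 have "(\<lambda>a::complex^3. a$1) \<in> PF" by (rule polynomial_functions.linear) auto
 hence W: "openin (zariski (*s) UNIV) W"
  unfolding openin_zariski by (intro conjI exI[of _ "{\<lambda>a. a$1}"]) (auto simp: W_def)
 have "W ~= {}" using W_def by (auto intro!: exI[of _ "axis 1 1"] simp: axis_def)
 hence "U \<inter> U' \<inter> W ~= {}" using assms(1,2) U'(1,2) W by (intro zariski_open_inter openin_Int)
 then obtain a where "a \<in> U" "a \<in> U'" "a \<in> W" by blast
 moreover from this have "a ~= 0" by (auto simp: W_def)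
 ultimately show "n = l" using assms(3)[of a] U'(3)[of a] by auto
qed

section \<open>Algebraic relations between automorphic functions\<close>

context fuchsian
begin

definition relp :: "cfn => cfn => complex poly poly => bool"
 where "relp \<phi> \<psi> R \<longleftrightarrow> (AEH z. ev2 R (\<phi> z) (\<psi> z) = 0)"

definition nonconst :: "cfn => bool"
 where "nonconst \<phi> \<longleftrightarrow> (\<forall>c. \<not> (AEH z. \<phi> z = c))"

lemma not_ae_False: "\<not> (AEH z. False)" using cosparse_uhp_neq_bot by (simp add: eventually_False)

lemma mf_ev2: "mf \<phi> ==> mf \<psi> ==> mf (\<lambda>z. ev2 R (\<phi> z) (\<psi> z))"
 unfolding ev2_altdef[OF order_refl] by (intro mf_sum mf_mult mf_poly mf_power)

lemma relp_mult_cases: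
 assumes "mf \<phi>" "mf \<psi>" "relp \<phi> \<psi> (A * B)"
 shows "relp \<phi> \<psi> A \<or> relp \<phi> \<psi> B"
proof (rule disjCI)
 assume "\<not> relp \<phi> \<psi> B"
 hence "AEH z. ev2 B (\<phi> z) (\<psi> z) ~= 0"
  using mf_zero_or_nonzero[OF mf_ev2[OF assms(1,2)], of B 0] unfolding relp_def by blast
 with assms(3) show "relp \<phi> \<psi> A" unfolding relp_def by eventually_elim simp
qed

lemma relp_combination: "relp \<phi> \<psi> A ==> relp \<phi> \<psi> B ==> relp \<phi> \<psi> (C * A + D * B)"
 unfolding relp_def
proof -
 assume "AEH z. ev2 A (\<phi> z) (\<psi> z) = 0" "AEH z. ev2 B (\<phi> z) (\<psi> z) = 0"
 thus "AEH z. ev2 (C * A + D * B) (\<phi> z) (\<psi> z) = 0" by eventually_elim simp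
qed

text \<open>A nonconstant \<open>\<phi>\<close> avoids the finitely many roots of \<open>c\<close>
  almost everywhere, that is, it is transcendental over the constants.\<close>

lemma relp_const:
 assumes phi: "mf \<phi>" "nonconst \<phi>" and c: "relp \<phi> \<psi> [:c:]"
 shows "c = 0"
proof (rule ccontr)
 assume "c ~= 0"
 hence fin: "finite {x. poly c x = 0}" by (rule poly_roots_finite)
 have "AEH z. \<phi> z ~= x" for x using mf_zero_or_nonzero[OF phi(1), of x] phi(2) by (auto simp: nonconst_def)
 hence "AEH z. \<forall>x\<in>{x. poly c x = 0}. \<phi> z ~= x"
  unfolding eventually_ball_finite_distrib[OF fin] by (rule ballI)
 with c have "AEH z. False" unfolding relp_def by eventually_elim auto
 thus False using not_ae_False by blast
qed

lemma nonconst_nonzero: "\<phi> \<in> CF ==> nonconst \<phi> ==> \<phi> ~= FF0"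
proof
 assume *: "nonconst \<phi>" "\<phi> = FF0"
 hence "AEH z. \<phi> z = 0" by (simp add: FF_simps)
 thus False using *(1) unfolding nonconst_def by blast
qed

text \<open>
 In the module with generators \<open>e\<^sub>1, \<dots>, e\<^sub>n\<close> over the polynomials in \<open>\<phi>\<close>, the monomials of degree
 at most \<open>n\<close> in \<open>p(\<phi>) \<psi>\<close> and at most \<open>J\<close> in \<open>\<phi>\<close> outnumber the coefficients once \<open>J\<close> is large.
\<close>

lemma uniform_relation:
 assumes phi: "\<phi> \<in> CF" "nonconst \<phi>" and v: "\<And>i. i < (s::nat) ==> mf (v i)"
 shows "\<exists>D. \<forall>c. \<exists>R. R ~= 0 \<and> tdeg_le D R \<and> relp \<phi> (\<lambda>z. \<Sum>i<s. c i * v i z) R"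
proof -
 note phi0 = phi(1) nonconst_nonzero[OF phi]
 have mphi: "mf \<phi>" by (rule carrier_imp_mf[OF phi(1)])
 define good where "good i p k \<longleftrightarrow> p ~= 0 \<and> (\<lambda>z. poly p (\<phi> z) * v i z) \<in> Lsp \<phi> k" for i p k
 have "\<forall>i\<in>{..<s}. \<exists>p k. good i p k" unfolding good_def by (intro ballI denominator_exists phi0 v) simp
 then obtain p k where "\<forall>i\<in>{..<s}. good i (p i) (k i)" by metis
 hence pk: "p i ~= 0" "(\<lambda>z. poly (p i) (\<phi> z) * v i z) \<in> Lsp \<phi> (k i)" if "i < s" for i
  using that unfolding good_def by auto
 define P where "P = (\<Prod>i<s. p i)"
 have P0: "P ~= 0" using pk(1) by (simp add: P_def)
 define k1 where "k1 = (\<Sum>i<s. k i + degree P)"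
 have poly_L: "(\<lambda>z. poly q (\<phi> z)) \<in> Lsp \<phi> (degree q)" for q
 proof -
  obtain B where B: "\<And>x. cmod (poly q x) \<le> B * (1 + cmod x) ^ degree q" using poly_growth by blast
  show ?thesis by (rule LspI[of _ B, OF mf_poly[OF mphi] always_eventually]) (intro allI B)
 qed
 have Pv: "(\<lambda>z. poly P (\<phi> z) * v i z) \<in> Lsp \<phi> k1" if i: "i < s" for i
 proof -
  define Q where "Q = (\<Prod>j\<in>{..<s} - {i}. p j)"
  have PQ: "P = Q * p i" unfolding P_def Q_def using i by (subst prod.remove[of _ i]) (auto simp: mult.commute)
  have "degree Q \<le> degree P" using P0 by (simp add: PQ degree_mult_eq)
  moreover have "k i + degree P \<le> k1" unfolding k1_def using i by (intro member_le_sum[of i _ "\<lambda>i. k i + degree P"]) auto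
  ultimately have "degree Q + k i \<le> k1" by linarith
  moreover have "(\<lambda>z. poly Q (\<phi> z) * (poly (p i) (\<phi> z) * v i z)) \<in> Lsp \<phi> (degree Q + k i)"
   by (rule Lsp_mult[OF poly_L pk(2)[OF i]])
  ultimately have "(\<lambda>z. poly Q (\<phi> z) * (poly (p i) (\<phi> z) * v i z)) \<in> Lsp \<phi> k1" by (rule Lsp_mono[rotated])
  thus ?thesis by (simp add: PQ mult.assoc)
 qed
 obtain k0 n e where e: "\<forall>j. \<forall>u\<in>Lsp \<phi> (k0 + j). \<exists>p. (\<forall>s<n. degree (p s) \<le> j) \<and>
   (AEH z. u z = (\<Sum>s<(n::nat). poly (p s) (\<phi> z) * e s z))" using Lsp_generators[OF phi0] by (elim exE conjE)
 \<comment> \<open>\<open>N\<close> unknowns stand against \<open>n * (T + 1)\<close> linear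
   conditions, and this \<open>J\<close> makes \<open>N = n * (T + 1) + 1\<close>.\<close>
 define J where "J = n * n * k1"
 define T where "T = n * k1 + J"
 define N where "N = (n + 1) * (J + 1)"
 have count: "card ({..<n} \<times> {..T}) < N" unfolding N_def T_def J_def by (simp add: algebra_simps)
 \<comment> \<open>The bound on the total degree: \<open>J\<close> for the power of
   \<open>\<phi>\<close>, and \<open>degree P + 1\<close> for each of at most \<open>n\<close>
   factors \<open>P(\<phi>) \<psi>\<close>. It is fixed before \<open>c\<close> is.\<close>
 show ?thesis
 proof (intro exI[of _ "J + n * (degree P + 1)"] allI)
  fix c :: "nat => complex"
  define \<psi> where "\<psi> = (\<lambda>z. \<Sum>i<s. c i * v i z)"
  define y where "y = (\<lambda>z. poly P (\<phi> z) * \<psi> z)"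
  have "(\<lambda>z. \<Sum>i<s. c i * (poly P (\<phi> z) * v i z)) \<in> Lsp \<phi> k1" by (rule Lsp_sum) (use Pv in auto)
  hence yL: "y \<in> Lsp \<phi> k1" by (simp add: y_def \<psi>_def sum_distrib_left algebra_simps)
  define ii jj where "ii k = k div (J + 1)" and "jj k = k mod (J + 1)" for k
  have ij: "ii k \<le> n" "jj k \<le> J" if "k < N" for k
  proof -
   have "ii k < n + 1" unfolding ii_def using that by (simp add: N_def less_mult_imp_div_less)
   thus "ii k \<le> n" by simp
   show "jj k \<le> J" unfolding jj_def using mod_less_divisor[of "J + 1" k] by linarith
  qed
  have "\<exists>q. (\<forall>s<n. degree (q s) \<le> T) \<and> (AEH z. y z ^ ii k * \<phi> z ^ jj k = (\<Sum>s<n. poly (q s) (\<phi> z) * e s z))"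
   if k: "k < N" for k
  proof -
   have "(\<lambda>z. y z ^ ii k * \<phi> z ^ jj k) \<in> Lsp \<phi> (ii k * k1 + jj k * 1)"
    by (intro Lsp_mult Lsp_power yL Lsp_self mphi)
   moreover have "ii k * k1 + jj k * 1 \<le> k0 + T" unfolding T_def using ij[OF k] mult_le_mono1[of "ii k" n k1] by linarith
   ultimately have "(\<lambda>z. y z ^ ii k * \<phi> z ^ jj k) \<in> Lsp \<phi> (k0 + T)" by (rule Lsp_mono)
   thus ?thesis by (rule e[THEN spec, THEN bspec])
  qed
  hence "\<forall>k\<in>{..<N}. \<exists>q. (\<forall>s<n. degree (q s) \<le> T) \<and>
    (AEH z. y z ^ ii k * \<phi> z ^ jj k = (\<Sum>s<n. poly (q s) (\<phi> z) * e s z))" by (intro ballI) simp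
  from bchoice[OF this] obtain q where "\<forall>k\<in>{..<N}. (\<forall>s<n. degree (q k s) \<le> T) \<and>
    (AEH z. y z ^ ii k * \<phi> z ^ jj k = (\<Sum>s<n. poly (q k s) (\<phi> z) * e s z))" by (elim exE)
  hence q: "\<And>s. s < n ==> degree (q k s) \<le> T"
   "AEH z. y z ^ ii k * \<phi> z ^ jj k = (\<Sum>s<n. poly (q k s) (\<phi> z) * e s z)" if "k < N" for k
   using that by simp_all
  obtain d where d: "\<exists>k<N. d k ~= 0" "\<And>s \<tau>. s < n ==> \<tau> \<le> T ==> (\<Sum>k<N. d k * coeff (q k s) \<tau>) = 0"
   using dep_of_card[OF _ count, of "\<lambda>k z. coeff (q k (fst z)) (snd z)"] unfolding dep_def by auto
  have zero: "(\<Sum>k<N. smult (d k) (q k s)) = 0" if s: "s < n" for s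
  proof (rule poly_eqI)
   fix \<tau>
   show "coeff (\<Sum>k<N. smult (d k) (q k s)) \<tau> = coeff 0 \<tau>"
   proof (cases "\<tau> \<le> T")
    case False
    hence "coeff (q k s) \<tau> = 0" if "k < N" for k using q(1)[OF that s] by (intro coeff_eq_0) simp
    thus ?thesis by (simp add: coeff_sum)
   qed (use d(2)[OF s, of \<tau>] in \<open>simp add: coeff_sum\<close>)
  qed
  define R where "R = (\<Sum>k<N. monom (monom (d k) (jj k) * P ^ ii k) (ii k))"
  \<comment> \<open>A nonzero \<open>d k\<close> cannot cancel: monomials with the same power of
    \<open>\<psi>\<close> share the factor \<open>P ^ ii k\<close> and differ in the power of
    \<open>\<phi>\<close>.\<close>
  have R0: "R ~= 0"
  proof
   assume R0: "R = 0"
   obtain k where k: "k < N" "d k ~= 0" using d(1) by blast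
   have "coeff R (ii k) = (\<Sum>l\<in>{l\<in>{..<N}. ii l = ii k}. monom (d l) (jj l)) * P ^ ii k"
    unfolding R_def coeff_sum coeff_monom sum_distrib_right by (subst sum.inter_filter[symmetric]) (auto intro!: sum.cong)
   hence "(\<Sum>l\<in>{l\<in>{..<N}. ii l = ii k}. monom (d l) (jj l)) = 0" using R0 P0 by simp
   hence "coeff (\<Sum>l\<in>{l\<in>{..<N}. ii l = ii k}. monom (d l) (jj l)) (jj k) = 0" by simp
   moreover have "l = k" if "ii l = ii k" "jj l = jj k" for l using that unfolding ii_def jj_def by (metis div_mult_mod_eq)
   hence "coeff (\<Sum>l\<in>{l\<in>{..<N}. ii l = ii k}. monom (d l) (jj l)) (jj k) =
     (\<Sum>l\<in>{l\<in>{..<N}. ii l = ii k}. if l = k then d k else 0)"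
    unfolding coeff_sum coeff_monom by (intro sum.cong) auto
   ultimately show False using k by simp
  qed
  have "tdeg_le (J + n * (degree P + 1)) R" unfolding R_def
  proof (rule tdeg_le_sum)
   fix k assume "k \<in> {..<N}"
   hence k: "ii k \<le> n" "jj k \<le> J" using ij by auto
   have "degree (monom (d k) (jj k) * P ^ ii k) \<le> jj k + ii k * degree P"
    using degree_mult_le[of "monom (d k) (jj k)" "P ^ ii k"] degree_monom_le[of "d k" "jj k"] degree_power_le[of P "ii k"]
    by (simp add: mult.commute)
   moreover have "jj k + ii k * degree P + ii k \<le> J + n * (degree P + 1)"
    using k(2) mult_le_mono1[OF k(1), of "degree P + 1"] by simp
   ultimately show "tdeg_le (J + n * (degree P + 1)) (monom (monom (d k) (jj k) * P ^ ii k) (ii k))"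
    unfolding tdeg_le_def by (auto simp: split: if_splits)
  qed
  moreover have "relp \<phi> \<psi> R" unfolding relp_def
  proof -
   have "AEH z. \<forall>k\<in>{..<N}. y z ^ ii k * \<phi> z ^ jj k = (\<Sum>s<n. poly (q k s) (\<phi> z) * e s z)"
    using q(2) by (subst eventually_ball_finite_distrib) auto
   thus "AEH z. ev2 R (\<phi> z) (\<psi> z) = 0"
   proof eventually_elim
    case (elim z)
    have "ev2 R (\<phi> z) (\<psi> z) = (\<Sum>k<N. d k * (y z ^ ii k * \<phi> z ^ jj k))" unfolding R_def ev2_sum
     by (intro sum.cong) (auto simp: ev2_def poly_monom poly_const_pow y_def power_mult_distrib)
    also have "\<dots> = (\<Sum>k<N. \<Sum>s<n. d k * (poly (q k s) (\<phi> z) * e s z))"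
     using elim by (intro sum.cong) (auto simp: sum_distrib_left)
    also have "\<dots> = (\<Sum>s<n. \<Sum>k<N. d k * (poly (q k s) (\<phi> z) * e s z))" by (rule sum.swap)
    also have "\<dots> = (\<Sum>s<n. poly (\<Sum>k<N. smult (d k) (q k s)) (\<phi> z) * e s z)"
     by (simp add: poly_sum sum_distrib_right mult.assoc)
    finally show ?case using zero by simp
   qed
  qed
  ultimately show "\<exists>R. R ~= 0 \<and> tdeg_le (J + n * (degree P + 1)) R \<and> relp \<phi> (\<lambda>z. \<Sum>i<s. c i * v i z) R"
   unfolding \<psi>_def[symmetric] using R0 by (intro exI[of _ R] conjI)
 qed
qed

text \<open>Minimality refers to the total degree, which determines the degree of the curve; that
  \<open>P\<close> has also the least degree in \<open>\<psi>\<close> follows from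
  \<open>min_rel_dvd\<close>.\<close>

definition min_rel :: "cfn => cfn => nat => complex poly poly => bool"
 where "min_rel \<phi> \<psi> l P \<longleftrightarrow> P ~= 0 \<and> tdeg_le l P \<and> relp \<phi> \<psi> P \<and>
  (\<forall>R k. R ~= 0 --> relp \<phi> \<psi> R --> tdeg_le k R --> l \<le> k)"

lemma min_rel_exists:
 assumes "R ~= 0" "relp \<phi> \<psi> R" "tdeg_le k R"
 obtains l P where "min_rel \<phi> \<psi> l P" "l \<le> k"
proof -
 define A where "A l \<longleftrightarrow> (\<exists>R. R ~= 0 \<and> relp \<phi> \<psi> R \<and> tdeg_le l R)" for l
 have "A k" using assms by (auto simp: A_def)
 then obtain l where l: "A l" "\<And>j. A j ==> l \<le> j" using LeastI Least_le by metis
 then obtain P where "P ~= 0" "relp \<phi> \<psi> P" "tdeg_le l P" by (auto simp: A_def)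
 hence "min_rel \<phi> \<psi> l P" using l(2) unfolding min_rel_def A_def by blast
 thus ?thesis using that l(2)[OF \<open>A k\<close>] by blast
qed

text \<open>A product of meromorphic functions vanishes only if a factor does, so one factor of
  \<open>P\<close> is again a relation; by minimality it takes up all of the total degree, and the
  other factor is a constant.\<close>

lemma min_rel_irreducible:
 assumes mf: "mf \<phi>" "mf \<psi>" and P: "min_rel \<phi> \<psi> l P"
 shows "irreducible P"
proof (rule irreducibleI)
 note D = P[unfolded min_rel_def]
 show "P ~= 0" using D by blast
 show "\<not> P dvd 1"
 proof
  assume "P dvd 1"
  then obtain Q where "1 = P * Q" by blast
  moreover have "relp \<phi> \<psi> (Q * P + 0 * P)" by (rule relp_combination) (use D in auto)
  ultimately have "relp \<phi> \<psi> 1" by (simp add: mult.commute)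
  thus False using not_ae_False by (simp add: relp_def)
 qed
 have unit: "B dvd 1" if AB: "A * B ~= 0" "tdeg_le l (A * B)" "relp \<phi> \<psi> A" for A B
 proof -
  obtain a b where ab: "tdeg_le a A" "tdeg_le b B" "a + b \<le> l" using tdeg_factors[OF AB(2)] AB(1) by auto
  have "l \<le> a" using D AB ab(1) by auto
  hence "tdeg_le 0 B" using ab by (auto intro: tdeg_le_mono)
  hence d: "degree B = 0" "degree (coeff B 0) = 0" using tdeg_le_degree tdeg_le_coeff(1)[of 0 B 0] by auto
  then obtain c where c: "B = [:c:]" by (metis degree_eq_zeroE)
  then obtain x where "c = [:x:]" using d(2) by (auto elim: degree_eq_zeroE)
  thus ?thesis using c AB(1) by (simp add: is_unit_const_poly_iff is_unit_pCons_iff)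
 qed
 fix A B assume P: "P = A * B"
 hence "relp \<phi> \<psi> A \<or> relp \<phi> \<psi> B" using relp_mult_cases[OF mf] D by blast
 thus "A dvd 1 \<or> B dvd 1" using unit[of A B] unit[of B A] D unfolding P by (auto simp: mult.commute)
qed

text \<open>Otherwise the Bezout identity with the irreducible \<open>P\<close> would give a nonzero
  polynomial in \<open>\<phi>\<close> alone that vanishes, against
  \<open>relp_const\<close>.\<close>

lemma min_rel_dvd:
 assumes mf: "mf \<phi>" "mf \<psi>" "nonconst \<phi>" and P: "min_rel \<phi> \<psi> l P" and R: "relp \<phi> \<psi> R"
 shows "P dvd R" "1 \<le> degree P"
proof -
 note D = P[unfolded min_rel_def]
 show deg: "1 \<le> degree P"
 proof (rule ccontr)
  assume "\<not> 1 \<le> degree P"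
  then obtain c where "P = [:c:]" by (metis degree_eq_zeroE less_one not_le)
  thus False using D relp_const[OF mf(1,3)] by auto
 qed
 show "P dvd R"
 proof (rule ccontr)
  assume "\<not> P dvd R"
  then obtain a b c where abc: "a * P + b * R = [:c:]" "c ~= 0"
   using prime_elem_combination_const[OF irreducible_imp_prime_elem[OF min_rel_irreducible[OF mf(1,2) P]] deg] by blast
  have "relp \<phi> \<psi> (a * P + b * R)" by (rule relp_combination) (use D R in auto)
  thus False using abc relp_const[OF mf(1,3)] by simp
 qed
qed

end

section \<open>The plane curve and its equation\<close>

text \<open>In the Leibniz formula each summand is, up to sign, a product of \<open>n\<close>
  entries of total degree at most 1.\<close>

lemma tdeg_le_char_poly:
 assumes A: "A \<in> carrier_mat n n" and deg: "\<And>i j. i < n ==> j < n ==> degree (A $$ (i, j)) \<le> 1"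
 shows "tdeg_le n (char_poly A)"
proof -
 have C: "char_poly_matrix A \<in> carrier_mat n n" using A by simp
 have entry: "tdeg_le 1 (char_poly_matrix A $$ (i, j))" if "i < n" "j < n" for i j
 proof -
  have "char_poly_matrix A $$ (i, j) = [:- (A $$ (i, j)), if i = j then 1 else 0:]"
   using A that by (auto simp: char_poly_matrix_def)
  thus ?thesis using deg[OF that] by (auto simp: tdeg_le_def coeff_pCons split: nat.splits if_splits)
 qed
 have "tdeg_le n (signof p * (\<Prod>i = 0..<n. char_poly_matrix A $$ (i, p i)))" if p: "p permutes {0..<n}" for p
 proof -
  have "tdeg_le (card {0..<n}) (\<Prod>i = 0..<n. char_poly_matrix A $$ (i, p i))"
  proof (rule tdeg_le_prod)
   fix i assume "i \<in> {0..<n}"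
   thus "tdeg_le 1 (char_poly_matrix A $$ (i, p i))" using permutes_in_image[OF p, of i] by (intro entry) simp_all
  qed simp
  moreover have "tdeg_le 0 (signof p :: complex poly poly)"
   using tdeg_le_const[of 1 0] tdeg_le_const[of "-1" 0] by (cases "evenperm p") (simp_all add: sign_def one_pCons)
  ultimately show ?thesis using tdeg_le_mult[of 0 "signof p" n] by simp
 qed
 thus ?thesis unfolding char_poly_def det_def'[OF C] by (intro tdeg_le_sum) simp
qed

context fuchsian
begin

text \<open>
 Multiplication by \<open>\<psi>\<close> acts on the generators \<open>e\<^sub>s\<close> by a matrix with entries of degree at most one
 in \<open>\<phi>\<close>; its characteristic polynomial annihilates \<open>\<psi>\<close>.
\<close>

lemma monic_relation:
 assumes phi: "\<phi> \<in> CF" "\<phi> ~= FF0" and psi: "\<psi> \<in> Lsp \<phi> 1"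
 shows "\<exists>N r. tdeg_le N r \<and> coeff r N = 1 \<and> relp \<phi> \<psi> r"
proof -
 obtain k0 n e where e: "\<forall>s<(n::nat). e s \<in> Lsp \<phi> k0" "\<forall>j. \<forall>u\<in>Lsp \<phi> (k0 + j). \<exists>p. (\<forall>s<n. degree (p s) \<le> j) \<and>
   (AEH z. u z = (\<Sum>s<n. poly (p s) (\<phi> z) * e s z))" using Lsp_generators[OF phi] by (elim exE conjE)
 have "(\<lambda>z. e i z * \<psi> z) \<in> Lsp \<phi> (k0 + 1)" if "i < n" for i using e(1) that psi by (intro Lsp_mult) auto
 hence "\<exists>p. (\<forall>s<n. degree (p s) \<le> 1) \<and> (AEH z. e i z * \<psi> z = (\<Sum>s<n. poly (p s) (\<phi> z) * e s z))"
  if "i < n" for i using that by (intro e(2)[THEN spec, THEN bspec])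
 hence "\<forall>i\<in>{..<n}. \<exists>p. (\<forall>s<n. degree (p s) \<le> 1) \<and> (AEH z. e i z * \<psi> z = (\<Sum>s<n. poly (p s) (\<phi> z) * e s z))"
  by (intro ballI) simp
 from bchoice[OF this] obtain p where "\<forall>i\<in>{..<n}. (\<forall>s<n. degree (p i s) \<le> 1) \<and>
   (AEH z. e i z * \<psi> z = (\<Sum>s<n. poly (p i s) (\<phi> z) * e s z))" by (elim exE)
 hence p: "\<And>s. s < n ==> degree (p i s) \<le> 1"
  "AEH z. e i z * \<psi> z = (\<Sum>s<n. poly (p i s) (\<phi> z) * e s z)" if "i < n" for i using that by simp_all
 \<comment> \<open>The constant 1 is a combination of the generators, so almost nowhere do they
   vanish together: the vector \<open>v\<close> in the kernel below is nonzero.\<close>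
 have "\<exists>q. (\<forall>s<n. degree (q s) \<le> 0) \<and> (AEH z. 1 = (\<Sum>s<n. poly (q s) (\<phi> z) * e s z))"
  by (rule e(2)[THEN spec, THEN bspec, OF Lsp_one[of 1 \<phi> "k0 + 0"]])
 then obtain q where q: "AEH z. 1 = (\<Sum>s<n. poly (q s) (\<phi> z) * e s z)" by (elim exE conjE)
 define A where "A = Matrix.mat n n (\<lambda>(i, j). p i j)"
 have A: "A \<in> carrier_mat n n" by (simp add: A_def)
 have C: "char_poly_matrix A \<in> carrier_mat n n" using A by simp
 have "AEH z. \<forall>i\<in>{..<n}. e i z * \<psi> z = (\<Sum>s<n. poly (p i s) (\<phi> z) * e s z)"
  using p(2) by (subst eventually_ball_finite_distrib) auto
 with q have "relp \<phi> \<psi> (char_poly A)" unfolding relp_def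
 proof eventually_elim
  case (elim z)
  interpret ev: comm_ring_hom "\<lambda>R. ev2 R (\<phi> z) (\<psi> z)" by unfold_locales auto
  define B where "B = map_mat (\<lambda>R. ev2 R (\<phi> z) (\<psi> z)) (char_poly_matrix A)"
  define v where "v = Matrix.vec n (\<lambda>j. e j z)"
  have B: "B \<in> carrier_mat n n" using C by (simp add: B_def)
  have "v ~= 0\<^sub>v n"
  proof
   assume "v = 0\<^sub>v n"
   hence "e s z = 0" if "s < n" for s using that by (metis index_vec index_zero_vec(1) v_def)
   thus False using elim(1) by simp
  qed
  moreover have "B *\<^sub>v v = 0\<^sub>v n"
  proof (rule Matrix.eq_vecI)
   fix i assume "i < dim_vec (0\<^sub>v n :: complex Matrix.vec)"
   hence i: "i < n" by simp
   have Bij: "B $$ (i, j) = (if i = j then \<psi> z else 0) - poly (p i j) (\<phi> z)" if "j < n" for j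
    using i that A by (auto simp: B_def char_poly_matrix_def A_def)
   have "Matrix.vec_index (B *\<^sub>v v) i = (\<Sum>j = 0..<n. B $$ (i, j) * e j z)"
    using B i by (simp add: scalar_prod_def v_def)
   also have "\<dots> = (\<Sum>j<n. (if i = j then \<psi> z * e j z else 0) - poly (p i j) (\<phi> z) * e j z)"
    unfolding atLeast0LessThan by (intro sum.cong) (auto simp: Bij algebra_simps)
   also have "\<dots> = 0" using elim(2) i by (simp add: sum_subtractf mult.commute)
   finally show "Matrix.vec_index (B *\<^sub>v v) i = Matrix.vec_index (0\<^sub>v n) i" using i by simp
  qed (use B in simp)
  moreover have "v \<in> carrier_vec n" by (simp add: v_def)
  ultimately have "Determinant.det B = 0" using det_0_iff_vec_prod_zero[OF B] by blast
  thus ?case unfolding B_def char_poly_def by simp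
 qed
 moreover have "tdeg_le n (char_poly A)" by (rule tdeg_le_char_poly[OF A]) (use p(1) in \<open>auto simp: A_def\<close>)
 ultimately show ?thesis using degree_monic_char_poly[OF A] by blast
qed

text \<open>By the local normal form: a positive order gives the limit 0, an order at most 0 keeps
  the values away from 0.\<close>

lemma limit_dichotomy:
 assumes Phi: "\<Phi> \<in> SP" and v: "v \<in> CF"
 shows "(v \<longlongrightarrow> 0) \<Phi> \<or> (\<exists>c>0. \<forall>\<^sub>F z in \<Phi>. c \<le> cmod (v z))"
proof (cases "v = FF0")
 case True
 hence "v = (\<lambda>z. 0)" by (auto simp: FF_simps)
 thus ?thesis by simp
next
 case False
 obtain q r where q: "uniformizer \<Gamma> \<Phi> q r"
  and gr: "\<And>\<psi>. \<psi> \<in> CF ==> \<exists>C n. \<forall>\<^sub>F z in \<Phi>. \<psi> analytic_on {z} \<and> cmod (\<psi> z) \<le> C / cmod (q z) ^ n"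
  by (rule chart_exists[OF Phi], rule that)
 note uD = uniformizerD[OF q]
 obtain ro U m where nf: "0 < ro" "ro \<le> r" "U holomorphic_on ball 0 ro" "\<And>t. cmod t < ro ==> U t ~= 0"
  "\<And>z. z \<in> coord_nbhd q ro ==> v analytic_on {z}"
  "\<And>z. z \<in> coord_nbhd q ro ==> v z = U (q z) * (q z) powi m"
  by (rule chart_normal_form[OF q gr[OF v] v False], rule that)
 have small: "\<forall>\<^sub>F z in \<Phi>. z \<in> coord_nbhd q de" if "de > 0" for de
  unfolding uD(3) using that uD(1) by (intro exI[of _ "min de r"]) (auto simp: coord_nbhd_def)
 have U: "isCont U 0" using holomorphic_on_imp_continuous_on[OF nf(3)] nf(1) by (auto simp: continuous_on_eq_continuous_at)
 have lim_q: "(q \<longlongrightarrow> 0) \<Phi>"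
 proof (rule tendstoI)
  fix de :: real assume "0 < de"
  from small[OF this] show "\<forall>\<^sub>F z in \<Phi>. dist (q z) 0 < de" by eventually_elim (simp add: coord_nbhd_def)
 qed
 have lim_U: "((\<lambda>z. U (q z)) \<longlongrightarrow> U 0) \<Phi>" by (rule isCont_tendsto_compose[OF U lim_q])
 show ?thesis
 proof (cases "m > 0")
  case True
  have "((\<lambda>z. U (q z) * q z ^ nat m) \<longlongrightarrow> U 0 * 0 ^ nat m) \<Phi>" by (intro tendsto_intros lim_U lim_q)
  moreover have "\<forall>\<^sub>F z in \<Phi>. U (q z) * q z ^ nat m = v z"
   using small[OF nf(1)] by eventually_elim (use True in \<open>simp add: nf(6) power_int_def\<close>)
  ultimately have "(v \<longlongrightarrow> U 0 * 0 ^ nat m) \<Phi>" by (rule Lim_transform_eventually)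
  thus ?thesis using True by (simp add: power_0_left)
 next
  case False
  define c where "c = cmod (U 0) / 2"
  have c: "0 < c" "c < cmod (U 0)" using nf(1) nf(4)[of 0] by (auto simp: c_def)
  have s1: "\<forall>\<^sub>F z in \<Phi>. z \<in> coord_nbhd q 1" by (rule small) simp
  have "\<forall>\<^sub>F z in \<Phi>. c < cmod (U (q z))" by (rule order_tendstoD(1)[OF tendsto_norm[OF lim_U] c(2)])
  with s1 small[OF nf(1)] have "\<forall>\<^sub>F z in \<Phi>. c \<le> cmod (v z)"
  proof eventually_elim
   case (elim z)
   have qz: "0 < cmod (q z)" "cmod (q z) < 1" using elim(1) by (auto simp: coord_nbhd_def)
   have "1 \<le> inverse (cmod (q z)) ^ nat (- m)" using qz by (intro one_le_power) (simp add: one_le_inverse)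
   hence "c * 1 \<le> cmod (U (q z)) * inverse (cmod (q z)) ^ nat (- m)" using elim(3) c(1) by (intro mult_mono) auto
   also have "\<dots> = cmod (v z)"
    using False by (cases "m = 0") (simp_all add: nf(6)[OF elim(2)] norm_mult power_int_def norm_power norm_inverse)
   finally show ?case by simp
  qed
  thus ?thesis using c(1) by blast
 qed
qed

end

section \<open>Triples of forms and projective coordinates\<close>

locale form_space = fuchsian +
 fixes chi :: "real^2^2 => complex" and m :: nat and \<Xi> :: "cfn set"
 assumes chi: "\<And>ga. ga \<in> \<Gamma> ==> chi ga ~= 0"
  and subspace: "cfun.subspace \<Xi>" and forms: "\<Xi> \<subseteq> modular_forms m \<Gamma> chi"
begin

lemma form_lin: "f \<in> \<Xi> ==> g \<in> \<Xi> ==> (\<lambda>z. a * f z + b * g z) \<in> \<Xi>"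
 using cfun.subspace_add[OF subspace cfun.subspace_scale[OF subspace, of f a] cfun.subspace_scale[OF subspace, of g b]]
 by (simp add: cfun_scale_def plus_fun_def)

lemma form_sum: "(\<And>i. i \<in> I ==> f i \<in> \<Xi>) ==> (\<lambda>z. \<Sum>i\<in>I. c i * f i z) \<in> \<Xi>"
proof (induction I rule: infinite_finite_induct)
 case (insert i I)
 thus ?case using form_lin[of "f i" "\<lambda>z. \<Sum>i\<in>I. c i * f i z" "c i" 1] by simp
qed (use cfun.subspace_0[OF subspace] in \<open>simp_all add: zero_fun_def\<close>)

lemma form_holomorphic: "f \<in> \<Xi> ==> f holomorphic_on \<H>" using forms by (auto simp: modular_forms_def)

lemma form_analytic: "f \<in> \<Xi> ==> 0 < Im z ==> f analytic_on {z}"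
 using form_holomorphic[of f] open_uhp by (simp add: analytic_at) (metis uhp_iff)

lemma form_nonzero_ae:
 assumes "f \<in> \<Xi>" "0 < Im z0" "f z0 ~= 0"
 shows "AEH z. f z ~= 0"
proof -
 have "f nicely_meromorphic_on \<H>" using form_holomorphic[OF assms(1)] open_uhp
  by (intro analytic_on_imp_nicely_meromorphic_on) (simp add: analytic_on_open)
 from nicely_meromorphic_imp_constant_or_avoid[OF this open_uhp connected_uhp, of 0]
 show ?thesis using assms(2,3) by auto
qed

lemma ae_imp_near: "AEH z. P z ==> 0 < Im p ==> \<forall>\<^sub>F z in at p. 0 < Im z \<and> P z"
 using evz_ae[of P p] eventually_at_in_open'[OF open_uhp, of p] by (simp add: eventually_conj_iff)

text \<open>At a cusp, \<open>f\<close> divided by the automorphy factor is analytic in the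
  parameter. If that function vanished identically near 0, so would \<open>f\<close> high up in the
  frame, against the identity theorem; hence its zeros are isolated.\<close>

lemma form_nonzero_near:
 assumes f: "f \<in> \<Xi>" "0 < Im z0" "f z0 ~= 0" and Phi: "\<Phi> \<in> SP"
 shows "\<forall>\<^sub>F z in \<Phi>. 0 < Im z \<and> f z ~= 0"
proof -
 note ae = form_nonzero_ae[OF f]
 consider p where "0 < Im p" "\<Phi> = at p" | sg where "sg \<in> cusp_frames \<Gamma>" "\<Phi> = filtermap (mob sg) at_cusp"
  using Phi by (auto simp: surface_points_def)
 thus ?thesis
 proof cases
  case 1
  thus ?thesis using ae_imp_near[OF ae] by simp
 next
  case 2
  note det = det_cusp_frame[OF 2(1)]
  obtain b F where bF: "b > 0" "F analytic_on {0}"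
   "\<forall>\<^sub>F w in at_cusp. f (mob sg w) / automorphy sg w ^ m = F (cusp_param b w)"
   using f(1) forms 2(1) unfolding modular_forms_def holomorphic_at_cusps_def by blast
  have rep: "\<forall>\<^sub>F w in at_cusp. 0 < Im w \<and> (f (mob sg w) = 0 \<longleftrightarrow> F (cusp_param b w) = 0)"
   using bF(3) eventually_cusp_pos
  proof eventually_elim
   case (elim w)
   have "automorphy sg w ^ m ~= 0" using automorphy_nonzero[OF det] elim(2) by simp
   hence "f (mob sg w) = 0 \<longleftrightarrow> f (mob sg w) / automorphy sg w ^ m = 0" by (metis divide_eq_0_iff)
   thus ?case using elim by simp
  qed
  have near: "\<forall>\<^sub>F w in at_cusp. P (cusp_param b w)" if P: "\<forall>\<^sub>F t in at 0. P t" for P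
  proof -
   obtain de where d: "de > 0" "\<And>t. t ~= 0 ==> cmod t < de ==> P t"
    using P unfolding eventually_at by (auto simp: dist_norm)
   have "\<forall>\<^sub>F w in at_cusp. - b * ln de / (2 * pi) < Im w"
    unfolding at_cusp_infinity_def by (intro eventually_filtercomapI eventually_gt_at_top)
   thus ?thesis
   proof eventually_elim
    case (elim w)
    hence "cmod (cusp_param b w) < de" using cmod_cusp_param_less_iff[OF bF(1) d(1)] by blast
    moreover have "cusp_param b w ~= 0" by (simp add: cusp_param_def)
    ultimately show ?case by (rule d(2)[rotated])
   qed
  qed
  have "\<forall>\<^sub>F t in at 0. F t ~= 0"
  proof (rule ccontr)
   assume "\<not> ?thesis"
   hence "\<not> (\<exists>\<^sub>F t in at 0. F t ~= 0)"
    using non_zero_neighbour[of F 0] bF(2) isolated_singularity_at_analytic not_essential_analytic by blast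
   hence "\<forall>\<^sub>F t in at 0. F t = 0" by (simp add: frequently_def)
   from eventually_conj[OF near[OF this] rep] have "\<forall>\<^sub>F w in at_cusp. 0 < Im w \<and> f (mob sg w) = 0"
    by (rule eventually_mono) simp
   then obtain c where c: "\<And>w. c < Im w ==> 0 < Im w \<and> f (mob sg w) = 0"
    unfolding at_cusp_infinity_def eventually_filtercomap eventually_at_top_dense by blast
   define w where "w = \<i> * complex_of_real (c + 1)"
   have w: "c < Im w" "0 < Im w" using c[of w] by (auto simp: w_def)
   have "\<forall>\<^sub>F y in at (mob sg w). f y ~= 0" by (rule evz_ae[OF ae]) (use mobius_act_uhp[OF det w(2)] in simp)
   hence "\<forall>\<^sub>F y in at w. f (mob sg y) ~= 0"
    unfolding filtermap_mobius_act_at[OF det w(2), symmetric] eventually_filtermap .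
   moreover have "\<forall>\<^sub>F y in at w. y \<in> {y. c < Im y}"
    using w by (intro eventually_at_in_open' open_halfspace_Im_gt) auto
   ultimately have "\<forall>\<^sub>F y in at w. False" by eventually_elim (use c in auto)
   thus False by simp
  qed
  from near[OF this] rep have "\<forall>\<^sub>F w in at_cusp. 0 < Im (mob sg w) \<and> f (mob sg w) ~= 0"
   by eventually_elim (use mobius_act_uhp[OF det] in auto)
  thus ?thesis unfolding 2(2) eventually_filtermap .
 qed
qed

lemma surface_point_nonbot: "\<Phi> \<in> SP ==> \<Phi> ~= bot"
proof
 assume "\<Phi> \<in> SP" and bot: "\<Phi> = bot"
 then obtain q r where q: "uniformizer \<Gamma> \<Phi> q r" using chart_exists by metis
 have "eventually (\<lambda>z. False) \<Phi>" by (simp add: bot)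
 thus False using uniformizerD(3)[OF q, of "\<lambda>z. False"] uniformizer_nonempty[OF q] by blast
qed

text \<open>Three linearly independent forms as one vector, so that linear changes of projective
  coordinates act on it.\<close>

definition triple :: "(complex => complex^3) => bool"
 where "triple u \<longleftrightarrow> (\<forall>i. (\<lambda>z. u z $ i) \<in> \<Xi>) \<and> (\<forall>a. (\<forall>z. 0 < Im z --> dt a (u z) = 0) --> a = 0)"

abbreviation ph :: "(complex => complex^3) => complex => complex"
 where "ph u \<equiv> on_uhp (\<lambda>z. u z $ 2 / u z $ 1)"
abbreviation ps :: "(complex => complex^3) => complex => complex"
 where "ps u \<equiv> on_uhp (\<lambda>z. u z $ 3 / u z $ 1)"

lemma tripleD:
 assumes "triple u"
 shows "(\<lambda>z. u z $ i) \<in> \<Xi>" "\<exists>z. 0 < Im z \<and> u z $ i ~= 0"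
  "mf (\<lambda>z. u z $ j / u z $ i)" "on_uhp (\<lambda>z. u z $ j / u z $ i) \<in> CF"
proof -
 show X: "(\<lambda>z. u z $ i) \<in> \<Xi>" for i using assms by (simp add: triple_def)
 show mq: "mf (\<lambda>z. u z $ j / u z $ i)" for i j by (rule mf_quotient[OF subsetD[OF forms X] subsetD[OF forms X] chi])
 thus "on_uhp (\<lambda>z. u z $ j / u z $ i) \<in> CF" by (rule mf_carrier)
 have "dt (axis i 1) x = x $ i" for x using exhaust_3[of i] by (auto simp: dt_3 axis_def)
 moreover have "axis i (1::complex) ~= (0 :: complex^3)" by simp
 ultimately show "\<exists>z. 0 < Im z \<and> u z $ i ~= 0" using assms unfolding triple_def by metis
qed

lemma triple_ae:
 assumes "triple u"
 shows "AEH z. u z $ i ~= 0"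
  "AEH z. on_uhp (\<lambda>z. u z $ j / u z $ i) z = u z $ j / u z $ i"
 using tripleD(2)[OF assms, of i] form_nonzero_ae[OF tripleD(1)[OF assms, of i]] mf_ae[OF tripleD(3)[OF assms, of j i]] by auto

lemma triple_near:
 assumes "triple u" "\<Phi> \<in> SP"
 shows "\<forall>\<^sub>F z in \<Phi>. 0 < Im z \<and> (\<forall>i. u z $ i ~= 0) \<and> (\<forall>i j. on_uhp (\<lambda>z. u z $ j / u z $ i) z = u z $ j / u z $ i)"
proof -
 have nz: "\<forall>\<^sub>F z in \<Phi>. 0 < Im z \<and> u z $ i ~= 0" for i
 proof -
  obtain z0 where "0 < Im z0" "u z0 $ i ~= 0" using tripleD(2)[OF assms(1)] by blast
  thus ?thesis using form_nonzero_near[OF tripleD(1)[OF assms(1), of i] _ _ assms(2)] by simp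
 qed
 show ?thesis using nz[of 1] nz[of 2] nz[of 3]
 proof eventually_elim
  case (elim z)
  have "on_uhp (\<lambda>z. u z $ j / u z $ i) z = u z $ j / u z $ i" for i j
  proof (rule on_uhp_analytic(1))
   show "(\<lambda>z. u z $ j / u z $ i) analytic_on {z}"
    using elim exhaust_3[of i] by (intro analytic_intros form_analytic tripleD(1)[OF assms(1)]) auto
  qed (use elim in simp)
  thus ?case using elim by (simp add: forall_3)
 qed
qed

lemma ph_nonconst: "triple u ==> nonconst (ph u)" unfolding nonconst_def
proof (intro allI notI)
 fix c assume u: "triple u" and c: "AEH z. ph u z = c"
 define h where "h = (\<lambda>z. 1 * u z $ 2 + (- c) * u z $ 1)"
 have h: "h \<in> \<Xi>" unfolding h_def by (intro form_lin tripleD(1)[OF u])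
 have "AEH z. h z = 0"
  using c triple_ae(1)[OF u, of 1] triple_ae(2)[OF u, of 2 1] by eventually_elim (auto simp: h_def field_simps)
 hence "h z = 0" if "0 < Im z" for z using form_nonzero_ae[OF h that] not_ae_False eventually_elim2 by fastforce
 hence "dt (vector [- c, 1, 0]) (u z) = 0" if "0 < Im z" for z using that by (simp add: dt_3 vector_3 h_def)
 hence "vector [- c, 1, 0] = (0 :: complex^3)" using u unfolding triple_def by blast
 thus False by (simp add: vec3_eq vector_3)
qed

lemma triple_transform:
 assumes u: "triple u" and M: "(M' :: complex^3^3) ** M = mat 1"
 shows "triple (\<lambda>z. M' *v u z)" unfolding triple_def
proof (intro conjI allI impI)
 fix i
 have "(\<lambda>z. \<Sum>j\<in>UNIV. M'$i$j * u z $ j) \<in> \<Xi>" by (intro form_sum tripleD(1)[OF u])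
 thus "(\<lambda>z. (M' *v u z) $ i) \<in> \<Xi>" by (simp add: matrix_vector_mult_def)
next
 fix a assume a: "\<forall>z. 0 < Im z --> dt a (M' *v u z) = 0"
 define b where "b = (\<chi> j. \<Sum>i\<in>UNIV. a$i * M'$i$j)"
 have ab: "dt a (M' *v x) = dt b x" for x unfolding dt_def b_def matrix_vector_mult_def
  by (simp add: sum_distrib_left sum_distrib_right mult.assoc) (rule sum.swap)
 have "b = 0" using u a unfolding ab triple_def by blast
 hence "dt a (M' *v (M *v x)) = 0" for x unfolding ab by (simp add: dt_def)
 hence "dt a x = 0" for x unfolding matrix_vector_mul_assoc M by simp
 from this[of "axis 1 1"] this[of "axis 2 1"] this[of "axis 3 1"] show "a = 0" by (simp add: dt_3 axis_def vec3_eq)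
qed

lemma form_value_zero:
 assumes u: "triple u" and F: "HP l F" and ae: "AEH z. F (u z) = 0" and z: "0 < Im z"
 shows "F (u z) = 0"
proof -
 have "isCont (\<lambda>z. u z $ i) z" for i by (rule analytic_at_imp_isCont[OF form_analytic[OF tripleD(1)[OF u] z]])
 hence "(u \<longlongrightarrow> u z) (at z)" by (intro vec_tendstoI) (simp add: isCont_def)
 from isCont_tendsto_compose[OF HP_continuous[OF F] this] have "((\<lambda>z. F (u z)) \<longlongrightarrow> F (u z)) (at z)" .
 moreover have "\<forall>\<^sub>F w in at z. F (u w) = 0" by (rule evz_ae[OF ae z])
 ultimately have "((\<lambda>w. 0) \<longlongrightarrow> F (u z)) (at z)" by (rule Lim_transform_eventually)
 thus ?thesis by (simp add: tendsto_const_iff)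
qed

text \<open>By homogeneity \<open>F (u z)\<close> is a power of the first form times the value of
  \<open>R\<close> at the affine coordinates; continuity passes from almost all points to all
  points.\<close>

lemma HP_relp_iff:
 assumes u: "triple u" and F: "HP l F" "\<And>t w. F (vector [1, t, w]) = ev2 R t w"
 shows "(\<forall>z. 0 < Im z --> F (u z) = 0) \<longleftrightarrow> relp (ph u) (ps u) R"
proof -
 have "AEH z. z \<in> \<H>" by (rule eventually_in_cosparse) (auto simp: open_uhp)
 hence eq: "AEH z. 0 < Im z \<and> (F (u z) = 0 \<longleftrightarrow> ev2 R (ph u z) (ps u z) = 0)"
  using triple_ae(1)[OF u, of 1] triple_ae(2)[OF u, of 2 1] triple_ae(2)[OF u, of 3 1]
 proof eventually_elim
  case (elim z)
  have "u z = u z $ 1 *s vector [1, u z $ 2 / u z $ 1, u z $ 3 / u z $ 1]" using elim(2) by (simp add: vec3_eq vector_3)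
  hence "F (u z) = (u z $ 1) ^ l * ev2 R (u z $ 2 / u z $ 1) (u z $ 3 / u z $ 1)" using HP_homogeneous[OF F(1)] F(2) by metis
  thus ?case using elim by simp
 qed
 show ?thesis
 proof
  assume z: "\<forall>z. 0 < Im z --> F (u z) = 0"
  show "relp (ph u) (ps u) R" unfolding relp_def using eq by eventually_elim (use z in auto)
 next
  assume "relp (ph u) (ps u) R"
  hence "AEH z. F (u z) = 0" unfolding relp_def using eq by eventually_elim auto
  thus "\<forall>z. 0 < Im z --> F (u z) = 0" using form_value_zero[OF u F(1)] by blast
 qed
qed

text \<open>Relations as forms in all three coordinates. \<open>fmin\<close>, the minimal version
  below, corresponds to \<open>min_rel\<close> but is stable under linear substitutions.\<close>

definition frel :: "nat => (complex^3 => complex) => (complex => complex^3) => bool"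
 where "frel l F u \<longleftrightarrow> HP l F \<and> (\<exists>x. F x ~= 0) \<and> (\<forall>z. 0 < Im z --> F (u z) = 0)"

definition fmin :: "nat => (complex^3 => complex) => (complex => complex^3) => bool"
 where "fmin l F u \<longleftrightarrow> frel l F u \<and> (\<forall>k G. frel k G u --> l \<le> k)"

lemma frel_of_relp:
 assumes u: "triple u" and R: "R ~= 0" "relp (ph u) (ps u) R" "tdeg_le l R"
 shows "\<exists>F. frel l F u"
proof -
 obtain F where F: "HP l F" "\<And>t w. F (vector [1, t, w]) = ev2 R t w" using HP_homogenize[OF R(3)] by blast
 have "\<exists>x. F x ~= 0" using ev2_all_zero[of R] R(1) F(2) by metis
 thus ?thesis unfolding frel_def using HP_relp_iff[OF u F] R(2) F(1) by blast
qed

lemma relp_of_frel: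
 assumes u: "triple u" and F: "frel l F u"
 obtains R where "R ~= 0" "relp (ph u) (ps u) R" "tdeg_le l R" "\<And>t w. F (vector [1, t, w]) = ev2 R t w"
  "F (vector [0, 0, 1]) = coeff (coeff R l) 0"
proof -
 note D = F[unfolded frel_def]
 obtain R where R: "tdeg_le l R" "\<And>t w. F (vector [1, t, w]) = ev2 R t w" "F (vector [0, 0, 1]) = coeff (coeff R l) 0"
  using HP_dehomogenize D by blast
 have "R ~= 0"
 proof
  assume "R = 0"
  hence "F x = 0" for x using HP_eq_iff_dehomogenized[of l F] D R(2) by simp
  thus False using D by blast
 qed
 moreover have "relp (ph u) (ps u) R" using HP_relp_iff[OF u _ R(2)] D by blast
 ultimately show ?thesis using that R by blast
qed

lemma min_rel_of_fmin:
 assumes u: "triple u" and F: "fmin l F u"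
 obtains R where "min_rel (ph u) (ps u) l R" "\<And>t w. F (vector [1, t, w]) = ev2 R t w"
  "F (vector [0, 0, 1]) = coeff (coeff R l) 0"
proof -
 note D = F[unfolded fmin_def]
 obtain R where R: "R ~= 0" "relp (ph u) (ps u) R" "tdeg_le l R" "\<And>t w. F (vector [1, t, w]) = ev2 R t w"
  "F (vector [0, 0, 1]) = coeff (coeff R l) 0" using relp_of_frel[OF u] D by blast
 have "min_rel (ph u) (ps u) l R" unfolding min_rel_def using R frel_of_relp[OF u] D by blast
 thus ?thesis using that R by blast
qed

lemma frel_transform:
 assumes F: "frel l F u" and M: "(M :: complex^3^3) ** M' = mat 1"
 shows "frel l (\<lambda>x. F (M *v x)) (\<lambda>z. M' *v u z)"
proof -
 have inv: "M *v (M' *v x) = x" for x by (simp add: matrix_vector_mul_assoc M)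
 have "\<exists>x. F (M *v x) ~= 0" using F unfolding frel_def by (metis inv)
 thus ?thesis using F HP_linear_subst unfolding frel_def inv by blast
qed

lemma fmin_transform:
 assumes F: "fmin l F u" and M: "(M :: complex^3^3) ** M' = mat 1" "M' ** M = mat 1"
 shows "fmin l (\<lambda>x. F (M *v x)) (\<lambda>z. M' *v u z)"
proof -
 have "l \<le> k" if "frel k G (\<lambda>z. M' *v u z)" for k G
  using frel_transform[OF that M(2)] F unfolding fmin_def matrix_vector_mul_assoc M(1) by simp blast
 thus ?thesis using F frel_transform[OF _ M(1)] unfolding fmin_def by blast
qed

text \<open>If the point \<open>(0 : 0 : 1)\<close> is not on the curve, then \<open>\<psi>\<close> has poles at most those of \<open>\<phi>\<close>.\<close>

lemma off_curve_integral:
 assumes u: "triple u" and off: "\<And>\<Phi>. \<Phi> \<in> SP ==> \<not> proj_tendsto u (vector [0, 0, 1]) \<Phi>"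
 shows "ps u \<in> Lsp (ph u) 1"
proof -
 have loc: "\<exists>K. \<forall>\<^sub>F z in \<Phi>. cmod (ps u z) \<le> K * (1 + cmod (ph u z)) ^ 1" if Phi: "\<Phi> \<in> SP" for \<Phi>
 proof -
  define a b where "a = on_uhp (\<lambda>z. u z $ 1 / u z $ 3)" and "b = on_uhp (\<lambda>z. u z $ 2 / u z $ 3)"
  note near = triple_near[OF u Phi]
  \<comment> \<open>If the quotients of the first two forms by the third both tended to 0, the point
    would be mapped to \<open>(0 : 0 : 1)\<close>; by \<open>limit_dichotomy\<close> a quotient that
    does not tend to 0 stays away from 0.\<close>
  have "\<exists>c>0. \<forall>\<^sub>F z in \<Phi>. c \<le> cmod (a z) \<or> c \<le> cmod (b z)"
  proof (rule ccontr)
   assume no: "\<not> ?thesis"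
   have a0: "(a \<longlongrightarrow> 0) \<Phi>"
   proof (rule ccontr)
    assume "\<not> (a \<longlongrightarrow> 0) \<Phi>"
    then obtain c where "c > 0" "\<forall>\<^sub>F z in \<Phi>. c \<le> cmod (a z)"
     using limit_dichotomy[OF Phi tripleD(4)[OF u, of 1 3]] unfolding a_def by blast
    thus False using no by (blast intro: eventually_mono)
   qed
   have b0: "(b \<longlongrightarrow> 0) \<Phi>"
   proof (rule ccontr)
    assume "\<not> (b \<longlongrightarrow> 0) \<Phi>"
    then obtain c where "c > 0" "\<forall>\<^sub>F z in \<Phi>. c \<le> cmod (b z)"
     using limit_dichotomy[OF Phi tripleD(4)[OF u, of 2 3]] unfolding b_def by blast
    thus False using no by (blast intro: eventually_mono)
   qed
   have "((\<lambda>z. vector [a z, b z, 1] :: complex^3) \<longlongrightarrow> vector [0, 0, 1]) \<Phi>"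
   proof (rule vec_tendstoI)
    fix i :: 3
    show "((\<lambda>z. vector [a z, b z, 1] $ i) \<longlongrightarrow> (vector [0, 0, 1] :: complex^3) $ i) \<Phi>"
     using exhaust_3[of i] a0 b0 by (auto simp: vector_3)
   qed
   moreover have "\<forall>\<^sub>F z in \<Phi>. vector [a z, b z, 1] = (1 / u z $ 3) *s u z"
    using near by eventually_elim (simp add: vec3_eq vector_3 a_def b_def)
   ultimately have "((\<lambda>z. (1 / u z $ 3) *s u z) \<longlongrightarrow> vector [0, 0, 1]) \<Phi>" by (rule Lim_transform_eventually)
   moreover have "\<forall>\<^sub>F z in \<Phi>. 1 / u z $ 3 ~= 0" using near by eventually_elim simp
   moreover have "vector [0, 0, 1] ~= (0 :: complex^3)" by (simp add: vec3_eq vector_3)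
   ultimately have "proj_tendsto u (vector [0, 0, 1]) \<Phi>"
    unfolding proj_tendsto_def by (intro conjI exI[of _ "\<lambda>z. 1 / u z $ 3"])
   thus False using off[OF Phi] by blast
  qed
  then obtain c where c: "c > 0" "\<forall>\<^sub>F z in \<Phi>. c \<le> cmod (a z) \<or> c \<le> cmod (b z)" by blast
  have "\<forall>\<^sub>F z in \<Phi>. cmod (ps u z) \<le> (1 / c) * (1 + cmod (ph u z)) ^ 1" using c(2) near
  proof eventually_elim
   case (elim z)
   define x y w where "x = cmod (u z $ 1)" and "y = cmod (u z $ 2)" and "w = cmod (u z $ 3)"
   have pos: "0 < x" "0 < y" "0 < w" using elim(2) by (simp_all add: x_def y_def w_def)
   have "c \<le> x / w \<or> c \<le> y / w" using elim by (simp add: a_def b_def norm_divide x_def y_def w_def)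
   hence "c * w \<le> x + y" using pos by (auto simp: field_simps)
   hence "w / x \<le> (1 / c) * (1 + y / x)" using pos c(1) by (simp add: field_simps)
   thus ?case using elim(2) by (simp add: norm_divide x_def y_def w_def)
  qed
  thus ?thesis by blast
 qed
 obtain K where "AEH z. cmod (ps u z) \<le> K * (1 + cmod (ph u z)) ^ 1"
  using local_to_global[OF tripleD(4)[OF u, of 3 1] tripleD(4)[OF u, of 2 1] loc] by blast
 thus ?thesis by (rule LspI[OF carrier_imp_mf[OF tripleD(4)[OF u]]])
qed

text \<open>In coordinates where \<open>v\<close> is \<open>(0 : 0 : 1)\<close>, the function
  \<open>\<psi>\<close> has growth at most that of \<open>\<phi>\<close> and satisfies a relation of
  total degree \<open>N\<close> that is monic of degree \<open>N\<close> in \<open>\<psi>\<close>.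
  The minimal relation divides it, hence contains its own top power of \<open>\<psi>\<close> with a
  nonzero constant coefficient, and this coefficient is the value of \<open>F\<close> at
  \<open>v\<close>.\<close>

lemma off_curve_nonzero:
 assumes u: "triple u" and F: "fmin l F u" and v: "v ~= 0"
  and off: "\<And>\<Phi>. \<Phi> \<in> SP ==> \<not> proj_tendsto u v \<Phi>"
 shows "F v ~= 0"
proof -
 obtain M M' :: "complex^3^3" where M: "M ** M' = mat 1" "M' ** M = mat 1" "M *v vector [0, 0, 1] = v"
  using frame_exists[OF v] .
 define w where "w = (\<lambda>z. M' *v u z)"
 have w: "triple w" unfolding w_def by (rule triple_transform[OF u M(2)])
 have offw: "\<not> proj_tendsto w (vector [0, 0, 1]) \<Phi>" if Phi: "\<Phi> \<in> SP" for \<Phi>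
 proof
  assume "proj_tendsto w (vector [0, 0, 1]) \<Phi>"
  then obtain c where c: "\<forall>\<^sub>F z in \<Phi>. c z ~= 0" "((\<lambda>z. c z *s w z) \<longlongrightarrow> vector [0, 0, 1]) \<Phi>"
   unfolding proj_tendsto_def by blast
  have "((\<lambda>z. M *v (c z *s w z)) \<longlongrightarrow> M *v vector [0, 0, 1]) \<Phi>"
   unfolding matrix_vector_mult_def by (intro tendsto_vec_lambda tendsto_sum tendsto_mult tendsto_const tendsto_vec_nth c(2))
  moreover have "M *v (c z *s w z) = c z *s u z" for z by (simp add: w_def vector_scalar_commute matrix_vector_mul_assoc M(1))
  ultimately have "((\<lambda>z. c z *s u z) \<longlongrightarrow> v) \<Phi>" by (simp add: M(3))
  hence "proj_tendsto u v \<Phi>" unfolding proj_tendsto_def using c(1) v by blast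
  thus False using off[OF Phi] by blast
 qed
 note fw = fmin_transform[OF F M(1,2), folded w_def]
 obtain R where R: "min_rel (ph w) (ps w) l R" "F (M *v vector [0, 0, 1]) = coeff (coeff R l) 0"
  by (rule min_rel_of_fmin[OF w fw], rule that)
 note phw = tripleD(4)[OF w, of 2 1] and nc = ph_nonconst[OF w]
 obtain N r where r: "tdeg_le N r" "coeff r N = 1" "relp (ph w) (ps w) r"
  using monic_relation[OF phw nonconst_nonzero[OF phw nc] off_curve_integral[OF w offw]] by blast
 have "R dvd r" by (rule min_rel_dvd(1)[OF carrier_imp_mf[OF phw] carrier_imp_mf[OF tripleD(4)[OF w]] nc R(1) r(3)])
 then obtain s where s: "r = R * s" by blast
 have "coeff (coeff R l) 0 ~= 0"
 proof (rule dvd_monic_top[OF r(1,2) s])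
  show "tdeg_le l R" "\<And>k. tdeg_le k R ==> l \<le> k" using R(1) unfolding min_rel_def by blast+
 qed
 thus ?thesis using R(2) M(3) by simp
qed

lemma on_curve_zero:
 assumes F: "frel l F u" and u: "triple u" and Phi: "\<Phi> \<in> SP" and v: "proj_tendsto u v \<Phi>"
 shows "F v = 0"
proof -
 note D = F[unfolded frel_def]
 obtain c where c: "((\<lambda>z. c z *s u z) \<longlongrightarrow> v) \<Phi>" using v unfolding proj_tendsto_def by blast
 have "((\<lambda>z. F (c z *s u z)) \<longlongrightarrow> F v) \<Phi>" using D isCont_tendsto_compose[OF HP_continuous c] by blast
 moreover have "\<forall>\<^sub>F z in \<Phi>. F (c z *s u z) = 0" using triple_near[OF u Phi]
 proof eventually_elim
  case (elim z)
  hence "F (u z) = 0" using D by blast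
  thus ?case using HP_homogeneous[of l F "c z" "u z"] D by simp
 qed
 ultimately have "((\<lambda>w. 0) \<longlongrightarrow> F v) \<Phi>" by (rule Lim_transform_eventually)
 thus ?thesis using surface_point_nonbot[OF Phi] by (simp add: tendsto_const_iff)
qed

text \<open>The two preceding lemmas identify the image with the zero set of \<open>F\<close>. Any
  vector \<open>v\<close> with \<open>F v \<noteq> 0\<close> then serves as the centre
  \<open>(0 : 0 : 1)\<close> of a pencil of lines, and \<open>generic_line_exists\<close> applies to
  the irreducible minimal relation in such coordinates.\<close>

theorem plane_degree_eq:
 assumes u: "triple (\<lambda>z. vector [f z, g z, h z])" and F: "fmin l F (\<lambda>z. vector [f z, g z, h z])"
 shows "plane_degree (plane_curve \<Gamma> f g h) = l"
proof -
 define u where "u = (\<lambda>z. vector [f z, g z, h z] :: complex^3)"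
 have u: "triple u" and F: "fmin l F u" using u F by (simp_all add: u_def)
 note D = F[unfolded fmin_def]
 have "F v = 0 \<longleftrightarrow> (\<exists>\<Phi>\<in>SP. proj_tendsto u v \<Phi>)" if "v ~= 0" for v
  using off_curve_nonzero[OF u F that] on_curve_zero[OF _ u] D by blast
 moreover have "v ~= 0" if "proj_tendsto u v \<Phi>" for v \<Phi> using that by (simp add: proj_tendsto_def)
 ultimately have curve: "plane_curve \<Gamma> f g h = zero_set F"
  unfolding plane_curve_def zero_set_def u_def[symmetric] by blast
 have HF: "HP l F" "\<exists>x. F x ~= 0" using D by (auto simp: frel_def)
 then obtain v where v: "F v ~= 0" by blast
 have l1: "1 \<le> l"
 proof (rule ccontr)
  assume "\<not> 1 \<le> l"
  hence l0: "l = 0" by simp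
  have "F v = 0" for v using HP_homogeneous[OF HF(1), of 0 "u \<i>"] HP_homogeneous[OF HF(1), of 0 v] D
   by (simp add: l0 frel_def)
  thus False using v by blast
 qed
 have "v ~= 0"
 proof
  assume "v = 0"
  thus False using HP_homogeneous[OF HF(1), of 0 v] v l1 by (simp add: power_0_left)
 qed
 then obtain M M' :: "complex^3^3" where M: "M ** M' = mat 1" "M' ** M = mat 1" "M *v vector [0, 0, 1] = v"
  using frame_exists by metis
 define w where "w = (\<lambda>z. M' *v u z)"
 have w: "triple w" unfolding w_def by (rule triple_transform[OF u M(2)])
 obtain R where R: "min_rel (ph w) (ps w) l R" "\<And>t y. F (M *v vector [1, t, y]) = ev2 R t y"
  "F (M *v vector [0, 0, 1]) = coeff (coeff R l) 0"
  by (rule min_rel_of_fmin[OF w fmin_transform[OF F M(1,2), folded w_def]], rule that)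
 have "irreducible R" by (rule min_rel_irreducible[OF carrier_imp_mf carrier_imp_mf R(1)]) (rule tripleD(4)[OF w])+
 moreover have "tdeg_le l R" using R(1) by (simp add: min_rel_def)
 moreover have "coeff (coeff R l) 0 ~= 0" using R(3) v M(3) by simp
 moreover have "F (M *v vector [0, 0, 1]) ~= 0" using v M(3) by simp
 ultimately obtain U where U: "openin (zariski (*s) UNIV) U" "U ~= {}"
  "\<forall>a\<in>U. finite (zero_set F \<inter> proj_line a) \<and> card (zero_set F \<inter> proj_line a) = l"
  using generic_line_exists[OF HF(1) l1 M(2) R(2)] by blast
 show ?thesis unfolding curve by (rule plane_degree_eqI[OF U(1,2)]) (use U(3) in blast)
qed

end

section \<open>Degrees of the field extensions\<close>

context fuchsian
begin

interpretation FR: field FF by (rule field_FF)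

lemma eq_on_uhp: "x \<in> CF ==> mf u ==> AEH z. x z = u z ==> x = on_uhp u"
 using on_uhp_carrier_FF on_uhp_eq_iff[OF carrier_imp_mf] by metis

lemma poly_nonzero_ae: "mf \<phi> ==> nonconst \<phi> ==> c ~= 0 ==> AEH z. poly c (\<phi> z) ~= 0"
 using mf_zero_or_nonzero[OF mf_poly, of \<phi> c 0] relp_const[of \<phi> \<phi> c] by (auto simp: relp_def)

lemma consts_carrier: "S \<subseteq> CF ==> range (\<lambda>c. on_uhp (\<lambda>z. c)) \<union> S \<subseteq> CF"
 using mf_carrier[OF mf_const] by auto

lemma adjoin_subfield: "S \<subseteq> CF ==> subfield (adjoin \<Gamma> S) FF"
 unfolding adjoin_def by (rule FR.generate_field_is_subfield[OF consts_carrier])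

definition lies_in :: "cfn set => cfn => bool"
 where "lies_in L u \<longleftrightarrow> mf u \<and> on_uhp u \<in> L"

context
 fixes L
 assumes L: "subfield L FF" and constL: "\<And>c. on_uhp (\<lambda>z. c) \<in> L"
begin

lemma lies_in_carrier: "x \<in> L ==> lies_in L x" "x \<in> L ==> x \<in> CF"
 using subfieldE(3)[OF L] carrier_imp_mf on_uhp_carrier_FF by (auto simp: lies_in_def)

lemma lies_in_const: "lies_in L (\<lambda>z. c)" using constL by (simp add: lies_in_def mf_const del: on_uhp_const)

lemma lies_in_add: "lies_in L u ==> lies_in L v ==> lies_in L (\<lambda>z. u z + v z)"
 unfolding lies_in_def using subringE(7)[OF subfieldE(1)[OF L]] on_uhp_add[of u v] mf_add[of u v] by metis

lemma lies_in_mult: "lies_in L u ==> lies_in L v ==> lies_in L (\<lambda>z. u z * v z)"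
 unfolding lies_in_def using subringE(6)[OF subfieldE(1)[OF L]] on_uhp_mult[of u v] mf_mult[of u v] by metis

lemma lies_in_inverse:
 assumes "lies_in L u" "AEH z. u z ~= 0"
 shows "lies_in L (\<lambda>z. inverse (u z))"
proof -
 have u: "mf u" "on_uhp u \<in> L" using assms(1) by (auto simp: lies_in_def)
 note mi = mf_inverse[OF u(1)]
 have nz: "on_uhp u ~= FF0"
 proof
  assume "on_uhp u = FF0"
  hence "AEH z. u z = 0" using on_uhp_eq_iff[OF u(1) mf_const] by (simp only: FF_simps)
  with assms(2) have "AEH z. False" by eventually_elim simp
  thus False using not_ae_False by blast
 qed
 have "on_uhp u \<otimes>\<^bsub>FF\<^esub> on_uhp (\<lambda>z. inverse (u z)) = on_uhp (\<lambda>z. u z * inverse (u z))" by (rule on_uhp_mult[OF u(1) mi])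
 also have "\<dots> = \<one>\<^bsub>FF\<^esub>"
  unfolding FF_simps by (rule on_uhp_cong, rule eventually_mono[OF assms(2)]) simp
 finally have "inv\<^bsub>FF\<^esub> (on_uhp u) = on_uhp (\<lambda>z. inverse (u z))"
  using FR.comm_inv_char[OF mf_carrier[OF u(1)] mf_carrier[OF mi]] by simp
 moreover have "inv\<^bsub>FF\<^esub> (on_uhp u) \<in> L" using FR.subfield_m_inv(1)[OF L] u(2) nz by simp
 ultimately show ?thesis using mi by (simp add: lies_in_def)
qed

lemma lies_in_power: "lies_in L u ==> lies_in L (\<lambda>z. u z ^ n)"
 by (induction n) (auto intro: lies_in_const lies_in_mult)

lemma lies_in_sum: "(\<And>i. i \<in> I ==> lies_in L (u i)) ==> lies_in L (\<lambda>z. \<Sum>i\<in>I. u i z)"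
 by (induction I rule: infinite_finite_induct) (auto intro: lies_in_const lies_in_add)

lemma lies_in_poly: "lies_in L u ==> lies_in L (\<lambda>z. poly p (u z))"
 unfolding poly_altdef by (intro lies_in_sum lies_in_mult lies_in_const lies_in_power)

end

text \<open>Turns linear combinations in the field into pointwise sums of representatives, for which
  equalities almost everywhere can be used.\<close>

lemma combine_on_uhp:
 assumes "set Ks \<subseteq> CF" "set Us \<subseteq> CF"
 shows "FR.combine Ks Us = on_uhp (\<lambda>z. \<Sum>i<min (length Ks) (length Us). (Ks ! i) z * (Us ! i) z)" using assms
proof (induction Ks Us rule: FR.combine.induct)
 case (1 k Ks u Us)
 have ku: "mf k" "mf u" using 1(2,3) carrier_imp_mf by auto
 have ms: "mf (\<lambda>z. \<Sum>i<min (length Ks) (length Us). (Ks ! i) z * (Us ! i) z)"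
  using 1(2,3) by (intro mf_sum mf_mult carrier_imp_mf) auto
 have "k \<otimes>\<^bsub>FF\<^esub> u = on_uhp (\<lambda>z. k z * u z)" by (simp add: FF_simps)
 hence "FR.combine (k # Ks) (u # Us) = on_uhp (\<lambda>z. k z * u z + (\<Sum>i<min (length Ks) (length Us). (Ks ! i) z * (Us ! i) z))"
  using 1 on_uhp_add[OF mf_mult[OF ku] ms] by simp
 thus ?case by (simp add: sum.lessThan_Suc_shift del: sum.lessThan_Suc)
qed (simp_all add: FF_simps)

lemma in_Span:
 assumes L: "subfield L FF" and y: "y \<in> CF"
  and k: "\<And>i. lies_in L (k i)" and v: "\<And>i. i < n ==> mf (v i)"
  and sum: "AEH z. y z = (\<Sum>i<n. k i z * v i z)"
 shows "y \<in> FR.Span L (map (\<lambda>i. on_uhp (v i)) [0..<n])"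
proof -
 define Ks Us where KU: "Ks = map (\<lambda>i. on_uhp (k i)) [0..<n]" "Us = map (\<lambda>i. on_uhp (v i)) [0..<n]"
 have Ks: "set Ks \<subseteq> L" "length Ks = length Us" using k by (auto simp: KU lies_in_def)
 have mk: "mf (k i)" for i using k by (simp add: lies_in_def)
 have C: "set Ks \<subseteq> CF" "set Us \<subseteq> CF" using mf_carrier mk v by (auto simp: KU)
 have "y = on_uhp (\<lambda>z. \<Sum>i<n. (Ks ! i) z * (Us ! i) z)"
 proof (rule eq_on_uhp[OF y])
  show "mf (\<lambda>z. \<Sum>i<n. (Ks ! i) z * (Us ! i) z)" using C by (intro mf_sum mf_mult carrier_imp_mf) (auto simp: KU)
  have "AEH z. \<forall>i\<in>{..<n}. (Us ! i) z = v i z \<and> (Ks ! i) z = k i z"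
   using mf_ae[OF v] mf_ae[OF mk] by (subst eventually_ball_finite_distrib) (auto simp: KU eventually_conj_iff)
  with sum show "AEH z. y z = (\<Sum>i<n. (Ks ! i) z * (Us ! i) z)" by eventually_elim simp
 qed
 also have "\<dots> = FR.combine Ks Us" unfolding combine_on_uhp[OF C] by (simp add: KU)
 finally show ?thesis using FR.Span_mem_iff_length_version[OF L C(2)] Ks unfolding KU(2) by blast
qed

text \<open>The case \<open>\<psi> = \<phi>\<close> is included and serves as the field
  \<open>\<complex>(\<phi>)\<close>.\<close>

definition gen_field :: "cfn => cfn => cfn set"
 where "gen_field \<phi> \<psi> = adjoin \<Gamma> {\<phi>, \<psi>}"

lemma gen_fieldD:
 assumes "\<phi> \<in> CF" "\<psi> \<in> CF"
 shows "subfield (gen_field \<phi> \<psi>) FF" "on_uhp (\<lambda>z. c) \<in> gen_field \<phi> \<psi>" "\<phi> \<in> gen_field \<phi> \<psi>" "\<psi> \<in> gen_field \<phi> \<psi>"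
 unfolding gen_field_def using adjoin_subfield[of "{\<phi>, \<psi>}"] assms
 by (auto simp: adjoin_def intro: generate_field.incl simp del: on_uhp_const)

text \<open>
 Every element of \<open>\<complex>(\<phi>, \<psi>)\<close> is a quotient \<open>D(\<phi>, \<psi>) / c(\<phi>)\<close>: denominators \<open>B(\<phi>, \<psi>)\<close> are removed by
 a relation \<open>a P + b B = c\<close> with the irreducible \<open>P\<close>, and \<open>D\<close> is reduced modulo \<open>P\<close>.
\<close>

lemma gen_field_repr:
 assumes phi: "\<phi> \<in> CF" "nonconst \<phi>" and psi: "\<psi> \<in> CF" and P: "min_rel \<phi> \<psi> l P"
  and x: "x \<in> gen_field \<phi> \<psi>"
 shows "\<exists>D c. c ~= 0 \<and> degree D < degree P \<and> (AEH z. x z = ev2 D (\<phi> z) (\<psi> z) / poly c (\<phi> z))"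
proof -
 note mf = carrier_imp_mf[OF phi(1)] carrier_imp_mf[OF psi]
 note D = P[unfolded min_rel_def]
 have deg: "1 \<le> degree P" using min_rel_dvd(2)[OF mf phi(2) P] D by blast
 note c_nz = poly_nonzero_ae[OF mf(1) phi(2)]
 define rp where "rp x \<longleftrightarrow> x \<in> CF \<and> (\<exists>A c. c ~= 0 \<and> (AEH z. x z = ev2 A (\<phi> z) (\<psi> z) / poly c (\<phi> z)))" for x
 have rpI: "rp x" if "x \<in> CF" "c ~= 0" "AEH z. x z = ev2 A (\<phi> z) (\<psi> z) / poly c (\<phi> z)" for x A c
  using that unfolding rp_def by blast
 have rpE: thesis if "rp x" "\<And>A c. x \<in> CF ==> c ~= 0 ==> AEH z. x z = ev2 A (\<phi> z) (\<psi> z) / poly c (\<phi> z) ==> thesis" for x thesis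
  using that(1) unfolding rp_def by (elim exE conjE) (rule that(2))
 have ae_on: "AEH z. on_uhp u z = u z" if "mf u" for u by (rule mf_ae[OF that])
 have rp_add: "rp (a \<oplus>\<^bsub>FF\<^esub> b)" if ra: "rp a" and rb: "rp b" for a b
 proof (rule rpE[OF ra], rule rpE[OF rb])
  fix A c B d
  assume a: "a \<in> CF" "c ~= 0" "AEH z. a z = ev2 A (\<phi> z) (\<psi> z) / poly c (\<phi> z)"
   and b: "b \<in> CF" "d ~= 0" "AEH z. b z = ev2 B (\<phi> z) (\<psi> z) / poly d (\<phi> z)"
  show ?thesis
  proof (rule rpI[of _ "c * d" "smult d A + smult c B"])
   show "AEH z. (a \<oplus>\<^bsub>FF\<^esub> b) z = ev2 (smult d A + smult c B) (\<phi> z) (\<psi> z) / poly (c * d) (\<phi> z)"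
    using a(3) b(3) c_nz[OF a(2)] c_nz[OF b(2)] ae_on[OF mf_add[OF carrier_imp_mf[OF a(1)] carrier_imp_mf[OF b(1)]]]
    by eventually_elim (simp add: FF_simps field_simps)
  qed (use a b in auto)
 qed
 have rp_mult: "rp (a \<otimes>\<^bsub>FF\<^esub> b)" if ra: "rp a" and rb: "rp b" for a b
 proof (rule rpE[OF ra], rule rpE[OF rb])
  fix A c B d
  assume a: "a \<in> CF" "c ~= 0" "AEH z. a z = ev2 A (\<phi> z) (\<psi> z) / poly c (\<phi> z)"
   and b: "b \<in> CF" "d ~= 0" "AEH z. b z = ev2 B (\<phi> z) (\<psi> z) / poly d (\<phi> z)"
  show ?thesis
  proof (rule rpI[of _ "c * d" "A * B"])
   show "AEH z. (a \<otimes>\<^bsub>FF\<^esub> b) z = ev2 (A * B) (\<phi> z) (\<psi> z) / poly (c * d) (\<phi> z)"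
    using a(3) b(3) ae_on[OF mf_mult[OF carrier_imp_mf[OF a(1)] carrier_imp_mf[OF b(1)]]]
    by eventually_elim (simp add: FF_simps)
  qed (use a b in auto)
 qed
 have rp_const: "rp (on_uhp (\<lambda>z. k))" for k
  by (rule rpI[of _ 1 "[:[:k:]:]"]) (use mf_carrier[OF mf_const[of k]] ae_on[OF mf_const[of k]] in \<open>simp_all only: one_neq_zero not_False_eq_True ev2_simps poly_1 poly_pCons poly_0 mult_zero_right add_0_right div_by_1\<close>)
 have "rp x" using x unfolding gen_field_def adjoin_def
 proof induction
  case one
  show ?case using rp_const[of 1] by (simp only: FF_simps)
 next
  case (incl h)
  moreover have "rp \<phi>" by (rule rpI[of _ 1 "[:[:0, 1:]:]"]) (use phi in auto)
  moreover have "rp \<psi>" by (rule rpI[of _ 1 "[:0, 1:]"]) (use psi in auto)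
  ultimately show ?case using rp_const by blast
 next
  case (a_inv h)
  have h: "h \<in> CF" using a_inv.IH unfolding rp_def by blast
  have "\<ominus>\<^bsub>FF\<^esub> h = (\<ominus>\<^bsub>FF\<^esub> \<one>\<^bsub>FF\<^esub>) \<otimes>\<^bsub>FF\<^esub> h" using h by (simp add: FR.l_minus)
  moreover have "\<ominus>\<^bsub>FF\<^esub> \<one>\<^bsub>FF\<^esub> = on_uhp (\<lambda>z. - 1)"
  proof (rule FR.minus_equality)
   have "on_uhp (\<lambda>z. - 1) \<oplus>\<^bsub>FF\<^esub> on_uhp (\<lambda>z. 1) = on_uhp (\<lambda>z. (- 1) + 1)" by (rule on_uhp_add[OF mf_const mf_const])
   thus "on_uhp (\<lambda>z. - 1) \<oplus>\<^bsub>FF\<^esub> \<one>\<^bsub>FF\<^esub> = FF0" by (simp only: FF_simps add.left_inverse)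
  qed (use mf_carrier[OF mf_const[of "-1"]] in auto)
  ultimately show ?case using rp_mult[OF rp_const[of "-1"] a_inv.IH] by simp
 next
  case (m_inv h)
  show ?case
  proof (rule rpE[OF m_inv.IH])
   fix A c assume h: "h \<in> CF" "c ~= 0" "AEH z. h z = ev2 A (\<phi> z) (\<psi> z) / poly c (\<phi> z)"
   note mh = carrier_imp_mf[OF h(1)]
   have hnz: "AEH z. h z ~= 0" by (rule FF_nonzero_ae[OF h(1) m_inv.hyps(2)])
   have "\<not> P dvd A"
   proof
    assume "P dvd A"
    then obtain Q where "A = P * Q" by blast
    hence "relp \<phi> \<psi> A" using relp_combination[of \<phi> \<psi> P P Q 0] D by (simp add: mult.commute)
    hence "AEH z. False" unfolding relp_def using h(3) hnz by eventually_elim simp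
    thus False using not_ae_False by blast
   qed
   then obtain a b d where abd: "a * P + b * A = [:d:]" "d ~= 0"
    using prime_elem_combination_const[OF irreducible_imp_prime_elem[OF min_rel_irreducible[OF mf P]] deg] by blast
   have P0: "AEH z. ev2 P (\<phi> z) (\<psi> z) = 0" using D by (simp add: relp_def)
   have bA: "ev2 b t w * ev2 A t w = poly d t" if "ev2 P t w = 0" for t w
    using arg_cong[OF abd(1), of "\<lambda>R. ev2 R t w"] that by simp
   have inv: "inv\<^bsub>FF\<^esub> h = on_uhp (\<lambda>z. inverse (h z))"
   proof -
    have "h \<otimes>\<^bsub>FF\<^esub> on_uhp (\<lambda>z. inverse (h z)) = \<one>\<^bsub>FF\<^esub>" unfolding FF_simps
     by (rule on_uhp_cong, rule eventually_mono[OF eventually_conj[OF hnz ae_on[OF mf_inverse[OF mh]]]]) simp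
    thus ?thesis using FR.comm_inv_char[OF h(1) mf_carrier[OF mf_inverse[OF mh]]] by simp
   qed
   show ?thesis unfolding inv
   proof (rule rpI[OF mf_carrier[OF mf_inverse[OF mh]] abd(2), of "smult c b"])
    show "AEH z. on_uhp (\<lambda>z. inverse (h z)) z = ev2 (smult c b) (\<phi> z) (\<psi> z) / poly d (\<phi> z)"
     using h(3) hnz P0 c_nz[OF h(2)] c_nz[OF abd(2)] ae_on[OF mf_inverse[OF mh]]
    proof eventually_elim
     case (elim z)
     hence A: "ev2 A (\<phi> z) (\<psi> z) = h z * poly c (\<phi> z)" by simp
     have d: "poly d (\<phi> z) = ev2 b (\<phi> z) (\<psi> z) * (h z * poly c (\<phi> z))" using bA[OF elim(3)] unfolding A by simp
     hence "ev2 b (\<phi> z) (\<psi> z) ~= 0" using elim(5) by auto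
     thus ?case unfolding elim(6) d using elim(2,4) by (simp add: divide_simps)
    qed
   qed
  qed
 next
  case (eng_add h1 h2)
  thus ?case using rp_add by blast
 next
  case (eng_mult h1 h2)
  thus ?case using rp_mult by blast
 qed
 then obtain A c where A: "c ~= 0" "AEH z. x z = ev2 A (\<phi> z) (\<psi> z) / poly c (\<phi> z)" unfolding rp_def by blast
 obtain a q where aq: "a ~= 0" "smult a A = P * q + pseudo_mod A P" using pseudo_mod(1)[of P A] D by blast
 have "degree (pseudo_mod A P) < degree P" using pseudo_mod(2)[of P A] D deg by auto
 moreover have "AEH z. x z = ev2 (pseudo_mod A P) (\<phi> z) (\<psi> z) / poly (a * c) (\<phi> z)"
 proof -
  have P0: "AEH z. ev2 P (\<phi> z) (\<psi> z) = 0" using D by (simp add: relp_def)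
  show ?thesis using A(2) P0 c_nz[OF A(1)] c_nz[OF aq(1)]
  proof eventually_elim
   case (elim z)
   have "poly a (\<phi> z) * ev2 A (\<phi> z) (\<psi> z) = ev2 (pseudo_mod A P) (\<phi> z) (\<psi> z)"
    using arg_cong[OF aq(2), of "\<lambda>R. ev2 R (\<phi> z) (\<psi> z)"] elim(2) by simp
   thus ?case using elim(1,4) by (metis mult_divide_mult_cancel_left poly_mult)
  qed
 qed
 ultimately show ?thesis using A(1) aq(1) by (intro exI[of _ "pseudo_mod A P", OF exI[of _ "a * c"]]) auto
qed

text \<open>For \<open>\<psi> = \<phi>\<close> the relation \<open>w - t\<close> forces the minimal
  one to have degree at most 1 in \<open>w\<close>, so the numerators of
  \<open>gen_field_repr\<close> are free of \<open>w\<close>.\<close>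

lemma gen_field_self:
 assumes phi: "\<phi> \<in> CF" "nonconst \<phi>" and x: "x \<in> gen_field \<phi> \<phi>"
 shows "\<exists>a c. c ~= 0 \<and> (AEH z. x z = poly a (\<phi> z) / poly c (\<phi> z))"
proof -
 note mf = carrier_imp_mf[OF phi(1)]
 define R :: "complex poly poly" where "R = [:[:0, -1:], 1:]"
 have R: "R ~= 0" "relp \<phi> \<phi> R" "degree R = 1" by (simp_all add: R_def relp_def)
 have "tdeg_le 1 R" unfolding tdeg_le_def R_def by (auto simp: coeff_pCons split: nat.splits)
 then obtain l P where P: "min_rel \<phi> \<phi> l P" using min_rel_exists[OF R(1,2)] by metis
 have "P dvd R" by (rule min_rel_dvd(1)[OF mf mf phi(2) P R(2)])
 hence "degree P \<le> 1" using dvd_imp_degree_le R(1,3) by metis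
 moreover obtain D c where Dc: "c ~= 0" "degree D < degree P" "AEH z. x z = ev2 D (\<phi> z) (\<phi> z) / poly c (\<phi> z)"
  using gen_field_repr[OF phi phi(1) P x] by blast
 ultimately obtain a where "D = [:a:]" by (metis degree_eq_zeroE less_one order_less_le_trans)
 thus ?thesis using Dc by auto
qed

text \<open>The powers of \<open>\<psi>\<close> below \<open>degree P\<close> form a basis. Clearing
  denominators turns a vanishing combination into a relation of smaller degree in
  \<open>\<psi>\<close>, which \<open>P\<close> can divide only if it is zero;
  \<open>gen_field_repr\<close> gives the span.\<close>

lemma degree_of_extension:
 assumes phi: "\<phi> \<in> CF" "nonconst \<phi>" and psi: "\<psi> \<in> CF" and P: "min_rel \<phi> \<psi> l P"
 shows "FR.dimension (degree P) (gen_field \<phi> \<phi>) (gen_field \<phi> \<psi>)"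
proof -
 define e where "e = degree P"
 define K where "K = gen_field \<phi> \<phi>"
 define F where "F = gen_field \<phi> \<psi>"
 note mf = carrier_imp_mf[OF phi(1)] carrier_imp_mf[OF psi]
 note D = P[unfolded min_rel_def]
 note KD = gen_fieldD[OF phi(1) phi(1), folded K_def] and FD = gen_fieldD[OF phi(1) psi, folded F_def]
 have KF: "K \<subseteq> F"
  unfolding K_def F_def gen_field_def adjoin_def using phi(1) psi by (intro FR.mono_generate_field consts_carrier) auto
 define Us where "Us = map (\<lambda>i. on_uhp (\<lambda>z. \<psi> z ^ i)) [0..<e]"
 have Us: "set Us \<subseteq> CF" using mf_carrier[OF mf_power[OF mf(2)]] by (auto simp: Us_def)
 have lenU: "length Us = e" by (simp add: Us_def)
 have Ui: "AEH z. (Us ! i) z = \<psi> z ^ i" if "i < e" for i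
  using mf_ae[OF mf_power[OF mf(2), of i]] that by (simp add: Us_def)
 note c_nz = poly_nonzero_ae[OF mf(1) phi(2)]
 have "FR.independent K Us"
 proof (rule FR.trivial_combine_imp_independent[OF KD(1) Us])
  fix Ks assume Ks: "set Ks \<subseteq> K" "FR.combine Ks Us = FF0"
  define n where "n = min (length Ks) e"
  have KsC: "set Ks \<subseteq> CF" using Ks(1) lies_in_carrier(2)[OF KD(1,2)] by blast
  have KsK: "Ks ! i \<in> K" if "i < n" for i using Ks(1) that by (auto simp: n_def)
  define good where "good i a c \<longleftrightarrow> c ~= 0 \<and> (AEH z. (Ks ! i) z = poly a (\<phi> z) / poly c (\<phi> z))" for i a c
  have "\<forall>i\<in>{..<n}. \<exists>a c. good i a c"
   unfolding good_def by (intro ballI gen_field_self[OF phi]) (use KsK in \<open>simp add: K_def\<close>)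
  then obtain a c where "\<forall>i\<in>{..<n}. good i (a i) (c i)" by metis
  hence ac: "c i ~= 0" "AEH z. (Ks ! i) z = poly (a i) (\<phi> z) / poly (c i) (\<phi> z)" if "i < n" for i
   using that by (simp_all add: good_def)
  define C where "C = (\<Prod>i<n. c i)"
  have C0: "C ~= 0" using ac(1) by (simp add: C_def)
  \<comment> \<open>The numerators over the common denominator \<open>C\<close>.\<close>
  define A where "A i = a i * (\<Prod>j\<in>{..<n} - {i}. c j)" for i
  define R where "R = (\<Sum>i<n. monom (A i) i)"
  have cR: "coeff R i = (if i < n then A i else 0)" for i by (simp add: R_def coeff_sum)
  have zero: "AEH z. (\<Sum>i<n. (Ks ! i) z * (Us ! i) z) = 0"
  proof -
   have ms: "mf (\<lambda>z. \<Sum>i<n. (Ks ! i) z * (Us ! i) z)"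
    using KsC Us lenU by (intro mf_sum mf_mult carrier_imp_mf) (auto simp: n_def)
   have "on_uhp (\<lambda>z. \<Sum>i<n. (Ks ! i) z * (Us ! i) z) = on_uhp (\<lambda>z. 0)"
    using Ks(2) unfolding combine_on_uhp[OF KsC Us] lenU n_def[symmetric] by (simp only: FF_simps)
   thus ?thesis using on_uhp_eq_iff[OF ms mf_const] by blast
  qed
  have allU: "AEH z. \<forall>i\<in>{..<n}. (Us ! i) z = \<psi> z ^ i"
   using Ui by (subst eventually_ball_finite_distrib) (auto simp: n_def)
  have allK: "AEH z. \<forall>i\<in>{..<n}. (Ks ! i) z = poly (a i) (\<phi> z) / poly (c i) (\<phi> z)"
   using ac(2) by (subst eventually_ball_finite_distrib) auto
  have allc: "AEH z. \<forall>i\<in>{..<n}. poly (c i) (\<phi> z) ~= 0"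
   using ac(1) c_nz by (subst eventually_ball_finite_distrib) auto
  have "relp \<phi> \<psi> R" unfolding relp_def using zero allU allK allc
  proof eventually_elim
   case (elim z)
   have Ai: "poly (A i) (\<phi> z) = poly C (\<phi> z) * (Ks ! i) z" if "i < n" for i
   proof -
    have "C = c i * (\<Prod>j\<in>{..<n} - {i}. c j)" unfolding C_def using that by (subst prod.remove[of _ i]) auto
    thus ?thesis using elim(3,4) that by (simp add: A_def)
   qed
   have "ev2 R (\<phi> z) (\<psi> z) = (\<Sum>i<n. poly (A i) (\<phi> z) * \<psi> z ^ i)"
    unfolding R_def ev2_sum by (intro sum.cong) (auto simp: ev2_def poly_monom poly_const_pow)
   also have "\<dots> = poly C (\<phi> z) * (\<Sum>i<n. (Ks ! i) z * (Us ! i) z)"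
    unfolding sum_distrib_left using elim(2) by (intro sum.cong) (auto simp: Ai)
   finally show ?case using elim(1) by simp
  qed
  hence "P dvd R" by (rule min_rel_dvd(1)[OF mf phi(2) P])
  have "R = 0"
  proof (rule ccontr)
   assume R0: "R ~= 0"
   have "degree P \<le> degree R" by (rule dvd_imp_degree_le[OF \<open>P dvd R\<close> R0])
   moreover have "coeff R (degree R) ~= 0" using R0 by simp
   ultimately show False unfolding cR by (auto simp: n_def e_def split: if_splits)
  qed
  hence A0: "A i = 0" if "i < n" for i using cR[of i] that by simp
  have "Ks ! i = FF0" if i: "i < n" for i
  proof -
   have "(\<Prod>j\<in>{..<n} - {i}. c j) ~= 0" using ac(1) by auto
   hence "a i = 0" using A0[OF i] by (simp add: A_def)
   hence "AEH z. (Ks ! i) z = 0" using ac(2)[OF i] by simp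
   hence "Ks ! i = on_uhp (\<lambda>z. 0)" by (intro eq_on_uhp mf_const) (use KsC i in \<open>auto simp: n_def\<close>)
   thus ?thesis by (simp only: FF_simps)
  qed
  thus "set (take (length Us) Ks) \<subseteq> {FF0}" by (auto simp: lenU n_def set_conv_nth)
 qed
 moreover have "FR.Span K Us = F"
 proof
  show "FR.Span K Us \<subseteq> F"
  proof
   fix y assume "y \<in> FR.Span K Us"
   then obtain Ks where Ks: "set Ks \<subseteq> K" "length Ks = length Us" "y = FR.combine Ks Us"
    using FR.Span_mem_iff_length_version[OF KD(1) Us] by blast
   have KsF: "set Ks \<subseteq> CF" using Ks(1) lies_in_carrier(2)[OF KD(1,2)] by blast
   have pw: "lies_in F (\<lambda>z. \<psi> z ^ i)" for i by (intro lies_in_power[OF FD(1,2)] lies_in_carrier(1)[OF FD(1,2)] FD(4))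
   have "lies_in F (\<lambda>z. \<Sum>i<e. (Ks ! i) z * (Us ! i) z)"
   proof (intro lies_in_sum[OF FD(1,2)] lies_in_mult[OF FD(1,2)])
    fix i assume i: "i \<in> {..<e}"
    have "Ks ! i \<in> set Ks" using Ks(2) i lenU by simp
    thus "lies_in F (Ks ! i)" using Ks(1) KF by (intro lies_in_carrier(1)[OF FD(1,2)]) blast
    show "lies_in F (Us ! i)" using pw[of i] i by (intro lies_in_carrier(1)[OF FD(1,2)]) (simp add: Us_def lies_in_def)
   qed
   thus "y \<in> F" unfolding Ks(3) combine_on_uhp[OF KsF Us] using Ks(2) lenU by (simp add: lies_in_def)
  qed
  show "F \<subseteq> FR.Span K Us"
  proof
   fix y assume y: "y \<in> F"
   obtain A c where A: "c ~= 0" "degree A < e" "AEH z. y z = ev2 A (\<phi> z) (\<psi> z) / poly c (\<phi> z)"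
    using gen_field_repr[OF phi psi P, of y] y unfolding F_def e_def by blast
   define k where "k i = (\<lambda>z. poly (coeff A i) (\<phi> z) * inverse (poly c (\<phi> z)))" for i
   show "y \<in> FR.Span K Us" unfolding Us_def
   proof (rule in_Span[OF KD(1)])
    show "y \<in> CF" using y lies_in_carrier(2)[OF FD(1,2)] by blast
    show "lies_in K (k i)" for i unfolding k_def
     by (intro lies_in_mult[OF KD(1,2)] lies_in_inverse[OF KD(1,2)] lies_in_poly[OF KD(1,2)] lies_in_carrier(1)[OF KD(1,2)] KD(3) c_nz A(1))
    have "degree A \<le> e - 1" "{..e-1} = {..<e}" using A(2) by auto
    hence ev: "ev2 A t w = (\<Sum>i<e. poly (coeff A i) t * w ^ i)" for t w using ev2_altdef by metis
    show "AEH z. y z = (\<Sum>i<e. k i z * \<psi> z ^ i)" using A(3) by eventually_elim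
      (simp add: ev k_def sum_divide_distrib divide_inverse sum_distrib_left sum_distrib_right algebra_simps)
   qed (rule mf_power[OF mf(2)])
  qed
 qed
 ultimately show ?thesis using FR.dimensionI[OF KD(1)] lenU unfolding K_def F_def e_def by metis
qed

text \<open>Every element of the field has a denominator in \<open>\<complex>[\<phi>]\<close>, after
  which it is a combination of the finitely many generators \<open>e s\<close>; the coefficients
  needed are rational in \<open>\<phi>\<close> alone.\<close>

lemma finite_degree:
 assumes phi: "\<phi> \<in> CF" "nonconst \<phi>" and psi: "\<psi> \<in> CF"
 shows "\<exists>d>0. FR.dimension d (gen_field \<phi> \<psi>) (CF)"
proof -
 define F where "F = gen_field \<phi> \<psi>"
 note FD = gen_fieldD[OF phi(1) psi, folded F_def]
 note phi0 = phi(1) nonconst_nonzero[OF phi]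
 have mphi: "mf \<phi>" by (rule carrier_imp_mf[OF phi(1)])
 note c_nz = poly_nonzero_ae[OF mphi phi(2)]
 obtain k0 n e where e: "\<forall>s<(n::nat). e s \<in> Lsp \<phi> k0" "\<forall>j. \<forall>u\<in>Lsp \<phi> (k0 + j). \<exists>p. (\<forall>s<n. degree (p s) \<le> j) \<and>
   (AEH z. u z = (\<Sum>s<n. poly (p s) (\<phi> z) * e s z))" using Lsp_generators[OF phi0] by (elim exE conjE)
 have me: "mf (e s)" if "s < n" for s using e(1) that by (auto simp: Lsp_def)
 define Us where "Us = map (\<lambda>s. on_uhp (e s)) [0..<n]"
 have Us: "set Us \<subseteq> CF" using mf_carrier[OF me] by (auto simp: Us_def)
 have lenU: "length Us = n" by (simp add: Us_def)
 have "CF \<subseteq> FR.Span F Us"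
 proof
  fix y assume y: "y \<in> CF"
  obtain c k where c: "c ~= 0" "(\<lambda>z. poly c (\<phi> z) * y z) \<in> Lsp \<phi> k"
   using denominator_exists[OF phi0 carrier_imp_mf[OF y]] by blast
  have "\<exists>p. (\<forall>s<n. degree (p s) \<le> k) \<and> (AEH z. poly c (\<phi> z) * y z = (\<Sum>s<n. poly (p s) (\<phi> z) * e s z))"
   by (rule e(2)[THEN spec, THEN bspec]) (rule Lsp_mono[OF c(2)], simp)
  then obtain p where p: "AEH z. poly c (\<phi> z) * y z = (\<Sum>s<n. poly (p s) (\<phi> z) * e s z)" by (elim exE conjE)
  define q where "q s = (\<lambda>z. poly (p s) (\<phi> z) * inverse (poly c (\<phi> z)))" for s
  show "y \<in> FR.Span F Us" unfolding Us_def
  proof (rule in_Span[OF FD(1) y _ me])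
   show "lies_in F (q s)" for s unfolding q_def
    by (intro lies_in_mult[OF FD(1,2)] lies_in_inverse[OF FD(1,2)] lies_in_poly[OF FD(1,2)] lies_in_carrier(1)[OF FD(1,2)] FD(3) c_nz c(1))
   show "AEH z. y z = (\<Sum>s<n. q s z * e s z)" using p c_nz[OF c(1)]
   proof eventually_elim
    case (elim z)
    have "(\<Sum>s<n. q s z * e s z) = (\<Sum>s<n. poly (p s) (\<phi> z) * e s z) * inverse (poly c (\<phi> z))"
     unfolding sum_distrib_right by (simp add: q_def algebra_simps)
    thus ?case using elim(2) unfolding elim(1)[symmetric] by simp
   qed
  qed
 qed
 hence "FR.Span F Us = CF" using FR.Span_subgroup_props(1)[OF FD(1) Us] by blast
 then obtain d where d: "FR.dimension d F (CF)" using FR.Span_finite_dimension[OF FD(1) Us] by auto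
 moreover have "d ~= 0"
 proof
  assume "d = 0"
  hence "CF = {FF0}" using FR.dimension_zero[OF FD(1)] d by simp
  thus False using FR.one_closed FR.one_not_zero by blast
 qed
 ultimately show ?thesis unfolding F_def by blast
qed

text \<open>The tower law for \<open>\<complex>(\<phi>)\<close> inside
  \<open>\<complex>(\<phi>, \<psi>)\<close> inside the function field. Positivity allows the upper
  degree to be divided out later.\<close>

theorem degree_formula:
 assumes phi: "\<phi> \<in> CF" "nonconst \<phi>" and psi: "\<psi> \<in> CF" and P: "min_rel \<phi> \<psi> l P"
 shows "field_degree \<Gamma> (adjoin \<Gamma> {\<phi>}) = degree P * field_degree \<Gamma> (adjoin \<Gamma> {\<phi>, \<psi>})"
  "0 < field_degree \<Gamma> (adjoin \<Gamma> {\<phi>, \<psi>})"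
proof -
 note KD = gen_fieldD[OF phi(1) phi(1)] and FD = gen_fieldD[OF phi(1) psi]
 obtain d where d: "d > 0" "FR.dimension d (gen_field \<phi> \<psi>) (CF)" using finite_degree[OF phi psi] by blast
 have "FR.dimension (degree P * d) (gen_field \<phi> \<phi>) (CF)"
  by (rule FR.telescopic_base[OF KD(1) FD(1) degree_of_extension[OF phi psi P] d(2)])
 hence "field_degree \<Gamma> (gen_field \<phi> \<phi>) = degree P * d"
  unfolding field_degree_def using FR.dimI[OF KD(1)] by (simp add: over_def)
 moreover have "field_degree \<Gamma> (gen_field \<phi> \<psi>) = d"
  unfolding field_degree_def using FR.dimI[OF FD(1) d(2)] by (simp add: over_def)
 ultimately show "field_degree \<Gamma> (adjoin \<Gamma> {\<phi>}) = degree P * field_degree \<Gamma> (adjoin \<Gamma> {\<phi>, \<psi>})"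
  "0 < field_degree \<Gamma> (adjoin \<Gamma> {\<phi>, \<psi>})" using d(1) by (simp_all add: gen_field_def)
qed

end

section \<open>The strata\<close>

locale form_pencil = form_space +
 fixes f g :: cfn
 assumes fg: "f \<in> \<Xi>" "g \<in> \<Xi>" "f ~= g" "cfun.independent {f, g}" and dim: "3 \<le> cfun.dim \<Xi>"
begin

definition vec3 :: "cfn => complex => complex^3"
 where "vec3 h = (\<lambda>z. vector [f z, g z, h z])"

text \<open>Forms vanish outside the half-plane, so a linear relation on it is one between
  functions; \<open>h\<close> off the span removes the third coefficient, independence of
  \<open>f\<close> and \<open>g\<close> the other two.\<close>

lemma triple_vec3:
 assumes h: "h \<in> \<Xi>" "h \<notin> cfun.span {f, g}"
 shows "triple (vec3 h)" unfolding triple_def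
proof (intro conjI allI impI)
 fix i :: 3
 show "(\<lambda>z. vec3 h z $ i) \<in> \<Xi>" using exhaust_3[of i] fg(1,2) h(1) by (auto simp: vec3_def vector_3)
next
 fix a assume a: "\<forall>z. 0 < Im z --> dt a (vec3 h z) = 0"
 have out: "k z = 0" if "k \<in> \<Xi>" "\<not> 0 < Im z" for k z using that forms by (auto simp: modular_forms_def)
 have lin: "a$1 * f z + a$2 * g z + a$3 * h z = 0" for z
  using a out[OF fg(1), of z] out[OF fg(2), of z] out[OF h(1), of z] by (cases "0 < Im z") (auto simp: dt_3 vec3_def vector_3)
 have a3: "a$3 = 0"
 proof (rule ccontr)
  assume n: "a$3 ~= 0"
  have "h = cfun_scale (- a$1 / a$3) f + cfun_scale (- a$2 / a$3) g"
  proof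
   fix z
   have "a$3 * h z = - (a$1 * f z + a$2 * g z)" using lin[of z] by (simp only: add_eq_0_iff)
   hence "h z = - (a$1 * f z + a$2 * g z) / a$3" using n by (simp add: nonzero_eq_divide_eq mult.commute)
   thus "h z = (cfun_scale (- a$1 / a$3) f + cfun_scale (- a$2 / a$3) g) z"
    by (simp add: cfun_scale_def plus_fun_def diff_divide_distrib add_divide_distrib)
  qed
  moreover have "cfun_scale b f + cfun_scale c g \<in> cfun.span {f, g}" for b c
   by (intro cfun.span_add cfun.span_scale cfun.span_base) simp_all
  ultimately show False using h(2) by metis
 qed
 have no: "\<not> (\<exists>c. k = cfun_scale c k')" if "k \<in> {f, g}" "k' \<in> {f, g} - {k}" for k k'
  using fg(4) that cfun.span_scale[OF cfun.span_base[of k' "{f, g} - {k}"]] unfolding cfun.dependent_def by blast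
 have nofg: "\<not> (\<exists>c. f = cfun_scale c g)" "\<not> (\<exists>c. g = cfun_scale c f)"
  by (rule no; use fg(3) in simp)+
 have a1: "a$1 = 0"
 proof (rule ccontr)
  assume n: "a$1 ~= 0"
  have "f = cfun_scale (- a$2 / a$1) g"
  proof
   fix z
   have "a$1 * f z = - a$2 * g z" using lin[of z] a3 by (simp add: add_eq_0_iff2)
   thus "f z = cfun_scale (- a$2 / a$1) g z" using n by (simp add: cfun_scale_def field_simps)
  qed
  thus False using nofg(1) by blast
 qed
 have "a$2 = 0"
 proof (rule ccontr)
  assume n: "a$2 ~= 0"
  have "g = cfun_scale 0 f" using lin a1 a3 n by (auto simp: cfun_scale_def)
  thus False using nofg(2) by blast
 qed
 thus "a = 0" using a1 a3 by (simp add: vec3_eq)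
qed

lemma exists_off_span: "\<exists>h\<in>\<Xi>. h \<notin> cfun.span {f, g}"
proof (rule ccontr)
 assume "\<not> ?thesis"
 hence "\<Xi> \<subseteq> cfun.span {f, g}" by blast
 hence "cfun.dim \<Xi> \<le> card {f, g}" by (rule cfun.dim_le_card) simp
 thus False using dim card_insert_le_m1[of 2 "{g}" f] by simp
qed

lemma span_subset: "cfun.span {f, g} \<subseteq> \<Xi>" by (rule cfun.span_minimal[OF _ subspace]) (use fg in simp)

abbreviation \<phi> :: cfn where "\<phi> \<equiv> quotient_fun g f"
abbreviation \<psi> :: "cfn => complex => complex" where "\<psi> h \<equiv> quotient_fun h f"

lemma psi_facts:
 assumes "h \<in> \<Xi>"
 shows "mf (\<lambda>z. h z / f z)" "\<psi> h \<in> CF" "mf (\<psi> h)" "AEH z. \<psi> h z = h z / f z"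
proof -
 show mq: "mf (\<lambda>z. h z / f z)" by (rule mf_quotient[OF subsetD[OF forms fg(1)] subsetD[OF forms assms] chi])
 show "\<psi> h \<in> CF" "AEH z. \<psi> h z = h z / f z"
  unfolding quotient_fun_def using mf_carrier[OF mq] mf_ae[OF mq] by simp_all
 thus "mf (\<psi> h)" by (intro carrier_imp_mf)
qed

lemma ph_vec3: "ph (vec3 h) = \<phi>" "ps (vec3 h) = \<psi> h" by (simp_all add: vec3_def vector_3 quotient_fun_def)

lemma phi_nonconst: "nonconst \<phi>"
proof -
 obtain h where "h \<in> \<Xi>" "h \<notin> cfun.span {f, g}" using exists_off_span by blast
 from ph_nonconst[OF triple_vec3[OF this]] show ?thesis unfolding ph_vec3 .
qed

lemma f_nonzero: "AEH z. f z ~= 0"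
proof -
 obtain h where "h \<in> \<Xi>" "h \<notin> cfun.span {f, g}" using exists_off_span by blast
 from triple_ae(1)[OF triple_vec3[OF this], of 1] show ?thesis by (simp add: vec3_def vector_3)
qed

text \<open>Each \<open>h / f\<close> is a combination of the finitely many \<open>b i / f\<close>
  for a basis \<open>b\<close> of \<open>\<Xi>\<close>, and the bound of
  \<open>uniform_relation\<close> does not depend on the coefficients.\<close>

lemma uniform_bound: "\<exists>D. \<forall>h\<in>\<Xi>. \<exists>R. R ~= 0 \<and> tdeg_le D R \<and> relp \<phi> (\<psi> h) R"
proof -
 obtain B where B: "B \<subseteq> \<Xi>" "\<Xi> \<subseteq> cfun.span B" "card B = cfun.dim \<Xi>"
  by (rule cfun.basis_exists[of \<Xi>], rule that)
 \<comment> \<open>\<open>card B\<close> is at least 3, whereas the cardinality of an infinite set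
   is 0.\<close>
 have fin: "finite B" using B(3) dim by (intro card_ge_0_finite) linarith
 obtain b where b: "bij_betw b {..<card B} B" using ex_bij_betw_nat_finite[OF fin] by (auto simp: atLeast0LessThan)
 have bX: "b i \<in> \<Xi>" if "i < card B" for i using bij_betwE[OF b] B(1) that by auto
 have "\<exists>D. \<forall>c. \<exists>R. R ~= 0 \<and> tdeg_le D R \<and> relp \<phi> (\<lambda>z. \<Sum>i<card B. c i * (b i z / f z)) R"
  by (rule uniform_relation[OF psi_facts(2)[OF fg(2)] phi_nonconst]) (rule psi_facts(1)[OF bX])
 then obtain D where D: "\<forall>c. \<exists>R. R ~= 0 \<and> tdeg_le D R \<and> relp \<phi> (\<lambda>z. \<Sum>i<card B. c i * (b i z / f z)) R" ..
 show ?thesis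
 proof (intro exI[of _ D] ballI)
  fix h assume h: "h \<in> \<Xi>"
  hence "h \<in> cfun.span B" using B(2) by (rule subsetD[rotated])
  hence "h \<in> range (\<lambda>u. \<Sum>v\<in>B. cfun_scale (u v) v)" unfolding cfun.span_finite[OF fin] .
  then obtain c where c: "h = (\<Sum>v\<in>B. cfun_scale (c v) v)" by (elim rangeE)
  obtain R where R: "R ~= 0" "tdeg_le D R" "relp \<phi> (\<lambda>z. \<Sum>i<card B. c (b i) * (b i z / f z)) R"
   using D[THEN spec, of "\<lambda>i. c (b i)"] by (elim exE conjE)
  have sum_apply: "(\<Sum>v\<in>A. k v) z = (\<Sum>v\<in>A. k v z)" for A and k :: "_ => complex => complex" and z
   by (induction A rule: infinite_finite_induct) auto
  have hf: "h z / f z = (\<Sum>i<card B. c (b i) * (b i z / f z))" for z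
  proof -
   have "h z = (\<Sum>v\<in>B. c v * v z)" by (subst c) (simp add: sum_apply cfun_scale_def)
   also have "\<dots> = (\<Sum>i<card B. c (b i) * b i z)" by (rule sum.reindex_bij_betw[OF b, symmetric])
   finally show ?thesis by (simp add: sum_divide_distrib)
  qed
  have "relp \<phi> (\<psi> h) R"
   unfolding relp_def using R(3)[unfolded relp_def] psi_facts(4)[OF h] by eventually_elim (simp only: hf)
  thus "\<exists>R. R ~= 0 \<and> tdeg_le D R \<and> relp \<phi> (\<psi> h) R" using R(1,2) by (intro exI[of _ R] conjI)
 qed
qed

section \<open>Relations of bounded degree as closed conditions\<close>

definition bound :: nat where "bound = (SOME D. \<forall>h\<in>\<Xi>. \<exists>R. R ~= 0 \<and> tdeg_le D R \<and> relp \<phi> (\<psi> h) R)"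

lemma bound: "h \<in> \<Xi> ==> \<exists>R. R ~= 0 \<and> tdeg_le bound R \<and> relp \<phi> (\<psi> h) R"
 unfolding bound_def by (rule bspec[OF someI_ex[OF uniform_bound]])

definition rdep :: "nat => nat => cfn => bool"
 where "rdep l r h \<longleftrightarrow> (\<exists>R. R ~= 0 \<and> tdeg_le l R \<and> degree R \<le> r \<and> relp \<phi> (\<psi> h) R)"

text \<open>Multiplication by \<open>f ^ l\<close> clears denominators:
  \<open>\<phi> ^ j * \<psi> ^ i\<close> becomes \<open>f ^ (l - i - j) * g ^ j * h ^ i\<close>,
  which is polynomial in \<open>h\<close>. As these functions are analytic, vanishing almost
  everywhere and everywhere on the half-plane mean the same.\<close>

lemma rdep_iff:
 assumes h: "h \<in> \<Xi>" and I: "bij_betw I {..<n} {(i, j). i \<le> r \<and> i + j \<le> l}"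
 shows "rdep l r h \<longleftrightarrow> dep n (\<lambda>k z. f z ^ (l - fst (I k) - snd (I k)) * g z ^ snd (I k) * h z ^ fst (I k)) \<H>"
proof -
 define J where "J = {(i, j). i \<le> r \<and> i + j \<le> l}"
 note I = I[folded J_def]
 have finJ: "finite J" by (rule bij_betw_finite[OF I, THEN iffD1]) simp
 define G where "G c z = (\<Sum>p\<in>J. c p * (f z ^ (l - fst p - snd p) * g z ^ snd p * h z ^ fst p))" for c z
 define R where "R c = (\<Sum>p\<in>J. monom (monom (c p :: complex) (snd p)) (fst p))" for c
 have evR: "ev2 (R c) t w = (\<Sum>p\<in>J. c p * t ^ snd p * w ^ fst p)" for c t w
  unfolding R_def ev2_sum by (intro sum.cong) (auto simp: ev2_def poly_monom poly_const_pow)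
 have cR: "coeff (coeff (R c) i) j = (if (i, j) \<in> J then c (i, j) else 0)" for c i j
 proof -
  have "coeff (coeff (R c) i) j = (\<Sum>p\<in>J. if p = (i, j) then c p else 0)"
   unfolding R_def coeff_sum coeff_monom by (auto simp: coeff_sum prod_eq_iff intro!: sum.cong)
  thus ?thesis using finJ by simp
 qed
 have key: "relp \<phi> (\<psi> h) (R c) \<longleftrightarrow> (\<forall>z. 0 < Im z --> G c z = 0)" for c
 proof -
  have eq: "AEH z. G c z = f z ^ l * ev2 (R c) (\<phi> z) (\<psi> h z) \<and> f z ~= 0 \<and> 0 < Im z"
  proof -
   have "AEH z. z \<in> \<H>" by (rule eventually_in_cosparse) (auto simp: open_uhp)
   with f_nonzero psi_facts(4)[OF fg(2)] psi_facts(4)[OF h] show ?thesis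
   proof eventually_elim
    case (elim z)
    have "f z ^ (l - i - j) * g z ^ j * h z ^ i = f z ^ l * ((g z / f z) ^ j * (h z / f z) ^ i)" if "(i, j) \<in> J" for i j
    proof -
     have "l = (l - i - j) + j + i" using that by (auto simp: J_def)
     hence "f z ^ l = f z ^ (l - i - j) * f z ^ j * f z ^ i" by (metis power_add)
     thus ?thesis using elim(1) by (simp add: power_divide)
    qed
    hence "G c z = f z ^ l * ev2 (R c) (g z / f z) (h z / f z)"
     unfolding G_def evR sum_distrib_left by (intro sum.cong) (auto simp: algebra_simps)
    thus ?case using elim by simp
   qed
  qed
  have G_an: "G c analytic_on {z}" if "0 < Im z" for z unfolding G_def by (intro analytic_intros form_analytic fg h that)
  show ?thesis
  proof
   assume r: "relp \<phi> (\<psi> h) (R c)"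
   have ae: "AEH z. cmod (G c z) \<le> 0 * (1 + cmod 0) ^ 0" using eq r unfolding relp_def by eventually_elim simp
   show "\<forall>z. 0 < Im z --> G c z = 0" using ae_le_imp_le_analytic[OF ae G_an analytic_on_const] by simp
  next
   assume z: "\<forall>z. 0 < Im z --> G c z = 0"
   show "relp \<phi> (\<psi> h) (R c)" unfolding relp_def using eq by eventually_elim (use z in auto)
  qed
 qed
 have deg: "tdeg_le l (R c)" "degree (R c) \<le> r" for c
 proof -
  have out: "coeff (coeff (R c) i) j = 0" if "\<not> (i \<le> r \<and> i + j \<le> l)" for i j using that unfolding cR J_def by auto
  show "tdeg_le l (R c)"
  proof (rule tdeg_leI)
   show "degree (coeff (R c) i) \<le> l - i" for i by (rule degree_le, intro allI impI, rule out) auto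
   show "coeff (R c) i = 0" if "l < i" for i by (rule poly_eqI, unfold coeff_0, rule out) (use that in auto)
  qed
  show "degree (R c) \<le> r"
  proof (rule degree_le, intro allI impI)
   fix i assume "r < i"
   thus "coeff (R c) i = 0" by (intro poly_eqI, unfold coeff_0, intro out) auto
  qed
 qed
 have Gsum: "(\<Sum>k<n. c k * (f z ^ (l - fst (I k) - snd (I k)) * g z ^ snd (I k) * h z ^ fst (I k))) = G (\<lambda>p. c (inv_into {..<n} I p)) z" for c z
  unfolding G_def sum.reindex_bij_betw[OF I, symmetric]
  by (intro sum.cong) (simp_all add: inv_into_f_f[OF bij_betw_imp_inj_on[OF I]])
 show ?thesis
 proof
  assume "rdep l r h"
  then obtain S where S: "S ~= 0" "tdeg_le l S" "degree S \<le> r" "relp \<phi> (\<psi> h) S" unfolding rdep_def by blast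
  define c where "c p = coeff (coeff S (fst p)) (snd p)" for p
  have "coeff (coeff S i) j = coeff (coeff (R c) i) j" for i j
  proof (cases "(i, j) \<in> J")
   case False
   then consider "r < i" | "l < i + j" by (fastforce simp: J_def)
   hence "coeff (coeff S i) j = 0"
   proof cases
    case 1
    thus ?thesis using S(3) by (simp add: coeff_eq_0)
   next
    case 2
    show ?thesis
    proof (rule ccontr)
     assume nz: "coeff (coeff S i) j ~= 0"
     hence "coeff S i ~= 0" by auto
     hence "degree (coeff S i) + i \<le> l" using S(2) by (simp add: tdeg_le_def)
     thus False using le_degree[OF nz] 2 by linarith
    qed
   qed
   thus ?thesis using False cR by simp
  qed (simp add: cR c_def)
  hence SR: "S = R c" by (simp add: poly_eq_iff)
  have G0: "G c z = 0" if "0 < Im z" for z using S(4)[unfolded SR key, THEN spec, THEN mp, OF that] .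
  obtain i j where ij: "coeff (coeff S i) j ~= 0" using S(1) by (metis poly_eqI coeff_0)
  hence "(i, j) \<in> J" unfolding SR cR by (auto split: if_splits)
  hence "(i, j) \<in> I ` {..<n}" using bij_betw_imp_surj_on[OF I] by simp
  then obtain k where k: "k < n" "I k = (i, j)" by force
  have "G (\<lambda>p. c (I (inv_into {..<n} I p))) z = G c z" for z
   unfolding G_def by (intro sum.cong refl) (simp only: bij_betw_inv_into_right[OF I])
  hence Gz: "(\<Sum>k<n. c (I k) * (f z ^ (l - fst (I k) - snd (I k)) * g z ^ snd (I k) * h z ^ fst (I k))) = 0"
   if "0 < Im z" for z using Gsum[of "\<lambda>k. c (I k)" z] G0[OF that] by simp
  show "dep n (\<lambda>k z. f z ^ (l - fst (I k) - snd (I k)) * g z ^ snd (I k) * h z ^ fst (I k)) \<H>" unfolding dep_def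
  proof (intro exI[of _ "\<lambda>k. c (I k)"] conjI ballI)
   show "\<exists>i<n. c (I i) ~= 0" using k ij by (intro exI[of _ k]) (simp add: c_def)
  qed (use Gz in simp)
 next
  assume "dep n (\<lambda>k z. f z ^ (l - fst (I k) - snd (I k)) * g z ^ snd (I k) * h z ^ fst (I k)) \<H>"
  then obtain c where cc: "(\<exists>k<n. c k ~= 0) \<and>
   (\<forall>z\<in>\<H>. (\<Sum>k<n. c k * (f z ^ (l - fst (I k) - snd (I k)) * g z ^ snd (I k) * h z ^ fst (I k))) = 0)"
   unfolding dep_def ..
  note c0 = conjunct1[OF cc] conjunct2[OF cc]
  have c: "G (\<lambda>p. c (inv_into {..<n} I p)) z = 0" if "0 < Im z" for z using c0(2) Gsum[of c z] that by simp
  define c' where "c' p = c (inv_into {..<n} I p)" for p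
  obtain k where k: "k < n" "c k ~= 0" using c0(1) by blast
  have "I k \<in> J" using bij_betwE[OF I] k(1) by auto
  moreover have "c' (I k) = c k" unfolding c'_def using inv_into_f_f[OF bij_betw_imp_inj_on[OF I]] k(1) by simp
  ultimately have "coeff (coeff (R c') (fst (I k))) (snd (I k)) ~= 0" using k(2) by (simp add: cR)
  hence "R c' ~= 0" by auto
  moreover have "relp \<phi> (\<psi> h) (R c')" unfolding key unfolding c'_def by (intro allI impI c)
  ultimately show "rdep l r h" unfolding rdep_def using deg by blast
 qed
qed

abbreviation "ZT \<equiv> zariski cfun_scale \<Xi>"

text \<open>Evaluation at a point is a linear functional on \<open>\<Xi>\<close>, so
  \<open>closedin_dep\<close> applies with the half-plane as index set.\<close>

lemma closedin_rdep: "closedin ZT {h \<in> \<Xi>. rdep l r h}"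
proof -
 define J where "J = {(i, j). i \<le> r \<and> i + j \<le> l}"
 have "finite J" unfolding J_def by (rule finite_subset[of _ "{..r} \<times> {..l}"]) auto
 from ex_bij_betw_nat_finite[OF this] obtain I where I0: "bij_betw I {0..<card J} J" ..
 define n where "n = card J"
 have I: "bij_betw I {..<n} {(i, j). i \<le> r \<and> i + j \<le> l}"
  using I0 unfolding atLeast0LessThan J_def[symmetric] n_def .
 have ev: "(\<lambda>h. h z) \<in> polynomial_functions cfun_scale \<Xi>" for z
  by (rule polynomial_functions.linear) (simp_all add: cfun_scale_def)
 have "closedin ZT {h \<in> \<Xi>. dep n (\<lambda>k z. f z ^ (l - fst (I k) - snd (I k)) * g z ^ snd (I k) * h z ^ fst (I k)) \<H>}"
  by (rule closedin_dep) (intro polynomial_functions.mult polynomial_functions.const polynomial_functions_power ev)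
 moreover have "{h \<in> \<Xi>. dep n (\<lambda>k z. f z ^ (l - fst (I k) - snd (I k)) * g z ^ snd (I k) * h z ^ fst (I k)) \<H>}
   = {h \<in> \<Xi>. rdep l r h}" using rdep_iff[OF _ I] by (intro Collect_cong conj_cong) simp_all
 ultimately show ?thesis by simp
qed

text \<open>A relation of total degree 1 is a linear relation between \<open>f\<close>,
  \<open>g\<close> and \<open>h\<close>. This exhibits the span as one of the closed sets above, so
  its complement is open.\<close>

lemma span_eq_rdep: "cfun.span {f, g} = {h \<in> \<Xi>. rdep 1 1 h}"
proof (intro equalityI subsetI CollectI conjI)
 fix h assume h: "h \<in> cfun.span {f, g}"
 thus hX: "h \<in> \<Xi>" using span_subset by blast
 obtain a where "h - cfun_scale a f \<in> cfun.span {g}"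
  using cfun.span_breakdown_eq[of h f "{g}", THEN iffD1, OF h] by (elim exE)
 hence "h - cfun_scale a f \<in> range (\<lambda>b. cfun_scale b g)" unfolding cfun.span_singleton .
 then obtain b where b: "h - cfun_scale a f = cfun_scale b g" by (elim rangeE)
 have ab: "h z = a * f z + b * g z" for z using fun_cong[OF b, of z] by (simp add: cfun_scale_def algebra_simps)
 define R :: "complex poly poly" where "R = [:[:- a, - b:], 1:]"
 have "R ~= 0" "degree R \<le> 1" by (simp_all add: R_def)
 moreover have "tdeg_le 1 R" unfolding R_def tdeg_le_def by (auto simp: coeff_pCons split: nat.splits)
 moreover have "relp \<phi> (\<psi> h) R" unfolding relp_def using f_nonzero psi_facts(4)[OF fg(2)] psi_facts(4)[OF hX]
  by eventually_elim (simp add: R_def ab add_divide_distrib)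
 ultimately show "rdep 1 1 h" unfolding rdep_def by blast
next
 fix h assume "h \<in> {h \<in> \<Xi>. rdep 1 1 h}"
 then obtain R where h: "h \<in> \<Xi>" and R: "R ~= 0" "tdeg_le 1 R" "relp \<phi> (\<psi> h) R" unfolding rdep_def by blast
 show "h \<in> cfun.span {f, g}"
 proof (rule ccontr)
  assume "h \<notin> cfun.span {f, g}"
  hence u: "triple (vec3 h)" by (rule triple_vec3[OF h])
  define a b where "a = coeff (coeff R 0) 0" and "b = coeff (coeff R 0) 1"
  have ab: "coeff R 0 = [:a, b:]"
  proof (rule poly_eqI)
   fix i
   have "degree (coeff R 0) \<le> 1" using tdeg_le_coeff(1)[OF R(2), of 0] by simp
   thus "coeff (coeff R 0) i = coeff [:a, b:] i" by (auto simp: a_def b_def coeff_pCons coeff_eq_0 split: nat.splits)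
  qed
  obtain c where c: "coeff R 1 = [:c:]" using tdeg_le_coeff(1)[OF R(2), of 1] by (auto elim: degree_eq_zeroE)
  have Req: "R = [:[:a, b:], [:c:]:]"
  proof (rule poly_eqI)
   fix i :: nat
   consider "i = 0" | "i = 1" | "1 < i" by fastforce
   thus "coeff R i = coeff [:[:a, b:], [:c:]:] i"
    by cases (use ab c tdeg_le_coeff(2)[OF R(2), of i] in \<open>auto simp: coeff_pCons split: nat.splits\<close>)
  qed
  define h' where "h' = (\<lambda>z. 1 * (a * f z + b * g z) + c * h z)"
  have hX: "h' \<in> \<Xi>" unfolding h'_def by (intro form_lin fg h)
  have ae: "AEH z. h' z = 0" using R(3) f_nonzero psi_facts(4)[OF fg(2)] psi_facts(4)[OF h] unfolding relp_def
  proof eventually_elim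
   case (elim z)
   have "h' z = f z * (a + b * (g z / f z) + c * (h z / f z))" unfolding h'_def distrib_left using elim(2) by simp
   moreover have "a + b * (g z / f z) + c * (h z / f z) = 0" using elim(1) unfolding elim(3,4) Req by (simp add: mult.commute)
   ultimately show ?case by simp
  qed
  have "h' z = 0" if z: "0 < Im z" for z
  proof (rule ccontr)
   assume "h' z ~= 0"
   from form_nonzero_ae[OF hX z this] ae have "AEH z. False" by eventually_elim simp
   thus False using not_ae_False by blast
  qed
  hence "\<forall>z. 0 < Im z --> dt (vector [a, b, c]) (vec3 h z) = 0" by (simp add: dt_3 vec3_def vector_3 h'_def)
  hence "vector [a, b, c] = (0 :: complex^3)" using u unfolding triple_def by blast
  thus False using R(1) by (simp add: Req vec3_eq vector_3)
 qed
qed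

text \<open>\<open>e\<close> stands for the degree of the equation in \<open>\<psi>\<close>, that
  is, the degree of \<open>\<complex>(\<phi>, \<psi>)\<close> over
  \<open>\<complex>(\<phi>)\<close>. It is characterised among relations of total degree at most
  \<open>bound\<close>, because a closed condition needs one finite set of monomials for all
  \<open>h\<close>.\<close>

definition good :: "cfn => nat => nat => bool"
 where "good h l e \<longleftrightarrow> plane_degree (plane_curve \<Gamma> f g h) = l \<and> 1 \<le> l \<and> l \<le> bound \<and> 1 \<le> e \<and> e \<le> l \<and>
  field_degree \<Gamma> (adjoin \<Gamma> {\<phi>}) = e * map_degree \<Gamma> f g h \<and> 0 < map_degree \<Gamma> f g h \<and>
  (\<forall>k. rdep k k h \<longleftrightarrow> l \<le> k) \<and> (\<forall>r. rdep bound r h \<longleftrightarrow> e \<le> r)"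

text \<open>One relation \<open>P\<close> provides both numbers: it has the least total degree and,
  as it divides every relation, also the least degree in \<open>\<psi>\<close>; its own total degree
  is at most \<open>bound\<close>.\<close>

lemma good_exists:
 assumes h: "h \<in> \<Xi> - cfun.span {f, g}"
 shows "\<exists>l e. good h l e"
proof -
 have hX: "h \<in> \<Xi>" "h \<notin> cfun.span {f, g}" using h by auto
 have u: "triple (vec3 h)" by (rule triple_vec3[OF hX])
 note psi = psi_facts[OF hX(1)] and phi = psi_facts[OF fg(2)]
 obtain R where R: "R ~= 0" "tdeg_le bound R" "relp \<phi> (\<psi> h) R" using bound[OF hX(1)] by blast
 obtain l P where P: "min_rel \<phi> (\<psi> h) l P" "l \<le> bound" using min_rel_exists[OF R(1,3,2)] by blast
 note D = P(1)[unfolded min_rel_def]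
 obtain F where F: "frel l F (vec3 h)" using frel_of_relp[OF u, unfolded ph_vec3, of P l] D by blast
 have "fmin l F (vec3 h)" unfolding fmin_def
 proof (intro conjI allI impI F)
  fix k G assume "frel k G (vec3 h)"
  then obtain S where "S ~= 0" "relp \<phi> (\<psi> h) S" "tdeg_le k S" by (rule relp_of_frel[OF u, unfolded ph_vec3])
  thus "l \<le> k" using D by blast
 qed
 hence deg: "plane_degree (plane_curve \<Gamma> f g h) = l" using u unfolding vec3_def by (intro plane_degree_eq)
 have e1: "1 \<le> degree P" and dvd: "\<And>S. relp \<phi> (\<psi> h) S ==> P dvd S"
  using min_rel_dvd[OF phi(3) psi(3) phi_nonconst P(1)] D by blast+
 have el: "degree P \<le> l" using tdeg_le_degree D by blast
 have "rdep k k h \<longleftrightarrow> l \<le> k" for k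
  unfolding rdep_def using D el tdeg_le_mono[of l P k] by (meson order_trans)
 moreover have "rdep bound r h \<longleftrightarrow> degree P \<le> r" for r
 proof
  assume "rdep bound r h"
  then obtain S where "S ~= 0" "degree S \<le> r" "relp \<phi> (\<psi> h) S" unfolding rdep_def by blast
  thus "degree P \<le> r" using dvd_imp_degree_le[OF dvd] by (metis order_trans)
 next
  assume "degree P \<le> r"
  thus "rdep bound r h" unfolding rdep_def using D tdeg_le_mono[OF _ P(2)] by blast
 qed
 ultimately have "good h l (degree P)" unfolding good_def map_degree_def
  using deg e1 el P(2) degree_formula[OF phi(2) phi_nonconst psi(2) P(1)] by simp
 thus ?thesis by blast
qed

definition ll :: "cfn => nat" where "ll h = plane_degree (plane_curve \<Gamma> f g h)"
definition ee :: "cfn => nat" where "ee h = field_degree \<Gamma> (adjoin \<Gamma> {\<phi>}) div map_degree \<Gamma> f g h"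

lemma good_ll_ee:
 assumes h: "h \<in> \<Xi> - cfun.span {f, g}"
 shows "good h (ll h) (ee h)"
proof -
 obtain l e where "good h l e" using good_exists[OF h] by blast
 moreover from this have "ll h = l" "ee h = e" by (auto simp: good_def ll_def ee_def)
 ultimately show ?thesis by simp
qed

section \<open>Topology of the strata\<close>

definition Rd :: "nat => nat => cfn set" where "Rd l r = {h \<in> \<Xi>. rdep l r h}"

lemma open_compl_Rd: "openin ZT (\<Xi> - Rd l r)"
 using closedin_rdep[of l r] unfolding closedin_def topspace_zariski Rd_def by blast

lemma open_off_span: "openin ZT (\<Xi> - cfun.span {f, g})" using open_compl_Rd[of 1 1] by (simp add: Rd_def span_eq_rdep)

lemma X_stratum_eq: "X_stratum \<Gamma> \<Xi> f g l = {h \<in> \<Xi> - cfun.span {f, g}. ll h = l}"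
 by (simp add: X_stratum_def ll_def)

text \<open>The degree is at most \<open>l\<close> on a relatively closed set and at least
  \<open>l\<close> on an open one.\<close>

lemma X_locally_closed:
 assumes "1 \<le> l"
 shows "locally_closed_in ZT (X_stratum \<Gamma> \<Xi> f g l)" unfolding locally_closed_in_def
proof (intro exI conjI)
 show "openin ZT ((\<Xi> - cfun.span {f, g}) \<inter> (\<Xi> - Rd (l - 1) (l - 1)))"
  by (intro openin_Int open_off_span open_compl_Rd)
 show "closedin ZT (Rd l l)" unfolding Rd_def by (rule closedin_rdep)
 have "ll h = l \<longleftrightarrow> \<not> rdep (l - 1) (l - 1) h \<and> rdep l l h" if "h \<in> \<Xi> - cfun.span {f, g}" for h
  using good_ll_ee[OF that] assms unfolding good_def by auto
 thus "X_stratum \<Gamma> \<Xi> f g l = (\<Xi> - cfun.span {f, g}) \<inter> (\<Xi> - Rd (l - 1) (l - 1)) \<inter> Rd l l"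
  unfolding X_stratum_eq Rd_def by blast
qed

text \<open>Degrees are at most \<open>bound\<close>, so a largest one exists; for it the closed
  condition of \<open>X_locally_closed\<close> holds for all \<open>h\<close> off the span, and only
  open conditions remain.\<close>

lemma X_largest_open:
 "\<exists>L\<ge>1. X_stratum \<Gamma> \<Xi> f g L ~= {} \<and> (\<forall>l. X_stratum \<Gamma> \<Xi> f g l ~= {} --> l \<le> L) \<and> openin ZT (X_stratum \<Gamma> \<Xi> f g L)"
proof -
 define S where "S = ll ` (\<Xi> - cfun.span {f, g})"
 have "S \<subseteq> {..bound}" using good_ll_ee by (auto simp: S_def good_def)
 hence fin: "finite S" by (rule finite_subset) simp
 have ne: "S ~= {}" using exists_off_span by (auto simp: S_def)
 define L where "L = Max S"
 have L: "L \<in> S" "\<And>h. h \<in> \<Xi> - cfun.span {f, g} ==> ll h \<le> L"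
  using Max_in[OF fin ne] Max_ge[OF fin] by (auto simp: L_def S_def)
 have X: "X_stratum \<Gamma> \<Xi> f g L = (\<Xi> - cfun.span {f, g}) \<inter> (\<Xi> - Rd (L - 1) (L - 1))"
 proof -
  have "ll h = L \<longleftrightarrow> \<not> rdep (L - 1) (L - 1) h" if h: "h \<in> \<Xi> - cfun.span {f, g}" for h
   using good_ll_ee[OF h] L(2)[OF h] unfolding good_def by auto
  thus ?thesis unfolding X_stratum_eq Rd_def by blast
 qed
 obtain h where h: "h \<in> \<Xi> - cfun.span {f, g}" "L = ll h" using L(1) by (auto simp: S_def)
 show ?thesis
 proof (intro exI[of _ L] conjI allI impI)
  show "1 \<le> L" using good_ll_ee[OF h(1)] h(2) by (simp add: good_def)
  show "X_stratum \<Gamma> \<Xi> f g L ~= {}" using h unfolding X_stratum_eq by blast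
  show "l \<le> L" if "X_stratum \<Gamma> \<Xi> f g l ~= {}" for l using that L(2) unfolding X_stratum_eq by blast
  show "openin ZT (X_stratum \<Gamma> \<Xi> f g L)" unfolding X by (intro openin_Int open_off_span open_compl_Rd)
 qed
qed

text \<open>As \<open>ee h * map_degree \<Gamma> f g h\<close> is constant, the smallest degree of
  the map occurs where \<open>ee h\<close> has its largest value \<open>E\<close>, and
  \<open>ee h \<ge> E\<close> is the failure of the closed condition
  \<open>rdep bound (E - 1)\<close>.\<close>

lemma X_min_open:
 assumes "X_stratum \<Gamma> \<Xi> f g l ~= {}"
 shows "openin (subtopology ZT (X_stratum \<Gamma> \<Xi> f g l))
  {h \<in> X_stratum \<Gamma> \<Xi> f g l. \<forall>h' \<in> X_stratum \<Gamma> \<Xi> f g l. map_degree \<Gamma> f g h \<le> map_degree \<Gamma> f g h'}"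
proof -
 define X where "X = X_stratum \<Gamma> \<Xi> f g l"
 define d where "d = map_degree \<Gamma> f g"
 have X: "good h l (ee h)" if "h \<in> X" for h using good_ll_ee[of h] that unfolding X_def X_stratum_eq by auto
 have "ee ` X \<subseteq> {..l}" using X by (auto simp: good_def)
 hence fin: "finite (ee ` X)" by (rule finite_subset) simp
 define E where "E = Max (ee ` X)"
 have "E \<in> ee ` X" unfolding E_def using assms by (intro Max_in fin) (simp add: X_def)
 then obtain h0 where h0: "h0 \<in> X" "ee h0 = E" by blast
 have leE: "ee h \<le> E" if "h \<in> X" for h unfolding E_def using that by (intro Max_ge fin) simp
 have prod: "ee h * d h = E * d h0" if "h \<in> X" for h using X[OF that] X[OF h0(1)] h0(2) unfolding good_def d_def by metis
 have pos: "0 < d h" "1 \<le> ee h" if "h \<in> X" for h using X[OF that] by (auto simp: good_def d_def)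
 have "(\<forall>h'\<in>X. d h \<le> d h') \<longleftrightarrow> \<not> rdep bound (E - 1) h" if h: "h \<in> X" for h
 proof -
  have "(\<forall>h'\<in>X. d h \<le> d h') \<longleftrightarrow> ee h = E"
  proof
   assume "\<forall>h'\<in>X. d h \<le> d h'"
   hence "d h \<le> d h0" using h0 by blast
   hence "E * d h0 \<le> ee h * d h0" unfolding prod[OF h, symmetric] by (rule mult_le_mono2)
   thus "ee h = E" using pos(1)[OF h0(1)] leE[OF h] by simp
  next
   assume e: "ee h = E"
   show "\<forall>h'\<in>X. d h \<le> d h'"
   proof
    fix h' assume h': "h' \<in> X"
    have "E * d h = ee h' * d h'" using prod[OF h] prod[OF h'] e by simp
    also have "\<dots> \<le> E * d h'" by (rule mult_le_mono1[OF leE[OF h']])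
    finally show "d h \<le> d h'" using pos(2)[OF h] e by simp
   qed
  qed
  also have "\<dots> \<longleftrightarrow> \<not> rdep bound (E - 1) h"
   using X[OF h] leE[OF h] pos(2)[OF h] unfolding good_def by auto
  finally show ?thesis .
 qed
 moreover have "X \<subseteq> \<Xi>" unfolding X_def X_stratum_eq by blast
 ultimately have "{h \<in> X. \<forall>h'\<in>X. d h \<le> d h'} = (\<Xi> - Rd bound (E - 1)) \<inter> X" unfolding Rd_def by blast
 thus ?thesis unfolding X_def[symmetric] d_def[symmetric] openin_subtopology using open_compl_Rd by blast
qed

text \<open>The product formula shows that \<open>k\<close> divides the degree as soon as the
  stratum has an element, and that the stratum is where \<open>ee h\<close> equals the cofactor of
  \<open>k\<close>; it is even locally closed.\<close>

lemma Z_facts: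
 assumes k: "1 \<le> k"
 shows "constructible_in ZT (Z_stratum \<Gamma> \<Xi> f g k)"
  "\<not> k dvd field_degree \<Gamma> (adjoin \<Gamma> {\<phi>}) ==> Z_stratum \<Gamma> \<Xi> f g k = {}"
proof -
 define N where "N = field_degree \<Gamma> (adjoin \<Gamma> {\<phi>})"
 have N: "N = ee h * map_degree \<Gamma> f g h" "1 \<le> ee h" if "h \<in> \<Xi> - cfun.span {f, g}" for h
  using good_ll_ee[OF that] by (auto simp: good_def N_def)
 show empty: "Z_stratum \<Gamma> \<Xi> f g k = {}" if "\<not> k dvd field_degree \<Gamma> (adjoin \<Gamma> {\<phi>})"
  using that N(1) unfolding N_def[symmetric] Z_stratum_def by auto
 show "constructible_in ZT (Z_stratum \<Gamma> \<Xi> f g k)"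
 proof (cases "k dvd N")
  case False
  thus ?thesis unfolding constructible_in_def using empty by (intro exI[of _ "{}"]) (simp add: N_def)
 next
  case True
  then obtain e where e: "N = e * k" by (metis dvd_div_mult_self)
  have "map_degree \<Gamma> f g h = k \<longleftrightarrow> \<not> rdep bound (e - 1) h \<and> rdep bound e h" if h: "h \<in> \<Xi> - cfun.span {f, g}" for h
  proof -
   have "map_degree \<Gamma> f g h = k \<longleftrightarrow> ee h = e"
    using N[OF h] e k by (metis mult_cancel1 mult_cancel2 not_one_le_zero)
   also have "\<dots> \<longleftrightarrow> \<not> rdep bound (e - 1) h \<and> rdep bound e h"
    using good_ll_ee[OF h] unfolding good_def by auto
   finally show ?thesis .
  qed
  hence "Z_stratum \<Gamma> \<Xi> f g k = (\<Xi> - cfun.span {f, g}) \<inter> (\<Xi> - Rd bound (e - 1)) \<inter> Rd bound e"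
   unfolding Z_stratum_def Rd_def by blast
  moreover have "openin ZT ((\<Xi> - cfun.span {f, g}) \<inter> (\<Xi> - Rd bound (e - 1)))"
   by (intro openin_Int open_off_span open_compl_Rd)
  moreover have "closedin ZT (Rd bound e)" unfolding Rd_def by (rule closedin_rdep)
  ultimately have "locally_closed_in ZT (Z_stratum \<Gamma> \<Xi> f g k)" unfolding locally_closed_in_def by blast
  thus ?thesis unfolding constructible_in_def by (intro exI[of _ "{Z_stratum \<Gamma> \<Xi> f g k}"]) simp
 qed
qed

end

theorem theorem1p4:
  fixes \<Gamma> :: "(real^2^2) set" and chi :: "real^2^2 \<Rightarrow> complex" and m :: nat
    and \<Xi> :: "(complex \<Rightarrow> complex) set" and f g :: "complex \<Rightarrow> complex"
  assumes "fuchsian_first_kind \<Gamma>"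
    and "finite_order_character \<Gamma> chi"
    and "m \<ge> 1"
    and "cfun.subspace \<Xi>" and "\<Xi> \<subseteq> modular_forms m \<Gamma> chi" and "cfun.dim \<Xi> \<ge> 3"
    and "f \<in> \<Xi>" and "g \<in> \<Xi>" and "f \<noteq> g" and "cfun.independent {f, g}"
  shows
    "(\<forall>l\<ge>1. locally_closed_in (zariski cfun_scale \<Xi>) (X_stratum \<Gamma> \<Xi> f g l)) \<and>
     (\<exists>L\<ge>1. X_stratum \<Gamma> \<Xi> f g L \<noteq> {} \<and>
        (\<forall>l. X_stratum \<Gamma> \<Xi> f g l \<noteq> {} \<longrightarrow> l \<le> L) \<and>
        openin (zariski cfun_scale \<Xi>) (X_stratum \<Gamma> \<Xi> f g L)) \<and>
     (\<forall>l\<ge>1. X_stratum \<Gamma> \<Xi> f g l \<noteq> {} \<longrightarrow>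
        openin (subtopology (zariski cfun_scale \<Xi>) (X_stratum \<Gamma> \<Xi> f g l))
          {h \<in> X_stratum \<Gamma> \<Xi> f g l.
            \<forall>h' \<in> X_stratum \<Gamma> \<Xi> f g l. map_degree \<Gamma> f g h \<le> map_degree \<Gamma> f g h'}) \<and>
     (\<forall>k\<ge>1. constructible_in (zariski cfun_scale \<Xi>) (Z_stratum \<Gamma> \<Xi> f g k) \<and>
        (\<not> k dvd field_degree \<Gamma> (adjoin \<Gamma> {quotient_fun g f}) \<longrightarrow>
          Z_stratum \<Gamma> \<Xi> f g k = {}))"
proof -
 have "chi ga ~= 0" if "ga \<in> \<Gamma>" for ga
  using assms(2) that unfolding finite_order_character_def hom_def Cstar_def by auto
 then interpret form_pencil \<Gamma> chi m \<Xi> f g by unfold_locales (use assms in auto)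
 show ?thesis using X_locally_closed X_largest_open X_min_open Z_facts by blast
qed

end
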